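(* Let $q\in GL_n(A)$ satisfy $q^t=\pm q$ and assume that every entry of $q$ is either $0$ or a root of unity. Let $\delta=(\delta_p)_{p\in\mathcal V}$ be the Chern connection attached to $q$, with Frobenius lifts $(\phi_p)$. Then: 1) $\delta$ is global along $1$. 2) If $J$ is the ideal of $A[[T]]$ generated by the entries of the matrix $x^tqx-q$, then $\phi_p(J)\subset J$ for all $p\in\mathcal V$. 3) Assume $n=2r$, $q=1$, and write $x=\begin{pmatrix} a & b\\ c & d\end{pmatrix}$ with $a,b,c,d$ of size $r\times r$. Let $K$ be the ideal of $A[[T]]$ generated by the entries of $x^tx-1$, of $a-d$ and of $b+c$. Then $\phi_p(K)\subset K$ for all $p\in\mathcal V$.
   Context: Let $M$ be an even positive integer, $N\geq 1$, $\zeta_N$ a primitive $N$-th root of unity, and $A=\mathbb{Z}[1/M,\zeta_N]$. Let $\mathcal V$ be a (possibly infinite) set of rational primes not dividing $MN$. For a ring $B$, $B^{\widehat{p}}$ denotes its $p$-adic completion. For $p\in\mathcal V$ there is a unique ring endomorphism $\phi_p$ of $A$ lifting the $p$-power Frobenius of $A/pA$ (it sends $\zeta_N\mapsto\zeta_N^p$); it extends to $A^{\widehat p}$. A $p$-derivation on a $p$-torsion free ring $B$ is a map $\delta_p:B\to B$ such that $\phi_p(b):=b^p+p\delta_p(b)$ is a ring homomorphism (the Frobenius lift attached to $\delta_p$). Let $G=GL_n$ over $A$, $\mathcal O(G)=A[x,\det(x)^{-1}]$ with $x=(x_{kl})$ an $n\times n$ matrix of indeterminates. For a matrix $u$, $u^t$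 is its transpose, $u^{(p)}$ the matrix of $p$-th powers of its entries, and for a map $f$, $f(u)$ is applied entrywise. An adelic connection on $G$ is a family $(\delta_p)_{p\in\mathcal V}$ where $\delta_p$ is a $p$-derivation on $\mathcal O(G)^{\widehat p}$. Let $T=x-1$. The connection fixes $1$ if each Frobenius lift $\phi_p$ maps the ideal of the identity (generated by the entries of $T$) into itself, so that it induces a ring endomorphism $\phi_p$ of $A^{\widehat p}[[T]]$; it is global along $1$ if moreover each such $\phi_p$ maps $A[[T]]$ into $A[[T]]$. For $q\in GL_n(A)$ with $q^t=\pm q$, the Chern connection attached to $q$ is the adelic connection whose Frobenius lift $\phi_p$ on $\mathcal O(G)^{\widehat p}$ is the ring homomorphism extending $\phi_p$ on $A^{\widehat p}$ with $\phi_p(x)=x^{(p)}\{(x^{(p)t}\phi_p(q)x^{(p)})^{-1}(x^tqx)^{(p)}\}^{1/2}$, where the square root is $(1+u)^{1/2}=1+\sum_{i\geq1}\binom{1/2}{i}u^i$ applied to $u=(x^{(p)t}\phi_p(q)x^{(p)})^{-1}(x^tqx)^{(p)}-1$ (whose entries lie in $p\mathcal O(G)^{\widehat p}$, so the series converges $p$-adically). *)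

theory Defs
  imports
    Complex_Main
    "HOL-Computational_Algebra.Primes"
    "HOL-Combinatorics.Permutations"
    "HOL-Algebra.Generated_Rings"
    "HOL-Algebra.Indexed_Polynomials"
    "HOL-Algebra.Algebraic_Closure_Type"
    "Jordan_Normal_Form.Matrix"
begin

section \<open>The base ring\<close>

definition cyclotomic_ring :: "nat \<Rightarrow> complex \<Rightarrow> complex ring" where
  "cyclotomic_ring M \<zeta> =
     ring_of_type_algebra\<lparr>carrier := generate_ring ring_of_type_algebra {1 / of_nat M, \<zeta>}\<rparr>"

definition primitive_root :: "nat \<Rightarrow> complex \<Rightarrow> bool" where
  "primitive_root N \<zeta> \<longleftrightarrow> \<zeta> ^ N = 1 \<and> (\<forall>k. 0 < k \<and> k < N \<longrightarrow> \<zeta> ^ k \<noteq> 1)"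


section \<open>Matrices over a ring given by a record\<close>

text \<open>The matrix type and its structural operations (\<^const>\<open>mat\<close>, \<^const>\<open>map_mat\<close>,
  \<^const>\<open>transpose_mat\<close>, \<^const>\<open>split_block\<close>) are those of the library; its arithmetic
  operations are tied to type classes, so they are restated for ring records.\<close>

definition sq_mats :: "('a, 'b) ring_scheme \<Rightarrow> nat \<Rightarrow> 'a mat set" where
  "sq_mats R n = {Y. Y \<in> carrier_mat n n \<and> elements_mat Y \<subseteq> carrier R}"

definition rmat_one :: "('a, 'b) ring_scheme \<Rightarrow> nat \<Rightarrow> 'a mat" where
  "rmat_one R n = mat n n (\<lambda>(i, j). if i = j then \<one>\<^bsub>R\<^esub> else \<zero>\<^bsub>R\<^esub>)"

definition rmat_add :: "('a, 'b) ring_scheme \<Rightarrow> 'a mat \<Rightarrow> 'a mat \<Rightarrow> 'a mat" where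
  "rmat_add R Y Z = mat (dim_row Y) (dim_col Y) (\<lambda>ij. Y $$ ij \<oplus>\<^bsub>R\<^esub> Z $$ ij)"

definition rmat_diff :: "('a, 'b) ring_scheme \<Rightarrow> 'a mat \<Rightarrow> 'a mat \<Rightarrow> 'a mat" where
  "rmat_diff R Y Z = mat (dim_row Y) (dim_col Y) (\<lambda>ij. Y $$ ij \<ominus>\<^bsub>R\<^esub> Z $$ ij)"

definition rmat_mult :: "('a, 'b) ring_scheme \<Rightarrow> 'a mat \<Rightarrow> 'a mat \<Rightarrow> 'a mat" where
  "rmat_mult R Y Z = mat (dim_row Y) (dim_col Z)
     (\<lambda>(i, j). \<Oplus>\<^bsub>R\<^esub>k\<in>{..<dim_col Y}. Y $$ (i, k) \<otimes>\<^bsub>R\<^esub> Z $$ (k, j))"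

primrec rmat_pow :: "('a, 'b) ring_scheme \<Rightarrow> 'a mat \<Rightarrow> nat \<Rightarrow> 'a mat" where
  "rmat_pow R Y 0 = rmat_one R (dim_row Y)"
| "rmat_pow R Y (Suc i) = rmat_mult R Y (rmat_pow R Y i)"

definition rmat_det :: "('a, 'b) ring_scheme \<Rightarrow> 'a mat \<Rightarrow> 'a" where
  "rmat_det R Y = (\<Oplus>\<^bsub>R\<^esub>\<pi>\<in>{\<pi>. \<pi> permutes {..<dim_row Y}}.
     (if evenperm \<pi> then \<one>\<^bsub>R\<^esub> else \<ominus>\<^bsub>R\<^esub> \<one>\<^bsub>R\<^esub>) \<otimes>\<^bsub>R\<^esub> (\<Otimes>\<^bsub>R\<^esub>i\<in>{..<dim_row Y}. Y $$ (i, \<pi> i)))"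

definition rmat_inverse :: "('a, 'b) ring_scheme \<Rightarrow> nat \<Rightarrow> 'a mat \<Rightarrow> 'a mat \<Rightarrow> bool" where
  "rmat_inverse R n Y Z \<longleftrightarrow> Y \<in> sq_mats R n \<and> Z \<in> sq_mats R n \<and>
     rmat_mult R Y Z = rmat_one R n \<and> rmat_mult R Z Y = rmat_one R n"

definition GL :: "('a, 'b) ring_scheme \<Rightarrow> nat \<Rightarrow> 'a mat set" where
  "GL R n = {Y. \<exists>Z. rmat_inverse R n Y Z}"

text \<open>The matrix $u^{(p)}$ of $p$-th powers of the entries.\<close>
definition rmat_entry_pow :: "('a, 'b) ring_scheme \<Rightarrow> nat \<Rightarrow> 'a mat \<Rightarrow> 'a mat" where
  "rmat_entry_pow R p Y = map_mat (\<lambda>a. a [^]\<^bsub>R\<^esub> p) Y"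

text \<open>The product $y^t\, c\, y$.\<close>
definition rmat_conj :: "('a, 'b) ring_scheme \<Rightarrow> 'a mat \<Rightarrow> 'a mat \<Rightarrow> 'a mat" where
  "rmat_conj R c y = rmat_mult R (rmat_mult R (transpose_mat y) c) y"


section \<open>$p$-adic completion\<close>

definition pow_ideal :: "('a, 'b) ring_scheme \<Rightarrow> nat \<Rightarrow> nat \<Rightarrow> 'a set" where
  "pow_ideal R p k = PIdl\<^bsub>R\<^esub> ([(p ^ k)] \<cdot>\<^bsub>R\<^esub> \<one>\<^bsub>R\<^esub>)"

text \<open>The inverse limit of the rings $R/p^kR$. Elements of $R/p^kR$ are cosets, and the
  transition map sends a coset of $p^{k+1}R$ to the coset of $p^kR$ that contains it, so
  compatibility of a sequence is an inclusion of cosets.\<close>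
definition padic_completion :: "('a, 'b) ring_scheme \<Rightarrow> nat \<Rightarrow> (nat \<Rightarrow> 'a set) ring" where
  "padic_completion R p =
     \<lparr>carrier = {f. \<forall>k. f k \<in> carrier (R Quot pow_ideal R p k) \<and> f (Suc k) \<subseteq> f k},
      monoid.mult = (\<lambda>f g k. f k \<otimes>\<^bsub>R Quot pow_ideal R p k\<^esub> g k),
      one = (\<lambda>k. \<one>\<^bsub>R Quot pow_ideal R p k\<^esub>),
      zero = (\<lambda>k. \<zero>\<^bsub>R Quot pow_ideal R p k\<^esub>),
      add = (\<lambda>f g k. f k \<oplus>\<^bsub>R Quot pow_ideal R p k\<^esub> g k)\<rparr>"

definition to_completion :: "('a, 'b) ring_scheme \<Rightarrow> nat \<Rightarrow> 'a \<Rightarrow> (nat \<Rightarrow> 'a set)" where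
  "to_completion R p a = (\<lambda>k. pow_ideal R p k +>\<^bsub>R\<^esub> a)"

text \<open>The map on completions induced by a ring homomorphism \<open>h\<close> into \<open>S\<close>; all cosets in the
  union coincide.\<close>
definition completion_map ::
  "('c, 'd) ring_scheme \<Rightarrow> nat \<Rightarrow> ('a \<Rightarrow> 'c) \<Rightarrow> (nat \<Rightarrow> 'a set) \<Rightarrow> (nat \<Rightarrow> 'c set)" where
  "completion_map S p h f = (\<lambda>k. \<Union>a\<in>f k. pow_ideal S p k +>\<^bsub>S\<^esub> h a)"

definition padic_sums :: "('a, 'b) ring_scheme \<Rightarrow> nat \<Rightarrow> (nat \<Rightarrow> 'a) \<Rightarrow> 'a \<Rightarrow> bool" where
  "padic_sums R p f s \<longleftrightarrow>
     (\<forall>k. \<exists>m0. \<forall>m\<ge>m0. (\<Oplus>\<^bsub>R\<^esub>i\<in>{..<m}. f i) \<ominus>\<^bsub>R\<^esub> s \<in> pow_ideal R p k)"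


section \<open>Frobenius lifts and $p$-derivations\<close>

definition frobenius_lift :: "('a, 'b) ring_scheme \<Rightarrow> nat \<Rightarrow> ('a \<Rightarrow> 'a) \<Rightarrow> bool" where
  "frobenius_lift R p \<phi> \<longleftrightarrow>
     \<phi> \<in> Ring.ring_hom R R \<and> (\<forall>a\<in>carrier R. \<phi> a \<ominus>\<^bsub>R\<^esub> a [^]\<^bsub>R\<^esub> p \<in> pow_ideal R p 1)"

definition frob_of :: "('a, 'b) ring_scheme \<Rightarrow> nat \<Rightarrow> ('a \<Rightarrow> 'a) \<Rightarrow> 'a \<Rightarrow> 'a" where
  "frob_of R p d b = b [^]\<^bsub>R\<^esub> p \<oplus>\<^bsub>R\<^esub> [p] \<cdot>\<^bsub>R\<^esub> d b"

definition p_derivation :: "('a, 'b) ring_scheme \<Rightarrow> nat \<Rightarrow> ('a \<Rightarrow> 'a) \<Rightarrow> bool" where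
  "p_derivation R p d \<longleftrightarrow> d \<in> carrier R \<rightarrow> carrier R \<and> frob_of R p d \<in> Ring.ring_hom R R"


section \<open>Power series and polynomials in several variables\<close>

text \<open>As in \<^theory>\<open>HOL-Algebra.Indexed_Polynomials\<close>, monomials are multisets of variables, and
  series are coefficient functions. A series over \<open>I\<close> only involves monomials in the
  variables from \<open>I\<close>.\<close>
definition mpowser_ring :: "('a, 'b) ring_scheme \<Rightarrow> 'i set \<Rightarrow> ('i multiset \<Rightarrow> 'a) ring" where
  "mpowser_ring R I =
     \<lparr>carrier = {f. \<forall>m. f m \<in> carrier R \<and> (\<not> set_mset m \<subseteq> I \<longrightarrow> f m = \<zero>\<^bsub>R\<^esub>)},
      monoid.mult = (\<lambda>f g m. \<Oplus>\<^bsub>R\<^esub>k\<in>{k. k \<subseteq># m}. f k \<otimes>\<^bsub>R\<^esub> g (m - k)),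
      one = ring.indexed_const R \<one>\<^bsub>R\<^esub>,
      zero = ring.indexed_const R \<zero>\<^bsub>R\<^esub>,
      add = (\<lambda>f g m. f m \<oplus>\<^bsub>R\<^esub> g m)\<rparr>"

definition mpoly_ring :: "('a, 'b) ring_scheme \<Rightarrow> 'i set \<Rightarrow> ('i multiset \<Rightarrow> 'a) ring" where
  "mpoly_ring R I = (mpowser_ring R I)\<lparr>carrier := ring.indexed_pset R I (carrier R)\<rparr>"


section \<open>The coordinate ring of $GL_n$ and its completion\<close>

text \<open>$\mathcal O(GL_n) = A[x, \det(x)^{-1}]$ is presented as $A[x,y]/(y\det(x) - 1)$. The variable
  \<open>Some (k, l)\<close> is $x_{kl}$ (indices start at 0), and \<open>None\<close> is $y$.\<close>

definition GL_poly :: "('a, 'b) ring_scheme \<Rightarrow> nat \<Rightarrow> ((nat \<times> nat) option multiset \<Rightarrow> 'a) ring" where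
  "GL_poly A n = mpoly_ring A (insert None (Some ` ({..<n} \<times> {..<n})))"

definition GL_ideal :: "('a, 'b) ring_scheme \<Rightarrow> nat \<Rightarrow> ((nat \<times> nat) option multiset \<Rightarrow> 'a) set" where
  "GL_ideal A n = (let P = GL_poly A n in
     PIdl\<^bsub>P\<^esub> (ring.indexed_var A None \<otimes>\<^bsub>P\<^esub>
       rmat_det P (mat n n (\<lambda>kl. ring.indexed_var A (Some kl))) \<ominus>\<^bsub>P\<^esub> \<one>\<^bsub>P\<^esub>))"

definition GL_ring ::
  "('a, 'b) ring_scheme \<Rightarrow> nat \<Rightarrow> ((nat \<times> nat) option multiset \<Rightarrow> 'a) set ring" where
  "GL_ring A n = GL_poly A n Quot GL_ideal A n"

definition GL_const ::
  "('a, 'b) ring_scheme \<Rightarrow> nat \<Rightarrow> 'a \<Rightarrow> ((nat \<times> nat) option multiset \<Rightarrow> 'a) set" where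
  "GL_const A n a = GL_ideal A n +>\<^bsub>GL_poly A n\<^esub> ring.indexed_const A a"

definition GL_coord ::
  "('a, 'b) ring_scheme \<Rightarrow> nat \<Rightarrow> ((nat \<times> nat) option multiset \<Rightarrow> 'a) set mat" where
  "GL_coord A n =
     mat n n (\<lambda>kl. GL_ideal A n +>\<^bsub>GL_poly A n\<^esub> ring.indexed_var A (Some kl))"

type_synonym 'a GLhat = "nat \<Rightarrow> ((nat \<times> nat) option multiset \<Rightarrow> 'a) set set"

definition GLhat :: "('a, 'b) ring_scheme \<Rightarrow> nat \<Rightarrow> nat \<Rightarrow> 'a GLhat ring" where
  "GLhat A n p = padic_completion (GL_ring A n) p"

definition GLhat_const :: "('a, 'b) ring_scheme \<Rightarrow> nat \<Rightarrow> nat \<Rightarrow> 'a \<Rightarrow> 'a GLhat" where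
  "GLhat_const A n p a = to_completion (GL_ring A n) p (GL_const A n a)"

definition GLhat_coord :: "('a, 'b) ring_scheme \<Rightarrow> nat \<Rightarrow> nat \<Rightarrow> 'a GLhat mat" where
  "GLhat_coord A n p = map_mat (to_completion (GL_ring A n) p) (GL_coord A n)"

text \<open>The structure map from the completion of \<open>A\<close> to the completion of $\mathcal O(GL_n)$.\<close>
definition GLhat_struct ::
  "('a, 'b) ring_scheme \<Rightarrow> nat \<Rightarrow> nat \<Rightarrow> (nat \<Rightarrow> 'a set) \<Rightarrow> 'a GLhat" where
  "GLhat_struct A n p = completion_map (GL_ring A n) p (GL_const A n)"


section \<open>Formal power series along the identity\<close>

text \<open>The ring of power series over the given ring in the entries of $T$.\<close>
definition T_series :: "('a, 'b) ring_scheme \<Rightarrow> nat \<Rightarrow> ((nat \<times> nat) multiset \<Rightarrow> 'a) ring" where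
  "T_series A n = mpowser_ring A ({..<n} \<times> {..<n})"

definition T_series_hat ::
  "('a, 'b) ring_scheme \<Rightarrow> nat \<Rightarrow> nat \<Rightarrow> ((nat \<times> nat) multiset \<Rightarrow> nat \<Rightarrow> 'a set) ring" where
  "T_series_hat A n p = T_series (padic_completion A p) n"

text \<open>The matrix $x = 1 + T$ of power series over \<open>R\<close>.\<close>
definition series_coord :: "('a, 'b) ring_scheme \<Rightarrow> nat \<Rightarrow> ((nat \<times> nat) multiset \<Rightarrow> 'a) mat" where
  "series_coord R n = rmat_add (T_series R n) (rmat_one (T_series R n) n)
     (mat n n (\<lambda>kl. ring.indexed_var R kl))"

definition series_embed ::
  "('a, 'b) ring_scheme \<Rightarrow> nat \<Rightarrow> ((nat \<times> nat) multiset \<Rightarrow> 'a) \<Rightarrow>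
   ((nat \<times> nat) multiset \<Rightarrow> nat \<Rightarrow> 'a set)" where
  "series_embed A p f = (\<lambda>m. to_completion A p (f m))"

text \<open>The natural map from the completion of $\mathcal O(GL_n)$ to the power series in $T$ over the
  completion of \<open>A\<close>: the unique homomorphism of algebras over the completion of \<open>A\<close> that sends
  $x$ to $1 + T$. No continuity is demanded: homomorphisms respect divisibility by $p^k$, and
  the target is $p$-adically separated.\<close>
definition identity_expansion ::
  "('a, 'b) ring_scheme \<Rightarrow> nat \<Rightarrow> nat \<Rightarrow> 'a GLhat \<Rightarrow> ((nat \<times> nat) multiset \<Rightarrow> nat \<Rightarrow> 'a set)" where
  "identity_expansion A n p =
     (THE \<iota>. \<iota> \<in> Ring.ring_hom (GLhat A n p) (T_series_hat A n p) \<inter> extensional (carrier (GLhat A n p)) \<and>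
        (\<forall>a\<in>carrier (padic_completion A p).
           \<iota> (GLhat_struct A n p a) = ring.indexed_const (padic_completion A p) a) \<and>
        map_mat \<iota> (GLhat_coord A n p) = series_coord (padic_completion A p) n)"

text \<open>The endomorphism of the power series ring induced by an endomorphism \<open>\<Phi>\<close> of the completed
  coordinate ring that maps the ideal of the identity into itself. Again continuity is
  automatic: such an endomorphism maps the ideal $(T)$ into itself, and the image of the
  expansion map is dense in the $T$-adic topology.\<close>
definition induced_endo ::
  "('a, 'b) ring_scheme \<Rightarrow> nat \<Rightarrow> nat \<Rightarrow> ('a GLhat \<Rightarrow> 'a GLhat) \<Rightarrow>
   ((nat \<times> nat) multiset \<Rightarrow> nat \<Rightarrow> 'a set) \<Rightarrow> ((nat \<times> nat) multiset \<Rightarrow> nat \<Rightarrow> 'a set)" where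
  "induced_endo A n p \<Phi> =
     (THE \<Psi>. \<Psi> \<in> Ring.ring_hom (T_series_hat A n p) (T_series_hat A n p) \<inter>
              extensional (carrier (T_series_hat A n p)) \<and>
        (\<forall>f\<in>carrier (GLhat A n p).
           \<Psi> (identity_expansion A n p f) = identity_expansion A n p (\<Phi> f)))"


section \<open>Adelic connections\<close>

definition adelic_connection ::
  "('a, 'b) ring_scheme \<Rightarrow> nat \<Rightarrow> nat set \<Rightarrow> (nat \<Rightarrow> 'a GLhat \<Rightarrow> 'a GLhat) \<Rightarrow> bool" where
  "adelic_connection A n V \<delta> \<longleftrightarrow> (\<forall>p\<in>V. p_derivation (GLhat A n p) p (\<delta> p))"

definition conn_frob ::
  "('a, 'b) ring_scheme \<Rightarrow> nat \<Rightarrow> (nat \<Rightarrow> 'a GLhat \<Rightarrow> 'a GLhat) \<Rightarrow> nat \<Rightarrow> 'a GLhat \<Rightarrow> 'a GLhat" where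
  "conn_frob A n \<delta> p = frob_of (GLhat A n p) p (\<delta> p)"

definition formal_frob ::
  "('a, 'b) ring_scheme \<Rightarrow> nat \<Rightarrow> (nat \<Rightarrow> 'a GLhat \<Rightarrow> 'a GLhat) \<Rightarrow> nat \<Rightarrow>
   ((nat \<times> nat) multiset \<Rightarrow> nat \<Rightarrow> 'a set) \<Rightarrow> ((nat \<times> nat) multiset \<Rightarrow> nat \<Rightarrow> 'a set)" where
  "formal_frob A n \<delta> p = induced_endo A n p (conn_frob A n \<delta> p)"

definition identity_ideal :: "('a, 'b) ring_scheme \<Rightarrow> nat \<Rightarrow> nat \<Rightarrow> 'a GLhat set" where
  "identity_ideal A n p = (let B = GLhat A n p in
     Idl\<^bsub>B\<^esub> (elements_mat (rmat_diff B (GLhat_coord A n p) (rmat_one B n))))"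

definition fixes_one ::
  "('a, 'b) ring_scheme \<Rightarrow> nat \<Rightarrow> nat set \<Rightarrow> (nat \<Rightarrow> 'a GLhat \<Rightarrow> 'a GLhat) \<Rightarrow> bool" where
  "fixes_one A n V \<delta> \<longleftrightarrow>
     (\<forall>p\<in>V. conn_frob A n \<delta> p ` identity_ideal A n p \<subseteq> identity_ideal A n p)"

text \<open>Stability of a set of power series over \<open>A\<close> under the induced Frobenius lift, which is
  defined on power series over the completion of \<open>A\<close>.\<close>
definition frob_stable ::
  "('a, 'b) ring_scheme \<Rightarrow> nat \<Rightarrow> (nat \<Rightarrow> 'a GLhat \<Rightarrow> 'a GLhat) \<Rightarrow> nat \<Rightarrow>
   ((nat \<times> nat) multiset \<Rightarrow> 'a) set \<Rightarrow> bool" where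
  "frob_stable A n \<delta> p J \<longleftrightarrow>
     formal_frob A n \<delta> p ` (series_embed A p ` J) \<subseteq> series_embed A p ` J"

definition global_along_one ::
  "('a, 'b) ring_scheme \<Rightarrow> nat \<Rightarrow> nat set \<Rightarrow> (nat \<Rightarrow> 'a GLhat \<Rightarrow> 'a GLhat) \<Rightarrow> bool" where
  "global_along_one A n V \<delta> \<longleftrightarrow>
     fixes_one A n V \<delta> \<and> (\<forall>p\<in>V. frob_stable A n \<delta> p (carrier (T_series A n)))"


section \<open>The Chern connection\<close>

text \<open>\<open>S\<close> is the $p$-adic sum $\sum_i \binom{1/2}{i} U^i$; the map \<open>c\<close> places the binomial
  coefficients, which lie in $\mathbb Z[1/2]$, into the ring.\<close>
definition sqrt_one_plus ::
  "('a, 'b) ring_scheme \<Rightarrow> nat \<Rightarrow> (complex \<Rightarrow> 'a) \<Rightarrow> nat \<Rightarrow> 'a mat \<Rightarrow> 'a mat \<Rightarrow> bool" where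
  "sqrt_one_plus R p c n U S \<longleftrightarrow> S \<in> sq_mats R n \<and>
     (\<forall>i<n. \<forall>j<n. padic_sums R p
        (\<lambda>m. c ((1 / 2) gchoose m) \<otimes>\<^bsub>R\<^esub> rmat_pow R U m $$ (i, j)) (S $$ (i, j)))"

text \<open>The matrices \<open>W\<close> and \<open>S\<close>, an inverse and a $p$-adic limit, are unique. The family \<open>\<phi>\<close>
  consists of the Frobenius lifts of the base ring.\<close>
definition chern_connection ::
  "complex ring \<Rightarrow> (nat \<Rightarrow> complex \<Rightarrow> complex) \<Rightarrow> nat \<Rightarrow> complex mat \<Rightarrow> nat set \<Rightarrow>
   (nat \<Rightarrow> complex GLhat \<Rightarrow> complex GLhat) \<Rightarrow> bool" where
  "chern_connection A \<phi> n q V \<delta> \<longleftrightarrow> adelic_connection A n V \<delta> \<and>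
     (\<forall>p\<in>V. let B = GLhat A n p; c = GLhat_const A n p; x = GLhat_coord A n p;
                xp = rmat_entry_pow B p x in
        (\<forall>a\<in>carrier (padic_completion A p).
           conn_frob A n \<delta> p (GLhat_struct A n p a) =
           GLhat_struct A n p (completion_map A p (\<phi> p) a)) \<and>
        (\<exists>W S. rmat_inverse B n (rmat_conj B (map_mat (\<lambda>a. c (\<phi> p a)) q) xp) W \<and>
           sqrt_one_plus B p c n
             (rmat_diff B (rmat_mult B W (rmat_entry_pow B p (rmat_conj B (map_mat c q) x)))
               (rmat_one B n)) S \<and>
           map_mat (conn_frob A n \<delta> p) x = rmat_mult B xp S))"


section \<open>The ideals of symmetries\<close>

definition ideal_J :: "('a, 'b) ring_scheme \<Rightarrow> nat \<Rightarrow> 'a mat \<Rightarrow> ((nat \<times> nat) multiset \<Rightarrow> 'a) set" where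
  "ideal_J A n q = (let R = T_series A n; x = series_coord A n; q' = map_mat (ring.indexed_const A) q in
     Idl\<^bsub>R\<^esub> (elements_mat (rmat_diff R (rmat_conj R q' x) q')))"

definition ideal_K :: "('a, 'b) ring_scheme \<Rightarrow> nat \<Rightarrow> ((nat \<times> nat) multiset \<Rightarrow> 'a) set" where
  "ideal_K A r = (let R = T_series A (2 * r); x = series_coord A (2 * r) in
     case split_block x r r of (a, b, c, d) \<Rightarrow>
       Idl\<^bsub>R\<^esub> (elements_mat (rmat_diff R (rmat_mult R (transpose_mat x) x) (rmat_one R (2 * r))) \<union>
                elements_mat (rmat_diff R a d) \<union> elements_mat (rmat_add R b c)))"

end

theory Submission
  imports Defs "HOL-Computational_Algebra.Formal_Power_Series" "Jordan_Normal_Form.Char_Poly"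
begin

text \<open>Two roots of unity of \<open>A\<close> that are congruent modulo \<open>p\<close> coincide, so $\phi_p(q) = q^{(p)}$. Hence,
  expanded in $T = x - 1$, the matrix \<open>u\<close> under the square root has no constant term, and
  $S = (1 + u)^{1/2}$ converges $T$-adically with coefficients in \<open>A\<close>; coefficientwise the partial sums
  are eventually constant, so the $p$-adic limit is the same. The induced Frobenius lift is therefore
  the $\phi_p$-semilinear substitution $x \mapsto F = x^{(p)} S$, which preserves $A[[T]]$.

  Put $P = x^{(p)t} \phi_p(q) x^{(p)}$ and $Q = (x^t q x)^{(p)}$, which are both symmetric or both
  antisymmetric. From $S^2 = P^{-1} Q$ one gets $S^t P S = P S^2$, that is
  $F^t \phi_p(q) F = (x^t q x)^{(p)}$, and entrywise powers preserve congruences modulo \<open>J\<close>.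

  For \<open>K\<close>, the conditions $a \equiv d$, $b \equiv -c$ say that $x$ commutes modulo \<open>K\<close> with the matrix of
  the complex structure. This property passes to entrywise \<open>p\<close>-th powers (\<open>p\<close> is odd), transposes,
  products, inverses and power series, hence to $F$.\<close>

unbundle no fps_syntax

section \<open>Power series in several variables as a type\<close>

text \<open>The obstacle is the distance between the statement and the computation. The objects of
  the theorem are cosets of cosets, inverse limits and maps described by \<open>THE\<close>, whereas
  the argument is matrix algebra over A[[T]]. So every ring is written as the image of a subring of
  a type-class ring (\<open>mps\<close> serves for series and for polynomials), a completion as
  coherent sequences in that subring, and elements are handled through representatives modulo p^k
  (\<open>rel\<close>, \<open>Hrel\<close>, \<open>Mrel\<close>). The \<open>THE\<close> maps are
  then identified with explicit lifts; their uniqueness is proved without continuity, p-adically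
  from divisibility by p^k and T-adically by splitting off variables.

  Two reasons behind the main steps: 1/p is not in A, since M^k / p would be a rational algebraic
  integer, and a nontrivial root of unity congruent to 1 modulo p would put 1/p into A. And S^t P =
  P S holds because P u = Q - P = u^t P, so that P intertwines u with its transpose.\<close>

typedef ('i, 'a) mps = "UNIV :: ('i multiset \<Rightarrow> 'a) set"
  morphisms coef Mps by simp

lemma coef_Mps [simp]: "coef (Mps f) = f"
  by (simp add: Mps_inverse)

lemma Mps_coef [simp]: "Mps (coef f) = f"
  by (simp add: coef_inverse)

lemma mps_eqI: "(\<And>m. coef f m = coef g m) \<Longrightarrow> f = g"
  by (simp add: coef_inject[symmetric] fun_eq_iff)

text \<open>Splittings are ordered pairs rather than submultisets, so that commutativity and
  associativity of the product become reindexings; \<open>sum_splits\<close> translates to the sum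
  over submultisets that \<open>mpowser_ring\<close> uses.\<close>

definition splits :: "'i multiset \<Rightarrow> ('i multiset \<times> 'i multiset) set" where
  "splits m = {(a, b). a + b = m}"

lemma in_splits [simp]: "(a, b) \<in> splits m \<longleftrightarrow> a + b = m"
  by (simp add: splits_def)

lemma finite_submsets: "finite {k. k \<subseteq># m}"
proof (induction m)
  case (add x m)
  have "{k. k \<subseteq># add_mset x m} \<subseteq> {k. k \<subseteq># m} \<union> add_mset x ` {k. k \<subseteq># m}"
  proof
    fix k assume k: "k \<in> {k. k \<subseteq># add_mset x m}"
    show "k \<in> {k. k \<subseteq># m} \<union> add_mset x ` {k. k \<subseteq># m}"
    proof (cases "x \<in># k")
      case True
      then obtain l where "k = add_mset x l" by (metis multi_member_split)
      with k show ?thesis by auto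
    next
      case False
      with k have "k \<subseteq># m"
        using subset_eq_diff_conv[of k "{#x#}" m] by (simp add: diff_single_trivial)
      then show ?thesis by simp
    qed
  qed
  then show ?case using add finite_subset by auto
qed simp

lemma bij_splits: "bij_betw (\<lambda>k. (k, m - k)) {k. k \<subseteq># m} (splits m)"
  by (rule bij_betw_byWitness[where f' = fst]) (auto simp: splits_def)

lemma finite_splits [simp]: "finite (splits m)"
  using bij_splits finite_submsets bij_betw_finite by blast

lemma sum_splits: "(\<Sum>(a, b)\<in>splits m. F a b) = (\<Sum>k | k \<subseteq># m. F k (m - k))"
  by (subst sum.reindex_bij_betw[OF bij_splits, symmetric]) simp

instantiation mps :: (type, comm_ring_1) comm_ring_1
begin

definition "0 = Mps (\<lambda>_. 0)"
definition "1 = Mps (\<lambda>m. if m = {#} then 1 else 0)"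
definition "f + g = Mps (\<lambda>m. coef f m + coef g m)"
definition "f - g = Mps (\<lambda>m. coef f m - coef g m)"
definition "- f = Mps (\<lambda>m. - coef f m)"
definition "f * g = Mps (\<lambda>m. \<Sum>(a, b)\<in>splits m. coef f a * coef g b)"

instance
proof
  fix f g h :: "('a, 'b) mps"
  show "f * g = g * f"
  proof (rule mps_eqI)
    fix m
    have "(\<Sum>(a, b)\<in>splits m. coef f a * coef g b) = (\<Sum>(a, b)\<in>splits m. coef g a * coef f b)"
      by (rule sum.reindex_bij_witness[where i = prod.swap and j = prod.swap])
        (auto simp: algebra_simps)
    then show "coef (f * g) m = coef (g * f) m" by (simp add: times_mps_def)
  qed
  show "f * g * h = f * (g * h)"
  proof (rule mps_eqI)
    fix m
    have "coef (f * g * h) m = (\<Sum>x\<in>splits m. \<Sum>y\<in>splits (fst x).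
        coef f (fst y) * coef g (snd y) * coef h (snd x))"
      by (simp add: times_mps_def split_beta sum_distrib_right)
    also have "\<dots> = (\<Sum>(x, y)\<in>Sigma (splits m) (\<lambda>x. splits (fst x)).
        coef f (fst y) * coef g (snd y) * coef h (snd x))"
      by (subst sum.Sigma) auto
    also have "\<dots> = (\<Sum>(x, y)\<in>Sigma (splits m) (\<lambda>x. splits (snd x)).
        coef f (fst x) * (coef g (fst y) * coef h (snd y)))"
      \<comment> \<open>Both index sets enumerate the triples (a, b, c) with a + b + c = m; the
        witnesses only move the brackets.\<close>
      by (rule sum.reindex_bij_witness[where
            i = "\<lambda>(x, y). ((fst x + fst y, snd y), (fst x, fst y))" and
            j = "\<lambda>(x, y). ((fst y, snd y + snd x), (snd y, snd x))"])
        (auto simp: algebra_simps splits_def)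
    also have "\<dots> = (\<Sum>x\<in>splits m. \<Sum>y\<in>splits (snd x).
        coef f (fst x) * (coef g (fst y) * coef h (snd y)))"
      by (subst sum.Sigma) auto
    also have "\<dots> = coef (f * (g * h)) m"
      by (simp add: times_mps_def split_beta sum_distrib_left)
    finally show "coef (f * g * h) m = coef (f * (g * h)) m" .
  qed
  show "1 * f = f"
  proof (rule mps_eqI)
    fix m
    have "coef (1 * f) m = (\<Sum>(a, b)\<in>{({#}, m)}. coef 1 a * coef f b)"
      unfolding times_mps_def coef_Mps
      by (rule sum.mono_neutral_right) (auto simp: one_mps_def split: if_splits)
    then show "coef (1 * f) m = coef f m" by (simp add: one_mps_def)
  qed
  show "(f + g) * h = f * h + g * h"
    by (rule mps_eqI) (simp add: times_mps_def plus_mps_def split_beta ring_distribs sum.distrib)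
  show "(0 :: ('a, 'b) mps) \<noteq> 1"
    by (simp add: zero_mps_def one_mps_def Mps_inject fun_eq_iff)
qed (auto simp: zero_mps_def plus_mps_def minus_mps_def uminus_mps_def algebra_simps)

end

lemma coef_zero [simp]: "coef 0 m = 0"
  and coef_one: "coef 1 m = (if m = {#} then 1 else 0)"
  and coef_add [simp]: "coef (f + g) m = coef f m + coef g m"
  and coef_diff [simp]: "coef (f - g) m = coef f m - coef g m"
  and coef_uminus [simp]: "coef (- f) m = - coef f m"
  by (simp_all add: zero_mps_def one_mps_def plus_mps_def minus_mps_def uminus_mps_def)

lemma coef_mult: "coef (f * g) m = (\<Sum>(a, b)\<in>splits m. coef f a * coef g b)"
  by (simp add: times_mps_def)

lemma coef_sum [simp]: "coef (sum f S) m = (\<Sum>x\<in>S. coef (f x) m)"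
  by (induction S rule: infinite_finite_induct) auto

definition mconst :: "'a \<Rightarrow> ('i, 'a::comm_ring_1) mps" where
  "mconst c = Mps (\<lambda>m. if m = {#} then c else 0)"

definition mvar :: "'i \<Rightarrow> ('i, 'a::comm_ring_1) mps" where
  "mvar i = Mps (\<lambda>m. if m = {#i#} then 1 else 0)"

lemma coef_mconst: "coef (mconst c) m = (if m = {#} then c else 0)"
  and coef_mvar: "coef (mvar i) m = (if m = {#i#} then 1 else 0)"
  by (simp_all add: mconst_def mvar_def)

lemma coef_mconst_mult [simp]: "coef (mconst c * f) m = c * coef f m" for m :: "'i multiset"
proof -
  have "coef (mconst c * f) m = (\<Sum>(a, b)\<in>{({#} :: 'i multiset, m)}. coef (mconst c) a * coef f b)"
    unfolding coef_mult by (rule sum.mono_neutral_right) (auto simp: coef_mconst split: if_splits)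
  then show ?thesis by (simp add: coef_mconst)
qed

lemma coef_mult_mconst [simp]: "coef (f * mconst c) m = coef f m * c"
  by (simp add: mult.commute[of f] mult.commute[of _ c])

lemma coef_mvar_mult: "coef (mvar i * f) m = (if i \<in># m then coef f (m - {#i#}) else 0)"
proof (cases "i \<in># m")
  case True
  then have m: "m = {#i#} + (m - {#i#})" by simp
  have "coef (mvar i * f) m = (\<Sum>(a, b)\<in>{({#i#}, m - {#i#})}. coef (mvar i) a * coef f b)"
    unfolding coef_mult using True
    by (intro sum.mono_neutral_right) (auto simp: coef_mvar split: if_splits)
  then show ?thesis using True by (simp add: coef_mvar)
next
  case False
  have "coef (mvar i * f) m = (\<Sum>x\<in>splits m. 0)"
    unfolding coef_mult using False by (intro sum.cong) (auto simp: coef_mvar)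
  then show ?thesis using False by simp
qed

lemma mconst_simps [simp]: "mconst 0 = 0" "mconst 1 = 1"
  "mconst (a + b) = mconst a + mconst b" "mconst (a - b) = mconst a - mconst b"
  "mconst (- a) = - mconst a"
  by (auto intro!: mps_eqI simp: coef_mconst coef_one)

lemma mconst_mult [simp]: "mconst (a * b) = mconst a * mconst b"
  by (auto intro!: mps_eqI simp: coef_mconst)

lemma mconst_sum: "mconst (sum f S) = (\<Sum>x\<in>S. mconst (f x))"
  by (induction S rule: infinite_finite_induct) auto

lemma mconst_power: "mconst (a ^ k) = mconst a ^ k"
  by (induction k) auto

lemma mconst_of_nat: "mconst (of_nat k) = of_nat k"
  by (induction k) auto

lemma coef_empty_mult: "coef (f * g) {#} = coef f {#} * coef g {#}" for f :: "('i, 'a::comm_ring_1) mps"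
proof -
  have "splits {#} = {({#} :: 'i multiset, {#})}" by (auto simp: splits_def)
  then show ?thesis by (simp add: coef_mult)
qed

lemma coef_empty_power: "coef (f ^ k) {#} = coef f {#} ^ k"
  by (induction k) (auto simp: coef_empty_mult coef_one)

subsection \<open>Order of vanishing and locally finite sums\<close>

text \<open>The filtration by total degree. Only a lower bound for the order is recorded, so that
  zero is no special case.\<close>

definition ordge :: "nat \<Rightarrow> ('i, 'a::comm_ring_1) mps \<Rightarrow> bool" where
  "ordge d f \<longleftrightarrow> (\<forall>m. size m < d \<longrightarrow> coef f m = 0)"

lemma ordge_0 [simp]: "ordge 0 f" and ordge_zero [simp]: "ordge d 0"
  by (simp_all add: ordge_def)

lemma ordge_1: "ordge (Suc 0) f \<longleftrightarrow> coef f {#} = 0"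
  by (auto simp: ordge_def)

lemma ordge_mono: "ordge d f \<Longrightarrow> e \<le> d \<Longrightarrow> ordge e f"
  by (auto simp: ordge_def)

lemma ordge_add: "ordge d f \<Longrightarrow> ordge d g \<Longrightarrow> ordge d (f + g)"
  and ordge_diff: "ordge d f \<Longrightarrow> ordge d g \<Longrightarrow> ordge d (f - g)"
  by (auto simp: ordge_def)

lemma ordge_sum: "(\<And>x. x \<in> S \<Longrightarrow> ordge d (f x)) \<Longrightarrow> ordge d (sum f S)"
  by (simp add: ordge_def)

lemma ordge_mult:
  fixes f g :: "('i, 'a::comm_ring_1) mps"
  shows "ordge d f \<Longrightarrow> ordge e g \<Longrightarrow> ordge (d + e) (f * g)"
  unfolding ordge_def coef_mult
proof (intro allI impI sum.neutral ballI)
  fix m :: "'i multiset" and x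
  assume f: "\<forall>m. size m < d \<longrightarrow> coef f m = 0" and g: "\<forall>m. size m < e \<longrightarrow> coef g m = 0"
    and m: "size m < d + e" and x: "x \<in> splits m"
  obtain a b where ab: "x = (a, b)" "a + b = m" using x by (auto simp: splits_def)
  then have "size a < d \<or> size b < e" using m by auto
  then have "coef f a * coef g b = 0" using f g by auto
  then show "(case x of (a, b) \<Rightarrow> coef f a * coef g b) = 0" by (simp add: ab)
qed

lemma ordge_mult1: "ordge d f \<Longrightarrow> ordge d (f * g)"
  and ordge_mult2: "ordge d g \<Longrightarrow> ordge d (f * g)"
  using ordge_mult[of d f 0 g] ordge_mult[of 0 f d g] by simp_all

lemma mps_eq_ordI: "(\<And>d. ordge d (f - g)) \<Longrightarrow> f = g"
proof (rule mps_eqI)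
  fix m
  assume "\<And>d. ordge d (f - g)"
  from this[of "Suc (size m)"] have "coef (f - g) m = 0"
    unfolding ordge_def by blast
  then show "coef f m = coef g m" by simp
qed

text \<open>Each coefficient of a T-adically convergent sum is a finite sum. The cutoff
  \<open>Suc (size m)\<close> fits \<open>locfin\<close>: the terms from index
  \<open>size m + 2\<close> on have order greater than \<open>size m\<close>.\<close>

definition lsum :: "(nat \<Rightarrow> ('i, 'a::comm_ring_1) mps) \<Rightarrow> ('i, 'a) mps" where
  "lsum h = Mps (\<lambda>m. \<Sum>i\<le>Suc (size m). coef (h i) m)"

text \<open>The shift by one leaves room for derivative-like sums, whose i-th term only has order i
  - 1; they occur in the commutator with a power series in a matrix
  (\<open>comm_mat_mseries\<close>).\<close>

definition locfin :: "(nat \<Rightarrow> ('i, 'a::comm_ring_1) mps) \<Rightarrow> bool" where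
  "locfin h \<longleftrightarrow> (\<forall>i. ordge i (h (Suc i)))"

lemma locfinI: "(\<And>i. ordge i (h i)) \<Longrightarrow> locfin h"
  unfolding locfin_def by (meson le_SucI le_refl ordge_mono)

lemma coef_lsum:
  assumes "locfin h" "size m < B"
  shows "coef (lsum h) m = (\<Sum>i\<le>B. coef (h i) m)"
  unfolding lsum_def coef_Mps
proof (rule sum.mono_neutral_left)
  show "\<forall>i\<in>{..B} - {..Suc (size m)}. coef (h i) m = 0"
  proof
    fix i assume "i \<in> {..B} - {..Suc (size m)}"
    then obtain j where "i = Suc j" "size m < j" by (cases i) auto
    then show "coef (h i) m = 0" using assms by (auto simp: locfin_def ordge_def)
  qed
qed (use assms in auto)

lemma ordge_lsum_diff: "locfin h \<Longrightarrow> d \<le> B \<Longrightarrow> ordge d (lsum h - (\<Sum>i\<le>B. h i))"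
  unfolding ordge_def by (simp add: coef_lsum[of h _ B])

text \<open>The filtration is separated (\<open>mps_eq_ordI\<close>), so agreement with the partial
  sums at arbitrarily late cutoffs is enough. Products of infinite sums are identified through this
  criterion.\<close>

lemma lsum_unique:
  assumes "locfin h" "\<And>d. \<exists>B\<ge>d. ordge d (f - (\<Sum>i\<le>B. h i))"
  shows "f = lsum h"
proof (rule mps_eq_ordI)
  fix d
  obtain B where B: "B \<ge> d" "ordge d (f - (\<Sum>i\<le>B. h i))" using assms(2) by blast
  have "f - lsum h = (f - (\<Sum>i\<le>B. h i)) - (lsum h - (\<Sum>i\<le>B. h i))" by simp
  then show "ordge d (f - lsum h)"
    using B ordge_lsum_diff[OF assms(1) B(1)] by (metis ordge_diff)
qed

lemma lsum_cong: "(\<And>i. h i = g i) \<Longrightarrow> lsum h = lsum g"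
  by presburger

lemma lsum_add: "lsum (\<lambda>i. h i + g i) = lsum h + lsum g"
  by (rule mps_eqI) (simp add: lsum_def sum.distrib)

lemma lsum_sum: "lsum (\<lambda>i. \<Sum>x\<in>S. h x i) = (\<Sum>x\<in>S. lsum (h x))"
  by (rule mps_eqI) (simp only: lsum_def coef_Mps coef_sum, rule sum.swap)

lemma lsum_mult_right:
  assumes "locfin h"
  shows "lsum h * c = lsum (\<lambda>i. h i * c)"
proof (rule lsum_unique)
  show "locfin (\<lambda>i. h i * c)" using assms by (auto simp: locfin_def ordge_mult1)
  show "\<exists>B\<ge>d. ordge d (lsum h * c - (\<Sum>i\<le>B. h i * c))" for d
    using ordge_mult1[OF ordge_lsum_diff[OF assms order_refl, of d], of c]
    by (auto simp: left_diff_distrib sum_distrib_right)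
qed

lemma lsum_mult_left: "locfin h \<Longrightarrow> c * lsum h = lsum (\<lambda>i. c * h i)"
  using lsum_mult_right[of h c] by (simp add: mult.commute)

text \<open>Cauchy product: the product of two partial sums differs from the triangular partial sum
  only by terms with i + j > d, all of order at least d.\<close>

lemma lsum_mult:
  assumes "\<And>i. ordge i (h i)" "\<And>i. ordge i (g i)"
  shows "lsum h * lsum g = lsum (\<lambda>n. \<Sum>i\<le>n. h i * g (n - i))"
proof (rule lsum_unique)
  have o: "ordge n (h i * g (n - i))" if "i \<le> n" for i n
    using ordge_mult[OF assms(1)[of i] assms(2)[of "n - i"]] that by simp
  then show "locfin (\<lambda>n. \<Sum>i\<le>n. h i * g (n - i))"
    by (intro locfinI ordge_sum) auto
  show "\<exists>B\<ge>d. ordge d (lsum h * lsum g - (\<Sum>n\<le>B. \<Sum>i\<le>n. h i * g (n - i)))" for d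
  proof (intro exI[of _ d] conjI order_refl)
    let ?H = "\<Sum>i\<le>d. h i" and ?G = "\<Sum>i\<le>d. g i"
    have "?H * ?G = (\<Sum>(i, j)\<in>{..d} \<times> {..d}. h i * g j)"
      by (simp add: sum_product sum.cartesian_product)
    also have "\<dots> = (\<Sum>(i, j)\<in>{(i, j). i + j \<le> d}. h i * g j) +
        (\<Sum>(i, j)\<in>{..d} \<times> {..d} - {(i, j). i + j \<le> d}. h i * g j)"
      by (subst sum.subset_diff[of "{(i, j). i + j \<le> d}"]) (auto simp: add.commute)
    also have "(\<Sum>(i, j)\<in>{(i, j). i + j \<le> d}. h i * g j) = (\<Sum>n\<le>d. \<Sum>i\<le>n. h i * g (n - i))"
      by (rule sum.triangle_reindex_eq)
    finally have "?H * ?G - (\<Sum>n\<le>d. \<Sum>i\<le>n. h i * g (n - i)) =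
        (\<Sum>(i, j)\<in>{..d} \<times> {..d} - {(i, j). i + j \<le> d}. h i * g j)" by simp
    moreover have "ordge d (\<Sum>(i, j)\<in>{..d} \<times> {..d} - {(i, j). i + j \<le> d}. h i * g j)"
    proof (rule ordge_sum)
      fix x assume "x \<in> {..d} \<times> {..d} - {(i, j). i + j \<le> d}"
      then obtain i j where "x = (i, j)" "d \<le> i + j" by (cases x) auto
      then show "ordge d (case x of (i, j) \<Rightarrow> h i * g j)"
        using ordge_mono[OF ordge_mult[OF assms], of d i j] by simp
    qed
    ultimately have 1: "ordge d (?H * ?G - (\<Sum>n\<le>d. \<Sum>i\<le>n. h i * g (n - i)))" by simp
    have l: "locfin h" "locfin g" using assms by (auto intro: locfinI)
    have "lsum h * lsum g - ?H * ?G = (lsum h - ?H) * lsum g + ?H * (lsum g - ?G)"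
      by (simp add: algebra_simps)
    then have 2: "ordge d (lsum h * lsum g - ?H * ?G)"
      by (simp add: ordge_add ordge_mult1 ordge_mult2 ordge_lsum_diff[OF l(1)] ordge_lsum_diff[OF l(2)])
    show "ordge d (lsum h * lsum g - (\<Sum>n\<le>d. \<Sum>i\<le>n. h i * g (n - i)))"
      using ordge_add[OF 1 2] by simp
  qed
qed

subsection \<open>Univariate power series evaluated at a matrix\<close>

lemma entry_mult:
  "Y \<in> carrier_mat n m \<Longrightarrow> Z \<in> carrier_mat m k \<Longrightarrow> i < n \<Longrightarrow> j < k \<Longrightarrow>
    (Y * Z) $$ (i, j) = (\<Sum>l<m. Y $$ (i, l) * Z $$ (l, j))"
  by (auto simp: scalar_prod_def atLeast0LessThan intro!: sum.cong)

lemma smult_one_mat: "(1 :: 'a :: comm_ring_1) \<cdot>\<^sub>m Y = Y"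
  by (rule eq_matI) auto

lemma smult_zero_mat: "Y \<in> carrier_mat n n \<Longrightarrow> (0 :: 'a :: comm_ring_1) \<cdot>\<^sub>m Y = 0\<^sub>m n n"
  by (rule eq_matI) auto

lemma pow_mat_plus:
  assumes Y: "Y \<in> carrier_mat n n"
  shows "Y ^\<^sub>m (i + j) = Y ^\<^sub>m i * Y ^\<^sub>m j"
proof (induction j)
  case (Suc j)
  then show ?case
    using Y by (simp add: assoc_mult_mat[of _ n n _ n _ n])
qed (use Y in auto)

lemma pow_mat_Suc_left:
  assumes "Y \<in> carrier_mat n n"
  shows "Y ^\<^sub>m (Suc i) = Y * Y ^\<^sub>m i"
  using pow_mat_plus[OF assms, of 1 i] assms by simp

lemma transpose_pow_mat:
  assumes Y: "(Y :: 'a :: comm_ring_1 mat) \<in> carrier_mat n n"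
  shows "transpose_mat (Y ^\<^sub>m i) = transpose_mat Y ^\<^sub>m i"
proof (induction i)
  case (Suc i)
  have "transpose_mat (Y ^\<^sub>m Suc i) = transpose_mat Y * transpose_mat Y ^\<^sub>m i"
    using Y Suc by (simp add: transpose_mult[of _ n n _ n])
  also have "\<dots> = transpose_mat Y ^\<^sub>m Suc i"
    using Y by (subst pow_mat_Suc_left[of _ n]) auto
  finally show ?case .
qed (use Y in auto)

definition mord :: "nat \<Rightarrow> ('i, 'a::comm_ring_1) mps mat \<Rightarrow> bool" where
  "mord d Y \<longleftrightarrow> (\<forall>i<dim_row Y. \<forall>j<dim_col Y. ordge d (Y $$ (i, j)))"

lemma mord_mult:
  assumes "Y \<in> carrier_mat n n" "Z \<in> carrier_mat n n" "mord d Y" "mord e Z"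
  shows "mord (d + e) (Y * Z)"
  unfolding mord_def
proof (intro allI impI)
  fix i j assume "i < dim_row (Y * Z)" "j < dim_col (Y * Z)"
  then have "i < n" "j < n" using assms by auto
  then show "ordge (d + e) ((Y * Z) $$ (i, j))"
    using assms unfolding entry_mult[OF assms(1,2) \<open>i < n\<close> \<open>j < n\<close>] mord_def
    by (auto intro!: ordge_sum ordge_mult)
qed

lemma mord_pow:
  assumes "Y \<in> carrier_mat n n" "mord 1 Y"
  shows "mord i (Y ^\<^sub>m i)"
proof (induction i)
  case (Suc i)
  then show ?case using mord_mult[OF _ assms(1) Suc assms(2)] assms(1) by simp
qed (simp add: mord_def)

text \<open>The value f(Y). It is a T-adic limit when \<open>mord 1 Y\<close>, that is, when the
  entries of Y have no constant term; otherwise \<open>lsum\<close> is a mere truncation.\<close>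

definition mseries :: "'a fps \<Rightarrow> ('i, 'a::comm_ring_1) mps mat \<Rightarrow> ('i, 'a) mps mat" where
  "mseries f Y = mat (dim_row Y) (dim_row Y)
     (\<lambda>ab. lsum (\<lambda>i. mconst (fps_nth f i) * (Y ^\<^sub>m i) $$ ab))"

lemma mseries_carrier [simp]: "Y \<in> carrier_mat n n \<Longrightarrow> mseries f Y \<in> carrier_mat n n"
  by (simp add: mseries_def)

lemma dim_mseries [simp]: "dim_row (mseries f Y) = dim_row Y" "dim_col (mseries f Y) = dim_row Y"
  by (simp_all add: mseries_def)

lemma mseries_entry:
  "Y \<in> carrier_mat n n \<Longrightarrow> a < n \<Longrightarrow> b < n \<Longrightarrow>
    mseries f Y $$ (a, b) = lsum (\<lambda>i. mconst (fps_nth f i) * (Y ^\<^sub>m i) $$ (a, b))"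
  by (auto simp: mseries_def)

lemma ordge_pow_mat:
  "Y \<in> carrier_mat n n \<Longrightarrow> mord 1 Y \<Longrightarrow> a < n \<Longrightarrow> b < n \<Longrightarrow> ordge i ((Y ^\<^sub>m i) $$ (a, b))"
  using mord_pow[of Y n i] by (auto simp: mord_def)

lemma mseries_locfin:
  "Y \<in> carrier_mat n n \<Longrightarrow> mord 1 Y \<Longrightarrow> a < n \<Longrightarrow> b < n \<Longrightarrow>
    locfin (\<lambda>i. mconst (fps_nth f i) * (Y ^\<^sub>m i) $$ (a, b))"
  by (intro locfinI ordge_mult2 ordge_pow_mat)

text \<open>Cauchy product together with Y^i Y^j = Y^(i+j). Through it, identities between
  univariate series, such as those of the geometric series and of the square root, pass to
  matrices.\<close>

lemma mseries_mult:
  assumes Y: "Y \<in> carrier_mat n n" "mord 1 Y"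
  shows "mseries f Y * mseries g Y = mseries (f * g) Y"
proof (rule eq_matI)
  fix a b assume "a < dim_row (mseries (f * g) Y)" "b < dim_col (mseries (f * g) Y)"
  then have ab: "a < n" "b < n" using Y by auto
  let ?P = "\<lambda>i. Y ^\<^sub>m i"
  let ?t = "\<lambda>f i. mconst (fps_nth f i)"
  have "(mseries f Y * mseries g Y) $$ (a, b) =
      (\<Sum>c<n. lsum (\<lambda>i. ?t f i * ?P i $$ (a, c)) * lsum (\<lambda>i. ?t g i * ?P i $$ (c, b)))"
    using Y ab by (simp add: entry_mult[of _ n n _ n] mseries_entry del: index_mult_mat)
  also have "\<dots> = (\<Sum>c<n. lsum (\<lambda>k. \<Sum>i\<le>k. ?t f i * ?P i $$ (a, c) * (?t g (k - i) * ?P (k - i) $$ (c, b))))"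
    by (rule sum.cong[OF refl], rule lsum_mult)
      (auto intro!: ordge_mult2 ordge_pow_mat[OF Y] simp: ab)
  also have "\<dots> = lsum (\<lambda>k. \<Sum>c<n. \<Sum>i\<le>k. ?t f i * ?P i $$ (a, c) * (?t g (k - i) * ?P (k - i) $$ (c, b)))"
    by (simp add: lsum_sum)
  also have "\<dots> = lsum (\<lambda>k. ?t (f * g) k * ?P k $$ (a, b))"
  proof (rule lsum_cong)
    fix k
    have "(\<Sum>c<n. \<Sum>i\<le>k. ?t f i * ?P i $$ (a, c) * (?t g (k - i) * ?P (k - i) $$ (c, b))) =
        (\<Sum>i\<le>k. ?t f i * ?t g (k - i) * (\<Sum>c<n. ?P i $$ (a, c) * ?P (k - i) $$ (c, b)))"
      by (subst sum.swap) (simp add: sum_distrib_left algebra_simps)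
    also have "\<dots> = (\<Sum>i\<le>k. ?t f i * ?t g (k - i) * ?P k $$ (a, b))"
    proof (rule sum.cong[OF refl])
      fix i assume "i \<in> {..k}"
      then have "?P k = ?P i * ?P (k - i)" using pow_mat_plus[OF Y(1), of i "k - i"] by simp
      then show "?t f i * ?t g (k - i) * (\<Sum>c<n. ?P i $$ (a, c) * ?P (k - i) $$ (c, b)) =
          ?t f i * ?t g (k - i) * ?P k $$ (a, b)"
        using entry_mult[of "?P i" n n "?P (k - i)" n a b] Y ab by simp
    qed
    also have "\<dots> = ?t (f * g) k * ?P k $$ (a, b)"
      by (simp add: fps_mult_nth mconst_sum sum_distrib_right atMost_atLeast0)
    finally show "(\<Sum>c<n. \<Sum>i\<le>k. ?t f i * ?P i $$ (a, c) * (?t g (k - i) * ?P (k - i) $$ (c, b))) =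
        ?t (f * g) k * ?P k $$ (a, b)" .
  qed
  also have "\<dots> = mseries (f * g) Y $$ (a, b)"
    using mseries_entry[OF Y(1) ab] by simp
  finally show "(mseries f Y * mseries g Y) $$ (a, b) = mseries (f * g) Y $$ (a, b)" .
qed (use Y in auto)

text \<open>\<open>lsum\<close> always takes in the indices 0 and 1, and a linear series has no
  others. The case c = 1 gives 1 + Y, the case c = 0 the unit matrix.\<close>

lemma mseries_linear:
  assumes Y: "Y \<in> carrier_mat n n"
  shows "mseries (1 + fps_const c * fps_X) Y = 1\<^sub>m n + mconst c \<cdot>\<^sub>m Y"
proof (rule eq_matI)
  fix a b assume "a < dim_row (1\<^sub>m n + mconst c \<cdot>\<^sub>m Y)" "b < dim_col (1\<^sub>m n + mconst c \<cdot>\<^sub>m Y)"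
  then have ab: "a < n" "b < n" using Y by auto
  let ?h = "\<lambda>i. mconst (fps_nth (1 + fps_const c * fps_X) i) * (Y ^\<^sub>m i) $$ (a, b)"
  have z: "?h i = 0" if "i \<ge> 2" for i
    using that by (auto simp: fps_X_def)
  have s: "(\<Sum>i\<le>Suc k. coef (?h i) m) = coef (?h 0) m + coef (?h 1) m" for k m
    by (induction k) (simp_all del: coef_mconst_mult add: z)
  have "lsum ?h = ?h 0 + ?h 1"
    by (rule mps_eqI) (simp only: lsum_def coef_Mps s coef_add)
  then show "mseries (1 + fps_const c * fps_X) Y $$ (a, b) = (1\<^sub>m n + mconst c \<cdot>\<^sub>m Y) $$ (a, b)"
    using Y ab by (simp add: mseries_entry)
qed (use Y in auto)

lemma transpose_mseries:
  assumes Y: "Y \<in> carrier_mat n n"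
  shows "transpose_mat (mseries f Y) = mseries f (transpose_mat Y)"
  by (rule eq_matI)
    (use Y in \<open>auto simp: mseries_entry[of _ n] transpose_pow_mat[symmetric]\<close>)

lemma mseries_entry_left:
  assumes Y: "Y \<in> carrier_mat n n" "mord 1 Y" and Z: "Z \<in> carrier_mat n n" and ab: "a < n" "b < n"
  shows "(Z * mseries f Y) $$ (a, b) = lsum (\<lambda>i. mconst (fps_nth f i) * (Z * Y ^\<^sub>m i) $$ (a, b))"
proof -
  have "(Z * mseries f Y) $$ (a, b) =
      (\<Sum>c<n. lsum (\<lambda>i. Z $$ (a, c) * (mconst (fps_nth f i) * (Y ^\<^sub>m i) $$ (c, b))))"
    using Y Z ab by (simp add: entry_mult[of _ n n _ n] mseries_entry lsum_mult_left mseries_locfin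
        del: index_mult_mat)
  also have "\<dots> = lsum (\<lambda>i. mconst (fps_nth f i) * (Z * Y ^\<^sub>m i) $$ (a, b))"
    unfolding lsum_sum[symmetric] using Y Z ab
    by (intro lsum_cong) (simp add: entry_mult[of _ n n _ n] sum_distrib_left algebra_simps
        del: index_mult_mat)
  finally show ?thesis .
qed

lemma mseries_entry_right:
  assumes Y: "Y \<in> carrier_mat n n" "mord 1 Y" and Z: "Z \<in> carrier_mat n n" and ab: "a < n" "b < n"
  shows "(mseries f Y * Z) $$ (a, b) = lsum (\<lambda>i. mconst (fps_nth f i) * (Y ^\<^sub>m i * Z) $$ (a, b))"
proof -
  have "(mseries f Y * Z) $$ (a, b) =
      (\<Sum>c<n. lsum (\<lambda>i. mconst (fps_nth f i) * (Y ^\<^sub>m i) $$ (a, c) * Z $$ (c, b)))"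
    using Y Z ab by (simp add: entry_mult[of _ n n _ n] mseries_entry lsum_mult_right mseries_locfin
        del: index_mult_mat)
  also have "\<dots> = lsum (\<lambda>i. mconst (fps_nth f i) * (Y ^\<^sub>m i * Z) $$ (a, b))"
    unfolding lsum_sum[symmetric] using Y Z ab
    by (intro lsum_cong) (simp add: entry_mult[of _ n n _ n] sum_distrib_left algebra_simps
        del: index_mult_mat)
  finally show ?thesis .
qed

lemma pow_mat_intertwine:
  assumes "Y \<in> carrier_mat n n" "Y' \<in> carrier_mat n n" "Z \<in> carrier_mat n n" "Z * Y = Y' * Z"
  shows "Z * Y ^\<^sub>m i = Y' ^\<^sub>m i * Z"
proof (induction i)
  case (Suc i)
  have "Z * Y ^\<^sub>m Suc i = Z * Y ^\<^sub>m i * Y"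
    using assms by (simp add: assoc_mult_mat[of _ n n _ n _ n])
  also have "\<dots> = Y' ^\<^sub>m i * (Z * Y)"
    using Suc assms by (simp add: assoc_mult_mat[of _ n n _ n _ n])
  also have "\<dots> = Y' ^\<^sub>m Suc i * Z"
    using assms by (simp add: assoc_mult_mat[of _ n n _ n _ n])
  finally show ?case .
qed (use assms in auto)

text \<open>A matrix that intertwines Y and Y' intertwines all their powers. Applied with Z =
  \<open>P0\<close> and Y' the transpose of Y, this moves the square root across
  \<open>P0\<close>.\<close>

lemma mseries_intertwine:
  assumes "Y \<in> carrier_mat n n" "mord 1 Y" "Y' \<in> carrier_mat n n" "mord 1 Y'"
    and "Z \<in> carrier_mat n n" "Z * Y = Y' * Z"
  shows "Z * mseries f Y = mseries f Y' * Z"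
proof (rule eq_matI)
  fix a b assume "a < dim_row (mseries f Y' * Z)" "b < dim_col (mseries f Y' * Z)"
  then have "a < n" "b < n" using assms by auto
  then show "(Z * mseries f Y) $$ (a, b) = (mseries f Y' * Z) $$ (a, b)"
    using mseries_entry_left[of Y n Z a b f] mseries_entry_right[of Y' n Z a b f]
      pow_mat_intertwine[of Y n Y' Z] assms by simp
qed (use assms in auto)

lemma mseries_const_term:
  assumes Y: "Y \<in> carrier_mat n n" "mord 1 Y" and ab: "a < n" "b < n"
  shows "coef (mseries f Y $$ (a, b)) {#} = (if a = b then fps_nth f 0 else 0)"
proof -
  have "coef ((Y ^\<^sub>m Suc 0) $$ (a, b)) {#} = 0"
    using ordge_pow_mat[OF Y ab, of "Suc 0"] by (simp add: ordge_1)
  then show ?thesis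
    using Y ab by (simp add: mseries_entry lsum_def coef_one)
qed

text \<open>The geometric series: by \<open>mseries_mult\<close>, evaluating the univariate inverse
  of 1 + X at Y inverts 1 + Y on both sides.\<close>

lemma mseries_inverse:
  assumes Y: "Y \<in> carrier_mat n n" "mord 1 Y"
  obtains Z where "Z = mseries (inverse (1 + fps_X :: complex fps)) Y" "(1\<^sub>m n + Y) * Z = 1\<^sub>m n" "Z * (1\<^sub>m n + Y) = 1\<^sub>m n"
proof -
  have l: "mseries (1 + fps_X) Y = 1\<^sub>m n + Y"
    using mseries_linear[OF Y(1), of 1] smult_one_mat[of Y] by simp
  have o: "mseries 1 Y = 1\<^sub>m n"
    using mseries_linear[OF Y(1), of 0] smult_zero_mat[OF Y(1)] by simp
  have i: "(1 + fps_X) * inverse (1 + fps_X :: complex fps) = 1"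
    using inverse_mult_eq_1[of "1 + fps_X :: complex fps"] by (simp add: mult.commute)
  show thesis
    by (rule that[OF refl]) (simp_all only: l[symmetric] mseries_mult[OF Y] i i[unfolded mult.commute[of "1 + fps_X"]] o)
qed

section \<open>Subrings of a type\<close>

text \<open>Coefficient rings are subsets of a type, so that the simplifier and the matrix library
  work with the operations of the ambient type, while membership is tracked as a separate
  obligation.\<close>

locale subr =
  fixes S :: "'a :: comm_ring_1 set"
  assumes one_mem [simp, intro]: "1 \<in> S"
    and add_mem [simp, intro]: "x \<in> S \<Longrightarrow> y \<in> S \<Longrightarrow> x + y \<in> S"
    and mult_mem [simp, intro]: "x \<in> S \<Longrightarrow> y \<in> S \<Longrightarrow> x * y \<in> S"
    and uminus_mem [simp, intro]: "x \<in> S \<Longrightarrow> - x \<in> S"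
begin

lemma zero_mem [simp, intro]: "0 \<in> S"
  using add_mem[OF one_mem uminus_mem[OF one_mem]] by simp

lemma diff_mem [simp, intro]: "x \<in> S \<Longrightarrow> y \<in> S \<Longrightarrow> x - y \<in> S"
  using add_mem[of x "- y"] by simp

lemma sum_mem: "(\<And>i. i \<in> I \<Longrightarrow> f i \<in> S) \<Longrightarrow> sum f I \<in> S"
  by (induction I rule: infinite_finite_induct) auto

lemma prod_mem: "(\<And>i. i \<in> I \<Longrightarrow> f i \<in> S) \<Longrightarrow> prod f I \<in> S"
  by (induction I rule: infinite_finite_induct) auto

lemma power_mem [simp, intro]: "x \<in> S \<Longrightarrow> x ^ k \<in> S"
  by (induction k) auto

lemma of_nat_mem [simp, intro]: "of_nat k \<in> S"
  by (induction k) auto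

lemma of_int_mem [simp, intro]: "of_int k \<in> S"
  by (cases k) auto

lemma numeral_mem [simp, intro]: "numeral k \<in> S"
  using of_nat_mem[of "numeral k"] by simp

end

definition smats :: "'a set \<Rightarrow> nat \<Rightarrow> 'a mat set" where
  "smats S n = {Y \<in> carrier_mat n n. \<forall>i<n. \<forall>j<n. Y $$ (i, j) \<in> S}"

lemma smatsI: "Y \<in> carrier_mat n n \<Longrightarrow> (\<And>i j. i < n \<Longrightarrow> j < n \<Longrightarrow> Y $$ (i, j) \<in> S) \<Longrightarrow> Y \<in> smats S n"
  by (simp add: smats_def)

lemma smats_carrier: "Y \<in> smats S n \<Longrightarrow> Y \<in> carrier_mat n n"
  by (simp add: smats_def)

lemma smats_entry: "Y \<in> smats S n \<Longrightarrow> i < n \<Longrightarrow> j < n \<Longrightarrow> Y $$ (i, j) \<in> S"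
  by (simp add: smats_def)

lemma smats_elements: "Y \<in> smats S n \<longleftrightarrow> Y \<in> carrier_mat n n \<and> elements_mat Y \<subseteq> S"
proof
  assume Y: "Y \<in> smats S n"
  have "x \<in> S" if "x \<in> elements_mat Y" for x
    using elements_matD[OF that] Y by (auto simp: smats_def)
  then show "Y \<in> carrier_mat n n \<and> elements_mat Y \<subseteq> S"
    using Y by (auto simp: smats_carrier)
next
  assume "Y \<in> carrier_mat n n \<and> elements_mat Y \<subseteq> S"
  then show "Y \<in> smats S n"
    by (intro smatsI) (auto dest: elements_matI[OF _ _ _ refl])
qed

context subr
begin

lemma smats_mult [simp, intro]:
  assumes "Y \<in> smats S n" "Z \<in> smats S n"
  shows "Y * Z \<in> smats S n"
proof (rule smatsI)
  fix i j assume ij: "i < n" "j < n"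
  have "(Y * Z) $$ (i, j) = (\<Sum>l<n. Y $$ (i, l) * Z $$ (l, j))"
    using assms ij by (auto simp: scalar_prod_def atLeast0LessThan smats_def intro!: sum.cong)
  then show "(Y * Z) $$ (i, j) \<in> S" using assms ij by (auto simp: smats_entry intro!: sum_mem)
qed (use assms in \<open>auto simp: smats_def\<close>)

lemma smats_intros [simp, intro]:
  "Y \<in> smats S n \<Longrightarrow> Z \<in> smats S n \<Longrightarrow> Y + Z \<in> smats S n"
  "Y \<in> smats S n \<Longrightarrow> Z \<in> smats S n \<Longrightarrow> Y - Z \<in> smats S n"
  "Y \<in> smats S n \<Longrightarrow> transpose_mat Y \<in> smats S n"
  "1\<^sub>m n \<in> smats S n"
  "Y \<in> smats S n \<Longrightarrow> map_mat (\<lambda>a. a ^ k) Y \<in> smats S n"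
  by (auto simp: smats_def)

lemma smats_pow [simp, intro]: "Y \<in> smats S n \<Longrightarrow> Y ^\<^sub>m k \<in> smats S n"
proof (induction k)
  case (Suc k)
  then show ?case using smats_mult[of "Y ^\<^sub>m k" n Y] by simp
qed (auto simp: smats_def)

end

declare smats_carrier [simp] smats_entry [simp]

text \<open>The base ring of the statement has this form: \<open>cyclotomic_ring\<close> unfolds to
  \<open>rec\<close> of the generated set.\<close>

abbreviation rec :: "'a :: comm_ring_1 set \<Rightarrow> 'a ring" where
  "rec S \<equiv> ring_of_type_algebra\<lparr>carrier := S\<rparr>"

lemma ring_of_type_algebra_sel [simp]:
  "carrier ring_of_type_algebra = UNIV"
  "x \<otimes>\<^bsub>ring_of_type_algebra\<^esub> y = x * y" "\<one>\<^bsub>ring_of_type_algebra\<^esub> = 1"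
  "\<zero>\<^bsub>ring_of_type_algebra\<^esub> = 0" "x \<oplus>\<^bsub>ring_of_type_algebra\<^esub> y = x + y"
  by (simp_all add: ring_of_type_algebra_def)

context subr
begin

lemma cring_rec: "cring (rec S)"
proof (rule cringI)
  show "abelian_group (rec S)"
  proof (rule abelian_groupI)
    show "\<exists>y\<in>carrier (rec S). y \<oplus>\<^bsub>rec S\<^esub> x = \<zero>\<^bsub>rec S\<^esub>" if "x \<in> carrier (rec S)" for x
      using that by (intro bexI[of _ "- x"]) auto
  qed (simp_all add: add.assoc add.commute)
  show "Group.comm_monoid (rec S)"
    by (rule comm_monoidI) (simp_all add: mult.assoc mult.commute)
qed (simp add: distrib_right)

interpretation R: cring "rec S" by (rule cring_rec)

lemma rec_a_inv [simp]: "x \<in> S \<Longrightarrow> a_inv (rec S) x = - x"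
  using R.sum_zero_eq_neg[of "- x" x] by simp

lemma rec_finsum: "(\<And>i. i \<in> I \<Longrightarrow> f i \<in> S) \<Longrightarrow> finsum (rec S) f I = sum f I"
proof (induction I rule: infinite_finite_induct)
  case (infinite I)
  then show ?case by (simp add: finsum_def finprod_def)
qed (auto simp: Pi_def)

lemma rec_pow [simp]: "x \<in> S \<Longrightarrow> x [^]\<^bsub>rec S\<^esub> (k :: nat) = x ^ k"
  by (induction k) (auto simp: mult.commute)

lemma rec_add_pow [simp]: "x \<in> S \<Longrightarrow> [k] \<cdot>\<^bsub>rec S\<^esub> x = of_nat k * x"
  by (induction k) (auto simp: R.add.nat_pow_Suc algebra_simps)

lemma pow_ideal_rec: "pow_ideal (rec S) p k = {x * of_nat p ^ k | x. x \<in> S}"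
  by (simp add: pow_ideal_def cgenideal_def)

end

section \<open>Arithmetic of the cyclotomic base ring\<close>

lemma rec_UNIV: "rec UNIV = ring_of_type_algebra"
  by (simp add: ring_of_type_algebra_def)

lemma subr_generate: "subr (generate_ring ring_of_type_algebra H)"
proof
  let ?R = "ring_of_type_algebra :: 'a ring"
  let ?G = "generate_ring ?R H"
  show "1 \<in> ?G" using generate_ring.one[of ?R H] by (simp add: ring_of_type_algebra_def)
  show "x + y \<in> ?G" if "x \<in> ?G" "y \<in> ?G" for x y
    using generate_ring.eng_add[OF that] by (simp add: ring_of_type_algebra_def)
  show "x * y \<in> ?G" if "x \<in> ?G" "y \<in> ?G" for x y
    using generate_ring.eng_mult[OF that] by (simp add: ring_of_type_algebra_def)
  show "- x \<in> ?G" if "x \<in> ?G" for x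
  proof -
    have u: "subr (UNIV :: 'a set)" by unfold_locales auto
    have "a_inv ?R x = - x" using subr.rec_a_inv[OF u, of x] unfolding rec_UNIV by simp
    then show ?thesis using generate_ring.a_inv[OF that] by simp
  qed
qed

text \<open>Multiplication by r = f(\<zeta>) acts on the vector (1, \<zeta>, ..., \<zeta>^(N-1))
  through an integer matrix, because exponents may be reduced modulo N. So r is an eigenvalue of an
  integer matrix and a root of its monic characteristic polynomial.\<close>

lemma algebraic_int_poly_root_of_unity:
  fixes \<zeta> :: complex
  assumes N: "N > 0" and z: "\<zeta> ^ N = 1"
  shows "algebraic_int (poly (map_poly of_int f) \<zeta>)"
proof -
  define r where "r = poly (map_poly of_int f) \<zeta>"
  define E :: "int mat" where
    "E = mat N N (\<lambda>(i, l). \<Sum>j | j \<le> degree f \<and> (i + j) mod N = l. coeff f j)"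
  have E: "E \<in> carrier_mat N N" by (simp add: E_def)
  define F where "F = map_mat complex_of_int E"
  have F: "F \<in> carrier_mat N N" using E by (simp add: F_def)
  define v where "v = vec N (\<lambda>i. \<zeta> ^ i)"
  have v: "v \<in> carrier_vec N" by (simp add: v_def)
  have zm: "\<zeta> ^ (k mod N) = \<zeta> ^ k" for k
  proof -
    have "\<zeta> ^ k = \<zeta> ^ (N * (k div N) + k mod N)" by simp
    also have "\<dots> = \<zeta> ^ (k mod N)" unfolding power_add power_mult z by simp
    finally show ?thesis by simp
  qed
  have ent: "vec_index (F *\<^sub>v v) i = r * \<zeta> ^ i" if i: "i < N" for i
  proof -
    have "vec_index (F *\<^sub>v v) i = (\<Sum>l<N. of_int (\<Sum>j | j \<le> degree f \<and> (i + j) mod N = l. coeff f j) * \<zeta> ^ l)"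
      using i by (simp add: F_def E_def v_def scalar_prod_def atLeast0LessThan)
    also have "\<dots> = (\<Sum>l<N. \<Sum>j | j \<in> {..degree f} \<and> (i + j) mod N = l. of_int (coeff f j) * \<zeta> ^ (i + j))"
      by (simp add: sum_distrib_right) (intro sum.cong, auto simp: zm)
    also have "\<dots> = (\<Sum>j\<le>degree f. of_int (coeff f j) * \<zeta> ^ (i + j))"
      \<comment> \<open>Each j contributes to exactly one column l, the residue of i + j modulo
        N.\<close>
      by (rule sum.group) (use N in auto)
    also have "\<dots> = r * \<zeta> ^ i"
      by (simp add: r_def poly_altdef degree_map_poly sum_distrib_left power_add algebra_simps coeff_map_poly)
    finally show ?thesis .
  qed
  have "F *\<^sub>v v = r \<cdot>\<^sub>v v"
  proof (rule eq_vecI)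
    fix i assume "i < dim_vec (r \<cdot>\<^sub>v v)"
    then have "i < N" by (simp add: v_def)
    then show "vec_index (F *\<^sub>v v) i = vec_index (r \<cdot>\<^sub>v v) i"
      unfolding ent[OF \<open>i < N\<close>] by (simp add: v_def)
  next
    show "dim_vec (F *\<^sub>v v) = dim_vec (r \<cdot>\<^sub>v v)"
      by (simp add: F_def E_def v_def)
  qed
  moreover have "v \<noteq> 0\<^sub>v N"
  proof
    assume "v = 0\<^sub>v N"
    then have "vec_index v 0 = 0" using N by simp
    then show False using N by (simp add: v_def)
  qed
  ultimately have "eigenvalue F r"
    using F v by (auto simp: eigenvalue_def eigenvector_def)
  then have root: "poly (char_poly F) r = 0"
    using eigenvalue_root_char_poly[OF F] by simp
  have cp: "char_poly F = map_poly of_int (char_poly E)"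
    unfolding F_def using of_int_hom.char_poly_hom[OF E] by simp
  show ?thesis
    unfolding r_def[symmetric]
  proof (rule algebraic_int.intros[OF _ _ root])
    show "lead_coeff (char_poly F) = 1" using degree_monic_char_poly[OF F] by simp
    show "\<forall>i. coeff (char_poly F) i \<in> \<int>" unfolding cp by (simp add: coeff_map_poly)
  qed
qed

text \<open>Only powers of M occur as denominators, so a common one can be cleared; what is left is
  an integer polynomial in \<zeta>, to which \<open>algebraic_int_poly_root_of_unity\<close>
  applies.\<close>

lemma cyclotomic_elements:
  fixes \<zeta> :: complex
  assumes "M > 0" and "z \<in> generate_ring ring_of_type_algebra {1 / of_nat M, \<zeta>}"
  shows "\<exists>k f. of_nat M ^ k * z = poly (map_poly of_int f) \<zeta>"
  using assms(2)
proof (induction rule: generate_ring.induct)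
  case one
  show ?case by (rule exI[of _ 0], rule exI[of _ 1]) (simp add: ring_of_type_algebra_def)
next
  case (incl h)
  then consider "h = 1 / of_nat M" | "h = \<zeta>" by auto
  then show ?case
  proof cases
    case 1
    then show ?thesis using assms(1) by (intro exI[of _ 1] exI[of _ 1]) simp
  next
    case 2
    then show ?thesis by (intro exI[of _ 0] exI[of _ "[:0, 1:]"]) (simp add: map_poly_pCons)
  qed
next
  case (a_inv h)
  then obtain k f where kf: "of_nat M ^ k * h = poly (map_poly of_int f) \<zeta>" by blast
  have u: "subr (UNIV :: complex set)" by unfold_locales auto
  have "a_inv ring_of_type_algebra h = - h" using subr.rec_a_inv[OF u, of h] unfolding rec_UNIV by simp
  moreover have "of_nat M ^ k * (- h) = poly (map_poly of_int (- f)) \<zeta>"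
    unfolding of_int_poly_hom.hom_uminus poly_minus kf[symmetric] by simp
  ultimately show ?case by metis
next
  case (eng_add h1 h2)
  obtain k f where k: "of_nat M ^ k * h1 = poly (map_poly of_int f) \<zeta>"
    using eng_add.IH(1) by blast
  obtain l g where l: "of_nat M ^ l * h2 = poly (map_poly of_int g) \<zeta>"
    using eng_add.IH(2) by blast
  have "of_nat M ^ (k + l) * (h1 + h2) = of_nat M ^ l * (of_nat M ^ k * h1) + of_nat M ^ k * (of_nat M ^ l * h2)"
    by (simp add: power_add algebra_simps)
  also have "\<dots> = poly (map_poly of_int (Polynomial.smult (int M ^ l) f + Polynomial.smult (int M ^ k) g)) \<zeta>"
    unfolding k l by (simp add: of_int_poly_hom.hom_add of_int_hom.map_poly_hom_smult)
  finally show ?case unfolding ring_of_type_algebra_sel by blast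
next
  case (eng_mult h1 h2)
  obtain k f where k: "of_nat M ^ k * h1 = poly (map_poly of_int f) \<zeta>"
    using eng_mult.IH(1) by blast
  obtain l g where l: "of_nat M ^ l * h2 = poly (map_poly of_int g) \<zeta>"
    using eng_mult.IH(2) by blast
  have "of_nat M ^ (k + l) * (h1 * h2) = (of_nat M ^ k * h1) * (of_nat M ^ l * h2)"
    by (simp add: power_add algebra_simps)
  also have "\<dots> = poly (map_poly of_int (f * g)) \<zeta>"
    unfolding k l by (simp add: of_int_poly_hom.hom_mult)
  finally show ?case unfolding ring_of_type_algebra_sel by blast
qed

text \<open>Otherwise M^k / p would be a rational algebraic integer for some k, hence an integer,
  and p would divide a power of M.\<close>

lemma inverse_prime_not_cyclotomic:
  fixes \<zeta> :: complex
  assumes "M > 0" "N > 0" "\<zeta> ^ N = 1" and p: "prime p" "\<not> p dvd M"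
  shows "1 / of_nat p \<notin> generate_ring ring_of_type_algebra {1 / of_nat M, \<zeta>}"
proof
  assume "1 / of_nat p \<in> generate_ring ring_of_type_algebra {1 / of_nat M, \<zeta>}"
  from cyclotomic_elements[OF assms(1) this] obtain k f
    where kf: "of_nat M ^ k * (1 / of_nat p) = poly (map_poly of_int f) \<zeta>" by blast
  let ?x = "of_nat M ^ k * (1 / of_nat p) :: complex"
  have "algebraic_int ?x"
    using algebraic_int_poly_root_of_unity[OF assms(2,3)] kf by simp
  moreover have "?x \<in> \<rat>" by (intro Rats_mult Rats_power Rats_divide) auto
  ultimately have "?x \<in> \<int>" by (rule rational_algebraic_int_is_int)
  then obtain i where "?x = of_int i" by (auto elim: Ints_cases)
  then have "(of_nat M ^ k :: complex) = of_int i * of_nat p"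
    using p prime_gt_0_nat[of p] by (simp add: field_simps)
  then have "(of_int (int M ^ k) :: complex) = of_int (i * int p)" by simp
  then have "int M ^ k = i * int p" by (simp only: of_int_eq_iff)
  then have "int p dvd int M ^ k" by simp
  then have "p dvd M ^ k" by (metis int_dvd_int_iff of_nat_power)
  then show False using p prime_dvd_power by blast
qed

text \<open>Induction on the exponent k. For a prime divisor l of k, the power y = x^(k/l) is again
  congruent to 1 modulo p and satisfies y^l = 1. If y were not 1, the sum 1 + y + ... + y^(l-1)
  would vanish; expanded in powers of p, this makes p invertible in S. Hence y = 1 and the exponent
  drops to k/l.\<close>

lemma root_of_unity_congruent_1:
  fixes x :: complex
  assumes S: "subr S" and p: "prime p" "odd p" "1 / of_nat p \<notin> S"
    and "k > 0" "x ^ k = 1" "x - 1 = of_nat p * a" "a \<in> S"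
  shows "x = 1"
  using assms(5-8)
proof (induction k arbitrary: x a rule: less_induct)
  case (less k)
  interpret subr S by fact
  let ?P = "of_nat p :: complex"
  have P0: "?P \<noteq> 0" using p prime_gt_0_nat by fastforce
  show ?case
  proof (cases "k = 1")
    case False
    then obtain l where l: "prime l" "l dvd k" using prime_factor_nat by blast
    define y where "y = x ^ (k div l)"
    have x: "x = 1 + ?P * a" using less.prems(3) by (simp add: algebra_simps)
    then have xS: "x \<in> S" using less.prems by auto
    have "y - 1 = ?P * (a * (\<Sum>i<k div l. x ^ i))"
      unfolding y_def using power_diff_1_eq[of x "k div l"] less.prems(3) by (simp add: algebra_simps)
    moreover define b where "b = a * (\<Sum>i<k div l. x ^ i)"
    ultimately have y: "y = 1 + ?P * b" by (simp add: algebra_simps)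
    have b: "b \<in> S" unfolding b_def using less.prems xS by (intro mult_mem sum_mem power_mem)
    have yS: "y \<in> S" using y b by auto
    have yl: "y ^ l = 1" using l less.prems by (simp add: y_def flip: power_mult)
    have "y = 1"
    proof (rule ccontr)
      assume "y \<noteq> 1"
      then have s0: "(\<Sum>i<l. y ^ i) = 0" using yl power_diff_1_eq[of y l] by simp
      define s where "s i = (\<Sum>j<i. y ^ j)" for i
      have sS: "s i \<in> S" for i unfolding s_def using yS by (intro sum_mem) auto
      \<comment> \<open>The factorisation of y^i - 1 gives the first order expansion of the powers;
        \<open>t\<close> then collects what remains after one more summation, so that s_i = i + p
        t_i.\<close>
      have pw: "y ^ i = 1 + ?P * (b * s i)" for i
        unfolding s_def using power_diff_1_eq[of y i] y by (simp add: algebra_simps)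
      define t where "t i = (\<Sum>j<i. b * s j)" for i
      have tS: "t i \<in> S" for i unfolding t_def using b sS by (intro sum_mem) auto
      have s: "s i = of_nat i + ?P * t i" for i
        by (subst s_def) (simp add: pw sum.distrib t_def sum_distrib_left)
      show False
      proof (cases "l = p")
        \<comment> \<open>Here l is a unit modulo p, while 0 = s_l = l + p t_l makes it a multiple
          of p; Bezout then produces 1/p.\<close>
        case False
        then have "coprime l p" using l p by (simp add: primes_coprime)
        then have "coprime (int l) (int p)" by simp
        then obtain u v where "u * int l + v * int p = 1"
          using bezout_int[of "int l" "int p"] by (metis coprime_imp_gcd_eq_1)
        then have uv: "of_int u * of_nat l + of_int v * ?P = 1"
          by (metis of_int_1 of_int_add of_int_mult of_int_of_nat_eq)
        have "of_nat l = - ?P * t l" using s[of l] s0 by (simp add: s_def eq_neg_iff_add_eq_0)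
        with uv have "?P * (of_int v - of_int u * t l) = 1" by (simp add: algebra_simps)
        then have "1 / ?P = of_int v - of_int u * t l" using P0 by (simp add: field_simps)
        then show False using p(3) tS by auto
      next
        case True
        \<comment> \<open>For l = p one more order is needed. The sum 0 + 1 + ... + (p - 1) is
          divisible by p because p is odd, so 0 = s_p = p + p^2 c with c in S, and dividing by p
          exhibits -c as the inverse of p.\<close>
        have "t p = b * (\<Sum>j<p. of_nat j) + ?P * (b * (\<Sum>j<p. t j))"
          unfolding t_def[of p] by (simp add: s sum.distrib sum_distrib_left algebra_simps)
        moreover have "(\<Sum>j<p. of_nat j :: complex) = ?P * of_nat ((p - 1) div 2)"
        proof -
          have "2 * (\<Sum>j<k. j) = k * (k - 1)" for k :: nat
          proof (induction k)
            case (Suc k)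
            then show ?case by (cases k) simp_all
          qed simp
          then have "2 * (\<Sum>j<p. j) = p * (p - 1)" .
          moreover obtain k where k: "p = 2 * k + 1" using p(2) by (elim oddE)
          ultimately have "2 * (\<Sum>j<p. j) = 2 * (p * k)" by simp
          then have "(\<Sum>j<p. j) = p * k" by linarith
          moreover have "(p - 1) div 2 = k" using k by simp
          ultimately have "(\<Sum>j<p. j) = p * ((p - 1) div 2)" by (simp only:)
          then have "of_nat (\<Sum>j<p. j) = (of_nat (p * ((p - 1) div 2)) :: complex)" by (simp only:)
          then show ?thesis unfolding of_nat_sum of_nat_mult .
        qed
        ultimately have "s p = ?P + ?P * (?P * (b * of_nat ((p - 1) div 2) + b * (\<Sum>j<p. t j)))"
          using s[of p] by (simp add: algebra_simps)
        then have "?P * (1 + ?P * (b * of_nat ((p - 1) div 2) + b * (\<Sum>j<p. t j))) = 0"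
          using s0 True by (simp add: s_def algebra_simps)
        then have "1 + ?P * (b * of_nat ((p - 1) div 2) + b * (\<Sum>j<p. t j)) = 0"
          using P0 by simp
        then have "?P * - (b * of_nat ((p - 1) div 2) + b * (\<Sum>j<p. t j)) = 1"
          by (metis add_eq_0_iff minus_minus mult_minus_right)
        then have "1 / ?P = - (b * of_nat ((p - 1) div 2) + b * (\<Sum>j<p. t j))"
          using nonzero_mult_div_cancel_left[OF P0] by metis
        moreover have "- (b * of_nat ((p - 1) div 2) + b * (\<Sum>j<p. t j)) \<in> S"
          using b tS by (intro uminus_mem add_mem mult_mem sum_mem) auto
        ultimately show False using p(3) by simp
      qed
    qed
    then have "x ^ (k div l) = 1" by (simp add: y_def)
    moreover have "k div l < k" "k div l > 0"
      using l less.prems prime_gt_1_nat[OF l(1)] by (auto simp: div_greater_zero_iff dvd_imp_le prime_gt_0_nat)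
    ultimately show ?thesis using less.IH[of "k div l" x a] less.prems by blast
  qed (use less in simp)
qed

text \<open>Comparing coefficients in f^2 = 1 + X, where f is the binomial series of exponent 1/2,
  determines the m-th coefficient from the earlier ones with a division by 2 only.\<close>

lemma sqrt_binomial_mem:
  fixes S :: "complex set"
  assumes "subr S" "1 / 2 \<in> S"
  shows "(1 / 2) gchoose m \<in> S"
proof (induction m rule: less_induct)
  case (less m)
  interpret subr S by fact
  define f where "f = fps_binomial (1 / 2 :: complex)"
  have f: "fps_nth f i = (1 / 2) gchoose i" for i by (simp add: f_def)
  have ff: "f * f = 1 + fps_X"
    unfolding f_def fps_binomial_add_mult[symmetric] by (simp add: fps_binomial_1)
  have half: "x = 2 * y + R \<Longrightarrow> y = 1 / 2 * (x - R)" for x y R :: complex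
    by simp
  show ?case
  proof (cases "m = 0")
    case True
    then show ?thesis by simp
  next
    case False
    define R where "R = (\<Sum>i\<in>{1..<m}. fps_nth f i * fps_nth f (m - i))"
    \<comment> \<open>The two extreme indices of the convolution both contribute
      \<open>fps_nth f m\<close>, since the constant coefficient is 1.\<close>
    have m: "{0..m} = insert 0 (insert m {1..<m})" using False by auto
    have "fps_nth (f * f) m = 2 * fps_nth f m + R"
      unfolding fps_mult_nth m R_def using False by (simp add: f_def)
    then have e: "fps_nth f m = 1 / 2 * (fps_nth (1 + fps_X) m - R)"
      unfolding ff by (rule half)
    have "R \<in> S"
      unfolding R_def using less by (intro sum_mem mult_mem) (simp_all add: f)
    moreover have "fps_nth (1 + fps_X) m \<in> S" by (simp add: fps_X_nth)
    ultimately have "1 / 2 * (fps_nth (1 + fps_X) m - R) \<in> S"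
      using assms(2) by (intro mult_mem diff_mem)
    then show ?thesis by (simp only: e[symmetric] f)
  qed
qed

section \<open>Power series with restricted coefficients and variables\<close>

text \<open>The same two conditions that cut out the carrier of \<open>mpowser_ring\<close>, here
  for a subset of the type \<open>mps\<close>.\<close>

definition mps_over :: "'i set \<Rightarrow> 'a set \<Rightarrow> ('i, 'a::comm_ring_1) mps set" where
  "mps_over I S = {f. \<forall>m. coef f m \<in> S \<and> (\<not> set_mset m \<subseteq> I \<longrightarrow> coef f m = 0)}"

lemma mps_overI:
  "(\<And>m. coef f m \<in> S) \<Longrightarrow> (\<And>m. \<not> set_mset m \<subseteq> I \<Longrightarrow> coef f m = 0) \<Longrightarrow> f \<in> mps_over I S"
  by (simp add: mps_over_def)

lemma mps_over_coef: "f \<in> mps_over I S \<Longrightarrow> coef f m \<in> S"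
  by (simp add: mps_over_def)

lemma mps_over_vars: "f \<in> mps_over I S \<Longrightarrow> \<not> set_mset m \<subseteq> I \<Longrightarrow> coef f m = 0"
  by (simp add: mps_over_def)

lemma subr_mps_over:
  assumes "subr S"
  shows "subr (mps_over I S)"
proof -
  interpret subr S by fact
  show ?thesis
  proof
    fix f g :: "('b, 'a) mps" assume fg: "f \<in> mps_over I S" "g \<in> mps_over I S"
    show "f * g \<in> mps_over I S"
    proof (rule mps_overI)
      show "coef (f * g) m \<in> S" for m
        unfolding coef_mult using fg by (intro sum_mem) (auto simp: mps_over_coef)
      fix m assume m: "\<not> set_mset m \<subseteq> I"
      have "coef f a * coef g b = 0" if "a + b = m" for a b
      proof -
        from that m have "\<not> set_mset a \<subseteq> I \<or> \<not> set_mset b \<subseteq> I" by auto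
        then show ?thesis by (elim disjE) (simp_all add: mps_over_vars[OF fg(1), of a] mps_over_vars[OF fg(2), of b])
      qed
      then show "coef (f * g) m = 0"
        unfolding coef_mult by (intro sum.neutral) auto
    qed
  qed (auto simp: mps_over_def coef_one)
qed

lemma mconst_over: "subr S \<Longrightarrow> c \<in> S \<Longrightarrow> mconst c \<in> mps_over I S"
  by (auto simp: mps_over_def coef_mconst subr.zero_mem)

lemma mvar_over: "subr S \<Longrightarrow> i \<in> I \<Longrightarrow> mvar i \<in> mps_over I S"
  by (auto simp: mps_over_def coef_mvar subr.zero_mem subr.one_mem)

lemma lsum_over:
  assumes "subr S" "\<And>i. h i \<in> mps_over I S"
  shows "lsum h \<in> mps_over I S"
proof (rule mps_overI)
  show "coef (lsum h) m \<in> S" for m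
    unfolding lsum_def coef_Mps using assms by (intro subr.sum_mem mps_over_coef)
  show "coef (lsum h) m = 0" if "\<not> set_mset m \<subseteq> I" for m
    unfolding lsum_def coef_Mps using mps_over_vars[OF assms(2) that] by simp
qed

lemma mseries_over:
  assumes S: "subr S" and f: "\<And>i. fps_nth f i \<in> S" and Y: "Y \<in> smats (mps_over I S) n"
  shows "mseries f Y \<in> smats (mps_over I S) n"
proof -
  interpret R: subr "mps_over I S" using S by (rule subr_mps_over)
  show ?thesis
  proof (rule smatsI)
    fix a b assume ab: "a < n" "b < n"
    show "mseries f Y $$ (a, b) \<in> mps_over I S"
      unfolding mseries_entry[OF smats_carrier[OF Y] ab]
      by (intro lsum_over S R.mult_mem mconst_over f smats_entry[OF R.smats_pow[OF Y] ab])
  qed (use Y in simp)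
qed

section \<open>Homomorphisms on subrings\<close>

text \<open>Additivity and multiplicativity are demanded on R alone: the Frobenius lift of the base
  ring is a function on all complex numbers that is controlled only on S.\<close>

locale subr_hom = subr R for R :: "'a :: comm_ring_1 set" +
  fixes h :: "'a \<Rightarrow> 'b :: comm_ring_1"
  assumes hom_one: "h 1 = 1"
    and hom_add: "x \<in> R \<Longrightarrow> y \<in> R \<Longrightarrow> h (x + y) = h x + h y"
    and hom_mult: "x \<in> R \<Longrightarrow> y \<in> R \<Longrightarrow> h (x * y) = h x * h y"
begin

lemma hom_zero: "h 0 = 0"
  using hom_add[of 0 0] by simp

lemma hom_uminus: "x \<in> R \<Longrightarrow> h (- x) = - h x"
  using hom_add[of x "- x"] hom_zero by (simp add: eq_neg_iff_add_eq_0 add.commute)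

lemma hom_diff: "x \<in> R \<Longrightarrow> y \<in> R \<Longrightarrow> h (x - y) = h x - h y"
  using hom_add[of x "- y"] hom_uminus[of y] by simp

lemma hom_sum: "(\<And>i. i \<in> J \<Longrightarrow> f i \<in> R) \<Longrightarrow> h (sum f J) = sum (\<lambda>i. h (f i)) J"
  by (induction J rule: infinite_finite_induct) (simp_all add: hom_zero hom_add sum_mem)

lemma hom_prod: "(\<And>i. i \<in> J \<Longrightarrow> f i \<in> R) \<Longrightarrow> h (prod f J) = prod (\<lambda>i. h (f i)) J"
  by (induction J rule: infinite_finite_induct) (simp_all add: hom_one hom_mult prod_mem)

lemma hom_power: "x \<in> R \<Longrightarrow> h (x ^ k) = h x ^ k"
  by (induction k) (simp_all add: hom_one hom_mult)

lemma hom_of_nat: "h (of_nat k) = of_nat k"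
  by (induction k) (simp_all add: hom_zero hom_one hom_add)

lemma map_mat_mult:
  assumes "Y \<in> smats R n" "Z \<in> smats R n"
  shows "map_mat h (Y * Z) = map_mat h Y * map_mat h Z"
proof (rule eq_matI)
  fix i j assume "i < dim_row (map_mat h Y * map_mat h Z)" "j < dim_col (map_mat h Y * map_mat h Z)"
  then have ij: "i < n" "j < n" using assms[THEN smats_carrier] by auto
  have "map_mat h (Y * Z) $$ (i, j) = h ((Y * Z) $$ (i, j))"
    using assms[THEN smats_carrier] ij by simp
  also have "(Y * Z) $$ (i, j) = (\<Sum>l<n. Y $$ (i, l) * Z $$ (l, j))"
    by (rule entry_mult[OF assms[THEN smats_carrier] ij])
  also have "h \<dots> = (\<Sum>l<n. h (Y $$ (i, l)) * h (Z $$ (l, j)))"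
    by (subst hom_sum) (use assms ij in \<open>auto simp: hom_mult intro!: sum.cong\<close>)
  also have "\<dots> = (map_mat h Y * map_mat h Z) $$ (i, j)"
    using assms[THEN smats_carrier] ij by (subst entry_mult[of _ n n _ n]) auto
  finally show "map_mat h (Y * Z) $$ (i, j) = (map_mat h Y * map_mat h Z) $$ (i, j)" .
qed (use assms[THEN smats_carrier] in auto)

lemma map_mat_transpose: "map_mat h (transpose_mat Y) = transpose_mat (map_mat h Y)"
  by (rule eq_matI) auto

lemma map_mat_one: "map_mat h (1\<^sub>m n) = 1\<^sub>m n"
  by (rule eq_matI) (auto simp: hom_one hom_zero)

lemma map_mat_diff:
  assumes "Y \<in> smats R n" "Z \<in> smats R n"
  shows "map_mat h (Y - Z) = map_mat h Y - map_mat h Z"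
  by (rule eq_matI) (use assms[THEN smats_carrier] smats_entry[OF assms(1)] smats_entry[OF assms(2)] in \<open>auto simp: hom_diff\<close>)

end

lemma const_term_hom: "subr R \<Longrightarrow> subr_hom R (\<lambda>f. coef f {#})"
  by (simp add: subr_hom_def subr_hom_axioms_def coef_one coef_empty_mult)

lemma mconst_hom: "subr S \<Longrightarrow> subr_hom S mconst"
  by (simp add: subr_hom_def subr_hom_axioms_def)

subsection \<open>Substitution\<close>

definition monomials :: "'i set \<Rightarrow> nat \<Rightarrow> 'i multiset set" where
  "monomials I d = {k. size k = d \<and> set_mset k \<subseteq> I}"

lemma finite_monomials: "finite I \<Longrightarrow> finite (monomials I d)"
proof (induction d)
  case 0
  have "monomials I 0 \<subseteq> {{#}}" by (auto simp: monomials_def)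
  then show ?case by (rule finite_subset) simp
next
  case (Suc d)
  have "monomials I (Suc d) \<subseteq> (\<lambda>(i, k). add_mset i k) ` (I \<times> monomials I d)"
  proof
    fix k assume k: "k \<in> monomials I (Suc d)"
    then obtain i l where "k = add_mset i l" by (auto simp: monomials_def size_Suc_Diff1 dest!: size_eq_Suc_imp_eq_union)
    with k show "k \<in> (\<lambda>(i, k). add_mset i k) ` (I \<times> monomials I d)"
      by (intro image_eqI[of _ _ "(i, l)"]) (auto simp: monomials_def)
  qed
  then show ?case using Suc finite_subset by blast
qed

definition monom_eval :: "('i \<Rightarrow> ('j, 'a::comm_ring_1) mps) \<Rightarrow> 'i multiset \<Rightarrow> ('j, 'a) mps" where
  "monom_eval \<tau> k = prod_mset (image_mset \<tau> k)"

lemma monom_eval_simps [simp]: "monom_eval \<tau> {#} = 1" "monom_eval \<tau> (add_mset i k) = \<tau> i * monom_eval \<tau> k"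
  "monom_eval \<tau> (k + l) = monom_eval \<tau> k * monom_eval \<tau> l"
  by (simp_all add: monom_eval_def)

lemma ordge_monom_eval:
  "(\<And>i. i \<in># k \<Longrightarrow> ordge 1 (\<tau> i)) \<Longrightarrow> ordge (size k) (monom_eval \<tau> k)"
proof (induction k)
  case (add i k)
  then show ?case using ordge_mult[of 1 "\<tau> i" "size k" "monom_eval \<tau> k"] by simp
qed simp

lemma monom_eval_mem:
  "subr R \<Longrightarrow> (\<And>i. i \<in># k \<Longrightarrow> \<tau> i \<in> R) \<Longrightarrow> monom_eval \<tau> k \<in> R"
  by (induction k) (auto simp: subr.one_mem subr.mult_mem)

locale subst_data =
  fixes S :: "'a :: comm_ring_1 set" and I :: "'i set" and \<phi> :: "'a \<Rightarrow> 'a"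
    and \<tau> :: "'i \<Rightarrow> ('i, 'a) mps"
  assumes subr_S: "subr S" and fin: "finite I"
    and phi_hom: "subr_hom S \<phi>" and phi_closed: "c \<in> S \<Longrightarrow> \<phi> c \<in> S"
    and tau_mem: "i \<in> I \<Longrightarrow> \<tau> i \<in> mps_over I S" and tau_ord: "i \<in> I \<Longrightarrow> ordge 1 (\<tau> i)"
begin

interpretation phi: subr_hom S \<phi> by (rule phi_hom)

text \<open>The contribution of the monomials of degree d. The \<tau> have no constant term, so it
  has order at least d, and finiteness of I leaves finitely many such monomials; grouping by degree
  makes the substitution a locally finite sum over the natural numbers.\<close>

definition subst_term :: "('i, 'a) mps \<Rightarrow> nat \<Rightarrow> ('i, 'a) mps" where
  "subst_term g d = (\<Sum>k\<in>monomials I d. mconst (\<phi> (coef g k)) * monom_eval \<tau> k)"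

definition subst :: "('i, 'a) mps \<Rightarrow> ('i, 'a) mps" where
  "subst g = lsum (subst_term g)"

lemma ordge_subst_term: "ordge d (subst_term g d)"
  unfolding subst_term_def
proof (intro ordge_sum ordge_mult2)
  fix k assume "k \<in> monomials I d"
  then show "ordge d (monom_eval \<tau> k)"
    using ordge_monom_eval[of k \<tau>] tau_ord by (auto simp: monomials_def)
qed

lemma subst_mem:
  assumes "g \<in> mps_over I S"
  shows "subst g \<in> mps_over I S"
proof -
  interpret R: subr "mps_over I S" by (rule subr_mps_over[OF subr_S])
  have "monom_eval \<tau> k \<in> mps_over I S" if "k \<in> monomials I d" for k d
    using that by (intro monom_eval_mem R.subr_axioms tau_mem) (auto simp: monomials_def)
  then show ?thesis
    unfolding subst_def subst_term_def
    by (intro lsum_over subr_S R.sum_mem R.mult_mem mconst_over phi_closed mps_over_coef[OF assms])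
qed

lemma lsum_single:
  assumes "\<And>i. i \<noteq> j \<Longrightarrow> h i = 0" "ordge j (h j)"
  shows "lsum h = h j"
proof (rule mps_eqI)
  fix m
  have "coef (lsum h) m = (\<Sum>i\<le>Suc (size m + j). coef (h i) m)"
  proof (rule coef_lsum)
    have "ordge i (h i)" for i using assms by (cases "i = j") auto
    then show "locfin h" by (rule locfinI)
  qed simp
  also have "\<dots> = (\<Sum>i\<in>{j}. coef (h i) m)"
    by (rule sum.mono_neutral_right) (auto simp: assms)
  finally show "coef (lsum h) m = coef (h j) m" by simp
qed

lemma subst_mconst:
  assumes "c \<in> S"
  shows "subst (mconst c) = mconst (\<phi> c)"
proof -
  have t: "subst_term (mconst c) d = (if d = 0 then mconst (\<phi> c) else 0)" for d
  proof (cases "d = 0")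
    case True
    have "monomials I 0 = {{#}}" by (auto simp: monomials_def)
    then show ?thesis using True by (simp add: subst_term_def coef_mconst)
  next
    case False
    then show ?thesis
      by (auto simp: subst_term_def coef_mconst monomials_def phi.hom_zero intro!: sum.neutral)
  qed
  have "lsum (subst_term (mconst c)) = subst_term (mconst c) 0"
    by (rule lsum_single) (simp_all add: t)
  then show ?thesis by (simp add: subst_def t)
qed

lemma subst_mvar:
  assumes "i \<in> I"
  shows "subst (mvar i) = \<tau> i"
proof -
  have t: "subst_term (mvar i) d = (if d = 1 then \<tau> i else 0)" for d
  proof -
    have z: "mconst (\<phi> (coef (mvar i) k)) * monom_eval \<tau> k = (if k = {#i#} then \<tau> i else 0)" for k
      by (simp add: coef_mvar phi.hom_one phi.hom_zero)
    have "subst_term (mvar i) d = (\<Sum>k\<in>monomials I d. if k = {#i#} then \<tau> i else 0)"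
      unfolding subst_term_def z ..
    also have "\<dots> = (if {#i#} \<in> monomials I d then \<tau> i else 0)"
      using finite_monomials[OF fin] by (simp add: sum.delta')
    finally show ?thesis using assms by (auto simp: monomials_def)
  qed
  have "lsum (subst_term (mvar i)) = subst_term (mvar i) 1"
    by (rule lsum_single) (use tau_ord[OF assms] in \<open>simp_all add: t\<close>)
  then show ?thesis by (simp add: subst_def t)
qed

lemma subst_add:
  assumes "f \<in> mps_over I S" "g \<in> mps_over I S"
  shows "subst (f + g) = subst f + subst g"
proof -
  have "subst_term (f + g) d = subst_term f d + subst_term g d" for d
    using assms[THEN mps_over_coef]
    by (simp add: subst_term_def phi.hom_add ring_distribs sum.distrib)
  then have "subst_term (f + g) = (\<lambda>d. subst_term f d + subst_term g d)" by blast
  then show ?thesis unfolding subst_def by (simp add: lsum_add)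
qed

lemma subst_mult:
  assumes "f \<in> mps_over I S" "g \<in> mps_over I S"
  shows "subst (f * g) = subst f * subst g"
proof -
  have c: "coef f k \<in> S" "coef g k \<in> S" for k using assms[THEN mps_over_coef] by auto
  let ?c = "\<lambda>k. mconst (\<phi> k) :: ('i, 'a) mps"
  have "subst_term (f * g) d = (\<Sum>i\<le>d. subst_term f i * subst_term g (d - i))" for d
  proof -
    have "subst_term (f * g) d = (\<Sum>k\<in>monomials I d. \<Sum>x\<in>splits k.
        ?c (coef f (fst x)) * monom_eval \<tau> (fst x) * (?c (coef g (snd x)) * monom_eval \<tau> (snd x)))"
      unfolding subst_term_def
    proof (rule sum.cong[OF refl])
      fix k assume "k \<in> monomials I d"
      have "\<phi> (coef (f * g) k) = (\<Sum>x\<in>splits k. \<phi> (coef f (fst x)) * \<phi> (coef g (snd x)))"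
        unfolding coef_mult split_beta using c by (simp add: phi.hom_sum phi.hom_mult)
      then have "?c (coef (f * g) k) * monom_eval \<tau> k =
          (\<Sum>x\<in>splits k. ?c (coef f (fst x)) * ?c (coef g (snd x)) * monom_eval \<tau> k)"
        by (simp add: mconst_sum sum_distrib_right)
      also have "\<dots> = (\<Sum>x\<in>splits k.
        ?c (coef f (fst x)) * monom_eval \<tau> (fst x) * (?c (coef g (snd x)) * monom_eval \<tau> (snd x)))"
        by (rule sum.cong[OF refl]) (auto simp: splits_def algebra_simps)
      finally show "?c (coef (f * g) k) * monom_eval \<tau> k = \<dots>" .
    qed
    also have "\<dots> = (\<Sum>(k, x)\<in>Sigma (monomials I d) splits.
        ?c (coef f (fst x)) * monom_eval \<tau> (fst x) * (?c (coef g (snd x)) * monom_eval \<tau> (snd x)))"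
      by (subst sum.Sigma) (auto simp: finite_monomials[OF fin])
    also have "\<dots> = (\<Sum>(i, x)\<in>Sigma {..d} (\<lambda>i. monomials I i \<times> monomials I (d - i)).
        ?c (coef f (fst x)) * monom_eval \<tau> (fst x) * (?c (coef g (snd x)) * monom_eval \<tau> (snd x)))"
      \<comment> \<open>A monomial of degree d together with a splitting is the same as a pair of
        monomials of degrees i and d - i.\<close>
      by (rule sum.reindex_bij_witness[where
            i = "\<lambda>(i, x). (fst x + snd x, x)" and j = "\<lambda>(k, x). (size (fst x), x)"])
        (auto simp: monomials_def splits_def subset_iff)
    also have "\<dots> = (\<Sum>i\<le>d. \<Sum>x\<in>monomials I i \<times> monomials I (d - i).
        ?c (coef f (fst x)) * monom_eval \<tau> (fst x) * (?c (coef g (snd x)) * monom_eval \<tau> (snd x)))"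
      by (subst sum.Sigma) (auto simp: finite_monomials[OF fin])
    also have "\<dots> = (\<Sum>i\<le>d. subst_term f i * subst_term g (d - i))"
      unfolding subst_term_def sum_product sum.cartesian_product by (simp add: split_beta)
    finally show ?thesis .
  qed
  then have "subst (f * g) = lsum (\<lambda>d. \<Sum>i\<le>d. subst_term f i * subst_term g (d - i))"
    unfolding subst_def by (rule lsum_cong)
  also have "\<dots> = subst f * subst g"
    unfolding subst_def by (rule lsum_mult[symmetric]) (rule ordge_subst_term)+
  finally show ?thesis .
qed

lemma subst_hom: "subr_hom (mps_over I S) subst"
proof (intro subr_hom.intro subr_mps_over subr_S subr_hom_axioms.intro subst_add subst_mult)
  show "subst 1 = 1"
    using subst_mconst[of 1] by (simp add: phi.hom_one)
qed

end

lemma smats_map: "Y \<in> smats S n \<Longrightarrow> (\<And>a. a \<in> S \<Longrightarrow> f a \<in> T) \<Longrightarrow> map_mat f Y \<in> smats T n"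
  by (auto simp: smats_def simp del: smats_carrier smats_entry)

section \<open>Ideals of a subring and commutators modulo an ideal\<close>

locale subr_ideal = subr R for R :: "'a :: comm_ring_1 set" +
  fixes K :: "'a set"
  assumes K_sub: "K \<subseteq> R" and K_zero: "0 \<in> K"
    and K_add: "x \<in> K \<Longrightarrow> y \<in> K \<Longrightarrow> x + y \<in> K"
    and K_mult: "r \<in> R \<Longrightarrow> x \<in> K \<Longrightarrow> r * x \<in> K"
begin

lemma K_mult_right: "x \<in> K \<Longrightarrow> r \<in> R \<Longrightarrow> x * r \<in> K"
  using K_mult by (simp add: mult.commute)

lemma K_uminus: "x \<in> K \<Longrightarrow> - x \<in> K"
  using K_mult[of "- 1" x] by simp

lemma K_diff: "x \<in> K \<Longrightarrow> y \<in> K \<Longrightarrow> x - y \<in> K"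
  using K_add[of x "- y"] K_uminus[of y] by simp

lemma K_sum: "(\<And>i. i \<in> J \<Longrightarrow> f i \<in> K) \<Longrightarrow> sum f J \<in> K"
  by (induction J rule: infinite_finite_induct) (simp_all add: K_zero K_add)

lemma K_power_diff:
  assumes "a \<in> R" "b \<in> R" "a - b \<in> K"
  shows "a ^ k - b ^ k \<in> K"
proof (induction k)
  case (Suc k)
  have "a ^ Suc k - b ^ Suc k = a * (a ^ k - b ^ k) + (a - b) * b ^ k"
    by (simp add: algebra_simps)
  then show ?case
    using Suc assms by (simp only:) (intro K_add K_mult K_mult_right power_mem)
qed (simp add: K_zero)

lemma smats_K_mult_left:
  assumes "Y \<in> smats R n" "Z \<in> smats K n"
  shows "Y * Z \<in> smats K n"
proof (rule smatsI)
  fix i j assume ij: "i < n" "j < n"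
  show "(Y * Z) $$ (i, j) \<in> K"
    unfolding entry_mult[OF smats_carrier[OF assms(1)] smats_carrier[OF assms(2)] ij]
    using ij smats_entry[OF assms(1)] smats_entry[OF assms(2)] by (intro K_sum K_mult) auto
qed (use assms[THEN smats_carrier] in simp)

lemma smats_K_mult_right:
  assumes "Y \<in> smats K n" "Z \<in> smats R n"
  shows "Y * Z \<in> smats K n"
proof (rule smatsI)
  fix i j assume ij: "i < n" "j < n"
  show "(Y * Z) $$ (i, j) \<in> K"
    unfolding entry_mult[OF smats_carrier[OF assms(1)] smats_carrier[OF assms(2)] ij]
    using ij smats_entry[OF assms(1)] smats_entry[OF assms(2)] by (intro K_sum K_mult_right) auto
qed (use assms[THEN smats_carrier] in simp)

lemma smats_K_add: "Y \<in> smats K n \<Longrightarrow> Z \<in> smats K n \<Longrightarrow> Y + Z \<in> smats K n"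
  and smats_K_diff: "Y \<in> smats K n \<Longrightarrow> Z \<in> smats K n \<Longrightarrow> Y - Z \<in> smats K n"
  by (auto simp: smats_def K_add K_diff simp del: smats_carrier smats_entry)

lemma smats_K_transpose: "Y \<in> smats K n \<Longrightarrow> transpose_mat Y \<in> smats K n"
  by (auto simp: smats_def simp del: smats_carrier smats_entry)

end

section \<open>Commutators with a fixed matrix as a derivation\<close>

definition comm_mat :: "'a::comm_ring_1 mat \<Rightarrow> 'a mat \<Rightarrow> 'a mat" where
  "comm_mat J Y = J * Y - Y * J"

lemma comm_mat_carrier [simp]: "J \<in> carrier_mat n n \<Longrightarrow> Y \<in> carrier_mat n n \<Longrightarrow> comm_mat J Y \<in> carrier_mat n n"
  unfolding comm_mat_def by (intro minus_carrier_mat mult_carrier_mat)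

lemma minus_add_minus_mat:
  fixes A :: "'a :: comm_ring_1 mat"
  assumes "A \<in> carrier_mat n n" "B \<in> carrier_mat n n" "C \<in> carrier_mat n n"
  shows "A - C = (A - B) + (B - C)"
  by (rule eq_matI) (use assms in auto)

lemma comm_mat_mult:
  assumes "J \<in> carrier_mat n n" "Y \<in> carrier_mat n n" "Z \<in> carrier_mat n n"
  shows "comm_mat J (Y * Z) = comm_mat J Y * Z + Y * comm_mat J Z"
proof -
  have "comm_mat J Y * Z + Y * comm_mat J Z = (J * (Y * Z) - Y * J * Z) + (Y * J * Z - Y * Z * J)"
    using assms unfolding comm_mat_def
    by (simp add: minus_mult_distrib_mat[of _ n n _ _ n] mult_minus_distrib_mat[of _ n n _ n]
        assoc_mult_mat[of _ n n _ n _ n])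
  also have "\<dots> = J * (Y * Z) - Y * Z * J"
    using assms by (intro minus_add_minus_mat[of _ n, symmetric]) auto
  finally show ?thesis by (simp add: comm_mat_def)
qed

text \<open>Two signs cancel: transposition reverses the commutator, and it turns the antisymmetric
  J into -J.\<close>

lemma comm_mat_transpose:
  assumes "J \<in> carrier_mat n n" "Y \<in> carrier_mat n n" "transpose_mat J = - J"
  shows "comm_mat J (transpose_mat Y) = transpose_mat (comm_mat J Y)"
proof -
  have 1: "transpose_mat (J * Y) = - (transpose_mat Y * J)" "transpose_mat (Y * J) = - (J * transpose_mat Y)"
    using assms by (simp_all add: transpose_mult[of _ n n _ n])
  have "transpose_mat (comm_mat J Y) = transpose_mat (J * Y) - transpose_mat (Y * J)"
    using assms unfolding comm_mat_def by (intro transpose_minus[of _ n n]) auto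
  also have "\<dots> = comm_mat J (transpose_mat Y)"
    unfolding 1 comm_mat_def by (rule eq_matI) (use assms in auto)
  finally show ?thesis ..
qed

text \<open>Leibniz rule: [J, Y^i] is the sum of Y^j [J, Y] Y^(i-1-j) over j < i. The entries of
  [J, Y] are pulled out as outer factors, so that an infinite sum over i can later be taken inside
  each of finitely many terms.\<close>

lemma comm_mat_pow:
  assumes J: "J \<in> carrier_mat n n" and Y: "Y \<in> carrier_mat n n" and ab: "a < n" "b < n"
  shows "comm_mat J (Y ^\<^sub>m i) $$ (a, b) =
    (\<Sum>k<n. \<Sum>l<n. comm_mat J Y $$ (k, l) * (\<Sum>j<i. (Y ^\<^sub>m j) $$ (a, k) * (Y ^\<^sub>m (i - 1 - j)) $$ (l, b)))"
    (is "?C i b = ?R i b")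
  using ab(2)
proof (induction i arbitrary: b)
  case 0
  then show ?case using J Y ab by (simp add: comm_mat_def)
next
  case (Suc i)
  let ?D = "comm_mat J Y" and ?P = "\<lambda>i. Y ^\<^sub>m i"
  have D: "?D \<in> carrier_mat n n" using J Y by simp
  have "?C (Suc i) b = (comm_mat J (?P i) * Y + ?P i * ?D) $$ (a, b)"
    using J Y by (simp add: comm_mat_mult[of _ n])
  also have "\<dots> = (\<Sum>c<n. ?C i c * Y $$ (c, b)) + (\<Sum>k<n. ?P i $$ (a, k) * ?D $$ (k, b))"
    using Y ab(1) Suc.prems D comm_mat_carrier[OF J pow_carrier_mat[OF Y]]
    by (subst index_add_mat, simp, simp)
      (simp only: entry_mult[OF _ Y ab(1) Suc.prems] entry_mult[OF pow_carrier_mat[OF Y] D ab(1) Suc.prems])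
  also have "(\<Sum>c<n. ?C i c * Y $$ (c, b)) = (\<Sum>c<n. ?R i c * Y $$ (c, b))"
    using Suc.IH by (intro sum.cong) auto
  also have "\<dots> = (\<Sum>k<n. \<Sum>l<n. ?D $$ (k, l) * (\<Sum>j<i. ?P j $$ (a, k) * ?P (i - j) $$ (l, b)))"
  proof -
    have e: "(\<Sum>c<n. ?P (i - 1 - j) $$ (l, c) * Y $$ (c, b)) = ?P (i - j) $$ (l, b)" if "j < i" "l < n" for j l
    proof -
      have "?P (i - j) = ?P (i - 1 - j) * Y" using that by (metis Suc_diff_Suc diff_Suc_eq_diff_pred pow_mat.simps(2))
      then show ?thesis using entry_mult[of "?P (i - 1 - j)" n n Y n l b] Y that Suc.prems by simp
    qed
    have "(\<Sum>c<n. ?R i c * Y $$ (c, b)) =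
        (\<Sum>c<n. \<Sum>k<n. \<Sum>l<n. ?D $$ (k, l) * (\<Sum>j<i. ?P j $$ (a, k) * (?P (i - 1 - j) $$ (l, c) * Y $$ (c, b))))"
      by (simp add: sum_distrib_right sum_distrib_left mult.assoc)
    also have "\<dots> = (\<Sum>k<n. \<Sum>l<n. \<Sum>c<n. ?D $$ (k, l) * (\<Sum>j<i. ?P j $$ (a, k) * (?P (i - 1 - j) $$ (l, c) * Y $$ (c, b))))"
      by (subst sum.swap, rule sum.cong[OF refl], subst sum.swap, rule refl)
    also have "\<dots> = (\<Sum>k<n. \<Sum>l<n. ?D $$ (k, l) * (\<Sum>j<i. ?P j $$ (a, k) * (\<Sum>c<n. ?P (i - 1 - j) $$ (l, c) * Y $$ (c, b))))"
      by (intro sum.cong refl, simp only: sum_distrib_left[symmetric], subst sum.swap, simp only: sum_distrib_left[symmetric])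
    also have "\<dots> = (\<Sum>k<n. \<Sum>l<n. ?D $$ (k, l) * (\<Sum>j<i. ?P j $$ (a, k) * ?P (i - j) $$ (l, b)))"
      using e by (intro sum.cong refl arg_cong2[of _ _ _ _ "(*)"]) auto
    finally show ?thesis .
  qed
  also have "(\<Sum>k<n. ?P i $$ (a, k) * ?D $$ (k, b)) =
      (\<Sum>k<n. \<Sum>l<n. ?D $$ (k, l) * (?P i $$ (a, k) * ?P 0 $$ (l, b)))"
  proof (rule sum.cong[OF refl])
    fix k
    have "(\<Sum>l<n. ?D $$ (k, l) * (?P i $$ (a, k) * ?P 0 $$ (l, b))) =
        (\<Sum>l<n. if l = b then ?P i $$ (a, k) * ?D $$ (k, l) else 0)"
      using Y Suc.prems by (intro sum.cong) (auto simp: algebra_simps)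
    then show "?P i $$ (a, k) * ?D $$ (k, b) = (\<Sum>l<n. ?D $$ (k, l) * (?P i $$ (a, k) * ?P 0 $$ (l, b)))"
      using Suc.prems by (simp add: sum.delta)
  qed
  finally show ?case
    by (simp add: sum.distrib[symmetric] distrib_left[symmetric])
qed

section \<open>The Chern connection on power series\<close>

lemma left_inverse_unique:
  fixes V :: "'a :: comm_ring_1 mat"
  assumes "V \<in> carrier_mat n n" "P \<in> carrier_mat n n" "W \<in> carrier_mat n n" "V * P = 1\<^sub>m n" "P * W = 1\<^sub>m n"
  shows "V = W"
proof -
  have "V = V * (P * W)" using assms(1,5) by (simp only: right_mult_one_mat)
  also have "\<dots> = V * P * W" using assms(1-3) by (rule assoc_mult_mat[symmetric])
  also have "\<dots> = W" using assms(3,4) by (simp only: left_mult_one_mat)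
  finally show ?thesis .
qed

lemma one_plus_minus_one:
  "Y \<in> carrier_mat n n \<Longrightarrow> 1\<^sub>m n + (Y - 1\<^sub>m n) = (Y :: 'a :: comm_ring_1 mat)"
  by (rule eq_matI) auto

text \<open>The data at a single prime once the arithmetic of A has been used: the roots of unity
  survive only as the assumption that \<phi> raises the entries of q to the p-th power. Z is the
  inverse of q.\<close>

locale chern_core = phi: subr_hom S \<phi>
  for S :: "complex set" and \<phi> :: "complex \<Rightarrow> complex" +
  fixes n p :: nat and q Z :: "complex mat"
  assumes half: "1 / 2 \<in> S" and odd_p: "odd p" and phi_mem: "c \<in> S \<Longrightarrow> \<phi> c \<in> S"
    and q: "q \<in> smats S n" and Z: "Z \<in> smats S n" and qZ: "q * Z = 1\<^sub>m n" and Zq: "Z * q = 1\<^sub>m n"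
    and sym: "transpose_mat q = q \<or> transpose_mat q = - q"
    and phi_q: "i < n \<Longrightarrow> j < n \<Longrightarrow> \<phi> (q $$ (i, j)) = q $$ (i, j) ^ p"
begin

abbreviation I :: "(nat \<times> nat) set" where "I \<equiv> {..<n} \<times> {..<n}"
abbreviation R :: "(nat \<times> nat, complex) mps set" where "R \<equiv> mps_over I S"
abbreviation cmat :: "complex mat \<Rightarrow> (nat \<times> nat, complex) mps mat" where "cmat \<equiv> map_mat mconst"
abbreviation epow :: "(nat \<times> nat, complex) mps mat \<Rightarrow> (nat \<times> nat, complex) mps mat" where
  "epow \<equiv> map_mat (\<lambda>a. a ^ p)"

lemma subr_S: "subr S" by unfold_locales
sublocale R: subr R by (rule subr_mps_over[OF subr_S])
sublocale ct: subr_hom R "\<lambda>f. coef f {#}" by (rule const_term_hom[OF R.subr_axioms])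

lemma p_pos: "p > 0" using odd_p by (cases p) auto

section \<open>The matrices of the Chern formula over power series in T = x - 1\<close>

definition xm :: "(nat \<times> nat, complex) mps mat" where
  "xm = mat n n (\<lambda>(k, l). (if k = l then 1 else 0) + mvar (k, l))"
definition Xp where "Xp = epow xm"
definition q' where "q' = map_mat \<phi> q"
definition Z' where "Z' = map_mat \<phi> Z"
definition P0 where "P0 = transpose_mat Xp * cmat q' * Xp"
definition Q0 where "Q0 = epow (transpose_mat xm * cmat q * xm)"
text \<open>\<open>P0\<close> has constant term \<phi>(q), so multiplying it by the inverse
  \<open>Z'\<close> of \<phi>(q) gives 1 + \<open>N0\<close> with \<open>N0\<close> of positive
  order. The geometric series in \<open>N0\<close> then yields \<open>V0\<close> as the inverse of
  \<open>P0\<close>.\<close>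

definition N0 where "N0 = cmat Z' * P0 - 1\<^sub>m n"
definition V0 where "V0 = mseries (inverse (1 + fps_X)) N0 * cmat Z'"
definition U0 where "U0 = V0 * Q0 - 1\<^sub>m n"
text \<open>The square root is taken T-adically here; \<open>Mrel_sqrt\<close> compares it with the
  p-adic sum of the Chern formula.\<close>

definition S0 where "S0 = mseries (fps_binomial (1 / 2)) U0"
definition F where "F = Xp * S0"
abbreviation ctm :: "(nat \<times> nat, complex) mps mat \<Rightarrow> complex mat" where "ctm \<equiv> map_mat (\<lambda>f. coef f {#})"

lemma cmat_mem: "Y \<in> smats S n \<Longrightarrow> cmat Y \<in> smats R n"
  by (rule smats_map[OF _ mconst_over[OF subr_S]])

lemma phi_mats: "Y \<in> smats S n \<Longrightarrow> map_mat \<phi> Y \<in> smats S n"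
  by (rule smats_map[OF _ phi_mem])

lemma xm_mem: "xm \<in> smats R n"
  unfolding xm_def by (rule smatsI) (auto intro!: R.add_mem mvar_over[OF subr_S])

lemma Xp_mem: "Xp \<in> smats R n" unfolding Xp_def by (intro R.smats_intros xm_mem)
lemma q'_mem: "q' \<in> smats S n" unfolding q'_def by (intro phi_mats q)
lemma Z'_mem: "Z' \<in> smats S n" unfolding Z'_def by (intro phi_mats Z)
lemma P0_mem: "P0 \<in> smats R n"
  unfolding P0_def by (intro R.smats_mult R.smats_intros Xp_mem cmat_mem q'_mem)
lemma Q0_mem: "Q0 \<in> smats R n"
  unfolding Q0_def by (intro R.smats_mult R.smats_intros xm_mem cmat_mem q)
lemma N0_mem: "N0 \<in> smats R n"
  unfolding N0_def by (intro R.smats_mult R.smats_intros P0_mem cmat_mem Z'_mem)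

lemma V0_mem: "V0 \<in> smats R n"
proof -
  \<comment> \<open>The binomial series of exponent -1 has the coefficients (-1)^i, which lie in
    every subring.\<close>
  have "fps_nth (inverse (1 + fps_X) :: complex fps) i = (- 1) ^ i" for i
    by (simp add: fps_binomial_minus_one[symmetric] gbinomial_minus[of 1, simplified] binomial_gbinomial[symmetric])
  then have "fps_nth (inverse (1 + fps_X) :: complex fps) i \<in> S" for i
    using phi.power_mem[OF phi.uminus_mem[OF phi.one_mem]] by (simp only:)
  then show ?thesis
    unfolding V0_def by (intro R.smats_mult mseries_over[OF subr_S] N0_mem cmat_mem Z'_mem)
qed

lemma U0_mem: "U0 \<in> smats R n"
  unfolding U0_def by (intro R.smats_mult R.smats_intros V0_mem Q0_mem)

lemma S0_mem: "S0 \<in> smats R n"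
  unfolding S0_def
  by (intro mseries_over[OF subr_S] U0_mem) (simp only: fps_binomial_nth sqrt_binomial_mem[OF subr_S half])

lemma F_mem: "F \<in> smats R n" unfolding F_def by (intro R.smats_mult Xp_mem S0_mem)

lemmas car [simp] = smats_carrier[OF xm_mem] smats_carrier[OF Xp_mem] smats_carrier[OF P0_mem]
  smats_carrier[OF Q0_mem] smats_carrier[OF N0_mem] smats_carrier[OF V0_mem] smats_carrier[OF U0_mem]
  smats_carrier[OF S0_mem] smats_carrier[OF F_mem] smats_carrier[OF q] smats_carrier[OF Z]
  smats_carrier[OF q'_mem] smats_carrier[OF Z'_mem]

lemmas dims [simp] = car[THEN carrier_matD(1)] car[THEN carrier_matD(2)]

lemmas assoc = assoc_mult_mat[of _ n n _ n _ n]

lemma mconst_hom_map: "cmat (Y * W) = cmat Y * cmat W" if "Y \<in> smats S n" "W \<in> smats S n"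
proof -
  interpret m: subr_hom S "mconst :: complex \<Rightarrow> (nat \<times> nat, complex) mps" by (rule mconst_hom[OF subr_S])
  show ?thesis by (rule m.map_mat_mult[OF that])
qed

lemma cmat_one: "cmat (1\<^sub>m n) = 1\<^sub>m n"
  by (rule eq_matI) auto

lemma Z'q': "Z' * q' = 1\<^sub>m n" and q'Z': "q' * Z' = 1\<^sub>m n"
  unfolding Z'_def q'_def
  unfolding phi.map_mat_mult[OF Z q, symmetric] phi.map_mat_mult[OF q Z, symmetric] Zq qZ
  by (rule phi.map_mat_one)+

lemma cq'Z': "cmat q' * cmat Z' = 1\<^sub>m n"
  using mconst_hom_map[OF q'_mem Z'_mem] by (simp add: q'Z' cmat_one)

lemma ctm_cmat: "ctm (cmat Y) = Y"
  by (rule eq_matI) (auto simp: coef_mconst)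

lemma ctm_xm: "ctm xm = 1\<^sub>m n"
  by (rule eq_matI) (auto simp: xm_def coef_one coef_mvar)

lemma ctm_epow: "ctm (epow Y) = map_mat (\<lambda>a. a ^ p) (ctm Y)"
  by (rule eq_matI) (auto simp: coef_empty_power)

lemma ctm_Xp: "ctm Xp = 1\<^sub>m n"
  unfolding Xp_def ctm_epow ctm_xm by (rule eq_matI) (use p_pos in auto)

lemma q'_eq: "q' = map_mat (\<lambda>a. a ^ p) q"
  unfolding q'_def by (rule eq_matI) (simp_all add: phi_q)

lemma ctm_P0: "ctm P0 = q'"
  unfolding P0_def using car
  by (simp add: ct.map_mat_mult[of _ n] R.smats_mult R.smats_intros Xp_mem cmat_mem q'_mem
      ct.map_mat_transpose ctm_Xp ctm_cmat)

text \<open>At x = 1 the matrix x^t q x becomes q, so the constant term of \<open>Q0\<close> is the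
  entrywise p-th power of q. The roots of unity enter here: this power is \<phi>(q), which is also
  the constant term of \<open>P0\<close>.\<close>

lemma ctm_Q0: "ctm Q0 = q'"
  unfolding Q0_def ctm_epow q'_eq using car
  by (simp add: ct.map_mat_mult[of _ n] R.smats_mult R.smats_intros xm_mem cmat_mem q
      ct.map_mat_transpose ctm_xm ctm_cmat)

lemma mord_ctm: "Y \<in> carrier_mat n n \<Longrightarrow> ctm Y = 0\<^sub>m n n \<Longrightarrow> mord 1 Y"
  unfolding mord_def
proof (intro allI impI)
  fix i j assume Y: "Y \<in> carrier_mat n n" "ctm Y = 0\<^sub>m n n" and ij: "i < dim_row Y" "j < dim_col Y"
  have "ctm Y $$ (i, j) = 0" using Y ij by simp
  then show "ordge 1 (Y $$ (i, j))" using ij by (simp add: ordge_1)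
qed

lemma minus_self: "Y \<in> carrier_mat n n \<Longrightarrow> Y - Y = 0\<^sub>m n n" for Y :: "complex mat"
  by (rule eq_matI) auto

lemma N0_ord: "mord 1 N0"
proof (rule mord_ctm)
  show "ctm N0 = 0\<^sub>m n n"
    unfolding N0_def
    by (simp add: ct.map_mat_diff[of _ n] ct.map_mat_mult[of _ n] R.smats_mult R.smats_intros P0_mem
        cmat_mem Z'_mem ctm_cmat ctm_P0 Z'q' ct.map_mat_one minus_self)
qed simp

lemma one_plus_N0: "1\<^sub>m n + N0 = cmat Z' * P0"
  unfolding N0_def by (rule one_plus_minus_one, rule mult_carrier_mat[OF _ car(3)]) simp

lemma V0P0: "V0 * P0 = 1\<^sub>m n" and P0V0: "P0 * V0 = 1\<^sub>m n"
proof -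
  let ?E = "mseries (inverse (1 + fps_X)) N0"
  have E: "?E \<in> carrier_mat n n" by simp
  have cz: "cmat Z' \<in> carrier_mat n n" "cmat q' \<in> carrier_mat n n" by auto
  have inv: "cmat Z' * P0 * ?E = 1\<^sub>m n" "?E * (cmat Z' * P0) = 1\<^sub>m n"
    using mseries_inverse[OF car(5) N0_ord] unfolding one_plus_N0 by metis+
  show "V0 * P0 = 1\<^sub>m n"
    unfolding V0_def using inv(2) E cz by (simp add: assoc_mult_mat[of _ n n _ n _ n])
  \<comment> \<open>Inserting \<open>q' * Z' = 1\<close> on the left reduces the right inverse to
    the inverse of 1 + \<open>N0\<close>.\<close>
  have "P0 * V0 = cmat q' * (cmat Z' * P0) * V0"
    unfolding assoc[OF cz(2) cz(1) car(3), symmetric] cq'Z' left_mult_one_mat[OF car(3)] ..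
  also have "\<dots> = cmat q' * ((cmat Z' * P0 * ?E) * cmat Z')"
    unfolding V0_def
    using assoc[OF cz(2) mult_carrier_mat[OF cz(1) car(3)] mult_carrier_mat[OF E cz(1)]]
      assoc[OF mult_carrier_mat[OF cz(1) car(3)] E cz(1)] by simp
  also have "\<dots> = 1\<^sub>m n" using cz by (simp only: inv left_mult_one_mat cq'Z')
  finally show "P0 * V0 = 1\<^sub>m n" .
qed

lemma one_plus_U0: "1\<^sub>m n + U0 = V0 * Q0"
  unfolding U0_def by (rule one_plus_minus_one, rule mult_carrier_mat[OF car(6) car(4)])

text \<open>The constant terms of \<open>P0\<close> and \<open>Q0\<close> agree, so
  \<open>V0 * Q0\<close> equals 1 at the identity. This makes the square root series converge
  T-adically.\<close>

lemma U0_ord: "mord 1 U0"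
proof (rule mord_ctm)
  have "ctm (V0 * P0) = ctm V0 * q'"
    by (simp add: ct.map_mat_mult[OF V0_mem P0_mem] ctm_P0)
  then have "ctm V0 * q' = 1\<^sub>m n" by (simp add: V0P0 ct.map_mat_one)
  then show "ctm U0 = 0\<^sub>m n n"
    unfolding U0_def
    by (simp add: ct.map_mat_diff[of _ n] ct.map_mat_mult[of _ n] R.smats_mult R.smats_intros V0_mem Q0_mem
        ctm_Q0 ct.map_mat_one minus_self)
qed simp

lemma S0_square: "S0 * S0 = V0 * Q0"
proof -
  have "S0 * S0 = mseries (fps_binomial (1 / 2) * fps_binomial (1 / 2)) U0"
    unfolding S0_def by (rule mseries_mult[OF car(7) U0_ord])
  also have "fps_binomial (1 / 2) * fps_binomial (1 / 2) = (1 + fps_X :: complex fps)"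
    unfolding fps_binomial_add_mult[symmetric] by (simp add: fps_binomial_1)
  also have "mseries (1 + fps_X) U0 = 1\<^sub>m n + U0"
    using mseries_linear[OF car(7), of 1] smult_one_mat[of U0] by simp
  finally show ?thesis by (simp add: one_plus_U0)
qed

lemma ctm_S0: "ctm S0 = 1\<^sub>m n"
proof (rule eq_matI)
  fix i j assume "i < dim_row (1\<^sub>m n :: complex mat)" "j < dim_col (1\<^sub>m n :: complex mat)"
  then have "i < n" "j < n" by simp_all
  then show "ctm S0 $$ (i, j) = 1\<^sub>m n $$ (i, j)"
    using mseries_const_term[OF car(7) U0_ord, of i j "fps_binomial (1 / 2)"]
    by (simp add: S0_def)
qed (simp_all add: S0_def)

lemma ctm_F: "ctm F = 1\<^sub>m n"
  unfolding F_def by (simp add: ct.map_mat_mult[OF Xp_mem S0_mem] ctm_Xp ctm_S0)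

lemma cmat_transpose: "transpose_mat (cmat Y) = cmat (transpose_mat Y)"
  by (rule eq_matI) auto

lemma epow_transpose: "transpose_mat (epow Y) = epow (transpose_mat Y)"
  by (rule eq_matI) auto

lemma epow_uminus: "epow (- Y) = - epow Y"
  by (rule eq_matI) (use odd_p in \<open>auto simp: power_minus_odd\<close>)

lemma conj_transpose:
  fixes Y C :: "(nat \<times> nat, complex) mps mat"
  assumes "Y \<in> carrier_mat n n" "C \<in> carrier_mat n n"
  shows "transpose_mat (transpose_mat Y * C * Y) = transpose_mat Y * transpose_mat C * Y"
  using assms by (simp add: transpose_mult[of _ n n _ n] assoc_mult_mat[of _ n n _ n _ n])

text \<open>The product y^t c y keeps the symmetry type of c. In the antisymmetric case the sign
  also passes through entrywise p-th powers, as p is odd, and through \<phi>, which is additive on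
  S.\<close>

lemma PQ_sym: "(transpose_mat P0 = P0 \<and> transpose_mat Q0 = Q0) \<or>
    (transpose_mat P0 = - P0 \<and> transpose_mat Q0 = - Q0)"
  using sym
proof
  assume s: "transpose_mat q = q"
  then have "transpose_mat q' = q'" unfolding q'_def by (metis phi.map_mat_transpose)
  then show ?thesis using s
    unfolding P0_def Q0_def epow_transpose
    by (simp add: conj_transpose cmat_transpose)
next
  assume s: "transpose_mat q = - q"
  have cu: "cmat (- Y) = - cmat Y" for Y by (rule eq_matI) auto
  have "transpose_mat q' = - q'"
  proof (rule eq_matI)
    fix i j assume ij: "i < dim_row (- q')" "j < dim_col (- q')"
    then have ij: "i < n" "j < n" using smats_carrier[OF q'_mem] by auto
    have "q $$ (j, i) = - q $$ (i, j)"
      using arg_cong[OF s, of "\<lambda>Y. Y $$ (i, j)"] ij smats_carrier[OF q] by auto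
    then show "transpose_mat q' $$ (i, j) = (- q') $$ (i, j)"
      using ij phi.hom_uminus[OF smats_entry[OF q, of i j]] unfolding q'_def by simp
  qed (simp_all)
  moreover have "transpose_mat Y * - C * Y = - (transpose_mat Y * C * Y)"
    if "Y \<in> carrier_mat n n" "C \<in> carrier_mat n n" for Y C :: "(nat \<times> nat, complex) mps mat"
    using that by simp
  ultimately show ?thesis using s
    unfolding P0_def Q0_def epow_transpose
    by (simp add: conj_transpose cmat_transpose cu epow_uminus)
qed

text \<open>By uniqueness of inverses \<open>V0\<close> has the symmetry type of \<open>P0\<close>,
  and \<open>Q0\<close> has it too; a possible sign therefore cancels in the product.\<close>

lemma V0_transpose_Q0: "transpose_mat Q0 * transpose_mat V0 = Q0 * V0"
proof -
  have "transpose_mat V0 * transpose_mat P0 = 1\<^sub>m n"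
    using transpose_mult[of P0 n n V0 n] P0V0 by simp
  then have V: "transpose_mat V0 * transpose_mat P0 = 1\<^sub>m n" .
  show ?thesis using PQ_sym
  proof
    assume s: "transpose_mat P0 = P0 \<and> transpose_mat Q0 = Q0"
    then have "transpose_mat V0 = V0"
      using left_inverse_unique[of "transpose_mat V0" n P0 V0] V P0V0 by simp
    then show ?thesis using s by simp
  next
    assume s: "transpose_mat P0 = - P0 \<and> transpose_mat Q0 = - Q0"
    then have "- transpose_mat V0 * P0 = 1\<^sub>m n" using V by simp
    then have "- transpose_mat V0 = V0"
      using left_inverse_unique[of "- transpose_mat V0" n P0 V0] P0V0 by simp
    moreover have "- Q0 * transpose_mat V0 = Q0 * - transpose_mat V0" by simp
    ultimately show ?thesis using s by metis
  qed
qed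

text \<open>From \<open>P0 * U0\<close> = \<open>Q0 - P0\<close> =
  \<open>transpose_mat U0 * P0\<close> it follows that \<open>P0\<close> intertwines
  \<open>U0\<close> and its transpose, hence also their square roots. So the left side is
  \<open>P0 * (S0 * S0)\<close> = \<open>P0 * (V0 * Q0)\<close> = \<open>Q0\<close>.\<close>

lemma S0_conj: "transpose_mat S0 * P0 * S0 = Q0"
proof -
  have cU: "transpose_mat U0 \<in> carrier_mat n n" by simp
  have tU: "transpose_mat U0 = Q0 * V0 - 1\<^sub>m n"
    unfolding U0_def
    by (subst transpose_minus[OF mult_carrier_mat[OF car(6) car(4)] one_carrier_mat]) (use car in \<open>simp_all add: transpose_mult[of _ n n _ n] V0_transpose_Q0\<close>)
  have "P0 * U0 = P0 * (V0 * Q0) - P0"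
    unfolding U0_def mult_minus_distrib_mat[OF car(3) mult_carrier_mat[OF car(6) car(4)] one_carrier_mat]
    by simp
  also have "P0 * (V0 * Q0) = Q0"
    by (simp add: assoc_mult_mat[of _ n n _ n _ n, symmetric] P0V0)
  also have "Q0 - P0 = transpose_mat U0 * P0"
    unfolding tU minus_mult_distrib_mat[OF mult_carrier_mat[OF car(4) car(6)] one_carrier_mat car(3)]
      assoc[OF car(4) car(6) car(3)] V0P0 by simp
  finally have "P0 * S0 = mseries (fps_binomial (1 / 2)) (transpose_mat U0) * P0"
    unfolding S0_def
    by (intro mseries_intertwine[of _ n]) (use U0_ord in \<open>auto simp: mord_def\<close>)
  then have "P0 * S0 = transpose_mat S0 * P0"
    unfolding S0_def by (simp add: transpose_mseries[of _ n])
  then have "transpose_mat S0 * P0 * S0 = P0 * (S0 * S0)"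
    by (simp add: assoc_mult_mat[of _ n n _ n _ n] flip: \<open>P0 * S0 = transpose_mat S0 * P0\<close>)
  also have "\<dots> = Q0"
    unfolding S0_square by (simp add: assoc_mult_mat[of _ n n _ n _ n, symmetric] P0V0)
  finally show ?thesis .
qed

lemma F_conj: "transpose_mat F * cmat q' * F = Q0"
proof -
  have c: "cmat q' \<in> carrier_mat n n" by simp
  have t: "transpose_mat S0 \<in> carrier_mat n n" "transpose_mat Xp \<in> carrier_mat n n" by simp_all
  have "transpose_mat F * cmat q' * F = transpose_mat S0 * P0 * S0"
    unfolding F_def P0_def transpose_mult[OF car(2) car(8)]
    using assoc[OF mult_carrier_mat[OF mult_carrier_mat[OF t] c] car(2) car(8)]
      assoc[OF mult_carrier_mat[OF t] c car(2)] assoc[OF t mult_carrier_mat[OF c car(2)]]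
      assoc[OF t(2) c car(2)]
    by (simp only:)
  then show ?thesis by (simp add: S0_conj)
qed

end

lemma lsum_diff: "lsum (\<lambda>i. h i - g i) = lsum h - lsum g"
  by (rule mps_eqI) (simp add: lsum_def sum_subtractf)

text \<open>The entries of the commutator with $f(Y)$ are finite combinations of those of the commutator
  with \<open>Y\<close>, so they lie in any ideal that contains the latter, closed or not.\<close>
lemma comm_mat_mseries:
  assumes J: "J \<in> carrier_mat n n" and Y: "Y \<in> carrier_mat n n" "mord 1 Y" and ab: "a < n" "b < n"
  shows "comm_mat J (mseries f Y) $$ (a, b) =
    (\<Sum>k<n. \<Sum>l<n. comm_mat J Y $$ (k, l) *
      lsum (\<lambda>i. mconst (fps_nth f i) * (\<Sum>j<i. (Y ^\<^sub>m j) $$ (a, k) * (Y ^\<^sub>m (i - 1 - j)) $$ (l, b))))"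
proof -
  let ?G = "\<lambda>k l i. mconst (fps_nth f i) * (\<Sum>j<i. (Y ^\<^sub>m j) $$ (a, k) * (Y ^\<^sub>m (i - 1 - j)) $$ (l, b))"
  have lf: "locfin (?G k l)" if "k < n" "l < n" for k l
    unfolding locfin_def
  proof (intro allI, rule ordge_mult2, rule ordge_sum)
    fix i j assume "j \<in> {..<Suc i}"
    then show "ordge i ((Y ^\<^sub>m j) $$ (a, k) * (Y ^\<^sub>m (Suc i - 1 - j)) $$ (l, b))"
      using ordge_mult[OF ordge_pow_mat[OF Y ab(1) that(1), of j] ordge_pow_mat[OF Y that(2) ab(2), of "i - j"]]
      by simp
  qed
  have "comm_mat J (mseries f Y) $$ (a, b) = (J * mseries f Y) $$ (a, b) - (mseries f Y * J) $$ (a, b)"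
    unfolding comm_mat_def using J Y ab by (subst index_minus_mat) auto
  also have "\<dots> = lsum (\<lambda>i. mconst (fps_nth f i) * comm_mat J (Y ^\<^sub>m i) $$ (a, b))"
  proof -
    have "mconst (fps_nth f i) * comm_mat J (Y ^\<^sub>m i) $$ (a, b) =
        mconst (fps_nth f i) * (J * Y ^\<^sub>m i) $$ (a, b) - mconst (fps_nth f i) * (Y ^\<^sub>m i * J) $$ (a, b)" for i
      unfolding comm_mat_def right_diff_distrib[symmetric] using J Y ab
      by (subst index_minus_mat) auto
    then show ?thesis
      unfolding mseries_entry_left[OF Y J ab] mseries_entry_right[OF Y J ab] lsum_diff[symmetric]
      by (intro lsum_cong) simp
  qed
  also have "\<dots> = lsum (\<lambda>i. \<Sum>k<n. \<Sum>l<n. comm_mat J Y $$ (k, l) * ?G k l i)"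
    unfolding comm_mat_pow[OF J Y(1) ab]
    by (intro lsum_cong) (simp add: sum_distrib_left mult.left_commute)
  also have "\<dots> = (\<Sum>k<n. \<Sum>l<n. lsum (\<lambda>i. comm_mat J Y $$ (k, l) * ?G k l i))"
    by (simp only: lsum_sum)
  also have "\<dots> = (\<Sum>k<n. \<Sum>l<n. comm_mat J Y $$ (k, l) * lsum (?G k l))"
    using lf by (intro sum.cong refl lsum_mult_left[symmetric]) auto
  finally show ?thesis .
qed

context chern_core
begin

text \<open>The image of T_kl = x_kl - \<delta>_kl: the variables of the series ring are the entries
  of T, while the Chern formula prescribes the image of x.\<close>

definition \<tau> :: "nat \<times> nat \<Rightarrow> (nat \<times> nat, complex) mps" where
  "\<tau> kl = F $$ kl - (if fst kl = snd kl then 1 else 0)"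

sublocale psi: subst_data S I \<phi> \<tau>
proof
  show "finite I" by simp
  show "\<phi> c \<in> S" if "c \<in> S" for c using that by (rule phi_mem)
  fix i :: "nat \<times> nat" assume i: "i \<in> I"
  then obtain k l where kl: "i = (k, l)" "k < n" "l < n" by auto
  have "F $$ (k, l) \<in> R" using F_mem kl by simp
  then show "\<tau> i \<in> R"
    unfolding \<tau>_def using kl(1) by (intro R.diff_mem) auto
  have "coef (F $$ (k, l)) {#} = ctm F $$ (k, l)" using kl by simp
  then have "coef (\<tau> i) {#} = 0" using kl unfolding ctm_F by (simp add: \<tau>_def coef_one)
  then show "ordge 1 (\<tau> i)" by (simp add: ordge_1)
qed

abbreviation "psi \<equiv> psi.subst"

sublocale psih: subr_hom R psi by (rule psi.subst_hom)

lemma psi_xm: "map_mat psi xm = F"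
proof (rule eq_matI)
  fix i j assume "i < dim_row F" "j < dim_col F"
  then have ij: "i < n" "j < n" by simp_all
  have m: "mvar (i, j) \<in> R" using ij by (intro mvar_over[OF subr_S]) auto
  have "psi ((if i = j then 1 else 0) + mvar (i, j)) = (if i = j then 1 else 0) + \<tau> (i, j)"
    using ij by (subst psih.hom_add) (auto simp: m psih.hom_one psih.hom_zero psi.subst_mvar)
  then show "map_mat psi xm $$ (i, j) = F $$ (i, j)"
    using ij by (simp add: xm_def \<tau>_def)
qed (simp_all add: xm_def)

lemma psi_cmat:
  assumes "Y \<in> smats S n"
  shows "map_mat psi (cmat Y) = cmat (map_mat \<phi> Y)"
  by (rule eq_matI) (use smats_entry[OF assms] carrier_matD[OF smats_carrier[OF assms]] in \<open>auto simp: psi.subst_mconst\<close>)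

lemma psi_conj:
  assumes "Y \<in> smats S n"
  shows "map_mat psi (transpose_mat xm * cmat Y * xm) = transpose_mat F * cmat (map_mat \<phi> Y) * F"
proof -
  have t: "transpose_mat xm \<in> smats R n" using xm_mem by (rule R.smats_intros)
  show ?thesis
    unfolding psih.map_mat_mult[OF R.smats_mult[OF t cmat_mem[OF assms]] xm_mem]
      psih.map_mat_mult[OF t cmat_mem[OF assms]] psih.map_mat_transpose psi_xm psi_cmat[OF assms] ..
qed

text \<open>By \<open>F_conj\<close> the matrix x^t q x - q is sent to the difference of the
  entrywise p-th powers of x^t q x and q, and a - b divides a^p - b^p. K is any ideal that contains
  the generators; \<open>genideal_hom_stable\<close> passes to the generated one.\<close>

lemma psi_J:
  assumes "subr_ideal R K" and K: "transpose_mat xm * cmat q * xm - cmat q \<in> smats K n"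
  shows "map_mat psi (transpose_mat xm * cmat q * xm - cmat q) \<in> smats K n"
proof (rule smatsI)
  interpret K: subr_ideal R K by fact
  let ?B = "transpose_mat xm * cmat q * xm"
  have B: "?B \<in> smats R n" by (intro R.smats_mult R.smats_intros xm_mem cmat_mem q)
  have Bc: "?B \<in> carrier_mat n n" using B by simp
  have e: "map_mat psi (?B - cmat q) = Q0 - cmat q'"
    unfolding psih.map_mat_diff[OF B cmat_mem[OF q]] psi_conj[OF q] psi_cmat[OF q]
    unfolding q'_def[symmetric] F_conj ..
  fix i j assume ij: "i < n" "j < n"
  have "(?B - cmat q) $$ (i, j) \<in> K" using K ij by (intro smats_entry)
  then have "?B $$ (i, j) - mconst (q $$ (i, j)) \<in> K" using ij by (simp del: index_mult_mat(1))
  then have "?B $$ (i, j) ^ p - mconst (q $$ (i, j)) ^ p \<in> K"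
    using smats_entry[OF B ij] smats_entry[OF cmat_mem[OF q] ij] ij by (intro K.K_power_diff) simp_all
  moreover have "(Q0 - cmat q') $$ (i, j) = ?B $$ (i, j) ^ p - mconst (q $$ (i, j)) ^ p"
    using ij carrier_matD[OF Bc] by (simp add: Q0_def q'_eq mconst_power del: index_mult_mat(1))
  ultimately show "map_mat psi (?B - cmat q) $$ (i, j) \<in> K" unfolding e by simp
qed (simp add: minus_carrier_mat)

section \<open>Commutation with the complex structure modulo K\<close>

context
  fixes r :: nat and K
  assumes n2: "n = 2 * r" and q1: "q = 1\<^sub>m n" and ideal: "subr_ideal R K"
    and K_orth: "transpose_mat xm * xm - 1\<^sub>m n \<in> smats K n"
    and K_ad: "\<And>i j. i < r \<Longrightarrow> j < r \<Longrightarrow> xm $$ (i, j) - xm $$ (i + r, j + r) \<in> K"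
    and K_bc: "\<And>i j. i < r \<Longrightarrow> j < r \<Longrightarrow> xm $$ (i, j + r) + xm $$ (i + r, j) \<in> K"
begin

interpretation K: subr_ideal R K by (rule ideal)

text \<open>\<open>Jm\<close> is the matrix of the complex structure: multiplication by it from the left or right permutes
  the four blocks up to sign, so commuting with it modulo \<open>K\<close> means $a \equiv d$ and
  $b \equiv -c$.\<close>
definition sw :: "nat \<Rightarrow> nat" where "sw i = (if i < r then i + r else i - r)"
definition sg :: "nat \<Rightarrow> (nat \<times> nat, complex) mps" where "sg i = (if i < r then 1 else - 1)"
definition Jm where "Jm = mat n n (\<lambda>(i, j). if j = sw i then sg i else 0)"

lemma sw_less: "i < n \<Longrightarrow> sw i < n" and sw_sw: "i < n \<Longrightarrow> sw (sw i) = i"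
  and sg_sw: "i < n \<Longrightarrow> sg (sw i) = - sg i"
  by (auto simp: sw_def sg_def n2)

lemma Jm_mem: "Jm \<in> smats R n"
  by (rule smatsI) (auto simp: Jm_def sg_def)

lemma Jm_car [simp]: "Jm \<in> carrier_mat n n" using Jm_mem by simp

lemma Jm_transpose: "transpose_mat Jm = - Jm"
proof (rule eq_matI)
  fix i j assume "i < dim_row (- Jm)" "j < dim_col (- Jm)"
  then have ij: "i < n" "j < n" by (auto simp: Jm_def)
  then show "transpose_mat Jm $$ (i, j) = (- Jm) $$ (i, j)"
    using sw_sw sg_sw by (auto simp: Jm_def)
qed (auto simp: Jm_def)

lemma comm_Jm_entry:
  assumes Y: "Y \<in> carrier_mat n n" and ij: "i < n" "j < n"
  shows "comm_mat Jm Y $$ (i, j) = sg i * Y $$ (sw i, j) + sg j * Y $$ (i, sw j)"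
proof -
  have 1: "(Jm * Y) $$ (i, j) = sg i * Y $$ (sw i, j)"
  proof -
    have "(Jm * Y) $$ (i, j) = (\<Sum>l<n. if l = sw i then sg i * Y $$ (l, j) else 0)"
      unfolding entry_mult[OF Jm_car Y ij] using ij by (intro sum.cong) (auto simp: Jm_def)
    then show ?thesis using sw_less[OF ij(1)] by (simp add: sum.delta)
  qed
  have 2: "(Y * Jm) $$ (i, j) = - sg j * Y $$ (i, sw j)"
  proof -
    have "(Y * Jm) $$ (i, j) = (\<Sum>l<n. if l = sw j then - sg j * Y $$ (i, l) else 0)"
      unfolding entry_mult[OF Y Jm_car ij]
    proof (rule sum.cong[OF refl])
      fix l assume "l \<in> {..<n}"
      then have l: "l < n" by simp
      \<comment> \<open>The only row that contributes is l = \<open>sw j\<close>, and its sign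
        \<open>sg (sw j)\<close> is opposite to \<open>sg j\<close>.\<close>
      have "j = sw l \<longleftrightarrow> l = sw j" using sw_sw l ij by metis
      then show "Y $$ (i, l) * Jm $$ (l, j) = (if l = sw j then - sg j * Y $$ (i, l) else 0)"
        using l ij sg_sw[of j] by (simp add: Jm_def)
    qed
    then show ?thesis using sw_less[OF ij(2)] by (simp add: sum.delta)
  qed
  have "comm_mat Jm Y $$ (i, j) = (Jm * Y) $$ (i, j) - (Y * Jm) $$ (i, j)"
    unfolding comm_mat_def using Y ij by (subst index_minus_mat) (auto simp: Jm_def)
  then show ?thesis unfolding 1 2 by simp
qed

text \<open>Membership in R is recorded along with commutation, because K absorbs only elements of
  R; this makes the class closed under products.\<close>

definition Dk :: "(nat \<times> nat, complex) mps mat \<Rightarrow> bool" where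
  "Dk Y \<longleftrightarrow> Y \<in> smats R n \<and> comm_mat Jm Y \<in> smats K n"

lemma Dk_mult:
  assumes "Dk Y" "Dk W"
  shows "Dk (Y * W)"
proof -
  have m: "Y \<in> smats R n" "W \<in> smats R n" and k: "comm_mat Jm Y \<in> smats K n" "comm_mat Jm W \<in> smats K n"
    using assms by (simp_all add: Dk_def)
  show ?thesis
    unfolding Dk_def comm_mat_mult[OF Jm_car m[THEN smats_carrier]]
    by (intro conjI R.smats_mult m K.smats_K_add K.smats_K_mult_right[OF k(1) m(2)]
        K.smats_K_mult_left[OF m(1) k(2)])
qed

lemma Dk_transpose: "Dk Y \<Longrightarrow> Dk (transpose_mat Y)"
  unfolding Dk_def
  using comm_mat_transpose[OF Jm_car _ Jm_transpose, of Y] by (auto intro: K.smats_K_transpose)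

lemma Dk_xm: "Dk xm"
  unfolding Dk_def
proof (intro conjI xm_mem smatsI)
  fix i j assume ij: "i < n" "j < n"
  have "sg i * xm $$ (sw i, j) + sg j * xm $$ (i, sw j) \<in> K"
  \<comment> \<open>The diagonal blocks of the commutator give b + c, the off-diagonal ones a - d,
    up to sign.\<close>
  proof (cases "i < r"; cases "j < r")
    assume "i < r" "j < r"
    then show ?thesis using K_bc[of i j] by (simp add: sg_def sw_def add.commute)
  next
    assume a: "i < r" "\<not> j < r"
    then have "j - r < r" using ij n2 by simp
    then show ?thesis using K.K_uminus[OF K_ad[of i "j - r"]] a by (simp add: sg_def sw_def)
  next
    assume a: "\<not> i < r" "j < r"
    then have "i - r < r" using ij n2 by simp
    then show ?thesis using K.K_uminus[OF K_ad[of "i - r" j]] a by (simp add: sg_def sw_def)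
  next
    assume a: "\<not> i < r" "\<not> j < r"
    then have "i - r < r" "j - r < r" using ij n2 by simp_all
    then show ?thesis using K.K_uminus[OF K_bc[of "i - r" "j - r"]] a
      by (simp add: sg_def sw_def)
  qed
  then show "comm_mat Jm xm $$ (i, j) \<in> K" using ij by (simp only: comm_Jm_entry[OF car(1)])
qed (use comm_mat_carrier[OF Jm_car car(1)] in simp)

text \<open>Since \<open>Jm\<close> is a signed permutation matrix, every entry of the commutator is
  u + v with u and v single entries of x up to sign. So u \<equiv> -v can be raised to the p-th
  power, and p odd leaves all signs unchanged.\<close>

lemma Dk_Xp: "Dk Xp"
  unfolding Dk_def
proof (intro conjI Xp_mem smatsI)
  fix i j assume ij: "i < n" "j < n"
  let ?u = "sg i * xm $$ (sw i, j)" and ?v = "sg j * xm $$ (i, sw j)"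
  have sgR: "sg k \<in> R" for k by (auto simp: sg_def)
  have m: "xm $$ (sw i, j) \<in> R" "xm $$ (i, sw j) \<in> R" using xm_mem ij sw_less by auto
  have sgp: "sg k ^ p = sg k" for k using odd_p by (simp add: sg_def power_minus_odd)
  have "?u - (- ?v) \<in> K"
    using Dk_xm smats_entry[of "comm_mat Jm xm" K n i j] ij comm_Jm_entry[OF car(1) ij]
    by (simp add: Dk_def)
  then have "?u ^ p - (- ?v) ^ p \<in> K"
    using m sgR by (intro K.K_power_diff R.uminus_mem R.mult_mem)
  then have "sg i * xm $$ (sw i, j) ^ p + sg j * xm $$ (i, sw j) ^ p \<in> K"
    using odd_p by (simp add: power_minus_odd power_mult_distrib sgp)
  then show "comm_mat Jm Xp $$ (i, j) \<in> K"
    unfolding comm_Jm_entry[OF car(2) ij] using ij sw_less by (simp add: Xp_def)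
qed (use comm_mat_carrier[OF Jm_car car(2)] in simp)

lemma q'1: "cmat q' = 1\<^sub>m n" and cq1: "cmat q = 1\<^sub>m n"
  unfolding q'_def by (simp_all only: q1 phi.map_mat_one cmat_one)

lemma Dk_P0: "Dk P0"
proof -
  have "P0 = transpose_mat Xp * Xp" unfolding P0_def q'1 by simp
  then show ?thesis using Dk_mult[OF Dk_transpose[OF Dk_Xp] Dk_Xp] by simp
qed

text \<open>The derivation applied to \<open>V0 * P0 = 1\<close> gives [J, V0] P0 = - V0 [J, P0],
  and multiplication by \<open>V0\<close> on the right isolates [J, V0].\<close>

lemma Dk_V0: "Dk V0"
proof -
  have "comm_mat Jm (V0 * P0) = 0\<^sub>m n n"
    unfolding V0P0 comm_mat_def by (rule eq_matI) (auto simp: Jm_def)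
  then have z: "comm_mat Jm V0 * P0 + V0 * comm_mat Jm P0 = 0\<^sub>m n n"
    unfolding comm_mat_mult[OF Jm_car car(6) car(3)] .
  let ?A = "comm_mat Jm V0" and ?B = "V0 * comm_mat Jm P0"
  have A: "?A \<in> carrier_mat n n" by simp
  have B: "?B \<in> smats K n" using Dk_P0 V0_mem by (auto simp: Dk_def intro: K.smats_K_mult_left)
  have "?A * P0 = - ?B"
  proof (rule eq_matI)
    fix i j assume "i < dim_row (- ?B)" "j < dim_col (- ?B)"
    then have ij: "i < n" "j < n" using carrier_matD[OF smats_carrier[OF B]] by auto
    have "(?A * P0 + ?B) $$ (i, j) = 0" using z ij by simp
    then have "(?A * P0) $$ (i, j) + ?B $$ (i, j) = 0"
      using ij carrier_matD[OF smats_carrier[OF B]] by (simp del: index_mult_mat(1))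
    then show "(?A * P0) $$ (i, j) = (- ?B) $$ (i, j)"
      using ij carrier_matD[OF smats_carrier[OF B]] by (simp del: index_mult_mat(1) add: eq_neg_iff_add_eq_0)
  qed (use carrier_matD[OF smats_carrier[OF B]] carrier_matD[OF A] in simp_all)
  then have "?A * P0 * V0 = - ?B * V0" by simp
  then have "?A = - ?B * V0"
    unfolding assoc[OF A car(3) car(6)] P0V0 right_mult_one_mat[OF A] .
  moreover have "- ?B \<in> smats K n"
    by (rule smatsI) (use smats_entry[OF B] carrier_matD[OF smats_carrier[OF B]] K.K_uminus in \<open>auto simp del: index_mult_mat(1)\<close>)
  ultimately have "?A \<in> smats K n" using V0_mem by (simp only:) (rule K.smats_K_mult_right)
  then show ?thesis using V0_mem by (simp add: Dk_def)
qed

text \<open>The orthogonality generators enter here: x^t x \<equiv> 1 gives \<open>Q0\<close>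
  \<equiv> 1 entry by entry, and a matrix congruent to 1 has its commutators in K.\<close>

lemma Dk_Q0: "Dk Q0"
proof -
  have B: "transpose_mat xm * xm \<in> smats R n" by (intro R.smats_mult R.smats_intros xm_mem)
  have Bc: "transpose_mat xm * xm \<in> carrier_mat n n" using B by simp
  have Q: "Q0 = epow (transpose_mat xm * xm)" unfolding Q0_def cq1 by simp
  let ?E = "Q0 - 1\<^sub>m n"
  have E: "?E \<in> smats K n"
  proof (rule smatsI)
    fix i j assume ij: "i < n" "j < n"
    let ?b = "(transpose_mat xm * xm) $$ (i, j)" and ?o = "1\<^sub>m n $$ (i, j) :: (nat \<times> nat, complex) mps"
    have "?b - ?o \<in> K" using smats_entry[OF K_orth ij] ij Bc by (simp del: index_mult_mat(1))
    then have "?b ^ p - ?o ^ p \<in> K"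
      using smats_entry[OF B ij] smats_entry[OF R.smats_intros(4) ij] by (intro K.K_power_diff)
    \<comment> \<open>As p > 0, the unit matrix is its own entrywise p-th power.\<close>
    moreover have "?o ^ p = ?o" using ij p_pos by (cases "i = j") (simp_all add: zero_power)
    ultimately show "?E $$ (i, j) \<in> K"
      unfolding Q using ij carrier_matD[OF Bc] by (simp del: index_mult_mat(1))
  qed (rule minus_carrier_mat[OF one_carrier_mat])
  have "comm_mat Jm Q0 = Jm * ?E - ?E * Jm"
  proof -
    have "Jm * ?E = Jm * Q0 - Jm" "?E * Jm = Q0 * Jm - Jm"
      using mult_minus_distrib_mat[OF Jm_car car(4) one_carrier_mat]
        minus_mult_distrib_mat[OF car(4) one_carrier_mat Jm_car]
      by (simp_all add: right_mult_one_mat[OF Jm_car] left_mult_one_mat[OF Jm_car])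
    then show ?thesis unfolding comm_mat_def
      by (intro eq_matI) (use carrier_matD[OF Jm_car] in \<open>auto simp del: index_mult_mat(1)\<close>)
  qed
  then show ?thesis
    unfolding Dk_def using E Q0_mem Jm_mem
    by (auto intro: K.smats_K_diff K.smats_K_mult_left K.smats_K_mult_right)
qed

lemma Dk_U0: "comm_mat Jm U0 \<in> smats K n"
proof -
  have "comm_mat Jm U0 = comm_mat Jm (V0 * Q0)"
  proof -
    have c: "V0 * Q0 \<in> carrier_mat n n" by (rule mult_carrier_mat[OF car(6) car(4)])
    have "Jm * U0 = Jm * (V0 * Q0) - Jm" "U0 * Jm = V0 * Q0 * Jm - Jm"
      unfolding U0_def using mult_minus_distrib_mat[OF Jm_car c one_carrier_mat]
        minus_mult_distrib_mat[OF c one_carrier_mat Jm_car]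
      by (simp_all only: right_mult_one_mat[OF Jm_car] left_mult_one_mat[OF Jm_car])
    then show ?thesis unfolding comm_mat_def
      by (intro eq_matI) (use carrier_matD[OF Jm_car] in \<open>auto simp del: index_mult_mat(1)\<close>)
  qed
  then show ?thesis using Dk_mult[OF Dk_V0 Dk_Q0] by (simp add: Dk_def)
qed

lemma Dk_S0: "Dk S0"
  unfolding Dk_def
proof (intro conjI S0_mem smatsI)
  fix a b assume ab: "a < n" "b < n"
  have f: "mconst (fps_nth (fps_binomial (1 / 2)) i) \<in> R" for i
    unfolding fps_binomial_nth by (intro mconst_over[OF subr_S] sqrt_binomial_mem[OF subr_S half])
  have pm: "(U0 ^\<^sub>m j) $$ (k, l) \<in> R" if "k < n" "l < n" for j k l
    using R.smats_pow[OF U0_mem] that by (intro smats_entry)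
  show "comm_mat Jm S0 $$ (a, b) \<in> K"
    unfolding S0_def comm_mat_mseries[OF Jm_car car(7) U0_ord ab]
    by (intro K.K_sum K.K_mult_right smats_entry[OF Dk_U0] lsum_over[OF subr_S] R.mult_mem f R.sum_mem pm)
      (use ab in auto)
qed (use comm_mat_carrier[OF Jm_car car(8)] in simp)

lemma Dk_F: "Dk F"
  unfolding F_def by (rule Dk_mult[OF Dk_Xp Dk_S0])

lemma psi_K_orth: "map_mat psi (transpose_mat xm * xm - 1\<^sub>m n) \<in> smats K n"
  using psi_J[OF ideal] K_orth right_mult_one_mat[of "transpose_mat xm" n n] unfolding cq1 by simp

text \<open>The relations between the blocks of F are read off its commutator: the upper right block
  is d - a, and the upper left one, used in \<open>psi_K_bc\<close>, is b + c.\<close>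

lemma psi_K_ad:
  assumes "i < r" "j < r"
  shows "psi (xm $$ (i, j) - xm $$ (i + r, j + r)) \<in> K"
proof -
  have m: "i < n" "j < n" "i + r < n" "j + r < n" using assms n2 by auto
  have "comm_mat Jm F $$ (i, j + r) \<in> K" using Dk_F m unfolding Dk_def by (intro smats_entry) auto
  then have "F $$ (i + r, j + r) - F $$ (i, j) \<in> K"
    using assms unfolding comm_Jm_entry[OF car(9) m(1) m(4)] by (simp add: sg_def sw_def)
  then have "F $$ (i, j) - F $$ (i + r, j + r) \<in> K" using K.K_uminus by fastforce
  moreover have "psi (xm $$ (k, l)) = F $$ (k, l)" if "k < n" "l < n" for k l
    using arg_cong[OF psi_xm, of "\<lambda>Y. Y $$ (k, l)"] that by simp
  ultimately show ?thesis using m xm_mem by (simp add: psih.hom_diff)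
qed

lemma psi_K_bc:
  assumes "i < r" "j < r"
  shows "psi (xm $$ (i, j + r) + xm $$ (i + r, j)) \<in> K"
proof -
  have m: "i < n" "j < n" "i + r < n" "j + r < n" using assms n2 by auto
  have "comm_mat Jm F $$ (i, j) \<in> K" using Dk_F m unfolding Dk_def by (intro smats_entry) auto
  then have "F $$ (i + r, j) + F $$ (i, j + r) \<in> K"
    using assms unfolding comm_Jm_entry[OF car(9) m(1) m(2)] by (simp add: sg_def sw_def)
  moreover have "psi (xm $$ (k, l)) = F $$ (k, l)" if "k < n" "l < n" for k l
    using arg_cong[OF psi_xm, of "\<lambda>Y. Y $$ (k, l)"] that by simp
  ultimately show ?thesis using m xm_mem by (simp add: psih.hom_add add.commute)
qed

end

end

section \<open>Rings of coherent sequences\<close>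

text \<open>A choice of representatives in W for an element of the inverse limit of the quotients W
  / N k.\<close>

definition coherent :: "'a::comm_ring_1 set \<Rightarrow> (nat \<Rightarrow> 'a set) \<Rightarrow> (nat \<Rightarrow> 'a) \<Rightarrow> bool" where
  "coherent W N g \<longleftrightarrow> (\<forall>k. g k \<in> W \<and> g (Suc k) - g k \<in> N k)"

text \<open>One interface for the three limits that occur: the completion of A, the completion of
  the coordinate ring, and power series over the completed A. L sends a coherent sequence to its
  element and is injective up to componentwise congruence.\<close>

locale limring = subr W for W :: "'a :: comm_ring_1 set" +
  fixes N :: "nat \<Rightarrow> 'a set" and Q :: "'b ring" and L :: "(nat \<Rightarrow> 'a) \<Rightarrow> 'b"
  assumes N_ideal: "subr_ideal W (N k)" and N_dec: "N (Suc k) \<subseteq> N k"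
    and carrier_Q: "carrier Q = L ` Collect (coherent W N)"
    and L_eq_iff: "coherent W N g \<Longrightarrow> coherent W N g' \<Longrightarrow> L g = L g' \<longleftrightarrow> (\<forall>k. g k - g' k \<in> N k)"
    and L_mult: "coherent W N g \<Longrightarrow> coherent W N g' \<Longrightarrow> L g \<otimes>\<^bsub>Q\<^esub> L g' = L (\<lambda>k. g k * g' k)"
    and L_add: "coherent W N g \<Longrightarrow> coherent W N g' \<Longrightarrow> L g \<oplus>\<^bsub>Q\<^esub> L g' = L (\<lambda>k. g k + g' k)"
    and L_one: "\<one>\<^bsub>Q\<^esub> = L (\<lambda>_. 1)" and L_zero: "\<zero>\<^bsub>Q\<^esub> = L (\<lambda>_. 0)"
begin

abbreviation "coh \<equiv> coherent W N"

sublocale N: subr_ideal W "N k" for k by (rule N_ideal)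

lemma N_mono: "i \<le> j \<Longrightarrow> N j \<subseteq> N i"
  using N_dec by (rule lift_Suc_antimono_le)

lemma cohD: "coh g \<Longrightarrow> g k \<in> W" "coh g \<Longrightarrow> g (Suc k) - g k \<in> N k"
  by (auto simp: coherent_def)

lemma coh_diff_le:
  assumes "coh g" "i \<le> j"
  shows "g j - g i \<in> N i"
  using assms(2)
proof (induction j rule: dec_induct)
  case base
  then show ?case by (simp add: N.K_zero)
next
  case (step j)
  have "g (Suc j) - g j \<in> N i" using cohD(2)[OF assms(1), of j] N_mono step by blast
  from N.K_add[OF this step.IH] show ?case by simp
qed

lemma coh_const: "w \<in> W \<Longrightarrow> coh (\<lambda>_. w)"
  by (simp add: coherent_def N.K_zero)

lemma coh_add:
  assumes "coh g" "coh g'"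
  shows "coh (\<lambda>k. g k + g' k)"
  unfolding coherent_def
proof (intro allI conjI)
  fix k
  show "g k + g' k \<in> W" using assms cohD(1) by blast
  have "g (Suc k) + g' (Suc k) - (g k + g' k) = (g (Suc k) - g k) + (g' (Suc k) - g' k)" by simp
  then show "g (Suc k) + g' (Suc k) - (g k + g' k) \<in> N k"
    using assms by (simp only:) (intro N.K_add cohD)
qed

lemma coh_mult:
  assumes "coh g" "coh g'"
  shows "coh (\<lambda>k. g k * g' k)"
  unfolding coherent_def
proof (intro allI conjI)
  fix k
  show "g k * g' k \<in> W" using assms cohD(1) by blast
  have "g (Suc k) * g' (Suc k) - g k * g' k = g (Suc k) * (g' (Suc k) - g' k) + (g (Suc k) - g k) * g' k"
    by (simp add: algebra_simps)
  then show "g (Suc k) * g' (Suc k) - g k * g' k \<in> N k"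
    using assms by (simp only:) (intro N.K_add N.K_mult N.K_mult_right cohD)
qed

lemma coh_uminus:
  assumes "coh g"
  shows "coh (\<lambda>k. - g k)"
  using coh_mult[OF coh_const[of "- 1"] assms] by simp

lemma L_closed: "coh g \<Longrightarrow> L g \<in> carrier Q"
  by (auto simp: carrier_Q)

lemma carrierE: "f \<in> carrier Q \<Longrightarrow> \<exists>g. coh g \<and> f = L g"
  by (auto simp: carrier_Q)

lemma cring_Q: "cring Q"
proof (rule cringI)
  show "abelian_group Q"
  proof (rule abelian_groupI)
    fix x y z assume "x \<in> carrier Q" "y \<in> carrier Q" "z \<in> carrier Q"
    then obtain f g h where fgh: "coh f" "coh g" "coh h" "x = L f" "y = L g" "z = L h"
      by (auto simp: carrier_Q)
    show "x \<oplus>\<^bsub>Q\<^esub> y \<in> carrier Q" using fgh by (simp add: L_add L_closed coh_add)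
    show "x \<oplus>\<^bsub>Q\<^esub> y \<oplus>\<^bsub>Q\<^esub> z = x \<oplus>\<^bsub>Q\<^esub> (y \<oplus>\<^bsub>Q\<^esub> z)"
      using fgh by (simp add: L_add coh_add add.assoc)
    show "x \<oplus>\<^bsub>Q\<^esub> y = y \<oplus>\<^bsub>Q\<^esub> x" using fgh by (simp add: L_add add.commute)
    show "\<zero>\<^bsub>Q\<^esub> \<oplus>\<^bsub>Q\<^esub> x = x" using fgh by (simp add: L_zero L_add coh_const)
    show "\<exists>y\<in>carrier Q. y \<oplus>\<^bsub>Q\<^esub> x = \<zero>\<^bsub>Q\<^esub>"
      using fgh by (intro bexI[of _ "L (\<lambda>k. - f k)"]) (simp_all add: L_add L_zero coh_uminus L_closed)
  qed (simp add: L_zero L_closed coh_const)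
  show "Group.comm_monoid Q"
  proof (rule comm_monoidI)
    fix x y z assume "x \<in> carrier Q" "y \<in> carrier Q" "z \<in> carrier Q"
    then obtain f g h where fgh: "coh f" "coh g" "coh h" "x = L f" "y = L g" "z = L h"
      by (auto simp: carrier_Q)
    show "x \<otimes>\<^bsub>Q\<^esub> y \<in> carrier Q" using fgh by (simp add: L_mult L_closed coh_mult)
    show "x \<otimes>\<^bsub>Q\<^esub> y \<otimes>\<^bsub>Q\<^esub> z = x \<otimes>\<^bsub>Q\<^esub> (y \<otimes>\<^bsub>Q\<^esub> z)"
      using fgh by (simp add: L_mult coh_mult mult.assoc)
    show "x \<otimes>\<^bsub>Q\<^esub> y = y \<otimes>\<^bsub>Q\<^esub> x" using fgh by (simp add: L_mult mult.commute)
    show "\<one>\<^bsub>Q\<^esub> \<otimes>\<^bsub>Q\<^esub> x = x" using fgh by (simp add: L_one L_mult coh_const)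
  qed (simp add: L_one L_closed coh_const)
  fix x y z assume "x \<in> carrier Q" "y \<in> carrier Q" "z \<in> carrier Q"
  then obtain f g h where fgh: "coh f" "coh g" "coh h" "x = L f" "y = L g" "z = L h"
    by (auto simp: carrier_Q)
  then show "(x \<oplus>\<^bsub>Q\<^esub> y) \<otimes>\<^bsub>Q\<^esub> z = x \<otimes>\<^bsub>Q\<^esub> z \<oplus>\<^bsub>Q\<^esub> y \<otimes>\<^bsub>Q\<^esub> z"
    by (simp add: L_mult L_add coh_add coh_mult distrib_right)
qed

sublocale Q: cring Q by (rule cring_Q)

lemma L_uminus: "coh g \<Longrightarrow> \<ominus>\<^bsub>Q\<^esub> L g = L (\<lambda>k. - g k)"
  using Q.sum_zero_eq_neg[of "L (\<lambda>k. - g k)" "L g"]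
  by (simp add: L_closed coh_uminus L_add L_zero)

lemma L_minus: "coh g \<Longrightarrow> coh g' \<Longrightarrow> L g \<ominus>\<^bsub>Q\<^esub> L g' = L (\<lambda>k. g k - g' k)"
  by (simp add: a_minus_def L_uminus L_add coh_uminus)

lemma L_finsum:
  assumes "finite J" "\<And>i. i \<in> J \<Longrightarrow> coh (g i)"
  shows "finsum Q (\<lambda>i. L (g i)) J = L (\<lambda>k. \<Sum>i\<in>J. g i k) \<and> coh (\<lambda>k. \<Sum>i\<in>J. g i k)"
  using assms
proof (induction J rule: finite_induct)
  case (insert i J)
  then have "finsum Q (\<lambda>i. L (g i)) (insert i J) = L (g i) \<oplus>\<^bsub>Q\<^esub> finsum Q (\<lambda>i. L (g i)) J"
    by (intro Q.finsum_insert) (auto intro: L_closed)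
  with insert show ?case by (simp add: L_add coh_add)
qed (simp add: L_zero coh_const)

lemma L_of_nat: "[m] \<cdot>\<^bsub>Q\<^esub> \<one>\<^bsub>Q\<^esub> = L (\<lambda>_. of_nat m)"
proof (induction m)
  case (Suc m)
  then show ?case by (simp add: Q.add.nat_pow_Suc L_one L_add coh_const add.commute)
qed (simp add: L_zero)

text \<open>w stands for f modulo N k. Elements with a common representative at every level are
  equal (\<open>rel_eqI\<close>), so identities in Q are proved by computing in W.\<close>

definition rel :: "nat \<Rightarrow> 'b \<Rightarrow> 'a \<Rightarrow> bool" where
  "rel k f w \<longleftrightarrow> w \<in> W \<and> (\<exists>g. coh g \<and> f = L g \<and> g k - w \<in> N k)"

lemma relI: "coh g \<Longrightarrow> rel k (L g) (g k)"
  unfolding rel_def by (metis cohD(1) N.K_zero diff_self)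

lemma rel_const: "w \<in> W \<Longrightarrow> rel k (L (\<lambda>_. w)) w"
  using relI[OF coh_const] by simp

lemma rel_exists: "f \<in> carrier Q \<Longrightarrow> \<exists>w. rel k f w"
  using carrierE relI by blast

lemma rel_closed: "rel k f w \<Longrightarrow> f \<in> carrier Q" "rel k f w \<Longrightarrow> w \<in> W"
  by (auto simp: rel_def L_closed)

lemma rel_unique:
  assumes "rel k f w" "rel k f w'"
  shows "w - w' \<in> N k"
proof -
  obtain g where g: "coh g" "f = L g" "g k - w \<in> N k" using assms(1) by (auto simp: rel_def)
  obtain g' where g': "coh g'" "f = L g'" "g' k - w' \<in> N k" using assms(2) by (auto simp: rel_def)
  have "g k - g' k \<in> N k" using L_eq_iff[OF g(1) g'(1)] g g' by simp
  then have "(g k - g' k) - (g k - w) + (g' k - w') \<in> N k"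
    by (rule N.K_add[OF N.K_diff[OF _ g(3)] g'(3)])
  then show ?thesis by simp
qed

lemma rel_shift:
  assumes "rel k f w" "w' \<in> W" "w - w' \<in> N k"
  shows "rel k f w'"
proof -
  obtain g where g: "coh g" "f = L g" "g k - w \<in> N k" using assms(1) by (auto simp: rel_def)
  have "g k - w' = (g k - w) + (w - w')" by simp
  then have "g k - w' \<in> N k" using g assms by (simp only:) (intro N.K_add)
  then show ?thesis using g assms(2) by (auto simp: rel_def)
qed

lemma rel_eqI:
  assumes "\<And>k. \<exists>w. rel k f w \<and> rel k f' w" 
  shows "f = f'"
proof -
  obtain g g' where g: "coh g" "f = L g" and g': "coh g'" "f' = L g'"
    using assms[of 0] carrierE rel_closed(1) by meson
  have "g k - g' k \<in> N k" for k
  proof -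
    obtain w where w: "rel k f w" "rel k f' w" using assms by blast
    have "g k - w \<in> N k" "g' k - w \<in> N k"
      using rel_unique[OF relI[OF g(1)]] rel_unique[OF relI[OF g'(1)]] w g g' by auto
    from N.K_diff[OF this] show ?thesis by simp
  qed
  then show ?thesis using L_eq_iff[OF g(1) g'(1)] g g' by simp
qed

lemma rel_ops:
  assumes "rel k f w" "rel k f' w'"
  shows rel_add: "rel k (f \<oplus>\<^bsub>Q\<^esub> f') (w + w')"
    and rel_mult: "rel k (f \<otimes>\<^bsub>Q\<^esub> f') (w * w')"
    and rel_minus: "rel k (f \<ominus>\<^bsub>Q\<^esub> f') (w - w')"
proof -
  obtain g where g: "coh g" "f = L g" "g k - w \<in> N k" and w: "w \<in> W" using assms(1) by (auto simp: rel_def)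
  obtain g' where g': "coh g'" "f' = L g'" "g' k - w' \<in> N k" and w': "w' \<in> W"
    using assms(2) by (auto simp: rel_def)
  have gk: "g k \<in> W" "g' k \<in> W" using g(1) g'(1) cohD(1) by auto
  have "g k + g' k - (w + w') = (g k - w) + (g' k - w')" by simp
  then have "g k + g' k - (w + w') \<in> N k" using g g' by (simp only:) (intro N.K_add)
  then show "rel k (f \<oplus>\<^bsub>Q\<^esub> f') (w + w')"
    using rel_shift[OF relI[OF coh_add[OF g(1) g'(1)]]] w w' by (simp add: g g' L_add)
  have "g k - g' k - (w - w') \<in> N k" using N.K_diff[OF g(3) g'(3)] by (simp add: algebra_simps)
  then show "rel k (f \<ominus>\<^bsub>Q\<^esub> f') (w - w')"
    using rel_shift[OF relI[OF coh_add[OF g(1) coh_uminus[OF g'(1)]]]] w w' by (simp add: g g' L_minus)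
  have "g k * g' k - w * w' = g k * (g' k - w') + (g k - w) * w'" by (simp add: algebra_simps)
  then have "g k * g' k - w * w' \<in> N k"
    using g g' w' gk by (simp only:) (intro N.K_add N.K_mult N.K_mult_right)
  then show "rel k (f \<otimes>\<^bsub>Q\<^esub> f') (w * w')"
    using rel_shift[OF relI[OF coh_mult[OF g(1) g'(1)]]] w w' by (simp add: g g' L_mult)
qed

lemma rel_one: "rel k \<one>\<^bsub>Q\<^esub> 1" and rel_zero: "rel k \<zero>\<^bsub>Q\<^esub> 0"
  unfolding L_one L_zero by (rule rel_const, simp)+

lemma rel_finsum:
  assumes "finite J" "\<And>i. i \<in> J \<Longrightarrow> rel k (f i) (w i)"
  shows "rel k (finsum Q f J) (sum w J)"
  using assms
proof (induction J rule: finite_induct)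
  case (insert i J)
  have c: "f \<in> J \<rightarrow> carrier Q" using insert rel_closed(1) by auto
  have i: "rel k (f i) (w i)" using insert by blast
  have "finsum Q f (insert i J) = f i \<oplus>\<^bsub>Q\<^esub> finsum Q f J"
    using insert c rel_closed(1)[OF i] by (intro Q.finsum_insert) auto
  moreover have "rel k (f i \<oplus>\<^bsub>Q\<^esub> finsum Q f J) (w i + sum w J)"
    using insert by (intro rel_add i) blast
  ultimately show ?case using insert by simp
qed (simp add: rel_zero)

end

text \<open>\<open>SOME\<close> picks a representing sequence, and \<open>lift_L\<close> shows that
  the choice does not matter. The restriction to the carrier matches the \<open>extensional\<close>
  conditions in \<open>identity_expansion\<close> and \<open>induced_endo\<close>.\<close>

definition lim_lift :: "'a::comm_ring_1 set \<Rightarrow> (nat \<Rightarrow> 'a set) \<Rightarrow> 'b ring \<Rightarrow> ((nat \<Rightarrow> 'a) \<Rightarrow> 'b) \<Rightarrow>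
    ((nat \<Rightarrow> 'c) \<Rightarrow> 'd) \<Rightarrow> ('a \<Rightarrow> 'c) \<Rightarrow> 'b \<Rightarrow> 'd" where
  "lim_lift W N Q L L' h = restrict (\<lambda>f. L' (\<lambda>k. h ((SOME g. coherent W N g \<and> f = L g) k))) (carrier Q)"

locale limring_map = dom: limring W N Q L + cod: limring W' N' Q' L'
  for W :: "'a :: comm_ring_1 set" and N and Q :: "'b ring" and L
    and W' :: "'c :: comm_ring_1 set" and N' and Q' :: "'d ring" and L' +
  fixes h :: "'a \<Rightarrow> 'c"
  assumes h_hom: "subr_hom W h" and h_closed: "w \<in> W \<Longrightarrow> h w \<in> W'"
    and h_N: "w \<in> N k \<Longrightarrow> h w \<in> N' k"
begin

interpretation h: subr_hom W h by (rule h_hom)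

abbreviation "lift \<equiv> lim_lift W N Q L L' h"

lemma coh_h:
  assumes "dom.coh g"
  shows "cod.coh (\<lambda>k. h (g k))"
  unfolding coherent_def
proof (intro allI conjI)
  fix k
  show "h (g k) \<in> W'" using assms by (intro h_closed dom.cohD)
  show "h (g (Suc k)) - h (g k) \<in> N' k"
    using h_N[OF dom.cohD(2)[OF assms]] dom.cohD(1)[OF assms] by (simp add: h.hom_diff)
qed

lemma lift_L:
  assumes "dom.coh g"
  shows "lift (L g) = L' (\<lambda>k. h (g k))"
proof -
  define g' where "g' = (SOME g'. dom.coh g' \<and> L g = L g')"
  have g': "dom.coh g' \<and> L g = L g'" unfolding g'_def by (rule someI[of _ g]) (simp add: assms)
  have "h (g' k) - h (g k) \<in> N' k" for k
  proof -
    have "g' k - g k \<in> N k" using dom.L_eq_iff[of g' g] g' assms by simp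
    then show ?thesis
      using h_N[of "g' k - g k" k] g' assms dom.cohD(1) by (simp add: h.hom_diff)
  qed
  then have "L' (\<lambda>k. h (g' k)) = L' (\<lambda>k. h (g k))"
    using cod.L_eq_iff[OF coh_h coh_h] g' assms by simp
  then show ?thesis using dom.L_closed[OF assms] by (simp add: lim_lift_def g'_def)
qed

lemma lift_hom: "lift \<in> Ring.ring_hom Q Q'"
proof (rule ring_hom_memI)
  fix x y assume "x \<in> carrier Q" "y \<in> carrier Q"
  then obtain f g where fg: "dom.coh f" "dom.coh g" "x = L f" "y = L g" by (auto simp: dom.carrier_Q)
  have c: "f k \<in> W" "g k \<in> W" for k using fg dom.cohD(1) by auto
  show "lift x \<in> carrier Q'" using fg by (simp add: lift_L cod.L_closed coh_h)
  show "lift (x \<otimes>\<^bsub>Q\<^esub> y) = lift x \<otimes>\<^bsub>Q'\<^esub> lift y"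
    using fg by (simp add: dom.L_mult lift_L dom.coh_mult cod.L_mult coh_h h.hom_mult c)
  show "lift (x \<oplus>\<^bsub>Q\<^esub> y) = lift x \<oplus>\<^bsub>Q'\<^esub> lift y"
    using fg by (simp add: dom.L_add lift_L dom.coh_add cod.L_add coh_h h.hom_add c)
next
  show "lift \<one>\<^bsub>Q\<^esub> = \<one>\<^bsub>Q'\<^esub>"
    by (simp add: dom.L_one cod.L_one lift_L dom.coh_const h.hom_one)
qed

lemma lift_extensional: "lift \<in> extensional (carrier Q)"
  by (simp add: lim_lift_def)

lemma rel_lift:
  assumes "dom.rel k f w"
  shows "cod.rel k (lift f) (h w)"
proof -
  obtain g where g: "dom.coh g" "f = L g" "g k - w \<in> N k" and w: "w \<in> W"
    using assms by (auto simp: dom.rel_def)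
  have "h (g k) - h w \<in> N' k"
    using h_N[OF g(3)] dom.cohD(1)[OF g(1), of k] w by (simp add: h.hom_diff)
  then show ?thesis
    using cod.rel_shift[OF cod.relI[OF coh_h[OF g(1)]] h_closed[OF w]] by (simp add: g lift_L)
qed

end

subsection \<open>The $p$-adic case\<close>

text \<open>N k is the preimage in W of the multiples of p^k in the presented ring W / K. K is zero
  for A and for power series, and is generated by the relation y det(x) = 1 for the coordinate
  ring.\<close>

locale padic_limring = limring W N Q L for W :: "'a :: comm_ring_1 set" and N and Q :: "'b ring" and L +
  fixes p :: nat and K :: "'a set"
  assumes N_def: "N k = {h * of_nat p ^ k + y | h y. h \<in> W \<and> y \<in> K}"
    and K_ideal: "subr_ideal W K"
begin

sublocale K: subr_ideal W K by (rule K_ideal)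

lemma pow_ideal_iff: "f \<in> pow_ideal Q p k \<longleftrightarrow> (\<exists>u\<in>carrier Q. f = u \<otimes>\<^bsub>Q\<^esub> L (\<lambda>_. of_nat (p ^ k)))"
  unfolding pow_ideal_def cgenideal_def L_of_nat by auto

lemma NI: "h \<in> W \<Longrightarrow> y \<in> K \<Longrightarrow> h * of_nat p ^ k + y \<in> N k"
  by (auto simp: N_def)

lemma pow_mem_N: "h \<in> W \<Longrightarrow> h * of_nat p ^ k \<in> N k"
  using NI[OF _ K.K_zero] by simp

lemma K_sub_N: "K \<subseteq> N k"
  using NI[OF zero_mem] by auto

lemma rel_pow_ideal:
  assumes "f \<in> pow_ideal Q p k"
  shows "rel k f 0"
proof -
  obtain u where u: "u \<in> carrier Q" "f = u \<otimes>\<^bsub>Q\<^esub> L (\<lambda>_. of_nat (p ^ k))"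
    using assms pow_ideal_iff by blast
  obtain w where w: "rel k u w" using rel_exists[OF u(1)] by blast
  have "rel k f (w * of_nat (p ^ k))"
    unfolding u(2) by (rule rel_mult[OF w rel_const]) simp
  then show ?thesis
    by (rule rel_shift) (use pow_mem_N[OF rel_closed(2)[OF w], of k] in simp_all)
qed

lemma increments:
  assumes "coh g"
  obtains e y where "\<And>j. e j \<in> W" "\<And>j. y j \<in> K" "\<And>j. g (Suc j) - g j = e j * of_nat p ^ j + y j"
proof -
  have "\<forall>j. \<exists>ey. fst ey \<in> W \<and> snd ey \<in> K \<and> g (Suc j) - g j = fst ey * of_nat p ^ j + snd ey"
  proof
    fix j
    obtain h y where "h \<in> W" "y \<in> K" "g (Suc j) - g j = h * of_nat p ^ j + y"
      using cohD(2)[OF assms, of j] unfolding N_def by blast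
    then show "\<exists>ey. fst ey \<in> W \<and> snd ey \<in> K \<and> g (Suc j) - g j = fst ey * of_nat p ^ j + snd ey"
      by (intro exI[of _ "(h, y)"]) simp
  qed
  from choice[OF this] obtain ey where
    ey: "\<forall>j. fst (ey j) \<in> W \<and> snd (ey j) \<in> K \<and> g (Suc j) - g j = fst (ey j) * of_nat p ^ j + snd (ey j)" ..
  show ?thesis by (rule that[of "\<lambda>j. fst (ey j)" "\<lambda>j. snd (ey j)"]) (use ey in blast)+
qed

lemma coh_series:
  assumes "\<And>j. e j \<in> W" "c \<in> W"
  shows "coh (\<lambda>k. c + (\<Sum>j<k. e j * of_nat p ^ j))"
  unfolding coherent_def using assms by (auto intro!: sum_mem add_mem mult_mem pow_mem_N)

text \<open>An element whose component at level \<open>k\<close> vanishes is divisible by $p^k$: the quotient is built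
  from the increments of a coherent sequence.\<close>
lemma pow_ideal_rel:
  assumes "rel k f 0"
  shows "f \<in> pow_ideal Q p k"
proof -
  obtain g where g: "coh g" "f = L g" "g k \<in> N k" using assms by (auto simp: rel_def)
  obtain c y0 where c: "c \<in> W" "y0 \<in> K" "g k = c * of_nat p ^ k + y0" using g(3) unfolding N_def by blast
  obtain e y where e: "\<And>j. e j \<in> W" "\<And>j. y j \<in> K" "\<And>j. g (Suc j) - g j = e j * of_nat p ^ j + y j"
    using increments[OF g(1)] by blast
  \<comment> \<open>The increments of g beyond level k are divided by p^k: as p^(k+i) = p^k p^i, the
    quotients form a coherent sequence again.\<close>
  define C where "C j = c + (\<Sum>i<j. e (k + i) * of_nat p ^ i)" for j
  have C: "coh C" unfolding C_def by (rule coh_series) (auto simp: e c)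
  have dK: "g (k + j) - C j * of_nat p ^ k \<in> K" for j
  proof (induction j)
    case 0
    then show ?case by (simp add: C_def c)
  next
    case (Suc j)
    have "g (k + Suc j) = g (k + j) + (e (k + j) * of_nat p ^ (k + j) + y (k + j))"
      using e(3)[of "k + j"] by (simp add: algebra_simps)
    moreover have "C (Suc j) = C j + e (k + j) * of_nat p ^ j" by (simp add: C_def)
    ultimately have "g (k + Suc j) - C (Suc j) * of_nat p ^ k = (g (k + j) - C j * of_nat p ^ k) + y (k + j)"
      by (simp add: algebra_simps power_add)
    then show ?case using Suc e(2) by (simp only:) (intro K.K_add)
  qed
  \<comment> \<open>The components match after a shift by k; \<open>coh_diff_le\<close> brings
    \<open>g (k + j)\<close> back to \<open>g j\<close> at level j.\<close>
  have "g j - C j * of_nat (p ^ k) \<in> N j" for j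
  proof -
    have "g (k + j) - g j \<in> N j" by (rule coh_diff_le[OF g(1)]) simp
    moreover have "g (k + j) - C j * of_nat p ^ k \<in> N j" using dK K_sub_N by blast
    ultimately have "(g (k + j) - C j * of_nat p ^ k) - (g (k + j) - g j) \<in> N j" by (intro N.K_diff[of _ j "_ - _"])
    then show ?thesis by simp
  qed
  then have "L g = L (\<lambda>j. C j * of_nat (p ^ k))"
    using L_eq_iff[OF g(1) coh_mult[OF C coh_const[OF of_nat_mem[of "p ^ k"]]]] by simp
  also have "\<dots> = L C \<otimes>\<^bsub>Q\<^esub> L (\<lambda>_. of_nat (p ^ k))"
    by (rule L_mult[OF C coh_const[OF of_nat_mem], symmetric])
  finally show ?thesis using g(2) L_closed[OF C] pow_ideal_iff by auto
qed

text \<open>Continuity of homomorphisms is automatic, because they respect divisibility by $p^k$.\<close>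
lemma hom_eqI:
  assumes cod: "padic_limring W' N' Q' L' p K'"
    and h: "h \<in> Ring.ring_hom Q Q'" "h' \<in> Ring.ring_hom Q Q'"
    and eq: "\<And>w. w \<in> W \<Longrightarrow> h (L (\<lambda>_. w)) = h' (L (\<lambda>_. w))"
    and f: "f \<in> carrier Q"
  shows "h f = h' f"
proof -
  interpret c: padic_limring W' N' Q' L' p K' by fact
  have hom_pow: "c.rel k (g u) 0" if g: "g \<in> Ring.ring_hom Q Q'" and u: "u \<in> pow_ideal Q p k" for g u k
  proof -
    obtain v where v: "v \<in> carrier Q" "u = v \<otimes>\<^bsub>Q\<^esub> L (\<lambda>_. of_nat (p ^ k))"
      using u pow_ideal_iff by blast
    have nat: "g (L (\<lambda>_. of_nat m)) = L' (\<lambda>_. of_nat m)" for m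
    proof (induction m)
      case 0
      interpret rh: ring_hom_ring Q Q' g
        by (intro ring_hom_ringI2 Q.ring_axioms c.Q.ring_axioms g)
      show ?case using rh.hom_zero by (simp add: L_zero c.L_zero)
    next
      case (Suc m)
      have "L (\<lambda>_. of_nat (Suc m)) = \<one>\<^bsub>Q\<^esub> \<oplus>\<^bsub>Q\<^esub> L (\<lambda>_. of_nat m)"
        by (simp add: L_one L_add coh_const)
      then show ?case
        using Suc ring_hom_add[OF g] ring_hom_one[OF g] by (simp add: c.L_one c.L_add c.coh_const L_closed coh_const)
    qed
    have "g u = g v \<otimes>\<^bsub>Q'\<^esub> L' (\<lambda>_. of_nat (p ^ k))"
      unfolding v(2) nat[of "p ^ k", symmetric] using v(1) by (intro ring_hom_mult[OF g] L_closed coh_const) simp_all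
    then show ?thesis
      using c.rel_pow_ideal c.pow_ideal_iff ring_hom_closed[OF g v(1)] by blast
  qed
  show ?thesis
  proof (rule c.rel_eqI)
    fix k
    \<comment> \<open>f splits into a constant sequence, on which the two maps agree by assumption,
      and a multiple of p^k, whose image under either map is zero at level k.\<close>
    obtain w where w: "rel k f w" using rel_exists[OF f] by blast
    have W: "w \<in> W" "L (\<lambda>_. w) \<in> carrier Q" using rel_closed(2)[OF w] by (auto intro: L_closed coh_const)
    have "rel k (f \<ominus>\<^bsub>Q\<^esub> L (\<lambda>_. w)) (w - w)" by (intro rel_minus w rel_const W)
    then have pi: "f \<ominus>\<^bsub>Q\<^esub> L (\<lambda>_. w) \<in> pow_ideal Q p k" by (intro pow_ideal_rel) simp
    have fe: "f = L (\<lambda>_. w) \<oplus>\<^bsub>Q\<^esub> (f \<ominus>\<^bsub>Q\<^esub> L (\<lambda>_. w))"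
      using f W(2) by (simp add: a_minus_def Q.a_lcomm Q.r_neg)
    have img: "g f = g (L (\<lambda>_. w)) \<oplus>\<^bsub>Q'\<^esub> g (f \<ominus>\<^bsub>Q\<^esub> L (\<lambda>_. w))" if "g \<in> Ring.ring_hom Q Q'" for g
      using fe ring_hom_add[OF that W(2) Q.minus_closed[OF f W(2)]] by simp
    obtain w' where w': "c.rel k (h (L (\<lambda>_. w))) w'"
      using c.rel_exists[OF ring_hom_closed[OF h(1) W(2)]] by blast
    have "c.rel k (h f) (w' + 0)" unfolding img[OF h(1)] by (intro c.rel_add w' hom_pow[OF h(1) pi])
    moreover have "c.rel k (h' f) (w' + 0)"
      unfolding img[OF h(2)] eq[OF W(1), symmetric] by (intro c.rel_add w' hom_pow[OF h(2) pi])
    ultimately show "\<exists>w. c.rel k (h f) w \<and> c.rel k (h' f) w" by blast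
  qed
qed

end

section \<open>Completions of presented rings\<close>

text \<open>R is the quotient W / K, with W inside a type-class ring. The prime p enters through
  \<open>NN\<close> and \<open>LL\<close>, which describe the completion of R by sequences in
  W.\<close>

locale presentation = subr W for W :: "'a :: comm_ring_1 set" +
  fixes R :: "'b ring" and \<pi> :: "'a \<Rightarrow> 'b" and K :: "'a set" and p :: nat
  assumes cring_R: "cring R" and carrier_R: "carrier R = \<pi> ` W"
    and pi_one: "\<pi> 1 = \<one>\<^bsub>R\<^esub>"
    and pi_add: "x \<in> W \<Longrightarrow> y \<in> W \<Longrightarrow> \<pi> (x + y) = \<pi> x \<oplus>\<^bsub>R\<^esub> \<pi> y"
    and pi_mult: "x \<in> W \<Longrightarrow> y \<in> W \<Longrightarrow> \<pi> (x * y) = \<pi> x \<otimes>\<^bsub>R\<^esub> \<pi> y"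
    and K_eq: "K = {w \<in> W. \<pi> w = \<zero>\<^bsub>R\<^esub>}"
begin

sublocale R: cring R by (rule cring_R)

definition NN :: "nat \<Rightarrow> 'a set" where
  "NN k = {h * of_nat p ^ k + y | h y. h \<in> W \<and> y \<in> K}"

definition LL :: "(nat \<Rightarrow> 'a) \<Rightarrow> nat \<Rightarrow> 'b set" where
  "LL g = (\<lambda>k. pow_ideal R p k +>\<^bsub>R\<^esub> \<pi> (g k))"

lemma pi_closed: "w \<in> W \<Longrightarrow> \<pi> w \<in> carrier R"
  by (simp add: carrier_R)

lemma pi_zero: "\<pi> 0 = \<zero>\<^bsub>R\<^esub>"
proof -
  have "\<pi> 0 \<oplus>\<^bsub>R\<^esub> \<pi> 0 = \<pi> 0 \<oplus>\<^bsub>R\<^esub> \<zero>\<^bsub>R\<^esub>"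
    using pi_add[of 0 0] pi_closed[of 0] by simp
  then show ?thesis using pi_closed[of 0] by (subst (asm) R.add.l_cancel) auto
qed

lemma pi_uminus: "w \<in> W \<Longrightarrow> \<pi> (- w) = \<ominus>\<^bsub>R\<^esub> \<pi> w"
  using pi_add[of "- w" w] R.sum_zero_eq_neg[of "\<pi> (- w)" "\<pi> w"] by (simp add: pi_zero pi_closed)

lemma pi_minus: "x \<in> W \<Longrightarrow> y \<in> W \<Longrightarrow> \<pi> (x - y) = \<pi> x \<ominus>\<^bsub>R\<^esub> \<pi> y"
  using pi_add[of x "- y"] by (simp add: a_minus_def pi_uminus)

lemma pi_of_nat: "\<pi> (of_nat m) = [m] \<cdot>\<^bsub>R\<^esub> \<one>\<^bsub>R\<^esub>"
proof (induction m)
  case (Suc m)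
  have "\<pi> (of_nat (Suc m)) = \<pi> (of_nat m + 1)" by (simp add: add.commute)
  also have "\<dots> = [Suc m] \<cdot>\<^bsub>R\<^esub> \<one>\<^bsub>R\<^esub>"
    using Suc by (subst pi_add) (simp_all add: R.add.nat_pow_Suc pi_one)
  finally show ?case .
qed (simp add: pi_zero)

lemma ideal_pow: "ideal (pow_ideal R p k) R"
  unfolding pow_ideal_def by (intro R.cgenideal_ideal) simp

text \<open>Two elements with the same image under \<pi> differ by K, which is why
  \<open>NN k\<close> contains K. This turns statements about cosets of cosets into congruences in
  W.\<close>

lemma pi_mem_pow_ideal:
  assumes "w \<in> W"
  shows "\<pi> w \<in> pow_ideal R p k \<longleftrightarrow> w \<in> NN k"
proof
  assume "\<pi> w \<in> pow_ideal R p k"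
  then obtain h where h: "h \<in> W" "\<pi> w = \<pi> h \<otimes>\<^bsub>R\<^esub> \<pi> (of_nat (p ^ k))"
    unfolding pow_ideal_def cgenideal_def carrier_R pi_of_nat by blast
  have "\<pi> (w - h * of_nat (p ^ k)) = \<zero>\<^bsub>R\<^esub>"
    using h(1) assms by (subst pi_minus) (auto simp del: of_nat_power simp: pi_mult h(2)[symmetric] R.r_neg a_minus_def pi_closed)
  then have "w - h * of_nat p ^ k \<in> K" using assms h by (simp add: K_eq)
  then show "w \<in> NN k"
    unfolding NN_def using h(1) by (intro CollectI exI[of _ h] exI[of _ "w - h * of_nat p ^ k"]) simp
next
  assume "w \<in> NN k"
  then obtain h y where hy: "h \<in> W" "y \<in> W" "\<pi> y = \<zero>\<^bsub>R\<^esub>" "w = h * of_nat (p ^ k) + y"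
    unfolding NN_def by (auto simp: K_eq)
  have "\<pi> w = \<pi> h \<otimes>\<^bsub>R\<^esub> \<pi> (of_nat (p ^ k))"
    unfolding hy(4) using hy(1-3) by (subst pi_add) (auto simp del: of_nat_power simp: pi_mult pi_closed)
  then show "\<pi> w \<in> pow_ideal R p k"
    unfolding pow_ideal_def cgenideal_def pi_of_nat using pi_closed[OF hy(1)] by blast
qed

lemma coset_eq_iff:
  "x \<in> W \<Longrightarrow> y \<in> W \<Longrightarrow>
    pow_ideal R p k +>\<^bsub>R\<^esub> \<pi> x = pow_ideal R p k +>\<^bsub>R\<^esub> \<pi> y \<longleftrightarrow> x - y \<in> NN k"
  using R.quotient_eq_iff_same_a_r_cos[OF ideal_pow pi_closed pi_closed, of x y k]
    pi_mem_pow_ideal[of "x - y" k] by (simp add: pi_minus)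

lemma subr_ideal_kernel: "subr_ideal W K"
  by unfold_locales (auto simp: K_eq pi_zero pi_add pi_mult pi_closed)

lemma subr_ideal_NN: "subr_ideal W (NN k)"
proof
  interpret K: subr_ideal W K by (rule subr_ideal_kernel)
  show "NN k \<subseteq> W" using K.K_sub by (auto simp: NN_def)
  show "0 \<in> NN k" unfolding NN_def using K.K_zero by (intro CollectI exI[of _ 0]) simp
  fix x y assume "x \<in> NN k"
  then obtain h z where x: "h \<in> W" "z \<in> K" "x = h * of_nat p ^ k + z" by (auto simp: NN_def)
  show "x + y \<in> NN k" if y: "y \<in> NN k"
  proof -
    obtain h' z' where "h' \<in> W" "z' \<in> K" "y = h' * of_nat p ^ k + z'" using y by (auto simp: NN_def)
    then show ?thesis unfolding NN_def using x
      by (intro CollectI exI[of _ "h + h'"] exI[of _ "z + z'"]) (simp add: algebra_simps K.K_add)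
  qed
  show "r * x \<in> NN k" if "r \<in> W" for r
    unfolding NN_def using x that
    by (intro CollectI exI[of _ "r * h"] exI[of _ "r * z"]) (simp add: algebra_simps K.K_mult)
qed

lemma NN_dec: "NN (Suc k) \<subseteq> NN k"
proof
  fix x assume "x \<in> NN (Suc k)"
  then obtain h z where x: "h \<in> W" "z \<in> K" "x = h * of_nat p ^ Suc k + z" by (auto simp: NN_def)
  then show "x \<in> NN k"
    unfolding NN_def by (intro CollectI exI[of _ "h * of_nat p"] exI[of _ z]) (simp add: algebra_simps)
qed

lemma pow_ideal_dec: "pow_ideal R p (Suc k) \<subseteq> pow_ideal R p k"
proof
  fix x assume x: "x \<in> pow_ideal R p (Suc k)"
  interpret I: ideal "pow_ideal R p (Suc k)" R by (rule ideal_pow)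
  obtain w where w: "w \<in> W" "x = \<pi> w" using I.Icarr[OF x] by (auto simp: carrier_R)
  then show "x \<in> pow_ideal R p k" using x NN_dec pi_mem_pow_ideal by blast
qed

lemma padic_completion_sel:
  "carrier (padic_completion R p) =
     {f. \<forall>k. f k \<in> carrier (R Quot pow_ideal R p k) \<and> f (Suc k) \<subseteq> f k}"
  "f \<otimes>\<^bsub>padic_completion R p\<^esub> g = (\<lambda>k. f k \<otimes>\<^bsub>R Quot pow_ideal R p k\<^esub> g k)"
  "f \<oplus>\<^bsub>padic_completion R p\<^esub> g = (\<lambda>k. f k \<oplus>\<^bsub>R Quot pow_ideal R p k\<^esub> g k)"
  "\<one>\<^bsub>padic_completion R p\<^esub> = (\<lambda>k. \<one>\<^bsub>R Quot pow_ideal R p k\<^esub>)"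
  "\<zero>\<^bsub>padic_completion R p\<^esub> = (\<lambda>k. \<zero>\<^bsub>R Quot pow_ideal R p k\<^esub>)"
  by (simp_all add: padic_completion_def)

text \<open>The inclusion of the coset at level k + 1 in the one at level k says that their
  representatives are congruent modulo p^k; conversely a coset of a smaller ideal lies in the coset
  of the larger one with the same representative.\<close>

lemma carrier_completion: "carrier (padic_completion R p) = LL ` Collect (coherent W NN)"
proof (intro equalityI subsetI)
  fix f assume "f \<in> carrier (padic_completion R p)"
  then have f: "f k \<in> carrier (R Quot pow_ideal R p k)" "f (Suc k) \<subseteq> f k" for k
    by (auto simp: padic_completion_sel)
  have "\<forall>k. \<exists>w. w \<in> W \<and> f k = pow_ideal R p k +>\<^bsub>R\<^esub> \<pi> w"
    using f(1) by (auto simp: FactRing_def A_RCOSETS_def' carrier_R)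
  from choice[OF this] obtain g where g: "\<And>k. g k \<in> W" "\<And>k. f k = pow_ideal R p k +>\<^bsub>R\<^esub> \<pi> (g k)"
    by blast
  have "g (Suc k) - g k \<in> NN k" for k
  proof -
    interpret I: ideal "pow_ideal R p k" R by (rule ideal_pow)
    interpret J: ideal "pow_ideal R p (Suc k)" R by (rule ideal_pow)
    have "\<pi> (g (Suc k)) \<in> f (Suc k)" unfolding g(2) by (rule J.a_rcos_self[OF pi_closed[OF g(1)]])
    then have "\<pi> (g (Suc k)) \<in> pow_ideal R p k +>\<^bsub>R\<^esub> \<pi> (g k)" using f(2)[of k] g(2)[of k] by blast
    then have "pow_ideal R p k +>\<^bsub>R\<^esub> \<pi> (g k) = pow_ideal R p k +>\<^bsub>R\<^esub> \<pi> (g (Suc k))"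
      by (intro R.a_repr_independence pi_closed g(1) additive_subgroup.a_subgroup[OF I.additive_subgroup_axioms])
    then show ?thesis using coset_eq_iff[OF g(1) g(1)] by metis
  qed
  then have "coherent W NN g" using g(1) by (simp add: coherent_def)
  moreover have "f = LL g" using g(2) by (auto simp: LL_def)
  ultimately show "f \<in> LL ` Collect (coherent W NN)" by blast
next
  fix f assume "f \<in> LL ` Collect (coherent W NN)"
  then obtain g where "coherent W NN g" and gf: "f = LL g" by blast
  then have g: "\<And>k. g k \<in> W" "\<And>k. g (Suc k) - g k \<in> NN k" "f = LL g"
    by (auto simp: coherent_def)
  have "f k \<in> carrier (R Quot pow_ideal R p k)" for k
    unfolding g(3) LL_def using pi_closed[OF g(1)] by (auto simp: FactRing_def A_RCOSETS_def')
  moreover have "f (Suc k) \<subseteq> f k" for k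
  proof -
    have "f (Suc k) \<subseteq> pow_ideal R p k +>\<^bsub>R\<^esub> \<pi> (g (Suc k))"
      unfolding g(3) LL_def a_r_coset_def' using pow_ideal_dec by blast
    also have "\<dots> = f k" unfolding g(3) LL_def using coset_eq_iff[OF g(1) g(1)] g(2) by blast
    finally show ?thesis .
  qed
  ultimately show "f \<in> carrier (padic_completion R p)" by (auto simp: padic_completion_sel)
qed

lemma padic_limring_completion: "padic_limring W NN (padic_completion R p) LL p K"
proof (intro padic_limring.intro limring.intro limring_axioms.intro padic_limring_axioms.intro)
  show "subr W" by unfold_locales
  show "subr_ideal W (NN k)" for k by (rule subr_ideal_NN)
  show "NN (Suc k) \<subseteq> NN k" for k by (rule NN_dec)
  show "carrier (padic_completion R p) = LL ` Collect (coherent W NN)" by (rule carrier_completion)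
  show "NN k = {h * of_nat p ^ k + y |h y. h \<in> W \<and> y \<in> K}" for k by (rule NN_def)
  show "subr_ideal W K" by (rule subr_ideal_kernel)
  show "\<one>\<^bsub>padic_completion R p\<^esub> = LL (\<lambda>_. 1)"
    unfolding padic_completion_sel LL_def by (simp add: FactRing_def pi_one)
  show "\<zero>\<^bsub>padic_completion R p\<^esub> = LL (\<lambda>_. 0)"
    unfolding padic_completion_sel LL_def pi_zero
    using R.a_rcos_zero[OF ideal_pow ideal.axioms(1)[OF ideal_pow, THEN additive_subgroup.zero_closed]]
    by (simp add: FactRing_def)
  fix g g' assume "coherent W NN g" "coherent W NN g'"
  then have g: "g k \<in> W" "g' k \<in> W" for k by (auto simp: coherent_def)
  show "LL g = LL g' \<longleftrightarrow> (\<forall>k. g k - g' k \<in> NN k)"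
    by (simp add: LL_def fun_eq_iff coset_eq_iff g)
  show "LL g \<otimes>\<^bsub>padic_completion R p\<^esub> LL g' = LL (\<lambda>k. g k * g' k)"
    unfolding padic_completion_sel LL_def
    using ideal.rcoset_mult_add[OF ideal_pow pi_closed pi_closed] by (simp add: FactRing_def g pi_mult)
  show "LL g \<oplus>\<^bsub>padic_completion R p\<^esub> LL g' = LL (\<lambda>k. g k + g' k)"
    unfolding padic_completion_sel LL_def
    using ideal.a_rcos_sum[OF ideal_pow pi_closed pi_closed] by (simp add: FactRing_def g pi_add)
qed

lemma to_completion_pi: "to_completion R p (\<pi> w) = LL (\<lambda>_. w)"
  by (simp add: to_completion_def LL_def)

end

text \<open>The union in \<open>completion_map\<close> runs over the elements of one coset; by the
  congruence condition on t all its members are the same coset, so any representative computes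
  it.\<close>

lemma completion_map_LL:
  assumes 1: "presentation W R \<pi> K" and 2: "presentation W' R' \<pi>' K'"
    and t: "\<And>w. w \<in> W \<Longrightarrow> t w \<in> W'" "\<And>w. w \<in> W \<Longrightarrow> h (\<pi> w) = \<pi>' (t w)"
    and d: "\<And>v w k. v \<in> W \<Longrightarrow> w \<in> W \<Longrightarrow> v - w \<in> presentation.NN W K p k \<Longrightarrow> t v - t w \<in> presentation.NN W' K' p k"
    and g: "\<And>k. g k \<in> W"
  shows "completion_map R' p h (presentation.LL R \<pi> p g) = presentation.LL R' \<pi>' p (\<lambda>k. t (g k))"
proof (rule ext)
  interpret A: presentation W R \<pi> K p by fact
  interpret B: presentation W' R' \<pi>' K' p by fact
  fix k
  interpret I: ideal "pow_ideal R p k" R by (rule A.ideal_pow)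
  let ?C = "pow_ideal R p k +>\<^bsub>R\<^esub> \<pi> (g k)"
  have "pow_ideal R' p k +>\<^bsub>R'\<^esub> h a = pow_ideal R' p k +>\<^bsub>R'\<^esub> \<pi>' (t (g k))" if a: "a \<in> ?C" for a
  proof -
    have "a \<in> carrier R" using a A.pi_closed[OF g] I.a_elemrcos_carrier by blast
    then obtain w where w: "w \<in> W" "a = \<pi> w" by (auto simp: A.carrier_R)
    have "?C = pow_ideal R p k +>\<^bsub>R\<^esub> \<pi> w"
      using a w(2) by (intro A.R.a_repr_independence A.pi_closed g additive_subgroup.a_subgroup[OF I.additive_subgroup_axioms]) simp
    then have "w - g k \<in> A.NN k" using A.coset_eq_iff[OF w(1) g] by metis
    then have "t w - t (g k) \<in> B.NN k" by (intro d w g)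
    then show ?thesis using B.coset_eq_iff[OF t(1)[OF w(1)] t(1)[OF g]] by (simp add: w t(2))
  qed
  moreover have "\<pi> (g k) \<in> ?C" by (rule I.a_rcos_self[OF A.pi_closed[OF g]])
  ultimately show "completion_map R' p h (A.LL g) k = B.LL (\<lambda>k. t (g k)) k"
    unfolding completion_map_def A.LL_def B.LL_def by blast
qed

lemma presentation_rec: "subr S \<Longrightarrow> presentation S (rec S) (\<lambda>x. x) {0}"
  by (intro presentation.intro presentation_axioms.intro) (auto simp: subr.cring_rec subr.zero_mem)

section \<open>Power series rings over a ring of coherent sequences\<close>

lemma mpowser_ring_sel:
  "carrier (mpowser_ring Q I) = {f. \<forall>m. f m \<in> carrier Q \<and> (\<not> set_mset m \<subseteq> I \<longrightarrow> f m = \<zero>\<^bsub>Q\<^esub>)}"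
  "f \<otimes>\<^bsub>mpowser_ring Q I\<^esub> g = (\<lambda>m. \<Oplus>\<^bsub>Q\<^esub>k\<in>{k. k \<subseteq># m}. f k \<otimes>\<^bsub>Q\<^esub> g (m - k))"
  "f \<oplus>\<^bsub>mpowser_ring Q I\<^esub> g = (\<lambda>m. f m \<oplus>\<^bsub>Q\<^esub> g m)"
  "\<one>\<^bsub>mpowser_ring Q I\<^esub> = ring.indexed_const Q \<one>\<^bsub>Q\<^esub>"
  "\<zero>\<^bsub>mpowser_ring Q I\<^esub> = ring.indexed_const Q \<zero>\<^bsub>Q\<^esub>"
  by (simp_all add: mpowser_ring_def)

definition powser_lim :: "((nat \<Rightarrow> 'a) \<Rightarrow> 'b) \<Rightarrow> (nat \<Rightarrow> ('i, 'a::comm_ring_1) mps) \<Rightarrow> 'i multiset \<Rightarrow> 'b" where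
  "powser_lim L g = (\<lambda>m. L (\<lambda>k. coef (g k) m))"

text \<open>The multiples of p^k; the summand y from {0} only keeps the shape required by
  \<open>padic_limring\<close> with zero kernel.\<close>

definition powser_N :: "'i set \<Rightarrow> 'a set \<Rightarrow> nat \<Rightarrow> nat \<Rightarrow> ('i, 'a::comm_ring_1) mps set" where
  "powser_N I S p k = {h * of_nat p ^ k + y | h y. h \<in> mps_over I S \<and> y \<in> {0}}"

lemma powser_N_iff:
  assumes S: "subr S" and w: "w \<in> mps_over I S"
  shows "w \<in> powser_N I S p k \<longleftrightarrow> (\<forall>m. \<exists>c\<in>S. coef w m = c * of_nat p ^ k)"
proof
  assume "w \<in> powser_N I S p k"
  then obtain h where h: "h \<in> mps_over I S" "w = h * mconst (of_nat p ^ k)"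
    by (auto simp: powser_N_def mconst_power mconst_of_nat)
  then show "\<forall>m. \<exists>c\<in>S. coef w m = c * of_nat p ^ k" by (auto intro: mps_over_coef)
next
  assume "\<forall>m. \<exists>c\<in>S. coef w m = c * of_nat p ^ k"
  then obtain c where c: "\<And>m. c m \<in> S" "\<And>m. coef w m = c m * of_nat p ^ k" by metis
  \<comment> \<open>The quotients were chosen monomial by monomial, so they have to be set to zero
    by hand outside the variables in I.\<close>
  define h where "h = Mps (\<lambda>m. if set_mset m \<subseteq> I then c m else 0)"
  have "h \<in> mps_over I S" using c(1) subr.zero_mem[OF S] by (auto simp: h_def mps_over_def)
  moreover have "w = h * mconst (of_nat p ^ k)"
    by (rule mps_eqI) (use mps_over_vars[OF w] in \<open>auto simp: h_def c(2)[symmetric]\<close>)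
  ultimately show "w \<in> powser_N I S p k"
    by (auto simp: powser_N_def mconst_power mconst_of_nat)
qed

text \<open>Congruence of series modulo p^k is congruence of all coefficients
  (\<open>powser_N_iff\<close>), so a series with coefficients in the limit is a limit of series
  over S.\<close>

lemma padic_limring_mpowser:
  assumes "padic_limring S NS Q L p {0}"
  shows "padic_limring (mps_over I S) (powser_N I S p) (mpowser_ring Q I) (powser_lim L) p {0}"
proof -
  interpret Q: padic_limring S NS Q L p "{0}" by fact
  have S: "subr S" by unfold_locales
  interpret R: subr "mps_over I S" by (rule subr_mps_over[OF S])
  let ?R = "mps_over I S" and ?N = "powser_N I S p" and ?T = "mpowser_ring Q I"
  have N_iff: "w \<in> ?N k \<longleftrightarrow> (\<forall>m. coef w m \<in> NS k)" if "w \<in> ?R" for w k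
    unfolding powser_N_iff[OF S that] Q.N_def by auto
  have coh_coef: "Q.coh (\<lambda>k. coef (g k) m)" if "coherent ?R ?N g" for g m
  proof -
    have "g k \<in> ?R" "g (Suc k) - g k \<in> ?N k" for k using that by (auto simp: coherent_def)
    then show ?thesis
      unfolding coherent_def using N_iff[of "g (Suc _) - g _"] by (auto intro: mps_over_coef)
  qed
  have zero_ideal: "subr_ideal ?R {0}" by unfold_locales auto
  have NI: "subr_ideal ?R (?N k)" for k
  proof
    show "?N k \<subseteq> ?R" by (auto simp: powser_N_def)
    show "0 \<in> ?N k" unfolding powser_N_def by (intro CollectI exI[of _ 0]) simp
    fix x assume x: "x \<in> ?N k"
    have xR: "x \<in> ?R" using x by (auto simp: powser_N_def)
    show "x + y \<in> ?N k" if y: "y \<in> ?N k" for y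
    proof -
      have yR: "y \<in> ?R" using y by (auto simp: powser_N_def)
      show ?thesis using x y N_iff[OF xR] N_iff[OF yR] N_iff[OF R.add_mem[OF xR yR]] Q.N.K_add by simp
    qed
    show "r * x \<in> ?N k" if "r \<in> ?R" for r
    proof -
      obtain h where "h \<in> ?R" "x = h * of_nat p ^ k" using x by (auto simp: powser_N_def)
      then show ?thesis unfolding powser_N_def using that
        by (intro CollectI exI[of _ "r * h"] exI[of _ 0]) (simp add: mult.assoc)
    qed
  qed
  show ?thesis
  proof (intro padic_limring.intro limring.intro limring_axioms.intro padic_limring_axioms.intro NI R.subr_axioms zero_ideal)
    show "?N k = {h * of_nat p ^ k + y |h y. h \<in> ?R \<and> y \<in> {0}}" for k by (rule powser_N_def)
    show "?N (Suc k) \<subseteq> ?N k" for k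
    proof
      fix x assume x: "x \<in> ?N (Suc k)"
      then have xR: "x \<in> ?R" by (auto simp: powser_N_def)
      show "x \<in> ?N k" using x N_iff[OF xR] Q.N_dec[of k] by blast
    qed
    show "carrier ?T = powser_lim L ` Collect (coherent ?R ?N)"
    proof (intro equalityI subsetI)
      fix f assume "f \<in> carrier ?T"
      then have f: "f m \<in> carrier Q" "\<not> set_mset m \<subseteq> I \<Longrightarrow> f m = \<zero>\<^bsub>Q\<^esub>" for m
        by (auto simp: mpowser_ring_sel)
      \<comment> \<open>For monomials outside I the zero sequence is chosen: other sequences
        representing zero would take the components out of \<open>mps_over\<close>.\<close>
      have "\<forall>m. \<exists>g. Q.coh g \<and> f m = L g \<and> (\<not> set_mset m \<subseteq> I \<longrightarrow> g = (\<lambda>_. 0))"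
      proof
        fix m
        show "\<exists>g. Q.coh g \<and> f m = L g \<and> (\<not> set_mset m \<subseteq> I \<longrightarrow> g = (\<lambda>_. 0))"
        proof (cases "set_mset m \<subseteq> I")
          case True
          then show ?thesis using Q.carrierE[OF f(1)] by blast
        next
          case False
          then show ?thesis using f(2)[OF False] Q.L_zero Q.coh_const[of 0] by auto
        qed
      qed
      from choice[OF this] obtain G where
        G: "\<And>m. Q.coh (G m)" "\<And>m. f m = L (G m)" "\<And>m. \<not> set_mset m \<subseteq> I \<Longrightarrow> G m = (\<lambda>_. 0)" by blast
      define g where "g k = Mps (\<lambda>m. G m k)" for k
      have gR: "g k \<in> ?R" for k using G Q.cohD(1)[OF G(1)] by (auto simp: g_def mps_over_def)
      have "g (Suc k) - g k \<in> ?N k" for k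
        using N_iff[OF R.diff_mem[OF gR gR]] Q.cohD(2)[OF G(1)] by (simp add: g_def)
      then have "coherent ?R ?N g" using gR by (simp add: coherent_def)
      moreover have "f = powser_lim L g" by (auto simp: powser_lim_def g_def G(2))
      ultimately show "f \<in> powser_lim L ` Collect (coherent ?R ?N)" by blast
    next
      fix f assume "f \<in> powser_lim L ` Collect (coherent ?R ?N)"
      then obtain g where g: "coherent ?R ?N g" "f = powser_lim L g" by blast
      have "f m \<in> carrier Q" for m unfolding g(2) powser_lim_def by (rule Q.L_closed[OF coh_coef[OF g(1)]])
      moreover have "f m = \<zero>\<^bsub>Q\<^esub>" if "\<not> set_mset m \<subseteq> I" for m
      proof -
        have "coef (g k) m = 0" for k using g(1) mps_over_vars[OF _ that] by (auto simp: coherent_def)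
        then show ?thesis by (simp add: g(2) powser_lim_def Q.L_zero)
      qed
      ultimately show "f \<in> carrier ?T" by (auto simp: mpowser_ring_sel)
    qed
    show "\<one>\<^bsub>?T\<^esub> = powser_lim L (\<lambda>_. 1)"
      unfolding mpowser_ring_sel ring.indexed_const_def[OF Q.Q.ring_axioms]
      by (auto simp: powser_lim_def coef_one Q.L_one Q.L_zero)
    show "\<zero>\<^bsub>?T\<^esub> = powser_lim L (\<lambda>_. 0)"
      unfolding mpowser_ring_sel ring.indexed_const_def[OF Q.Q.ring_axioms]
      by (auto simp: powser_lim_def Q.L_zero)
    fix g g' assume g: "coherent ?R ?N g" "coherent ?R ?N g'"
    have gR: "g k \<in> ?R" "g' k \<in> ?R" for k using g by (auto simp: coherent_def)
    show "powser_lim L g = powser_lim L g' \<longleftrightarrow> (\<forall>k. g k - g' k \<in> ?N k)"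
      using N_iff[OF R.diff_mem[OF gR]] Q.L_eq_iff[OF coh_coef[OF g(1)] coh_coef[OF g(2)]]
      by (auto simp: powser_lim_def fun_eq_iff)
    show "powser_lim L g \<oplus>\<^bsub>?T\<^esub> powser_lim L g' = powser_lim L (\<lambda>k. g k + g' k)"
      unfolding mpowser_ring_sel powser_lim_def
      using Q.L_add[OF coh_coef[OF g(1)] coh_coef[OF g(2)]] by simp
    show "powser_lim L g \<otimes>\<^bsub>?T\<^esub> powser_lim L g' = powser_lim L (\<lambda>k. g k * g' k)"
    proof (rule ext)
      fix m
      have "(powser_lim L g \<otimes>\<^bsub>?T\<^esub> powser_lim L g') m =
          (\<Oplus>\<^bsub>Q\<^esub>k\<in>{k. k \<subseteq># m}. L (\<lambda>l. coef (g l) k * coef (g' l) (m - k)))"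
        unfolding mpowser_ring_sel powser_lim_def
        using Q.L_mult[OF coh_coef[OF g(1)] coh_coef[OF g(2)]] by simp
      also have "\<dots> = L (\<lambda>l. \<Sum>k | k \<subseteq># m. coef (g l) k * coef (g' l) (m - k))"
        using Q.L_finsum[OF finite_submsets, of m "\<lambda>k l. coef (g l) k * coef (g' l) (m - k)"]
          Q.coh_mult[OF coh_coef[OF g(1)] coh_coef[OF g(2)]] by blast
      also have "\<dots> = powser_lim L (\<lambda>k. g k * g' k) m"
        by (simp add: powser_lim_def coef_mult sum_splits)
      finally show "(powser_lim L g \<otimes>\<^bsub>?T\<^esub> powser_lim L g') m = powser_lim L (\<lambda>k. g k * g' k) m" .
    qed
  qed
qed

context presentation
begin

lemma pi_finsum:
  assumes "finite J" "\<And>i. i \<in> J \<Longrightarrow> w i \<in> W"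
  shows "finsum R (\<lambda>i. \<pi> (w i)) J = \<pi> (sum w J)"
  using assms
proof (induction J rule: finite_induct)
  case (insert i J)
  have "finsum R (\<lambda>i. \<pi> (w i)) (insert i J) = \<pi> (w i) \<oplus>\<^bsub>R\<^esub> finsum R (\<lambda>i. \<pi> (w i)) J"
    using insert by (intro R.finsum_insert) (auto intro: pi_closed)
  with insert show ?case by (simp add: pi_add sum_mem)
qed (simp add: pi_zero)

lemma pi_finprod:
  assumes "finite J" "\<And>i. i \<in> J \<Longrightarrow> w i \<in> W"
  shows "finprod R (\<lambda>i. \<pi> (w i)) J = \<pi> (prod w J)"
  using assms
proof (induction J rule: finite_induct)
  case (insert i J)
  have "finprod R (\<lambda>i. \<pi> (w i)) (insert i J) = \<pi> (w i) \<otimes>\<^bsub>R\<^esub> finprod R (\<lambda>i. \<pi> (w i)) J"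
    using insert by (intro R.finprod_insert) (auto intro: pi_closed)
  with insert show ?case by (simp add: pi_mult prod_mem)
qed (simp add: pi_one)

lemma pi_rmat_mult:
  assumes "Y \<in> smats W n" "Z \<in> smats W n"
  shows "rmat_mult R (map_mat \<pi> Y) (map_mat \<pi> Z) = map_mat \<pi> (Y * Z)"
proof (rule eq_matI)
  fix i j assume "i < dim_row (map_mat \<pi> (Y * Z))" "j < dim_col (map_mat \<pi> (Y * Z))"
  then have ij: "i < n" "j < n" using carrier_matD[OF smats_carrier[OF assms(1)]]
    carrier_matD[OF smats_carrier[OF assms(2)]] by auto
  have e: "\<pi> (Y $$ (i, k)) \<otimes>\<^bsub>R\<^esub> \<pi> (Z $$ (k, j)) \<in> carrier R" if "k < n" for k
    using that ij assms by (simp add: pi_closed)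
  have "rmat_mult R (map_mat \<pi> Y) (map_mat \<pi> Z) $$ (i, j) =
      (\<Oplus>\<^bsub>R\<^esub>k\<in>{..<n}. map_mat \<pi> Y $$ (i, k) \<otimes>\<^bsub>R\<^esub> map_mat \<pi> Z $$ (k, j))"
    unfolding rmat_mult_def using ij carrier_matD[OF smats_carrier[OF assms(1)]]
      carrier_matD[OF smats_carrier[OF assms(2)]] by simp
  also have "\<dots> = (\<Oplus>\<^bsub>R\<^esub>k\<in>{..<n}. \<pi> (Y $$ (i, k)) \<otimes>\<^bsub>R\<^esub> \<pi> (Z $$ (k, j)))"
    using ij carrier_matD[OF smats_carrier[OF assms(1)]] carrier_matD[OF smats_carrier[OF assms(2)]] e
    by (intro R.finsum_cong') auto
  also have "\<dots> = (\<Oplus>\<^bsub>R\<^esub>k\<in>{..<n}. \<pi> (Y $$ (i, k) * Z $$ (k, j)))"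
    using ij assms by (intro R.finsum_cong') (auto simp: pi_mult pi_closed)
  also have "\<dots> = \<pi> (\<Sum>k<n. Y $$ (i, k) * Z $$ (k, j))"
    using ij assms by (intro pi_finsum) auto
  also have "\<dots> = map_mat \<pi> (Y * Z) $$ (i, j)"
    using ij carrier_matD[OF smats_carrier[OF assms(1)]] carrier_matD[OF smats_carrier[OF assms(2)]]
    by (subst entry_mult[symmetric, OF smats_carrier[OF assms(1)] smats_carrier[OF assms(2)] ij]) simp
  finally show "rmat_mult R (map_mat \<pi> Y) (map_mat \<pi> Z) $$ (i, j) = map_mat \<pi> (Y * Z) $$ (i, j)" .
qed (simp_all add: rmat_mult_def)

lemma pi_rmat_one: "rmat_one R n = map_mat \<pi> (1\<^sub>m n)"
  unfolding rmat_one_def by (rule eq_matI) (auto simp: pi_one pi_zero)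

lemma pi_rmat_diff:
  assumes "Y \<in> smats W n" "Z \<in> smats W n"
  shows "rmat_diff R (map_mat \<pi> Y) (map_mat \<pi> Z) = map_mat \<pi> (Y - Z)"
  unfolding rmat_diff_def
  by (rule eq_matI) (use carrier_matD[OF smats_carrier[OF assms(1)]] carrier_matD[OF smats_carrier[OF assms(2)]]
      smats_entry[OF assms(1)] smats_entry[OF assms(2)] in \<open>auto simp: pi_minus\<close>)

lemma quotient_presentation:
  assumes "ideal I R"
  shows "presentation W (R Quot I) (\<lambda>w. I +>\<^bsub>R\<^esub> \<pi> w) {w \<in> W. \<pi> w \<in> I}"
proof -
  interpret I: ideal I R by fact
  interpret Q: cring "R Quot I" by (rule I.quotient_is_cring[OF cring_R])
  have z: "I +>\<^bsub>R\<^esub> \<pi> w = I \<longleftrightarrow> \<pi> w \<in> I" if "w \<in> W" for w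
    using R.quotient_eq_iff_same_a_r_cos[OF assms pi_closed[OF that] R.zero_closed]
      R.a_rcos_zero[OF assms I.zero_closed] pi_closed[OF that] by (simp add: a_minus_def)
  show ?thesis
  proof (intro presentation.intro presentation_axioms.intro subr_axioms Q.cring_axioms)
    show "carrier (R Quot I) = (\<lambda>w. I +>\<^bsub>R\<^esub> \<pi> w) ` W"
      by (auto simp: FactRing_def A_RCOSETS_def' carrier_R)
    show "I +>\<^bsub>R\<^esub> \<pi> 1 = \<one>\<^bsub>R Quot I\<^esub>" by (simp add: FactRing_def pi_one)
    show "{w \<in> W. \<pi> w \<in> I} = {w \<in> W. I +>\<^bsub>R\<^esub> \<pi> w = \<zero>\<^bsub>R Quot I\<^esub>}"
      using z by (auto simp: FactRing_def)
    fix x y assume xy: "x \<in> W" "y \<in> W"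
    show "I +>\<^bsub>R\<^esub> \<pi> (x + y) = (I +>\<^bsub>R\<^esub> \<pi> x) \<oplus>\<^bsub>R Quot I\<^esub> (I +>\<^bsub>R\<^esub> \<pi> y)"
      using xy I.a_rcos_sum[OF pi_closed pi_closed] by (simp add: FactRing_def pi_add)
    show "I +>\<^bsub>R\<^esub> \<pi> (x * y) = (I +>\<^bsub>R\<^esub> \<pi> x) \<otimes>\<^bsub>R Quot I\<^esub> (I +>\<^bsub>R\<^esub> \<pi> y)"
      using xy I.rcoset_mult_add[OF pi_closed pi_closed] by (simp add: FactRing_def pi_mult)
  qed
qed

end

section \<open>Power series and polynomial rings over a subring\<close>

lemma coef_presentation:
  assumes W: "subr W" and carr: "carrier Q = coef ` W"
    and one: "\<one>\<^bsub>Q\<^esub> = coef 1" and zero: "\<zero>\<^bsub>Q\<^esub> = coef 0"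
    and add: "\<And>f g. f \<in> W \<Longrightarrow> g \<in> W \<Longrightarrow> coef f \<oplus>\<^bsub>Q\<^esub> coef g = coef (f + g)"
    and mult: "\<And>f g. f \<in> W \<Longrightarrow> g \<in> W \<Longrightarrow> coef f \<otimes>\<^bsub>Q\<^esub> coef g = coef (f * g)"
  shows "presentation W Q coef {0}"
proof -
  interpret subr W by fact
  have "cring Q"
  proof (rule cringI)
    show "abelian_group Q"
    proof (rule abelian_groupI)
      fix x y z assume "x \<in> carrier Q" "y \<in> carrier Q" "z \<in> carrier Q"
      then obtain f g h where fgh: "f \<in> W" "g \<in> W" "h \<in> W" "x = coef f" "y = coef g" "z = coef h"
        by (auto simp: carr)
      show "x \<oplus>\<^bsub>Q\<^esub> y \<in> carrier Q" using fgh by (auto simp: add carr)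
      show "x \<oplus>\<^bsub>Q\<^esub> y \<oplus>\<^bsub>Q\<^esub> z = x \<oplus>\<^bsub>Q\<^esub> (y \<oplus>\<^bsub>Q\<^esub> z)" using fgh by (simp add: add add.assoc)
      show "x \<oplus>\<^bsub>Q\<^esub> y = y \<oplus>\<^bsub>Q\<^esub> x" using fgh by (simp add: add add.commute)
      show "\<zero>\<^bsub>Q\<^esub> \<oplus>\<^bsub>Q\<^esub> x = x" using fgh by (simp add: add zero)
      show "\<exists>y\<in>carrier Q. y \<oplus>\<^bsub>Q\<^esub> x = \<zero>\<^bsub>Q\<^esub>"
        using fgh by (intro bexI[of _ "coef (- f)"]) (auto simp: add zero carr)
    qed (auto simp: zero carr)
    show "Group.comm_monoid Q"
    proof (rule comm_monoidI)
      fix x y z assume "x \<in> carrier Q" "y \<in> carrier Q" "z \<in> carrier Q"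
      then obtain f g h where fgh: "f \<in> W" "g \<in> W" "h \<in> W" "x = coef f" "y = coef g" "z = coef h"
        by (auto simp: carr)
      show "x \<otimes>\<^bsub>Q\<^esub> y \<in> carrier Q" using fgh by (auto simp: mult carr)
      show "x \<otimes>\<^bsub>Q\<^esub> y \<otimes>\<^bsub>Q\<^esub> z = x \<otimes>\<^bsub>Q\<^esub> (y \<otimes>\<^bsub>Q\<^esub> z)" using fgh by (simp add: mult mult.assoc)
      show "x \<otimes>\<^bsub>Q\<^esub> y = y \<otimes>\<^bsub>Q\<^esub> x" using fgh by (simp add: mult mult.commute)
      show "\<one>\<^bsub>Q\<^esub> \<otimes>\<^bsub>Q\<^esub> x = x" using fgh by (simp add: mult one)
    qed (auto simp: one carr)
    fix x y z assume "x \<in> carrier Q" "y \<in> carrier Q" "z \<in> carrier Q"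
    then obtain f g h where fgh: "f \<in> W" "g \<in> W" "h \<in> W" "x = coef f" "y = coef g" "z = coef h"
      by (auto simp: carr)
    then show "(x \<oplus>\<^bsub>Q\<^esub> y) \<otimes>\<^bsub>Q\<^esub> z = x \<otimes>\<^bsub>Q\<^esub> z \<oplus>\<^bsub>Q\<^esub> y \<otimes>\<^bsub>Q\<^esub> z"
      by (simp add: mult add distrib_right)
  qed
  then show ?thesis
    by (intro presentation.intro presentation_axioms.intro W)
      (auto simp: carr one zero add mult coef_inject)
qed

lemma indexed_const_rec:
  assumes "subr S"
  shows "ring.indexed_const (rec S) c = coef (mconst c)"
  using cring.axioms(1)[OF subr.cring_rec[OF assms]]
  by (auto simp: ring.indexed_const_def coef_mconst)

lemma indexed_pmult_rec:
  assumes "subr S"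
  shows "ring.indexed_pmult (rec S) (coef f) i = coef (mvar i * f)"
  using cring.axioms(1)[OF subr.cring_rec[OF assms]]
  by (auto simp: ring.indexed_pmult_def coef_mvar_mult)

lemma indexed_var_rec:
  assumes "subr S"
  shows "ring.indexed_var (rec S) i = coef (mvar i)"
  using indexed_pmult_rec[OF assms, of "mconst 1" i] cring.axioms(1)[OF subr.cring_rec[OF assms]]
  by (simp add: ring.indexed_var_def indexed_const_rec[OF assms])

lemma coef_mpowser_mult:
  assumes S: "subr S" and f: "f \<in> mps_over I S" and g: "g \<in> mps_over I S"
  shows "coef f \<otimes>\<^bsub>mpowser_ring (rec S) I\<^esub> coef g = coef (f * g)"
proof (rule ext)
  fix m
  have "(coef f \<otimes>\<^bsub>mpowser_ring (rec S) I\<^esub> coef g) m = finsum (rec S) (\<lambda>k. coef f k * coef g (m - k)) {k. k \<subseteq># m}"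
    by (simp add: mpowser_ring_sel)
  also have "\<dots> = (\<Sum>k | k \<subseteq># m. coef f k * coef g (m - k))"
    by (rule subr.rec_finsum[OF S]) (intro subr.mult_mem[OF S] mps_over_coef[OF f] mps_over_coef[OF g])
  also have "\<dots> = coef (f * g) m" by (simp add: coef_mult sum_splits)
  finally show "(coef f \<otimes>\<^bsub>mpowser_ring (rec S) I\<^esub> coef g) m = coef (f * g) m" .
qed

lemma mpowser_presentation:
  assumes S: "subr S"
  shows "presentation (mps_over I S) (mpowser_ring (rec S) I) coef {0}"
proof (rule coef_presentation[OF subr_mps_over[OF S]])
  show "carrier (mpowser_ring (rec S) I) = coef ` mps_over I S"
  proof (intro equalityI subsetI)
    fix f assume f: "f \<in> carrier (mpowser_ring (rec S) I)"
    then have "Mps f \<in> mps_over I S" by (auto simp: mpowser_ring_sel mps_over_def)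
    then show "f \<in> coef ` mps_over I S" by (metis coef_Mps image_eqI)
  qed (auto simp: mpowser_ring_sel mps_over_def)
  show "coef f \<otimes>\<^bsub>mpowser_ring (rec S) I\<^esub> coef g = coef (f * g)"
    if "f \<in> mps_over I S" "g \<in> mps_over I S" for f g
    by (rule coef_mpowser_mult[OF S that])
qed (auto simp: mpowser_ring_sel indexed_const_rec[OF S])

definition mpoly_over :: "'i set \<Rightarrow> 'a set \<Rightarrow> ('i, 'a::comm_ring_1) mps set" where
  "mpoly_over I S = {f \<in> mps_over I S. finite {m. coef f m \<noteq> 0}}"

lemma mpoly_over_sub: "mpoly_over I S \<subseteq> mps_over I S"
  by (auto simp: mpoly_over_def)

lemma subr_mpoly_over:
  assumes "subr S"
  shows "subr (mpoly_over I S)"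
proof -
  interpret R: subr "mps_over I S" by (rule subr_mps_over[OF assms])
  show ?thesis
  proof
    fix f g :: "('b, 'a) mps" assume fg: "f \<in> mpoly_over I S" "g \<in> mpoly_over I S"
    then have fin: "finite {m. coef f m \<noteq> 0}" "finite {m. coef g m \<noteq> 0}" by (auto simp: mpoly_over_def)
    have "{m. coef (f + g) m \<noteq> 0} \<subseteq> {m. coef f m \<noteq> 0} \<union> {m. coef g m \<noteq> 0}" by auto
    with fin show "f + g \<in> mpoly_over I S"
      using fg finite_subset unfolding mpoly_over_def by (auto intro: finite_subset)
    have "{m. coef (f * g) m \<noteq> 0} \<subseteq> (\<lambda>(a, b). a + b) ` ({m. coef f m \<noteq> 0} \<times> {m. coef g m \<noteq> 0})"
    proof
      fix m assume "m \<in> {m. coef (f * g) m \<noteq> 0}"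
      then have "(\<Sum>x\<in>splits m. case x of (a, b) \<Rightarrow> coef f a * coef g b) \<noteq> 0" by (simp add: coef_mult)
      then obtain x where x: "x \<in> splits m" "(case x of (a, b) \<Rightarrow> coef f a * coef g b) \<noteq> 0"
        by (metis (no_types, lifting) sum.neutral)
      then show "m \<in> (\<lambda>(a, b). a + b) ` ({m. coef f m \<noteq> 0} \<times> {m. coef g m \<noteq> 0})"
        by (cases x) (auto intro!: image_eqI[of _ _ x])
    qed
    with fin show "f * g \<in> mpoly_over I S"
      using fg unfolding mpoly_over_def by (auto intro: finite_subset)
  next
    have "{m. coef 1 m \<noteq> (0 :: 'a)} \<subseteq> {{#}}" by (auto simp: coef_one)
    then show "1 \<in> mpoly_over I S" unfolding mpoly_over_def by (auto intro: finite_subset)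
  qed (auto simp: mpoly_over_def)
qed

lemma mconst_mpoly: "subr S \<Longrightarrow> c \<in> S \<Longrightarrow> mconst c \<in> mpoly_over I S"
  unfolding mpoly_over_def using mconst_over by (auto simp: coef_mconst intro: finite_subset[of _ "{{#}}"])

lemma mvar_mpoly: "subr S \<Longrightarrow> i \<in> I \<Longrightarrow> mvar i \<in> mpoly_over I S"
  unfolding mpoly_over_def using mvar_over by (auto simp: coef_mvar intro: finite_subset[of _ "{{#i#}}"])

lemma coef_monom: "coef (monom_eval mvar k) m = (if m = k then 1 else 0)"
proof (induction k arbitrary: m)
  case (add i k)
  show ?case
  proof (cases "i \<in># m")
    case True
    then show ?thesis using add by (auto simp: coef_mvar_mult)
  next
    case False
    then show ?thesis by (auto simp: coef_mvar_mult)
  qed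
qed (simp add: coef_one)

lemma mpoly_expand:
  assumes "finite B" "{m. coef f m \<noteq> 0} \<subseteq> B"
  shows "f = (\<Sum>k\<in>B. mconst (coef f k) * monom_eval mvar k)"
proof (rule mps_eqI)
  fix m
  have "(\<Sum>k\<in>B. coef f k * (if m = k then 1 else 0)) = (\<Sum>k\<in>B. if k = m then coef f k else 0)"
    by (intro sum.cong) auto
  then show "coef f m = coef (\<Sum>k\<in>B. mconst (coef f k) * monom_eval mvar k) m"
    using assms by (auto simp: coef_monom sum.delta)
qed

text \<open>Constants and variables generate, so a property that defines a subring need only be
  checked on them. Closure of evaluation, uniqueness of homomorphisms and the expansion at the
  identity are all proved in this form.\<close>

lemma mpoly_over_induct:
  assumes T: "subr T" and "\<And>c. c \<in> S \<Longrightarrow> mconst c \<in> T" "\<And>i. i \<in> I \<Longrightarrow> mvar i \<in> T"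
  shows "mpoly_over I S \<subseteq> T"
proof
  fix f assume f: "f \<in> mpoly_over I S"
  let ?B = "{m. coef f m \<noteq> 0}"
  have fin: "finite ?B" and fR: "f \<in> mps_over I S" using f by (auto simp: mpoly_over_def)
  have "mconst (coef f k) * monom_eval mvar k \<in> T" if "k \<in> ?B" for k
    using that assms mps_over_coef[OF fR] mps_over_vars[OF fR, of k]
    by (intro subr.mult_mem[OF T] monom_eval_mem[OF T]) auto
  then have "(\<Sum>k\<in>?B. mconst (coef f k) * monom_eval mvar k) \<in> T" by (intro subr.sum_mem[OF T])
  then show "f \<in> T" using mpoly_expand[OF fin order_refl] by simp
qed

text \<open>The inductively defined polynomials are the finitely supported series: one inclusion is
  rule induction, the other builds up the finite expansion into monomials.\<close>

lemma indexed_pset_rec: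
  assumes S: "subr S"
  shows "ring.indexed_pset (rec S) I S = coef ` mpoly_over I S"
proof (intro equalityI subsetI)
  have r: "ring (rec S)" by (rule cring.axioms(1)[OF subr.cring_rec[OF S]])
  interpret M: subr "mpoly_over I S" by (rule subr_mpoly_over[OF S])
  fix f assume "f \<in> ring.indexed_pset (rec S) I S"
  then show "f \<in> coef ` mpoly_over I S"
  proof (induction rule: ring.indexed_pset.induct[OF r, consumes 1, case_names const add mult])
    case (const k)
    then show ?case using mconst_mpoly[OF S] by (auto simp: indexed_const_rec[OF S])
  next
    case (add P Q)
    then obtain f g where "f \<in> mpoly_over I S" "g \<in> mpoly_over I S" "P = coef f" "Q = coef g" by blast
    moreover have "ring.indexed_padd (rec S) (coef f) (coef g) = coef (f + g)"
      by (auto simp: ring.indexed_padd_def[OF r])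
    ultimately show ?case by (metis M.add_mem image_eqI)
  next
    case (mult P i)
    then obtain f where "f \<in> mpoly_over I S" "P = coef f" by blast
    then show ?case
      using mult.hyps indexed_pmult_rec[OF S, of f i] M.mult_mem[OF mvar_mpoly[OF S]]
      by (metis image_eqI)
  qed
next
  have r: "ring (rec S)" by (rule cring.axioms(1)[OF subr.cring_rec[OF S]])
  let ?P = "ring.indexed_pset (rec S) I S"
  have const: "coef (mconst c) \<in> ?P" if "c \<in> S" for c
    using ring.indexed_pset.indexed_const[OF r that] by (simp add: indexed_const_rec[OF S])
  have add: "coef (f + g) \<in> ?P" if "coef f \<in> ?P" "coef g \<in> ?P" for f g
  proof -
    have "ring.indexed_padd (rec S) (coef f) (coef g) = coef (f + g)"
      by (auto simp: ring.indexed_padd_def[OF r])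
    then show ?thesis using ring.indexed_pset.indexed_padd[OF r that] by simp
  qed
  have monom: "coef (mconst c * monom_eval mvar k) \<in> ?P" if "c \<in> S" "set_mset k \<subseteq> I" for c k
    using that(2)
  proof (induction k)
    case (add i k)
    then show ?case
      using ring.indexed_pset.indexed_pmult[OF r, of "coef (mconst c * monom_eval mvar k)" I S i]
      unfolding indexed_pmult_rec[OF S] monom_eval_simps mult.left_commute[of "mconst c"]
      by (simp only: set_mset_add_mset_insert insert_subset)
  qed (use const that in simp)
  fix f assume "f \<in> coef ` mpoly_over I S"
  then obtain g where g: "g \<in> mpoly_over I S" "f = coef g" by blast
  let ?B = "{m. coef g m \<noteq> 0}"
  have fin: "finite ?B" and gR: "g \<in> mps_over I S" using g by (auto simp: mpoly_over_def)
  have "coef (\<Sum>k\<in>B. mconst (coef g k) * monom_eval mvar k) \<in> ?P" if "finite B" "B \<subseteq> ?B" for B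
    using that
  proof (induction B rule: finite_induct)
    case empty
    then show ?case using const[OF subr.zero_mem[OF S]] by (simp only: sum.empty mconst_simps)
  next
    case (insert k B)
    then have "set_mset k \<subseteq> I" using mps_over_vars[OF gR, of k] by auto
    then have "coef (mconst (coef g k) * monom_eval mvar k + (\<Sum>k\<in>B. mconst (coef g k) * monom_eval mvar k)) \<in> ?P"
      using insert.prems by (intro add monom mps_over_coef[OF gR] insert.IH) simp_all
    then show ?case using insert.hyps by (simp only: sum.insert not_False_eq_True)
  qed
  from this[OF fin order_refl] show "f \<in> ?P"
    unfolding g(2) by (subst mpoly_expand[OF fin order_refl])
qed

lemma mpoly_presentation:
  assumes S: "subr S"
  shows "presentation (mpoly_over I S) (mpoly_ring (rec S) I) coef {0}"
proof -
  interpret P: presentation "mps_over I S" "mpowser_ring (rec S) I" coef "{0}" for p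
    by (rule mpowser_presentation[OF S])
  have sub: "f \<in> mps_over I S" if "f \<in> mpoly_over I S" for f using that mpoly_over_sub by blast
  show ?thesis
    by (rule coef_presentation[OF subr_mpoly_over[OF S]])
      (auto simp: mpoly_ring_def indexed_pset_rec[OF S] P.pi_one P.pi_zero P.pi_add[OF sub sub] P.pi_mult[OF sub sub])
qed

subsection \<open>Evaluation of polynomials\<close>

definition poly_eval :: "('a \<Rightarrow> 'b::comm_ring_1) \<Rightarrow> ('i \<Rightarrow> 'b) \<Rightarrow> ('i, 'a::comm_ring_1) mps \<Rightarrow> 'b" where
  "poly_eval h \<sigma> f = (\<Sum>m | coef f m \<noteq> 0. h (coef f m) * prod_mset (image_mset \<sigma> m))"

text \<open>The support changes under the ring operations; a common finite superset makes the sums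
  for different polynomials comparable.\<close>

lemma poly_eval_superset:
  assumes "finite B" "{m. coef f m \<noteq> 0} \<subseteq> B" "h 0 = 0"
  shows "poly_eval h \<sigma> f = (\<Sum>m\<in>B. h (coef f m) * prod_mset (image_mset \<sigma> m))"
  unfolding poly_eval_def by (rule sum.mono_neutral_left) (use assms in auto)

lemma poly_eval_hom:
  assumes "subr_hom S h"
  shows "subr_hom (mpoly_over I S) (poly_eval h \<sigma>)"
proof -
  interpret h: subr_hom S h by fact
  have S: "subr S" by unfold_locales
  interpret M: subr "mpoly_over I S" by (rule subr_mpoly_over[OF S])
  let ?\<sigma> = "\<lambda>m. prod_mset (image_mset \<sigma> m)"
  show ?thesis
  proof (intro subr_hom.intro M.subr_axioms subr_hom_axioms.intro)
    have "{m. coef 1 m \<noteq> (0 :: 'a)} \<subseteq> {{#}}" by (auto simp: coef_one)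
    then show "poly_eval h \<sigma> 1 = 1"
      by (subst poly_eval_superset[of "{{#}}"]) (auto simp: h.hom_zero h.hom_one coef_one)
    fix f g assume fg: "f \<in> mpoly_over I S" "g \<in> mpoly_over I S"
    let ?A = "{m. coef f m \<noteq> 0}" and ?B = "{m. coef g m \<noteq> 0}"
    have fin: "finite ?A" "finite ?B" using fg by (auto simp: mpoly_over_def)
    have c: "coef f m \<in> S" "coef g m \<in> S" for m using fg by (auto simp: mpoly_over_def mps_over_coef)
    have "poly_eval h \<sigma> (f + g) = (\<Sum>m\<in>?A \<union> ?B. h (coef (f + g) m) * ?\<sigma> m)"
      by (rule poly_eval_superset) (use fin h.hom_zero in auto)
    also have "\<dots> = (\<Sum>m\<in>?A \<union> ?B. h (coef f m) * ?\<sigma> m) + (\<Sum>m\<in>?A \<union> ?B. h (coef g m) * ?\<sigma> m)"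
      by (simp add: h.hom_add c distrib_right sum.distrib)
    also have "\<dots> = poly_eval h \<sigma> f + poly_eval h \<sigma> g"
      by (subst (1 2) poly_eval_superset[of "?A \<union> ?B"]) (use fin h.hom_zero in auto)
    finally show "poly_eval h \<sigma> (f + g) = poly_eval h \<sigma> f + poly_eval h \<sigma> g" .
    define B where "B = (\<lambda>(a, b). a + b) ` (?A \<times> ?B)"
    have finB: "finite B" unfolding B_def using fin by simp
    have supp: "{m. coef (f * g) m \<noteq> 0} \<subseteq> B"
    proof
      fix m assume "m \<in> {m. coef (f * g) m \<noteq> 0}"
      then have "(\<Sum>x\<in>splits m. case x of (a, b) \<Rightarrow> coef f a * coef g b) \<noteq> 0" by (simp add: coef_mult)
      then obtain x where x: "x \<in> splits m" "(case x of (a, b) \<Rightarrow> coef f a * coef g b) \<noteq> 0"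
        by (metis (no_types, lifting) sum.neutral)
      then show "m \<in> B" unfolding B_def by (cases x) (auto intro!: image_eqI[of _ _ x])
    qed
    let ?t = "\<lambda>x. h (coef f (fst x)) * ?\<sigma> (fst x) * (h (coef g (snd x)) * ?\<sigma> (snd x))"
    have "poly_eval h \<sigma> (f * g) = (\<Sum>m\<in>B. h (coef (f * g) m) * ?\<sigma> m)"
      by (rule poly_eval_superset) (rule finB supp h.hom_zero)+
    also have "\<dots> = (\<Sum>m\<in>B. \<Sum>x\<in>splits m. ?t x)"
    proof (rule sum.cong[OF refl])
      fix m
      have "h (coef (f * g) m) = (\<Sum>x\<in>splits m. h (coef f (fst x)) * h (coef g (snd x)))"
        unfolding coef_mult split_beta by (subst h.hom_sum) (auto simp: c h.hom_mult)
      then have "h (coef (f * g) m) * ?\<sigma> m = (\<Sum>x\<in>splits m. h (coef f (fst x)) * h (coef g (snd x)) * ?\<sigma> m)"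
        by (simp add: sum_distrib_right)
      also have "\<dots> = (\<Sum>x\<in>splits m. ?t x)"
        by (rule sum.cong[OF refl]) (auto simp: splits_def algebra_simps)
      finally show "h (coef (f * g) m) * ?\<sigma> m = (\<Sum>x\<in>splits m. ?t x)" .
    qed
    also have "\<dots> = (\<Sum>(m, x)\<in>Sigma B splits. ?t x)"
      by (subst sum.Sigma) (auto simp: finB)
    \<comment> \<open>Splittings outside the product of the two supports contribute nothing, because
      a coefficient vanishes there and h 0 = 0.\<close>
    also have "\<dots> = (\<Sum>(m, x)\<in>(\<lambda>x. (fst x + snd x, x)) ` (?A \<times> ?B). ?t x)"
    proof (rule sum.mono_neutral_right)
      show "finite (Sigma B splits)" using finB by auto
      show "(\<lambda>x. (fst x + snd x, x)) ` (?A \<times> ?B) \<subseteq> Sigma B splits"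
        by (auto simp: B_def splits_def image_iff)
      show "\<forall>i\<in>Sigma B splits - (\<lambda>x. (fst x + snd x, x)) ` (?A \<times> ?B). (case i of (m, x) \<Rightarrow> ?t x) = 0"
        by (auto simp: splits_def image_iff h.hom_zero)
    qed
    also have "\<dots> = (\<Sum>x\<in>?A \<times> ?B. ?t x)"
      by (subst sum.reindex) (auto simp: inj_on_def)
    also have "\<dots> = poly_eval h \<sigma> f * poly_eval h \<sigma> g"
      unfolding poly_eval_def sum_product sum.cartesian_product by (simp add: split_beta)
    finally show "poly_eval h \<sigma> (f * g) = poly_eval h \<sigma> f * poly_eval h \<sigma> g" .
  qed
qed

lemma poly_eval_mconst:
  assumes "h 0 = 0"
  shows "poly_eval h \<sigma> (mconst c) = h c"
  by (subst poly_eval_superset[of "{{#}}"]) (auto simp: coef_mconst assms)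

lemma poly_eval_mvar:
  assumes "h 0 = 0" "h 1 = 1"
  shows "poly_eval h \<sigma> (mvar i) = \<sigma> i"
  by (subst poly_eval_superset[of "{{#i#}}"]) (auto simp: coef_mvar assms)

section \<open>The expansion along the identity\<close>

lemma (in subr) det_mem:
  assumes "Y \<in> smats S n"
  shows "det Y \<in> S"
  unfolding det_def'[OF smats_carrier[OF assms]]
  using assms by (intro sum_mem mult_mem prod_mem) (auto simp: sign_def permutes_in_image)

lemma (in subr_hom) hom_det:
  assumes "Y \<in> smats R n"
  shows "h (det Y) = det (map_mat h Y)"
proof -
  have Y: "map_mat h Y \<in> carrier_mat n n" using smats_carrier[OF assms] by simp
  have e: "Y $$ (i, \<pi> i) \<in> R" if "\<pi> permutes {0..<n}" "i \<in> {0..<n}" for \<pi> i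
    using assms that permutes_in_image[OF that(1), of i] by auto
  have s: "signof \<pi> \<in> R" "h (signof \<pi>) = signof \<pi>" for \<pi> :: "nat \<Rightarrow> nat"
    by (auto simp: sign_def hom_one hom_uminus)
  have "h (det Y) = (\<Sum>\<pi> | \<pi> permutes {0..<n}. h (signof \<pi> * (\<Prod>i = 0..<n. Y $$ (i, \<pi> i))))"
    unfolding det_def'[OF smats_carrier[OF assms]] by (rule hom_sum) (use e s in \<open>auto intro!: mult_mem prod_mem\<close>)
  also have "\<dots> = (\<Sum>\<pi> | \<pi> permutes {0..<n}. signof \<pi> * (\<Prod>i = 0..<n. map_mat h Y $$ (i, \<pi> i)))"
  proof (rule sum.cong[OF refl])
    fix \<pi> assume "\<pi> \<in> {\<pi>. \<pi> permutes {0..<n}}"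
    then have p: "\<pi> permutes {0..<n}" by simp
    have "h (\<Prod>i = 0..<n. Y $$ (i, \<pi> i)) = (\<Prod>i = 0..<n. h (Y $$ (i, \<pi> i)))"
      by (rule hom_prod[OF e[OF p]])
    also have "\<dots> = (\<Prod>i = 0..<n. map_mat h Y $$ (i, \<pi> i))"
      using carrier_matD[OF smats_carrier[OF assms]] permutes_in_image[OF p] by (intro prod.cong) auto
    finally show "h (signof \<pi> * (\<Prod>i = 0..<n. Y $$ (i, \<pi> i))) = signof \<pi> * (\<Prod>i = 0..<n. map_mat h Y $$ (i, \<pi> i))"
      using e[OF p] s by (subst hom_mult) (auto intro: prod_mem)
  qed
  finally show ?thesis unfolding det_def'[OF Y] .
qed

lemma (in presentation) pi_rmat_det:
  assumes "Y \<in> smats W n"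
  shows "rmat_det R (map_mat \<pi> Y) = \<pi> (det Y)"
proof -
  note Yd = carrier_matD[OF smats_carrier[OF assms]]
  have e: "Y $$ (i, s i) \<in> W" if "s permutes {..<n}" "i \<in> {..<n}" for s i
    using assms that permutes_in_image[OF that(1), of i] by auto
  have sg: "signof s \<in> W" "(if evenperm s then \<one>\<^bsub>R\<^esub> else \<ominus>\<^bsub>R\<^esub> \<one>\<^bsub>R\<^esub>) = \<pi> (signof s)" for s :: "nat \<Rightarrow> nat"
    by (auto simp: sign_def pi_one pi_uminus)
  have "rmat_det R (map_mat \<pi> Y) = finsum R (\<lambda>s. \<pi> (signof s * (\<Prod>i<n. Y $$ (i, s i)))) {s. s permutes {..<n}}"
    unfolding rmat_det_def
  proof (rule R.finsum_cong')
    show "{s. s permutes {..<dim_row (map_mat \<pi> Y)}} = {s. s permutes {..<n}}" by (simp add: Yd)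
    show "(\<lambda>s. \<pi> (signof s * (\<Prod>i<n. Y $$ (i, s i)))) \<in> {s. s permutes {..<n}} \<rightarrow> carrier R"
      using e sg by (auto intro!: pi_closed mult_mem prod_mem)
    fix s assume "s \<in> {s. s permutes {..<n}}"
    then have s: "s permutes {..<n}" by simp
    have "finprod R (\<lambda>i. map_mat \<pi> Y $$ (i, s i)) {..<dim_row (map_mat \<pi> Y)} = finprod R (\<lambda>i. \<pi> (Y $$ (i, s i))) {..<n}"
      using e[OF s] Yd permutes_in_image[OF s] by (intro R.finprod_cong') (auto intro!: pi_closed)
    also have "\<dots> = \<pi> (\<Prod>i<n. Y $$ (i, s i))" by (rule pi_finprod) (use e[OF s] in auto)
    finally show "(if evenperm s then \<one>\<^bsub>R\<^esub> else \<ominus>\<^bsub>R\<^esub> \<one>\<^bsub>R\<^esub>) \<otimes>\<^bsub>R\<^esub>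
        finprod R (\<lambda>i. map_mat \<pi> Y $$ (i, s i)) {..<dim_row (map_mat \<pi> Y)} = \<pi> (signof s * (\<Prod>i<n. Y $$ (i, s i)))"
      using sg e[OF s] by (subst pi_mult) (auto intro!: prod_mem)
  qed
  also have "\<dots> = \<pi> (\<Sum>s | s permutes {..<n}. signof s * (\<Prod>i<n. Y $$ (i, s i)))"
    by (rule pi_finsum) (use e sg in \<open>auto intro!: mult_mem prod_mem finite_permutations\<close>)
  also have "\<dots> = \<pi> (det Y)" unfolding det_def'[OF smats_carrier[OF assms]] by (simp add: atLeast0LessThan)
  finally show ?thesis .
qed

section \<open>The completed coordinate ring of GL_n and its expansion at the identity\<close>

context chern_core
begin

abbreviation "AA \<equiv> rec S"
abbreviation "Ahat \<equiv> padic_completion AA p"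
abbreviation I' :: "(nat \<times> nat) option set" where "I' \<equiv> insert None (Some ` I)"
abbreviation "W1 \<equiv> mpoly_over I' S"

sublocale A: presentation S AA "\<lambda>x. x" "{0}" p
  by (rule presentation_rec[OF subr_S])

sublocale Ah: padic_limring S A.NN Ahat A.LL p "{0}"
  by (rule A.padic_limring_completion)

sublocale T: presentation R "T_series AA n" coef "{0}" p
  unfolding T_series_def by (rule mpowser_presentation[OF subr_S])

sublocale Th: padic_limring R "powser_N I S p" "T_series_hat AA n p" "powser_lim A.LL" p "{0}"
  unfolding T_series_hat_def T_series_def
  by (rule padic_limring_mpowser[OF Ah.padic_limring_axioms])

sublocale P: presentation W1 "GL_poly AA n" coef "{0}" p
  unfolding GL_poly_def by (rule mpoly_presentation[OF subr_S])

definition Xvar :: "((nat \<times> nat) option, complex) mps mat" where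
  "Xvar = mat n n (\<lambda>kl. mvar (Some kl))"

lemma Xvar_mem: "Xvar \<in> smats W1 n"
  unfolding Xvar_def by (rule smatsI) (auto intro!: mvar_mpoly[OF subr_S])

definition gen :: "((nat \<times> nat) option, complex) mps" where
  "gen = mvar None * det Xvar - 1"

lemma None_mem: "mvar None \<in> W1"
  by (rule mvar_mpoly[OF subr_S]) simp

lemma gen_mem: "gen \<in> W1"
  unfolding gen_def by (intro P.diff_mem P.mult_mem None_mem P.det_mem[OF Xvar_mem] P.one_mem)

lemma GL_ideal_eq: "GL_ideal AA n = coef ` {z * gen | z. z \<in> W1}"
proof -
  have "mat n n (\<lambda>kl. ring.indexed_var AA (Some kl)) = map_mat coef Xvar"
    unfolding Xvar_def by (rule eq_matI) (auto simp: indexed_var_rec[OF subr_S])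
  then have "rmat_det (GL_poly AA n) (mat n n (\<lambda>kl. ring.indexed_var AA (Some kl))) = coef (det Xvar)"
    using P.pi_rmat_det[OF Xvar_mem] by simp
  then have "ring.indexed_var AA None \<otimes>\<^bsub>GL_poly AA n\<^esub>
       rmat_det (GL_poly AA n) (mat n n (\<lambda>kl. ring.indexed_var AA (Some kl))) \<ominus>\<^bsub>GL_poly AA n\<^esub> \<one>\<^bsub>GL_poly AA n\<^esub> = coef gen"
    unfolding indexed_var_rec[OF subr_S] gen_def
    by (simp add: P.pi_minus P.pi_mult P.pi_one None_mem P.det_mem[OF Xvar_mem] del: coef_diff)
  then have "GL_ideal AA n = PIdl\<^bsub>GL_poly AA n\<^esub> (coef gen)" unfolding GL_ideal_def Let_def by simp
  also have "\<dots> = (\<lambda>z. coef (z * gen)) ` W1"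
    unfolding cgenideal_def P.carrier_R by (auto simp: P.pi_mult gen_mem)
  also have "\<dots> = coef ` {z * gen | z. z \<in> W1}" by blast
  finally show ?thesis .
qed

definition K1 where "K1 = {z * gen | z. z \<in> W1}"

lemma GL_ideal_ideal: "ideal (GL_ideal AA n) (GL_poly AA n)"
  unfolding GL_ideal_def Let_def
proof (rule P.R.cgenideal_ideal)
  have "ring.indexed_var AA None \<in> carrier (GL_poly AA n)"
    unfolding indexed_var_rec[OF subr_S] by (rule P.pi_closed[OF None_mem])
  moreover have "rmat_det (GL_poly AA n) (mat n n (\<lambda>kl. ring.indexed_var AA (Some kl))) \<in> carrier (GL_poly AA n)"
  proof -
    have "mat n n (\<lambda>kl. ring.indexed_var AA (Some kl)) = map_mat coef Xvar"
      unfolding Xvar_def by (rule eq_matI) (auto simp: indexed_var_rec[OF subr_S])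
    then show ?thesis using P.pi_rmat_det[OF Xvar_mem] P.pi_closed[OF P.det_mem[OF Xvar_mem]] by simp
  qed
  ultimately show "ring.indexed_var AA None \<otimes>\<^bsub>GL_poly AA n\<^esub>
       rmat_det (GL_poly AA n) (mat n n (\<lambda>kl. ring.indexed_var AA (Some kl))) \<ominus>\<^bsub>GL_poly AA n\<^esub> \<one>\<^bsub>GL_poly AA n\<^esub>
       \<in> carrier (GL_poly AA n)" by simp
qed

abbreviation gpi where "gpi \<equiv> \<lambda>w. GL_ideal AA n +>\<^bsub>GL_poly AA n\<^esub> coef w"

text \<open>\<open>coef\<close> is injective, so the kernel of the composite onto the coordinate
  ring is the principal ideal \<open>K1\<close> generated by \<open>gen\<close>, that is, by the
  relation y det(x) = 1.\<close>

sublocale G: presentation W1 "GL_ring AA n" gpi K1 p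
proof -
  have "{w \<in> W1. coef w \<in> GL_ideal AA n} = K1"
  proof -
    have sub: "{z * gen | z. z \<in> W1} \<subseteq> W1" using P.mult_mem[OF _ gen_mem] by blast
    have "coef w \<in> GL_ideal AA n \<longleftrightarrow> w \<in> {z * gen | z. z \<in> W1}" for w
      unfolding GL_ideal_eq by (rule inj_image_mem_iff) (simp add: inj_def coef_inject)
    then show ?thesis unfolding K1_def using sub by blast
  qed
  then show "presentation W1 (GL_ring AA n) gpi K1"
    unfolding GL_ring_def using P.quotient_presentation[OF GL_ideal_ideal] by simp
qed

sublocale Gh: padic_limring W1 G.NN "GLhat AA n p" G.LL p K1
  unfolding GLhat_def by (rule G.padic_limring_completion)

lemma GL_const_eq: "GL_const AA n c = gpi (mconst c)"
  unfolding GL_const_def indexed_const_rec[OF subr_S] ..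

lemma GLhat_const_eq: "GLhat_const AA n p c = G.LL (\<lambda>_. mconst c)"
  unfolding GLhat_const_def GL_const_eq by (rule G.to_completion_pi)

lemma GLhat_coord_eq: "GLhat_coord AA n p = map_mat (\<lambda>w. G.LL (\<lambda>_. w)) Xvar"
  unfolding GLhat_coord_def GL_coord_def Xvar_def
  by (rule eq_matI) (auto simp: indexed_var_rec[OF subr_S] G.to_completion_pi)

lemma GLhat_struct_eq:
  assumes "Ah.coh g"
  shows "GLhat_struct AA n p (A.LL g) = G.LL (\<lambda>k. mconst (g k))"
  unfolding GLhat_struct_def
proof (rule completion_map_LL[OF A.presentation_axioms G.presentation_axioms])
  show "mconst w \<in> W1" if "w \<in> S" for w using that by (rule mconst_mpoly[OF subr_S])
  show "GL_const AA n w = gpi (mconst w)" for w by (rule GL_const_eq)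
  show "g k \<in> S" for k by (rule Ah.cohD[OF assms])
  fix v w k assume "v \<in> S" "w \<in> S" "v - w \<in> A.NN k"
  then obtain h where h: "h \<in> S" "v - w = h * of_nat p ^ k" by (auto simp: A.NN_def)
  have "mconst v - mconst w = (mconst (v - w) :: ((nat \<times> nat) option, complex) mps)" by simp
  also have "\<dots> = mconst h * of_nat p ^ k" unfolding h(2) by (simp add: mconst_power mconst_of_nat)
  finally show "mconst v - mconst w \<in> G.NN k" using Gh.pow_mem_N[OF mconst_mpoly[OF subr_S h(1)]] by simp
qed

subsection \<open>Evaluation at the identity expansion\<close>

text \<open>The inverse of x = 1 + T by the geometric series; its determinant is the image of the
  variable y under evaluation.\<close>

definition Xinv where "Xinv = mseries (inverse (1 + fps_X)) (xm - 1\<^sub>m n)"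

lemma xm_minus_one: "xm - 1\<^sub>m n \<in> carrier_mat n n" "mord 1 (xm - 1\<^sub>m n)"
proof -
  show c: "xm - 1\<^sub>m n \<in> carrier_mat n n" by (rule minus_carrier_mat) simp
  show "mord 1 (xm - 1\<^sub>m n)"
  proof (rule mord_ctm[OF c])
    show "ctm (xm - 1\<^sub>m n) = 0\<^sub>m n n"
      by (simp add: ct.map_mat_diff[OF xm_mem R.smats_intros(4)] ctm_xm ct.map_mat_one minus_self)
  qed
qed

lemma xm_Xinv: "xm * Xinv = 1\<^sub>m n"
proof -
  have "1\<^sub>m n + (xm - 1\<^sub>m n) = xm" by (rule one_plus_minus_one) simp
  then show ?thesis using mseries_inverse[OF xm_minus_one] unfolding Xinv_def by metis
qed

lemma Xinv_mem: "Xinv \<in> smats R n"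
proof -
  have "fps_nth (inverse (1 + fps_X) :: complex fps) i = (- 1) ^ i" for i
    by (simp add: fps_binomial_minus_one[symmetric] gbinomial_minus[of 1, simplified] binomial_gbinomial[symmetric])
  then have "fps_nth (inverse (1 + fps_X) :: complex fps) i \<in> S" for i
    using phi.power_mem[OF phi.uminus_mem[OF phi.one_mem]] by (simp only:)
  then show ?thesis
    unfolding Xinv_def by (intro mseries_over[OF subr_S] R.smats_intros xm_mem)
qed

definition \<sigma> :: "(nat \<times> nat) option \<Rightarrow> (nat \<times> nat, complex) mps" where
  "\<sigma> = case_option (det Xinv) (\<lambda>kl. xm $$ kl)"

definition ev :: "((nat \<times> nat) option, complex) mps \<Rightarrow> (nat \<times> nat, complex) mps" where
  "ev = poly_eval mconst \<sigma>"

sublocale ev: subr_hom W1 ev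
  unfolding ev_def by (rule poly_eval_hom[OF mconst_hom[OF subr_S]])

lemma ev_mconst: "ev (mconst c) = mconst c" and ev_None: "ev (mvar None) = det Xinv"
  and ev_Some: "ev (mvar (Some kl)) = xm $$ kl"
  by (simp_all add: ev_def poly_eval_mconst poly_eval_mvar \<sigma>_def)

lemma ev_Xvar: "map_mat ev Xvar = xm"
  by (rule eq_matI) (simp_all add: Xvar_def ev_Some)

lemma ev_gen: "ev gen = 0"
proof -
  have "det xm * det Xinv = 1"
    using det_mult[OF car(1) smats_carrier[OF Xinv_mem]] by (simp add: xm_Xinv)
  then show ?thesis
    unfolding gen_def
    by (simp add: ev.hom_diff ev.hom_mult None_mem P.det_mem[OF Xvar_mem] ev.hom_one ev_None
        ev.hom_det[OF Xvar_mem] ev_Xvar mult.commute)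
qed

lemma ev_mem: "w \<in> W1 \<Longrightarrow> ev w \<in> R"
proof -
  have "subr {w \<in> W1. ev w \<in> R}"
    by unfold_locales (auto simp: ev.hom_one ev.hom_add ev.hom_mult ev.hom_uminus)
  then have "W1 \<subseteq> {w \<in> W1. ev w \<in> R}"
  proof (rule mpoly_over_induct)
    show "mconst c \<in> {w \<in> W1. ev w \<in> R}" if "c \<in> S" for c
      using that by (simp add: ev_mconst mconst_over[OF subr_S] mconst_mpoly[OF subr_S])
    fix i assume i: "i \<in> I'"
    show "mvar i \<in> {w \<in> W1. ev w \<in> R}"
    proof (cases i)
      case None
      then show ?thesis using None_mem R.det_mem[OF Xinv_mem] by (simp add: ev_None)
    next
      case (Some kl)
      then show ?thesis using i mvar_mpoly[OF subr_S i] xm_mem by (auto simp: ev_Some)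
    qed
  qed
  then show "w \<in> W1 \<Longrightarrow> ev w \<in> R" by blast
qed

text \<open>Evaluation kills \<open>gen\<close>, hence \<open>K1\<close>, and respects integers, so
  it maps the preimage of the multiples of p^k to multiples of p^k and lifts to the
  completions.\<close>

sublocale iota: limring_map W1 G.NN "GLhat AA n p" G.LL R "powser_N I S p" "T_series_hat AA n p" "powser_lim A.LL" ev
proof unfold_locales
  show "ev w \<in> R" if "w \<in> W1" for w using that by (rule ev_mem)
  fix w k assume "w \<in> G.NN k"
  then obtain h y where h: "h \<in> W1" "y \<in> K1" "w = h * of_nat p ^ k + y" unfolding G.NN_def by blast
  from h(2) obtain z where z: "z \<in> W1" "y = z * gen" unfolding K1_def by blast
  note hz = h(1) z(1) h(3)[unfolded z(2)]
  have "ev w = ev h * of_nat p ^ k"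
  proof -
    have m: "h * of_nat p ^ k \<in> W1" "z * gen \<in> W1"
      by (intro P.mult_mem hz P.power_mem P.of_nat_mem gen_mem)+
    have "ev (h * of_nat p ^ k) = ev h * of_nat p ^ k"
      unfolding ev.hom_mult[OF hz(1) P.power_mem[OF P.of_nat_mem]] ev.hom_power[OF P.of_nat_mem] ev.hom_of_nat ..
    moreover have "ev (z * gen) = 0" unfolding ev.hom_mult[OF hz(2) gen_mem] ev_gen by simp
    ultimately show ?thesis unfolding hz(3) ev.hom_add[OF m] by simp
  qed
  then show "ev w \<in> powser_N I S p k" using Th.pow_mem_N[OF ev_mem[OF hz(1)]] by simp
qed

abbreviation "iota \<equiv> iota.lift"

end

context chern_core
begin

text \<open>Agreement on constants and coordinates spreads to the determinant, then to y as its
  inverse, then to all polynomials; \<open>hom_eqI\<close> extends it to the completion.\<close>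

lemma hom_generators:
  assumes h: "h \<in> Ring.ring_hom (GLhat AA n p) (T_series_hat AA n p)"
    and h': "h' \<in> Ring.ring_hom (GLhat AA n p) (T_series_hat AA n p)"
    and c: "\<And>c. c \<in> S \<Longrightarrow> h (G.LL (\<lambda>_. mconst c)) = h' (G.LL (\<lambda>_. mconst c))"
    and x: "\<And>kl. kl \<in> I \<Longrightarrow> h (G.LL (\<lambda>_. mvar (Some kl))) = h' (G.LL (\<lambda>_. mvar (Some kl)))"
    and f: "f \<in> carrier (GLhat AA n p)"
  shows "h f = h' f"
proof (rule Gh.hom_eqI[OF Th.padic_limring_axioms h h' _ f])
  let ?l = "\<lambda>w. G.LL (\<lambda>_. w)"
  have lc: "?l w \<in> carrier (GLhat AA n p)" if "w \<in> W1" for w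
    using that by (intro Gh.L_closed Gh.coh_const)
  have hadd: "g (?l (v + w)) = g (?l v) \<oplus>\<^bsub>T_series_hat AA n p\<^esub> g (?l w)"
    and hmult: "g (?l (v * w)) = g (?l v) \<otimes>\<^bsub>T_series_hat AA n p\<^esub> g (?l w)"
    if "v \<in> W1" "w \<in> W1" "g \<in> Ring.ring_hom (GLhat AA n p) (T_series_hat AA n p)" for v w g
    using ring_hom_add[OF that(3) lc[OF that(1)] lc[OF that(2)]] ring_hom_mult[OF that(3) lc[OF that(1)] lc[OF that(2)]]
    by (simp_all add: Gh.L_add Gh.L_mult Gh.coh_const that)
  have hone: "g (?l 1) = \<one>\<^bsub>T_series_hat AA n p\<^esub>" if "g \<in> Ring.ring_hom (GLhat AA n p) (T_series_hat AA n p)" for g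
    using ring_hom_one[OF that] by (simp add: Gh.L_one)
  let ?E = "{w \<in> W1. h (?l w) = h' (?l w)}"
  have mc: "mconst c \<in> ?E" if "c \<in> S" for c using that c mconst_mpoly[OF subr_S] by simp
  have sE: "subr ?E"
  proof
    show "1 \<in> ?E" using hone[OF h] hone[OF h'] by simp
    fix v w assume v: "v \<in> ?E" and w: "w \<in> ?E"
    show "v + w \<in> ?E" using v w hadd[OF _ _ h] hadd[OF _ _ h'] by simp
    show "v * w \<in> ?E" using v w hmult[OF _ _ h] hmult[OF _ _ h'] by simp
    have "mconst (- 1) \<in> ?E" by (rule mc) simp
    then have "mconst (- 1) * v \<in> ?E" using v hmult[OF _ _ h] hmult[OF _ _ h'] by (simp del: mconst_simps)
    then show "- v \<in> ?E" by simp
  qed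
  have sm: "mvar (Some kl) \<in> ?E" if "kl \<in> I" for kl
    using x[OF that] mvar_mpoly[OF subr_S, of "Some kl" I'] that by simp
  have D: "det Xvar \<in> ?E"
    by (rule subr.det_mem[OF sE, of _ n]) (rule smatsI, auto simp: Xvar_def intro!: sm[simplified])
  have "mvar None \<in> ?E"
  proof -
    have y: "?l (mvar None * det Xvar) = ?l 1"
    proof (subst Gh.L_eq_iff)
      have "1 * gen \<in> K1" unfolding K1_def using P.one_mem by blast
      then have "gen \<in> K1" by simp
      then show "\<forall>k. mvar None * det Xvar - 1 \<in> G.NN k"
        unfolding gen_def[symmetric] using Gh.K_sub_N by blast
    qed (intro Gh.coh_const P.mult_mem None_mem P.det_mem[OF Xvar_mem] P.one_mem)+
    have inv: "g (?l (mvar None)) \<otimes>\<^bsub>T_series_hat AA n p\<^esub> g (?l (det Xvar)) = \<one>\<^bsub>T_series_hat AA n p\<^esub>"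
      if "g \<in> Ring.ring_hom (GLhat AA n p) (T_series_hat AA n p)" for g
      using hmult[OF None_mem P.det_mem[OF Xvar_mem] that] hone[OF that] by (simp add: y)
    have cl: "g (?l w) \<in> carrier (T_series_hat AA n p)" if "w \<in> W1"
      "g \<in> Ring.ring_hom (GLhat AA n p) (T_series_hat AA n p)" for g w
      using ring_hom_closed[OF that(2) lc[OF that(1)]] .
    have "h (?l (mvar None)) = h' (?l (mvar None))"
    proof (rule Th.Q.inv_unique)
      show "h (?l (mvar None)) \<otimes>\<^bsub>T_series_hat AA n p\<^esub> h (?l (det Xvar)) = \<one>\<^bsub>T_series_hat AA n p\<^esub>" by (rule inv[OF h])
      show "h (?l (det Xvar)) \<otimes>\<^bsub>T_series_hat AA n p\<^esub> h' (?l (mvar None)) = \<one>\<^bsub>T_series_hat AA n p\<^esub>"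
        using inv[OF h'] D Th.Q.m_comm[OF cl[OF None_mem h'] cl[OF P.det_mem[OF Xvar_mem] h]] by simp
    qed (intro cl h h' None_mem P.det_mem[OF Xvar_mem])+
    then show ?thesis using None_mem by simp
  qed
  then have "mvar i \<in> ?E" if "i \<in> I'" for i using that sm by auto
  from mpoly_over_induct[OF sE mc this] show "h (?l w) = h' (?l w)" if "w \<in> W1" for w using that by blast
qed

end

context chern_core
begin

lemma series_coord_hat: "series_coord Ahat n = map_mat (\<lambda>w. powser_lim A.LL (\<lambda>_. w)) xm"
proof (rule eq_matI)
  let ?T = "T_series_hat AA n p"
  fix i j assume "i < dim_row (map_mat (\<lambda>w. powser_lim A.LL (\<lambda>_. w)) xm)" "j < dim_col (map_mat (\<lambda>w. powser_lim A.LL (\<lambda>_. w)) xm)"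
  then have ij: "i < n" "j < n" by simp_all
  have v: "ring.indexed_var Ahat (i, j) = powser_lim A.LL (\<lambda>_. mvar (i, j))"
    unfolding ring.indexed_var_def[OF Ah.Q.ring_axioms] ring.indexed_pmult_def[OF Ah.Q.ring_axioms]
      ring.indexed_const_def[OF Ah.Q.ring_axioms]
  proof (rule ext)
    fix m :: "(nat \<times> nat) multiset"
    have iff: "(i, j) \<in># m \<and> m - {#(i, j)#} = {#} \<longleftrightarrow> m = {#(i, j)#}"
    proof
      assume a: "(i, j) \<in># m \<and> m - {#(i, j)#} = {#}"
      have "add_mset (i, j) (m - {#(i, j)#}) = m" using conjunct1[OF a] by (rule insert_DiffM)
      then show "m = {#(i, j)#}" unfolding conjunct2[OF a] by simp
    qed simp
    have nest: "(if P then if P' then u else v else v) = (if P \<and> P' then u else v)" for P P' and u v :: 'z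
      by simp
    show "(if (i, j) \<in># m then if m - {#(i, j)#} = {#} then \<one>\<^bsub>Ahat\<^esub> else \<zero>\<^bsub>Ahat\<^esub> else \<zero>\<^bsub>Ahat\<^esub>) =
        powser_lim A.LL (\<lambda>_. mvar (i, j)) m"
      unfolding nest iff powser_lim_def coef_mvar Ah.L_one Ah.L_zero by (simp only: if_distrib[of A.LL] split: if_split) simp
  qed
  have m: "mvar (i, j) \<in> R" using ij by (intro mvar_over[OF subr_S]) auto
  have "series_coord Ahat n $$ (i, j) =
      (if i = j then \<one>\<^bsub>?T\<^esub> else \<zero>\<^bsub>?T\<^esub>) \<oplus>\<^bsub>?T\<^esub> powser_lim A.LL (\<lambda>_. mvar (i, j))"
    using ij by (simp add: series_coord_def rmat_add_def rmat_one_def v T_series_hat_def)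
  also have "\<dots> = powser_lim A.LL (\<lambda>_. (if i = j then 1 else 0) + mvar (i, j))"
    using Th.L_add[OF Th.coh_const[OF R.one_mem] Th.coh_const[OF m]]
      Th.L_add[OF Th.coh_const[OF R.zero_mem] Th.coh_const[OF m]]
    by (cases "i = j") (simp_all add: Th.L_one Th.L_zero)
  finally show "series_coord Ahat n $$ (i, j) = map_mat (\<lambda>w. powser_lim A.LL (\<lambda>_. w)) xm $$ (i, j)"
    using ij by (simp add: xm_def)
qed (simp_all add: series_coord_def rmat_add_def rmat_one_def)

lemma iota_const: "w \<in> W1 \<Longrightarrow> iota (G.LL (\<lambda>_. w)) = powser_lim A.LL (\<lambda>_. ev w)"
  by (rule iota.lift_L[OF Gh.coh_const])

lemma indexed_const_hat: "ring.indexed_const Ahat (A.LL g) = powser_lim A.LL (\<lambda>k. mconst (g k))"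
  unfolding ring.indexed_const_def[OF Ah.Q.ring_axioms] powser_lim_def
  by (auto simp: coef_mconst Ah.L_zero)

lemma coh_mconst: "Ah.coh g \<Longrightarrow> Gh.coh (\<lambda>k. mconst (g k))"
  unfolding coherent_def
proof (intro allI conjI)
  fix k assume g: "\<forall>k. g k \<in> S \<and> g (Suc k) - g k \<in> A.NN k"
  then show "mconst (g k) \<in> W1" using mconst_mpoly[OF subr_S] by blast
  obtain h where h: "h \<in> S" "g (Suc k) - g k = h * of_nat p ^ k" using g by (auto simp: A.NN_def)
  have "mconst (g (Suc k)) - mconst (g k) = (mconst (g (Suc k) - g k) :: ((nat \<times> nat) option, complex) mps)" by simp
  also have "\<dots> = mconst h * of_nat p ^ k" unfolding h(2) by (simp add: mconst_power mconst_of_nat)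
  finally show "mconst (g (Suc k)) - mconst (g k) \<in> G.NN k" using Gh.pow_mem_N[OF mconst_mpoly[OF subr_S h(1)]] by simp
qed

text \<open>Existence is the lift of evaluation. Uniqueness is \<open>hom_generators\<close>:
  constant sequences under the structure map give the constants, and the coordinate matrix gives the
  variables.\<close>

lemma identity_expansion_eq: "identity_expansion AA n p = iota"
  unfolding identity_expansion_def
proof (rule the_equality)
  have s: "iota (GLhat_struct AA n p a) = ring.indexed_const Ahat a" if "a \<in> carrier Ahat" for a
  proof -
    obtain g where g: "Ah.coh g" "a = A.LL g" using Ah.carrierE[OF \<open>a \<in> carrier Ahat\<close>] by blast
    show ?thesis
      unfolding g(2) GLhat_struct_eq[OF g(1)] indexed_const_hat iota.lift_L[OF coh_mconst[OF g(1)]] ev_mconst ..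
  qed
  have x: "map_mat iota (GLhat_coord AA n p) = series_coord Ahat n"
    unfolding series_coord_hat GLhat_coord_eq
  proof (rule eq_matI)
    fix i j assume "i < dim_row (map_mat (\<lambda>w. powser_lim A.LL (\<lambda>_. w)) xm)" "j < dim_col (map_mat (\<lambda>w. powser_lim A.LL (\<lambda>_. w)) xm)"
    then have ij: "i < n" "j < n" by simp_all
    then show "map_mat iota (map_mat (\<lambda>w. G.LL (\<lambda>_. w)) Xvar) $$ (i, j) = map_mat (\<lambda>w. powser_lim A.LL (\<lambda>_. w)) xm $$ (i, j)"
      using iota_const[OF mvar_mpoly[OF subr_S, of "Some (i, j)" I']] by (simp add: Xvar_def ev_Some)
  qed (simp_all add: Xvar_def)
  show "iota \<in> Ring.ring_hom (GLhat AA n p) (T_series_hat AA n p) \<inter> extensional (carrier (GLhat AA n p)) \<and>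
    (\<forall>a\<in>carrier Ahat. iota (GLhat_struct AA n p a) = ring.indexed_const Ahat a) \<and>
    map_mat iota (GLhat_coord AA n p) = series_coord Ahat n"
    using iota.lift_hom iota.lift_extensional s x by blast
  fix \<iota> assume a: "\<iota> \<in> Ring.ring_hom (GLhat AA n p) (T_series_hat AA n p) \<inter> extensional (carrier (GLhat AA n p)) \<and>
    (\<forall>a\<in>carrier Ahat. \<iota> (GLhat_struct AA n p a) = ring.indexed_const Ahat a) \<and>
    map_mat \<iota> (GLhat_coord AA n p) = series_coord Ahat n"
  have "\<iota> f = iota f" if f: "f \<in> carrier (GLhat AA n p)" for f
  proof (rule hom_generators[OF _ iota.lift_hom _ _ f])
    show "\<iota> \<in> Ring.ring_hom (GLhat AA n p) (T_series_hat AA n p)" using a by blast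
    fix c assume c: "c \<in> S"
    have "\<iota> (GLhat_struct AA n p (A.LL (\<lambda>_. c))) = iota (GLhat_struct AA n p (A.LL (\<lambda>_. c)))"
      using a s Ah.L_closed[OF Ah.coh_const[OF c]] by simp
    then show "\<iota> (G.LL (\<lambda>_. mconst c)) = iota (G.LL (\<lambda>_. mconst c))"
      unfolding GLhat_struct_eq[OF Ah.coh_const[OF c]] .
  next
    fix kl assume "kl \<in> I"
    then obtain i j where ij: "kl = (i, j)" "i < n" "j < n" by auto
    have "map_mat \<iota> (GLhat_coord AA n p) $$ (i, j) = map_mat iota (GLhat_coord AA n p) $$ (i, j)" using a x by simp
    then show "\<iota> (G.LL (\<lambda>_. mvar (Some kl))) = iota (G.LL (\<lambda>_. mvar (Some kl)))"
      using ij by (simp add: GLhat_coord_eq Xvar_def)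
  qed
  then show "\<iota> = iota" using a iota.lift_extensional by (intro extensionalityI[of _ "carrier (GLhat AA n p)"]) blast+
qed

end

section \<open>The induced endomorphism\<close>

text \<open>\<Phi> abstracts the Frobenius lift of the connection at one prime: a ring homomorphism,
  semilinear over the completed A, with the Chern formula for its values on x.\<close>

locale chern_hat = chern_core S \<phi> n p q Z
  for S :: "complex set" and \<phi> :: "complex \<Rightarrow> complex" and n p :: nat and q Z :: "complex mat" +
  fixes \<Phi> :: "complex GLhat \<Rightarrow> complex GLhat"
  assumes Phi_hom: "\<Phi> \<in> Ring.ring_hom (GLhat AA n p) (GLhat AA n p)"
    and Phi_struct: "a \<in> carrier Ahat \<Longrightarrow>
      \<Phi> (GLhat_struct AA n p a) = GLhat_struct AA n p (completion_map AA p \<phi> a)"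
    and Phi_coord: "let B = GLhat AA n p; c = GLhat_const AA n p; x = GLhat_coord AA n p;
                xp = rmat_entry_pow B p x in
        \<exists>W S. rmat_inverse B n (rmat_conj B (map_mat (\<lambda>a. c (\<phi> a)) q) xp) W \<and>
           sqrt_one_plus B p c n
             (rmat_diff B (rmat_mult B W (rmat_entry_pow B p (rmat_conj B (map_mat c q) x)))
               (rmat_one B n)) S \<and>
           map_mat \<Phi> x = rmat_mult B xp S"
begin

abbreviation "B \<equiv> GLhat AA n p"
abbreviation "TT \<equiv> T_series_hat AA n p"
abbreviation "LT \<equiv> powser_lim A.LL"

text \<open>Elements of the completed coordinate ring are compared with series over A through their
  expansion, modulo p^k. The matrices W and S of the Chern formula are given only in the completed
  ring; \<open>Mrel\<close> carries the formula over to \<open>V0\<close> and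
  \<open>S0\<close>.\<close>

definition Hrel :: "nat \<Rightarrow> complex GLhat \<Rightarrow> (nat \<times> nat, complex) mps \<Rightarrow> bool" where
  "Hrel k f w \<longleftrightarrow> f \<in> carrier B \<and> Th.rel k (iota f) w"

lemma iota_ring_hom: "ring_hom_cring B TT iota"
  by (intro ring_hom_cring.intro ring_hom_cring_axioms.intro Gh.cring_Q Th.cring_Q iota.lift_hom)

lemma Hrel_mem: "Hrel k f w \<Longrightarrow> f \<in> carrier B" "Hrel k f w \<Longrightarrow> w \<in> R"
  by (auto simp: Hrel_def dest: Th.rel_closed)

lemma Hrel_exists: "f \<in> carrier B \<Longrightarrow> \<exists>w. Hrel k f w"
  unfolding Hrel_def using Th.rel_exists ring_hom_closed[OF iota.lift_hom] by blast

lemma Hrel_ops: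
  assumes "Hrel k f w" "Hrel k g v"
  shows Hrel_add: "Hrel k (f \<oplus>\<^bsub>B\<^esub> g) (w + v)" and Hrel_mult: "Hrel k (f \<otimes>\<^bsub>B\<^esub> g) (w * v)"
    and Hrel_minus: "Hrel k (f \<ominus>\<^bsub>B\<^esub> g) (w - v)"
proof -
  interpret i: ring_hom_cring B TT iota by (rule iota_ring_hom)
  have fg: "f \<in> carrier B" "g \<in> carrier B" and r: "Th.rel k (iota f) w" "Th.rel k (iota g) v"
    using assms by (simp_all add: Hrel_def)
  show "Hrel k (f \<oplus>\<^bsub>B\<^esub> g) (w + v)" "Hrel k (f \<otimes>\<^bsub>B\<^esub> g) (w * v)"
    using fg Th.rel_ops[OF r] by (simp_all add: Hrel_def)
  show "Hrel k (f \<ominus>\<^bsub>B\<^esub> g) (w - v)"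
    using fg Th.rel_minus[OF r] by (simp add: Hrel_def a_minus_def)
qed

lemma Hrel_one: "Hrel k \<one>\<^bsub>B\<^esub> 1" and Hrel_zero: "Hrel k \<zero>\<^bsub>B\<^esub> 0"
proof -
  interpret i: ring_hom_cring B TT iota by (rule iota_ring_hom)
  show "Hrel k \<one>\<^bsub>B\<^esub> 1" "Hrel k \<zero>\<^bsub>B\<^esub> 0"
    using Th.rel_one Th.rel_zero by (simp_all add: Hrel_def)
qed

lemma Hrel_pow: "Hrel k f w \<Longrightarrow> Hrel k (f [^]\<^bsub>B\<^esub> (m :: nat)) (w ^ m)"
proof (induction m)
  case (Suc m)
  then show ?case using Hrel_mult[OF Suc.IH[OF Suc.prems] Suc.prems] by (simp add: mult.commute)
qed (simp add: Hrel_one)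

lemma Hrel_finsum:
  assumes "finite J" "\<And>i. i \<in> J \<Longrightarrow> Hrel k (f i) (w i)"
  shows "Hrel k (finsum B f J) (sum w J)"
  using assms
proof (induction J rule: finite_induct)
  case (insert i J)
  have c: "f \<in> J \<rightarrow> carrier B" using insert Hrel_mem(1) by blast
  have i: "Hrel k (f i) (w i)" using insert by blast
  have "finsum B f (insert i J) = f i \<oplus>\<^bsub>B\<^esub> finsum B f J"
    using insert c Hrel_mem(1)[OF i] by (intro Gh.Q.finsum_insert) auto
  moreover have "Hrel k (f i \<oplus>\<^bsub>B\<^esub> finsum B f J) (w i + sum w J)"
    using insert by (intro Hrel_add i) blast
  ultimately show ?case using insert by simp
qed (simp add: Hrel_zero)

definition Mrel :: "nat \<Rightarrow> complex GLhat mat \<Rightarrow> (nat \<times> nat, complex) mps mat \<Rightarrow> bool" where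
  "Mrel k Y y \<longleftrightarrow> Y \<in> carrier_mat n n \<and> y \<in> carrier_mat n n \<and>
     (\<forall>i<n. \<forall>j<n. Hrel k (Y $$ (i, j)) (y $$ (i, j)))"

lemma MrelI: "Y \<in> carrier_mat n n \<Longrightarrow> y \<in> carrier_mat n n \<Longrightarrow>
    (\<And>i j. i < n \<Longrightarrow> j < n \<Longrightarrow> Hrel k (Y $$ (i, j)) (y $$ (i, j))) \<Longrightarrow> Mrel k Y y"
  by (simp add: Mrel_def)

lemma MrelD: "Mrel k Y y \<Longrightarrow> Y \<in> carrier_mat n n" "Mrel k Y y \<Longrightarrow> y \<in> carrier_mat n n"
    "Mrel k Y y \<Longrightarrow> i < n \<Longrightarrow> j < n \<Longrightarrow> Hrel k (Y $$ (i, j)) (y $$ (i, j))"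
  by (auto simp: Mrel_def)

lemma Mrel_mult:
  assumes "Mrel k Y y" "Mrel k W w"
  shows "Mrel k (rmat_mult B Y W) (y * w)"
proof (rule MrelI)
  note d = carrier_matD[OF MrelD(1)[OF assms(1)]] carrier_matD[OF MrelD(1)[OF assms(2)]]
  show "rmat_mult B Y W \<in> carrier_mat n n" by (rule carrier_matI) (simp_all add: rmat_mult_def d)
  show "y * w \<in> carrier_mat n n" by (rule mult_carrier_mat[OF MrelD(2)[OF assms(1)] MrelD(2)[OF assms(2)]])
  fix i j assume ij: "i < n" "j < n"
  have "rmat_mult B Y W $$ (i, j) = (\<Oplus>\<^bsub>B\<^esub>l\<in>{..<n}. Y $$ (i, l) \<otimes>\<^bsub>B\<^esub> W $$ (l, j))"
    using ij by (simp add: rmat_mult_def d)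
  moreover have "Hrel k (\<Oplus>\<^bsub>B\<^esub>l\<in>{..<n}. Y $$ (i, l) \<otimes>\<^bsub>B\<^esub> W $$ (l, j)) (\<Sum>l<n. y $$ (i, l) * w $$ (l, j))"
    using ij by (intro Hrel_finsum Hrel_mult MrelD(3)[OF assms(1)] MrelD(3)[OF assms(2)]) auto
  ultimately show "Hrel k (rmat_mult B Y W $$ (i, j)) ((y * w) $$ (i, j))"
    using entry_mult[OF MrelD(2)[OF assms(1)] MrelD(2)[OF assms(2)] ij] by simp
qed

lemma Mrel_one: "Mrel k (rmat_one B n) (1\<^sub>m n)"
  by (rule MrelI) (auto simp: rmat_one_def Hrel_one Hrel_zero)

lemma Mrel_diff:
  assumes "Mrel k Y y" "Mrel k W w"
  shows "Mrel k (rmat_diff B Y W) (y - w)"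
proof (rule MrelI)
  note d = carrier_matD[OF MrelD(1)[OF assms(1)]] carrier_matD[OF MrelD(2)[OF assms(2)]]
  show "rmat_diff B Y W \<in> carrier_mat n n" by (rule carrier_matI) (simp_all add: rmat_diff_def d)
  show "y - w \<in> carrier_mat n n" using assms by (intro minus_carrier_mat MrelD(2))
  fix i j assume ij: "i < n" "j < n"
  then show "Hrel k (rmat_diff B Y W $$ (i, j)) ((y - w) $$ (i, j))"
    using Hrel_minus[OF MrelD(3)[OF assms(1) ij] MrelD(3)[OF assms(2) ij]] d by (simp add: rmat_diff_def)
qed

lemma Mrel_transpose: "Mrel k Y y \<Longrightarrow> Mrel k (transpose_mat Y) (transpose_mat y)"
  by (auto simp: Mrel_def)

lemma Mrel_entry_pow:
  assumes "Mrel k Y y"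
  shows "Mrel k (rmat_entry_pow B p Y) (epow y)"
  using assms by (auto simp: Mrel_def rmat_entry_pow_def Hrel_pow)

lemma Mrel_conj: "Mrel k C c \<Longrightarrow> Mrel k Y y \<Longrightarrow> Mrel k (rmat_conj B C Y) (transpose_mat y * c * y)"
  unfolding rmat_conj_def by (intro Mrel_mult Mrel_transpose)

lemma Mrel_pow:
  assumes "Mrel k Y y"
  shows "Mrel k (rmat_pow B Y m) (y ^\<^sub>m m)"
proof (induction m)
  case 0
  then show ?case using Mrel_one[of k] carrier_matD[OF MrelD(1)[OF assms]] carrier_matD[OF MrelD(2)[OF assms]] by simp
next
  case (Suc m)
  then show ?case using Mrel_mult[OF assms Suc] pow_mat_Suc_left[OF MrelD(2)[OF assms]] by simp
qed

lemma Hrel_const: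
  assumes "w \<in> W1"
  shows "Hrel k (G.LL (\<lambda>_. w)) (ev w)"
  unfolding Hrel_def using Gh.L_closed[OF Gh.coh_const[OF assms]] iota.rel_lift[OF Gh.rel_const[OF assms]] by simp

lemma Hrel_GLhat_const: "c \<in> S \<Longrightarrow> Hrel k (GLhat_const AA n p c) (mconst c)"
  unfolding GLhat_const_eq using Hrel_const[OF mconst_mpoly[OF subr_S]] by (simp add: ev_mconst)

lemma Mrel_coord: "Mrel k (GLhat_coord AA n p) xm"
proof (rule MrelI)
  fix i j assume ij: "i < n" "j < n"
  then show "Hrel k (GLhat_coord AA n p $$ (i, j)) (xm $$ (i, j))"
    using Hrel_const[OF mvar_mpoly[OF subr_S, of "Some (i, j)" I'], of k]
    by (simp add: GLhat_coord_eq Xvar_def ev_Some)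
qed (simp_all add: GLhat_coord_eq Xvar_def)

lemma Mrel_q: "Mrel k (map_mat (GLhat_const AA n p) q) (cmat q)"
  by (rule MrelI) (simp_all add: Hrel_GLhat_const smats_entry[OF q])

lemma Mrel_q': "Mrel k (map_mat (\<lambda>a. GLhat_const AA n p (\<phi> a)) q) (cmat q')"
  by (rule MrelI) (simp_all add: Hrel_GLhat_const phi_mem smats_entry[OF q] q'_def)

lemma Hrel_shift: "Hrel k f w \<Longrightarrow> v \<in> R \<Longrightarrow> w - v \<in> powser_N I S p k \<Longrightarrow> Hrel k f v"
  unfolding Hrel_def using Th.rel_shift by blast

lemma Hrel_unique: "Hrel k f w \<Longrightarrow> Hrel k f v \<Longrightarrow> w - v \<in> powser_N I S p k"
  unfolding Hrel_def using Th.rel_unique by blast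

lemma Mrel_exists:
  assumes "Y \<in> sq_mats B n"
  obtains y where "Mrel k Y y" "y \<in> smats R n"
proof -
  have Y: "Y \<in> carrier_mat n n" "\<And>i j. i < n \<Longrightarrow> j < n \<Longrightarrow> Y $$ (i, j) \<in> carrier B"
    using assms elements_matI[of Y n n] by (auto simp: sq_mats_def)
  have "\<forall>ij. \<exists>w. ij \<in> I \<longrightarrow> Hrel k (Y $$ ij) w"
  proof
    fix ij
    show "\<exists>w. ij \<in> I \<longrightarrow> Hrel k (Y $$ ij) w"
    proof (cases ij)
      case (Pair i j)
      then show ?thesis using Hrel_exists[OF Y(2), of i j k] by auto
    qed
  qed
  from choice[OF this] obtain f where f: "\<forall>ij. ij \<in> I \<longrightarrow> Hrel k (Y $$ ij) (f ij)" ..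
  have "Mrel k Y (mat n n f)" by (rule MrelI) (use f Y(1) in auto)
  moreover have "mat n n f \<in> smats R n" by (rule smatsI) (use f in \<open>auto intro: Hrel_mem(2)\<close>)
  ultimately show ?thesis by (rule that)
qed

text \<open>Any representative w of W satisfies \<open>P0 * w\<close> \<equiv> 1 modulo p^k;
  multiplying by \<open>V0\<close> on the left gives w \<equiv> \<open>V0\<close>.\<close>

lemma Mrel_inverse:
  assumes Y: "Mrel k Y P0" and W: "rmat_inverse B n Y W"
  shows "Mrel k W V0"
proof -
  have "W \<in> sq_mats B n" using W by (simp add: rmat_inverse_def)
  then obtain w where w: "Mrel k W w" "w \<in> smats R n" by (rule Mrel_exists)
  have "Mrel k (rmat_one B n) (P0 * w)"
    using Mrel_mult[OF Y w(1)] W by (simp add: rmat_inverse_def)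
  then have d: "P0 * w - 1\<^sub>m n \<in> smats (powser_N I S p k) n"
  proof -
    assume a: "Mrel k (rmat_one B n) (P0 * w)"
    have c: "P0 * w \<in> carrier_mat n n" by (rule MrelD(2)[OF a])
    show ?thesis
    proof (rule smatsI)
      fix i j assume ij: "i < n" "j < n"
      then show "(P0 * w - 1\<^sub>m n) $$ (i, j) \<in> powser_N I S p k"
        using Hrel_unique[OF MrelD(3)[OF a ij] MrelD(3)[OF Mrel_one ij]] c by (simp del: index_mult_mat(1))
    qed (rule minus_carrier_mat[OF one_carrier_mat])
  qed
  have wc: "w \<in> carrier_mat n n" by (rule MrelD(2)[OF w(1)])
  have "V0 * (P0 * w - 1\<^sub>m n) = w - V0"
    unfolding mult_minus_distrib_mat[OF car(6) mult_carrier_mat[OF car(3) wc] one_carrier_mat]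
      assoc[OF car(6) car(3) wc, symmetric] V0P0 left_mult_one_mat[OF wc] right_mult_one_mat[OF car(6)] ..
  then have e: "w - V0 \<in> smats (powser_N I S p k) n"
    using Th.N.smats_K_mult_left[OF V0_mem d] by simp
  show ?thesis
  proof (rule MrelI)
    fix i j assume ij: "i < n" "j < n"
    have "w $$ (i, j) - V0 $$ (i, j) \<in> powser_N I S p k" using smats_entry[OF e ij] ij by simp
    then show "Hrel k (W $$ (i, j)) (V0 $$ (i, j))"
      by (rule Hrel_shift[OF MrelD(3)[OF w(1) ij] smats_entry[OF V0_mem ij]])
  qed (use MrelD(1)[OF w(1)] in simp_all)
qed

text \<open>Coefficientwise, the partial sums of the $p$-adic series become stationary, since their terms
  have increasing order in \<open>T\<close>; so the $p$-adic limit is the formal sum.\<close>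
lemma Mrel_sqrt:
  assumes U: "\<And>k. Mrel k U U0" and s: "sqrt_one_plus B p (GLhat_const AA n p) n U Y"
  shows "Mrel k Y S0"
proof (rule MrelI)
  have Y: "Y \<in> sq_mats B n" using s by (simp add: sqrt_one_plus_def)
  then show "Y \<in> carrier_mat n n" by (simp add: sq_mats_def)
  fix i j assume ij: "i < n" "j < n"
  have Yij: "Y $$ (i, j) \<in> carrier B" using Y ij elements_matI[of Y n n] by (auto simp: sq_mats_def)
  then obtain y where y: "Hrel k (Y $$ (i, j)) y" using Hrel_exists by blast
  let ?t = "\<lambda>m. mconst ((1 / 2) gchoose m) * (U0 ^\<^sub>m m) $$ (i, j)"
  let ?T = "\<lambda>m. GLhat_const AA n p ((1 / 2) gchoose m) \<otimes>\<^bsub>B\<^esub> rmat_pow B U m $$ (i, j)"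
  have t: "Hrel k (?T m) (?t m)" for m
    by (intro Hrel_mult Hrel_GLhat_const sqrt_binomial_mem[OF subr_S half] MrelD(3)[OF Mrel_pow[OF U] ij])
  obtain m0 where m0: "\<And>m. m \<ge> m0 \<Longrightarrow> (\<Oplus>\<^bsub>B\<^esub>l\<in>{..<m}. ?T l) \<ominus>\<^bsub>B\<^esub> Y $$ (i, j) \<in> pow_ideal B p k"
    using s ij unfolding sqrt_one_plus_def padic_sums_def by blast
  have diff: "(\<Sum>l<m. ?t l) - y \<in> powser_N I S p k" if "m \<ge> m0" for m
  proof -
    have "Hrel k ((\<Oplus>\<^bsub>B\<^esub>l\<in>{..<m}. ?T l) \<ominus>\<^bsub>B\<^esub> Y $$ (i, j)) ((\<Sum>l<m. ?t l) - y)"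
      by (intro Hrel_minus Hrel_finsum t y) simp
    moreover have "Hrel k ((\<Oplus>\<^bsub>B\<^esub>l\<in>{..<m}. ?T l) \<ominus>\<^bsub>B\<^esub> Y $$ (i, j)) (ev 0)"
    proof -
      have "Gh.rel k ((\<Oplus>\<^bsub>B\<^esub>l\<in>{..<m}. ?T l) \<ominus>\<^bsub>B\<^esub> Y $$ (i, j)) 0"
        by (rule Gh.rel_pow_ideal[OF m0[OF that]])
      then show ?thesis unfolding Hrel_def using iota.rel_lift Gh.rel_closed(1) by blast
    qed
    ultimately have "(\<Sum>l<m. ?t l) - y - ev 0 \<in> powser_N I S p k" by (rule Hrel_unique)
    then show ?thesis by (simp add: ev.hom_zero)
  qed
  have S0e: "S0 $$ (i, j) = lsum ?t"
    unfolding S0_def mseries_entry[OF car(7) ij] by simp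
  have lf: "locfin ?t"
    using mseries_locfin[OF car(7) U0_ord ij, of "fps_binomial (1 / 2)"] by simp
  have S0R: "S0 $$ (i, j) \<in> R" using S0_mem ij by simp
  have "S0 $$ (i, j) - y \<in> powser_N I S p k"
  proof (subst powser_N_iff[OF subr_S R.diff_mem[OF S0R Hrel_mem(2)[OF y]]], rule allI)
    fix mm :: "(nat \<times> nat) multiset"
    \<comment> \<open>The cutoff lies beyond the p-adic index \<open>m0\<close> and beyond
      \<open>size mm + 1\<close>, so that the coefficient at mm of the formal sum is already that of
      the partial sum up to \<open>m - 1\<close>.\<close>
    define m where "m = max m0 (Suc (Suc (size mm)))"
    have d: "(\<Sum>l<m. ?t l) - y \<in> powser_N I S p k" by (rule diff) (simp add: m_def)
    have "{..<m} = {..m - 1}" by (auto simp: m_def)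
    then have "coef (S0 $$ (i, j)) mm = coef (\<Sum>l<m. ?t l) mm"
      unfolding S0e coef_sum by (subst coef_lsum[OF lf, of mm "m - 1"]) (auto simp: m_def)
    then have "coef (S0 $$ (i, j) - y) mm = coef ((\<Sum>l<m. ?t l) - y) mm"
      by (simp only: coef_diff)
    moreover have "\<exists>c\<in>S. coef ((\<Sum>l<m. ?t l) - y) mm = c * of_nat p ^ k"
      using d powser_N_iff[OF subr_S Th.N.K_sub[THEN subsetD, OF d]] by blast
    ultimately show "\<exists>c\<in>S. coef (S0 $$ (i, j) - y) mm = c * of_nat p ^ k" by simp
  qed
  from Th.N.K_uminus[OF this] have "y - S0 $$ (i, j) \<in> powser_N I S p k" by simp
  then show "Hrel k (Y $$ (i, j)) (S0 $$ (i, j))" by (rule Hrel_shift[OF y S0R])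
qed simp

lemma Mrel_Phi: "Mrel k (map_mat \<Phi> (GLhat_coord AA n p)) F"
proof -
  let ?c = "GLhat_const AA n p" and ?x = "GLhat_coord AA n p"
  let ?xp = "rmat_entry_pow B p ?x"
  from Phi_coord obtain W Y where
    W: "rmat_inverse B n (rmat_conj B (map_mat (\<lambda>a. ?c (\<phi> a)) q) ?xp) W" and
    Y: "sqrt_one_plus B p ?c n (rmat_diff B (rmat_mult B W (rmat_entry_pow B p (rmat_conj B (map_mat ?c q) ?x)))
               (rmat_one B n)) Y" and
    e: "map_mat \<Phi> ?x = rmat_mult B ?xp Y"
    unfolding Let_def by blast
  have xp: "Mrel k ?xp Xp" for k unfolding Xp_def by (rule Mrel_entry_pow[OF Mrel_coord])
  have P: "Mrel k (rmat_conj B (map_mat (\<lambda>a. ?c (\<phi> a)) q) ?xp) P0" for k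
    unfolding P0_def by (rule Mrel_conj[OF Mrel_q' xp])
  have U: "Mrel k (rmat_diff B (rmat_mult B W (rmat_entry_pow B p (rmat_conj B (map_mat ?c q) ?x))) (rmat_one B n)) U0" for k
    unfolding U0_def Q0_def
    by (intro Mrel_diff Mrel_mult Mrel_one Mrel_entry_pow Mrel_conj Mrel_q Mrel_coord Mrel_inverse[OF P W])
  show ?thesis unfolding e F_def by (rule Mrel_mult[OF xp Mrel_sqrt[OF U Y]])
qed

lemma iota_Phi_coord:
  assumes "i < n" "j < n"
  shows "iota (\<Phi> (G.LL (\<lambda>_. mvar (Some (i, j))))) = LT (\<lambda>_. F $$ (i, j))"
proof (rule Th.rel_eqI)
  fix k
  have "Hrel k (\<Phi> (G.LL (\<lambda>_. mvar (Some (i, j))))) (F $$ (i, j))"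
    using MrelD(3)[OF Mrel_Phi assms, of k] assms by (simp add: GLhat_coord_eq Xvar_def)
  moreover have "Th.rel k (LT (\<lambda>_. F $$ (i, j))) (F $$ (i, j))"
    by (rule Th.rel_const[OF smats_entry[OF F_mem assms]])
  ultimately show "\<exists>w. Th.rel k (iota (\<Phi> (G.LL (\<lambda>_. mvar (Some (i, j)))))) w \<and> Th.rel k (LT (\<lambda>_. F $$ (i, j))) w"
    unfolding Hrel_def by blast
qed

lemma completion_map_phi:
  assumes g: "Ah.coh g"
  shows "completion_map AA p \<phi> (A.LL g) = A.LL (\<lambda>k. \<phi> (g k))" and "Ah.coh (\<lambda>k. \<phi> (g k))"
proof -
  have d: "\<phi> v - \<phi> w \<in> A.NN k" if a: "v \<in> S" "w \<in> S" "v - w \<in> A.NN k" for v w k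
  proof -
    obtain h where h: "h \<in> S" "v - w = h * of_nat p ^ k" using a(3) by (auto simp: A.NN_def)
    have "\<phi> v - \<phi> w = \<phi> (v - w)" using phi.hom_diff[OF a(1,2)] by simp
    also have "\<dots> = \<phi> h * of_nat p ^ k"
      unfolding h(2) phi.hom_mult[OF h(1) phi.power_mem[OF phi.of_nat_mem]] phi.hom_power[OF phi.of_nat_mem] phi.hom_of_nat ..
    finally show ?thesis using Ah.pow_mem_N[OF phi_mem[OF h(1)]] by simp
  qed
  show "completion_map AA p \<phi> (A.LL g) = A.LL (\<lambda>k. \<phi> (g k))"
  proof (rule completion_map_LL[where t = \<phi> and h = \<phi>, OF A.presentation_axioms A.presentation_axioms])
    show "\<phi> w \<in> S" if "w \<in> S" for w using that by (rule phi_mem)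
    show "\<phi> w = \<phi> w" for w by (rule refl)
    show "\<phi> v - \<phi> w \<in> A.NN k" if "v \<in> S" "w \<in> S" "v - w \<in> A.NN k" for v w k using that by (rule d)
    show "g k \<in> S" for k by (rule Ah.cohD(1)[OF g])
  qed
  show "Ah.coh (\<lambda>k. \<phi> (g k))" unfolding coherent_def
    by (intro allI conjI phi_mem d Ah.cohD(1)[OF g] Ah.cohD(2)[OF g])
qed

text \<open>A semilinear substitution fixes integers, so it preserves divisibility by p^k and
  extends to series over the completed A.\<close>

sublocale Psi: limring_map R "powser_N I S p" TT LT R "powser_N I S p" TT LT psi
proof unfold_locales
  show "psi w \<in> R" if "w \<in> R" for w by (rule psi.subst_mem[OF that])
  fix w k assume "w \<in> powser_N I S p k"
  then obtain h where h: "h \<in> R" "w = h * of_nat p ^ k" by (auto simp: powser_N_def)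
  have "psi w = psi h * of_nat p ^ k"
    unfolding h(2) psih.hom_mult[OF h(1) R.power_mem[OF R.of_nat_mem]] psih.hom_power[OF R.of_nat_mem] psih.hom_of_nat ..
  then show "psi w \<in> powser_N I S p k" using Th.pow_mem_N[OF psi.subst_mem[OF h(1)]] by simp
qed

abbreviation "Psi \<equiv> Psi.lift"

lemma Psi_const: "w \<in> R \<Longrightarrow> Psi (LT (\<lambda>_. w)) = LT (\<lambda>_. psi w)"
  by (rule Psi.lift_L[OF Th.coh_const])

lemma iota_struct: "c \<in> S \<Longrightarrow> iota (G.LL (\<lambda>_. mconst c)) = LT (\<lambda>_. mconst c)"
  using iota_const[OF mconst_mpoly[OF subr_S]] by (simp add: ev_mconst)

lemma Phi_mconst: "c \<in> S \<Longrightarrow> \<Phi> (G.LL (\<lambda>_. mconst c)) = G.LL (\<lambda>_. mconst (\<phi> c))"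
  using Phi_struct[OF Ah.L_closed[OF Ah.coh_const]] completion_map_phi[OF Ah.coh_const]
    GLhat_struct_eq[OF Ah.coh_const] phi_mem by simp

text \<open>Both composites are homomorphisms out of the completed coordinate ring, so constants and
  coordinates suffice; there both sides are given by \<phi> and by x \<mapsto> F.\<close>

lemma Psi_iota:
  assumes f: "f \<in> carrier B"
  shows "Psi (iota f) = iota (\<Phi> f)"
proof -
  have c: "Psi \<circ> iota \<in> Ring.ring_hom B TT" by (rule ring_hom_trans[OF iota.lift_hom Psi.lift_hom])
  have d: "iota \<circ> \<Phi> \<in> Ring.ring_hom B TT" by (rule ring_hom_trans[OF Phi_hom iota.lift_hom])
  have "(Psi \<circ> iota) f = (iota \<circ> \<Phi>) f"
  proof (rule hom_generators[OF c d _ _ f])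
    fix c assume c: "c \<in> S"
    show "(Psi \<circ> iota) (G.LL (\<lambda>_. mconst c)) = (iota \<circ> \<Phi>) (G.LL (\<lambda>_. mconst c))"
      using c phi_mem[OF c] by (simp add: iota_struct Phi_mconst Psi_const mconst_over[OF subr_S] psi.subst_mconst)
  next
    fix kl assume "kl \<in> I"
    then obtain i j where ij: "kl = (i, j)" "i < n" "j < n" by auto
    have "psi (xm $$ (i, j)) = F $$ (i, j)"
      using arg_cong[OF psi_xm, of "\<lambda>Y. Y $$ (i, j)"] ij by simp
    then show "(Psi \<circ> iota) (G.LL (\<lambda>_. mvar (Some kl))) = (iota \<circ> \<Phi>) (G.LL (\<lambda>_. mvar (Some kl)))"
      using ij iota_const[OF mvar_mpoly[OF subr_S, of "Some (i, j)" I']] xm_mem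
      by (simp add: ev_Some iota_Phi_coord Psi_const)
  qed
  then show ?thesis by simp
qed

end

text \<open>Each nonconstant monomial is assigned one of its variables by \<open>SOME\<close>, a
  choice that depends on the monomial alone; \<open>mdiv i\<close> divides the monomials assigned to
  i by that variable. So \<open>mdiv_expand\<close> counts no monomial twice, and the quotients are
  additive in f.\<close>

definition mdiv :: "'i \<Rightarrow> ('i, 'a::comm_ring_1) mps \<Rightarrow> ('i, 'a) mps" where
  "mdiv i f = Mps (\<lambda>m. if (SOME j. j \<in># add_mset i m) = i then coef f (add_mset i m) else 0)"

lemma mdiv_diff: "mdiv i (f - g) = mdiv i f - mdiv i g"
  by (rule mps_eqI) (simp add: mdiv_def)

lemma mdiv_mem: "subr S \<Longrightarrow> f \<in> mps_over I S \<Longrightarrow> mdiv i f \<in> mps_over I S"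
  by (auto simp: mdiv_def mps_over_def subr.zero_mem)

lemma mdiv_expand:
  assumes "finite I" "f \<in> mps_over I S"
  shows "f = mconst (coef f {#}) + (\<Sum>i\<in>I. mvar i * mdiv i f)"
proof (rule mps_eqI)
  fix m :: "'a multiset"
  show "coef f m = coef (mconst (coef f {#}) + (\<Sum>i\<in>I. mvar i * mdiv i f)) m"
  proof (cases "m = {#}")
    case True
    then show ?thesis by (simp add: coef_mconst coef_mvar_mult)
  next
    case False
    define j where "j = (SOME j. j \<in># m)"
    have j: "j \<in># m" unfolding j_def by (rule someI_ex[OF multiset_nonemptyE[OF False]]) (rule exI)
    have "coef (mvar i * mdiv i f) m = (if i = j then coef f m else 0)" for i
    proof (cases "i \<in># m")
      case True
      have a: "add_mset i (m - {#i#}) = m" using True by (rule insert_DiffM)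
      show ?thesis using True unfolding coef_mvar_mult mdiv_def coef_Mps a j_def[symmetric] by simp
    next
      case False
      then show ?thesis using j by (auto simp: coef_mvar_mult)
    qed
    then have "(\<Sum>i\<in>I. coef (mvar i * mdiv i f) m) = (if j \<in> I then coef f m else 0)"
      using assms(1) by (simp add: sum.delta)
    moreover have "coef f m = 0" if "j \<notin> I" using j that by (intro mps_over_vars[OF assms(2)]) blast
    ultimately show ?thesis using False by (auto simp: coef_mconst)
  qed
qed

lemma (in ideal) finsum_mem:
  assumes "finite J" "\<And>i. i \<in> J \<Longrightarrow> f i \<in> I"
  shows "finsum R f J \<in> I"
  using assms
proof (induction J rule: finite_induct)
  case (insert i J)
  have "finsum R f (insert i J) = f i \<oplus>\<^bsub>R\<^esub> finsum R f J"
    using insert Icarr by (intro finsum_insert) auto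
  then show ?case using insert by simp
qed simp

context chern_hat
begin

lemma powser_N_coef: "w \<in> powser_N I S p k \<Longrightarrow> \<exists>c\<in>S. coef w m = c * of_nat p ^ k"
  by (rule iffD1[OF powser_N_iff[OF subr_S Th.N.K_sub[THEN subsetD]], THEN spec])

lemma powser_N_mdiv:
  assumes "w \<in> powser_N I S p k"
  shows "mdiv i w \<in> powser_N I S p k"
proof -
  have w: "w \<in> R" by (rule Th.N.K_sub[THEN subsetD, OF assms])
  have "\<forall>m. \<exists>c\<in>S. coef (mdiv i w) m = c * of_nat p ^ k"
  proof
    fix m
    have z: "(0 :: complex) = 0 * of_nat p ^ k" by simp
    show "\<exists>c\<in>S. coef (mdiv i w) m = c * of_nat p ^ k"
      unfolding mdiv_def coef_Mps
    proof (split if_split, intro conjI impI)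
      show "\<exists>c\<in>S. coef w (add_mset i m) = c * of_nat p ^ k" by (rule powser_N_coef[OF assms])
      show "\<exists>c\<in>S. 0 = c * of_nat p ^ k" by (rule bexI, rule z, rule phi.zero_mem)
    qed
  qed
  then show ?thesis by (rule iffD2[OF powser_N_iff[OF subr_S mdiv_mem[OF subr_S w]]])
qed

lemma coh_mdiv:
  assumes g: "Th.coh g"
  shows "Th.coh (\<lambda>k. mdiv i (g k))"
  unfolding coherent_def mdiv_diff[symmetric]
  by (intro allI conjI mdiv_mem[OF subr_S] powser_N_mdiv Th.cohD(1)[OF g] Th.cohD(2)[OF g])

lemma coh_const_coef:
  assumes g: "Th.coh g"
  shows "Ah.coh (\<lambda>k. coef (g k) m)"
  unfolding coherent_def
proof (intro allI conjI)
  fix k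
  show "coef (g k) m \<in> S" by (rule mps_over_coef[OF Th.cohD(1)[OF g]])
  have d: "g (Suc k) - g k \<in> powser_N I S p k" by (rule Th.cohD(2)[OF g])
  then obtain c where "c \<in> S" "coef (g (Suc k) - g k) m = c * of_nat p ^ k"
    by (rule bexE[OF powser_N_coef])
  then show "coef (g (Suc k)) m - coef (g k) m \<in> A.NN k" using Ah.pow_mem_N by simp
qed

text \<open>T_ij = x_ij - \<delta>_ij lies in the image of the expansion, where h is prescribed. So
  the image of each variable is forced, and it has no constant term.\<close>

lemma hom_mvar:
  assumes h: "h \<in> Ring.ring_hom TT TT" and hi: "\<And>f. f \<in> carrier B \<Longrightarrow> h (iota f) = iota (\<Phi> f)"
    and ij: "i < n" "j < n"
  shows "h (LT (\<lambda>_. mvar (i, j))) = LT (\<lambda>_. \<tau> (i, j))"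
proof -
  interpret h: ring_hom_cring TT TT h
    by (intro ring_hom_cring.intro ring_hom_cring_axioms.intro Th.cring_Q h)
  let ?d = "if i = j then 1 else 0 :: (nat \<times> nat, complex) mps"
  have dR: "?d \<in> R" by auto
  have xR: "xm $$ (i, j) \<in> R" and FR: "F $$ (i, j) \<in> R" using smats_entry[OF xm_mem ij] smats_entry[OF F_mem ij] .
  have m1: "mvar (Some (i, j)) \<in> W1" by (rule mvar_mpoly[OF subr_S]) (use ij in auto)
  have "h (iota (G.LL (\<lambda>_. mvar (Some (i, j))))) = LT (\<lambda>_. F $$ (i, j))"
    using hi[OF Gh.L_closed[OF Gh.coh_const[OF m1]]] iota_Phi_coord[OF ij] by simp
  then have 1: "h (LT (\<lambda>_. xm $$ (i, j))) = LT (\<lambda>_. F $$ (i, j))"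
    unfolding iota_const[OF m1] ev_Some .
  have 2: "h (LT (\<lambda>_. ?d)) = LT (\<lambda>_. ?d)"
    using h.hom_one h.hom_zero by (cases "i = j") (simp_all add: Th.L_one Th.L_zero)
  have "mvar (i, j) = xm $$ (i, j) - ?d" using ij by (simp add: xm_def)
  then have "LT (\<lambda>_. mvar (i, j)) = LT (\<lambda>_. xm $$ (i, j)) \<ominus>\<^bsub>TT\<^esub> LT (\<lambda>_. ?d)"
    using Th.L_minus[OF Th.coh_const[OF xR] Th.coh_const[OF dR]] by simp
  then have "h (LT (\<lambda>_. mvar (i, j))) = LT (\<lambda>_. F $$ (i, j)) \<ominus>\<^bsub>TT\<^esub> LT (\<lambda>_. ?d)"
    using Th.L_closed[OF Th.coh_const[OF xR]] Th.L_closed[OF Th.coh_const[OF dR]] 1 2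
    by (simp add: a_minus_def)
  also have "\<dots> = LT (\<lambda>_. \<tau> (i, j))"
    using Th.L_minus[OF Th.coh_const[OF FR] Th.coh_const[OF dR]] by (simp add: \<tau>_def)
  finally show ?thesis .
qed

text \<open>Splitting off one variable at a time shows that two such endomorphisms agree modulo $(T)^d$
  for every \<open>d\<close>, since they map $(T)$ into itself.\<close>
lemma hom_agree_order:
  assumes h: "h \<in> Ring.ring_hom TT TT" "h' \<in> Ring.ring_hom TT TT"
    and hi: "\<And>f. f \<in> carrier B \<Longrightarrow> h (iota f) = iota (\<Phi> f)" "\<And>f. f \<in> carrier B \<Longrightarrow> h' (iota f) = iota (\<Phi> f)"
  shows "f \<in> carrier TT \<Longrightarrow> \<exists>w v. Th.rel k (h f) (w + v) \<and> Th.rel k (h' f) w \<and> v \<in> R \<and> ordge d v"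
proof (induction d arbitrary: f)
  case 0
  \<comment> \<open>At order 0 nothing is claimed: the difference of any two representatives serves
    as v.\<close>
  obtain w w' where w: "Th.rel k (h f) w" "Th.rel k (h' f) w'"
    using Th.rel_exists ring_hom_closed[OF h(1) 0] ring_hom_closed[OF h(2) 0] by blast
  have "w \<in> R" "w' \<in> R" by (rule Th.rel_closed(2)[OF w(1)], rule Th.rel_closed(2)[OF w(2)])
  then show ?case using w by (intro exI[of _ w'] exI[of _ "w - w'"]) simp
next
  case (Suc d)
  obtain g where g: "Th.coh g" "f = LT g" using Th.carrierE[OF Suc.prems] by blast
  define fi where "fi i = LT (\<lambda>k. mdiv i (g k))" for i
  define c where "c = G.LL (\<lambda>k. mconst (coef (g k) {#}))"
  have cB: "c \<in> carrier B" unfolding c_def by (rule Gh.L_closed[OF coh_mconst[OF coh_const_coef[OF g(1)]]])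
  have ic: "iota c = LT (\<lambda>k. mconst (coef (g k) {#}))"
    unfolding c_def iota.lift_L[OF coh_mconst[OF coh_const_coef[OF g(1)]]] ev_mconst ..
  have cohc: "Th.coh (\<lambda>k. mconst (coef (g k) {#}))"
    using iota.coh_h[OF coh_mconst[OF coh_const_coef[OF g(1)]]] by (simp only: ev_mconst)
  have fiC: "fi i \<in> carrier TT" for i unfolding fi_def by (rule Th.L_closed[OF coh_mdiv[OF g(1)]])
  have vR: "mvar i \<in> R" if "i \<in> I" for i using that by (rule mvar_over[OF subr_S])
  have vC: "LT (\<lambda>_. mvar i) \<in> carrier TT" if "i \<in> I" for i by (rule Th.L_closed[OF Th.coh_const[OF vR[OF that]]])
  have coht: "Th.coh (\<lambda>k. mvar i * mdiv i (g k))" if "i \<in> I" for i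
    by (rule Th.coh_mult[OF Th.coh_const[OF vR[OF that]] coh_mdiv[OF g(1)]])
  have fs: "finsum TT (\<lambda>i. LT (\<lambda>k. mvar i * mdiv i (g k))) I = LT (\<lambda>k. \<Sum>i\<in>I. mvar i * mdiv i (g k)) \<and>
      Th.coh (\<lambda>k. \<Sum>i\<in>I. mvar i * mdiv i (g k))"
    by (rule Th.L_finsum) (use coht in auto)
  have "g = (\<lambda>k. mconst (coef (g k) {#}) + (\<Sum>i\<in>I. mvar i * mdiv i (g k)))"
    using mdiv_expand[of I, OF _ Th.cohD(1)[OF g(1)]] by (intro ext) simp
  then have "f = LT (\<lambda>k. mconst (coef (g k) {#}) + (\<Sum>i\<in>I. mvar i * mdiv i (g k)))"
    unfolding g(2) by (rule arg_cong)
  also have "\<dots> = iota c \<oplus>\<^bsub>TT\<^esub> finsum TT (\<lambda>i. LT (\<lambda>k. mvar i * mdiv i (g k))) I"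
    unfolding ic using Th.L_add[OF cohc conjunct2[OF fs]] fs by simp
  also have "finsum TT (\<lambda>i. LT (\<lambda>k. mvar i * mdiv i (g k))) I = finsum TT (\<lambda>i. LT (\<lambda>_. mvar i) \<otimes>\<^bsub>TT\<^esub> fi i) I"
  proof (rule Th.Q.finsum_cong')
    fix i assume i: "i \<in> I"
    show "LT (\<lambda>k. mvar i * mdiv i (g k)) = LT (\<lambda>_. mvar i) \<otimes>\<^bsub>TT\<^esub> fi i"
      unfolding fi_def by (rule Th.L_mult[OF Th.coh_const[OF vR[OF i]] coh_mdiv[OF g(1)], symmetric])
  qed (use fiC vC in auto)
  finally have fe: "f = iota c \<oplus>\<^bsub>TT\<^esub> finsum TT (\<lambda>i. LT (\<lambda>_. mvar i) \<otimes>\<^bsub>TT\<^esub> fi i) I" .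
  have icC: "iota c \<in> carrier TT" by (rule ring_hom_closed[OF iota.lift_hom cB])
  \<comment> \<open>The constant part c comes from the coordinate ring, so only the values at the
    quotients \<open>fi i\<close> remain undetermined, and these occur with the factors
    \<tau>.\<close>
  have img: "e f = iota (\<Phi> c) \<oplus>\<^bsub>TT\<^esub> finsum TT (\<lambda>i. LT (\<lambda>_. \<tau> i) \<otimes>\<^bsub>TT\<^esub> e (fi i)) I"
    if e: "e \<in> Ring.ring_hom TT TT" and ei: "\<And>f. f \<in> carrier B \<Longrightarrow> e (iota f) = iota (\<Phi> f)" for e
  proof -
    interpret e: ring_hom_cring TT TT e
      by (intro ring_hom_cring.intro ring_hom_cring_axioms.intro Th.cring_Q e)
    have tC: "(\<lambda>i. LT (\<lambda>_. mvar i) \<otimes>\<^bsub>TT\<^esub> fi i) \<in> I \<rightarrow> carrier TT"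
      by (intro Pi_I Th.Q.m_closed vC fiC)
    have tauC: "LT (\<lambda>_. \<tau> i) \<in> carrier TT" if "i \<in> I" for i
      by (rule Th.L_closed[OF Th.coh_const[OF psi.tau_mem[OF that]]])
    have "e f = e (iota c) \<oplus>\<^bsub>TT\<^esub> e (finsum TT (\<lambda>i. LT (\<lambda>_. mvar i) \<otimes>\<^bsub>TT\<^esub> fi i) I)"
      unfolding fe by (rule e.hom_add[OF icC Th.Q.finsum_closed[OF tC]])
    also have "e (iota c) = iota (\<Phi> c)" by (rule ei[OF cB])
    also have "e (finsum TT (\<lambda>i. LT (\<lambda>_. mvar i) \<otimes>\<^bsub>TT\<^esub> fi i) I) = finsum TT (e \<circ> (\<lambda>i. LT (\<lambda>_. mvar i) \<otimes>\<^bsub>TT\<^esub> fi i)) I"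
      by (rule e.hom_finsum[OF tC])
    also have "\<dots> = finsum TT (\<lambda>i. LT (\<lambda>_. \<tau> i) \<otimes>\<^bsub>TT\<^esub> e (fi i)) I"
    proof (rule Th.Q.finsum_cong'[OF refl])
      show "(\<lambda>i. LT (\<lambda>_. \<tau> i) \<otimes>\<^bsub>TT\<^esub> e (fi i)) \<in> I \<rightarrow> carrier TT"
        by (intro Pi_I Th.Q.m_closed tauC e.hom_closed fiC)
      fix i assume i: "i \<in> I"
      then obtain a b where ab: "i = (a, b)" "a < n" "b < n" by auto
      show "(e \<circ> (\<lambda>i. LT (\<lambda>_. mvar i) \<otimes>\<^bsub>TT\<^esub> fi i)) i = LT (\<lambda>_. \<tau> i) \<otimes>\<^bsub>TT\<^esub> e (fi i)"
        using e.hom_mult[OF vC[OF i] fiC] hom_mvar[OF e ei ab(2,3)] by (simp add: ab(1))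
    qed
    finally show ?thesis .
  qed
  have "\<forall>i. \<exists>wv. Th.rel k (h (fi i)) (fst wv + snd wv) \<and> Th.rel k (h' (fi i)) (fst wv) \<and> snd wv \<in> R \<and> ordge d (snd wv)"
    using Suc.IH[OF fiC] by simp
  from choice[OF this] obtain wv where wv: "\<And>i. Th.rel k (h (fi i)) (fst (wv i) + snd (wv i))"
    "\<And>i. Th.rel k (h' (fi i)) (fst (wv i))" "\<And>i. snd (wv i) \<in> R" "\<And>i. ordge d (snd (wv i))" by blast
  have PcB: "\<Phi> c \<in> carrier B" by (rule ring_hom_closed[OF Phi_hom cB])
  obtain w0 where w0: "Th.rel k (iota (\<Phi> c)) w0"
    using Th.rel_exists[OF ring_hom_closed[OF iota.lift_hom PcB]] by blast
  have tr: "Th.rel k (LT (\<lambda>_. \<tau> i)) (\<tau> i)" if "i \<in> I" for i by (rule Th.rel_const[OF psi.tau_mem[OF that]])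
  have r1: "Th.rel k (h f) (w0 + (\<Sum>i\<in>I. \<tau> i * (fst (wv i) + snd (wv i))))"
    by (subst img[OF h(1)], erule hi(1), intro Th.rel_add w0 Th.rel_finsum Th.rel_mult tr wv(1)) auto
  have r2: "Th.rel k (h' f) (w0 + (\<Sum>i\<in>I. \<tau> i * fst (wv i)))"
    by (subst img[OF h(2)], erule hi(2), intro Th.rel_add w0 Th.rel_finsum Th.rel_mult tr wv(2)) auto
  \<comment> \<open>Each \<tau> has order at least 1, which raises the order of the discrepancy by
    one.\<close>
  have "ordge (Suc d) (\<Sum>i\<in>I. \<tau> i * snd (wv i))"
    using ordge_mult[OF psi.tau_ord wv(4)] by (intro ordge_sum) simp
  moreover have "(\<Sum>i\<in>I. \<tau> i * snd (wv i)) \<in> R" using psi.tau_mem wv(3) by (intro R.sum_mem R.mult_mem)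
  moreover have "w0 + (\<Sum>i\<in>I. \<tau> i * (fst (wv i) + snd (wv i))) = (w0 + (\<Sum>i\<in>I. \<tau> i * fst (wv i))) + (\<Sum>i\<in>I. \<tau> i * snd (wv i))"
    by (simp add: distrib_left sum.distrib add.assoc)
  ultimately show ?case
    by (intro exI[of _ "w0 + (\<Sum>i\<in>I. \<tau> i * fst (wv i))"] exI[of _ "\<Sum>i\<in>I. \<tau> i * snd (wv i)"] conjI r2)
      (use r1 in \<open>simp_all only:\<close>)
qed

text \<open>For each monomial m, agreement up to order \<open>size m + 1\<close> settles its
  coefficient modulo p^k. The representatives obtained there depend on m, so they are compared with
  fixed ones r and r'.\<close>

lemma hom_agree:
  assumes h: "h \<in> Ring.ring_hom TT TT" "h' \<in> Ring.ring_hom TT TT"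
    and hi: "\<And>f. f \<in> carrier B \<Longrightarrow> h (iota f) = iota (\<Phi> f)" "\<And>f. f \<in> carrier B \<Longrightarrow> h' (iota f) = iota (\<Phi> f)"
    and f: "f \<in> carrier TT"
  shows "h f = h' f"
proof (rule Th.rel_eqI)
  fix k
  obtain r r' where r: "Th.rel k (h f) r" "Th.rel k (h' f) r'"
    using Th.rel_exists ring_hom_closed[OF h(1) f] ring_hom_closed[OF h(2) f] by blast
  have rR: "r \<in> R" "r' \<in> R" by (rule Th.rel_closed(2)[OF r(1)], rule Th.rel_closed(2)[OF r(2)])
  have "r - r' \<in> powser_N I S p k"
  proof (subst powser_N_iff[OF subr_S R.diff_mem[OF rR]], rule allI)
    fix m :: "(nat \<times> nat) multiset"
    obtain w v where wv: "Th.rel k (h f) (w + v)" "Th.rel k (h' f) w" "ordge (Suc (size m)) v"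
      using hom_agree_order[OF h hi f, of k "Suc (size m)"] by blast
    have d: "r - (w + v) \<in> powser_N I S p k" "r' - w \<in> powser_N I S p k"
      by (rule Th.rel_unique[OF r(1) wv(1)], rule Th.rel_unique[OF r(2) wv(2)])
    have dd: "(r - (w + v)) - (r' - w) \<in> powser_N I S p k" by (rule Th.N.K_diff[OF d])
    then obtain c where c: "c \<in> S" "coef ((r - (w + v)) - (r' - w)) m = c * of_nat p ^ k"
      by (rule bexE[OF powser_N_coef])
    have "coef v m = 0" using wv(3) by (simp add: ordge_def)
    then have "coef (r - r') m = c * of_nat p ^ k" using c(2) by simp
    then show "\<exists>c\<in>S. coef (r - r') m = c * of_nat p ^ k" using c(1) by blast
  qed
  then have "Th.rel k (h f) r'" by (rule Th.rel_shift[OF r(1) rR(2)])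
  then show "\<exists>w. Th.rel k (h f) w \<and> Th.rel k (h' f) w" using r(2) by blast
qed

lemma induced_endo_eq: "induced_endo AA n p \<Phi> = Psi"
  unfolding induced_endo_def identity_expansion_eq
proof (rule the_equality)
  show "Psi \<in> Ring.ring_hom TT TT \<inter> extensional (carrier TT) \<and> (\<forall>f\<in>carrier B. Psi (iota f) = iota (\<Phi> f))"
    using Psi.lift_hom Psi.lift_extensional Psi_iota by blast
  fix \<Psi> assume a: "\<Psi> \<in> Ring.ring_hom TT TT \<inter> extensional (carrier TT) \<and> (\<forall>f\<in>carrier B. \<Psi> (iota f) = iota (\<Phi> f))"
  have "\<Psi> f = Psi f" if "f \<in> carrier TT" for f
    by (rule hom_agree[OF _ Psi.lift_hom _ Psi_iota that]) (use a in blast)+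
  then show "\<Psi> = Psi" using a Psi.lift_extensional by (intro extensionalityI[of _ "carrier TT"]) blast+
qed

subsection \<open>The ideal of the identity\<close>

definition ev1 :: "((nat \<times> nat) option, complex) mps \<Rightarrow> complex" where
  "ev1 w = coef (ev w) {#}"

definition xi :: "nat \<times> nat \<Rightarrow> ((nat \<times> nat) option, complex) mps" where
  "xi i = mvar (Some i) - (if fst i = snd i then 1 else 0)"

lemma xi_mem: "i \<in> I \<Longrightarrow> xi i \<in> W1"
  unfolding xi_def by (intro P.diff_mem mvar_mpoly[OF subr_S]) auto

lemma ev1_hom: "subr_hom W1 ev1"
  using ev_mem by unfold_locales (simp_all add: ev1_def ev.hom_one ev.hom_add ev.hom_mult coef_one coef_empty_mult)

lemma ev1_mem: "w \<in> W1 \<Longrightarrow> ev1 w \<in> S"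
  unfolding ev1_def by (rule mps_over_coef[OF ev_mem])

lemma ev1_K1: "y \<in> K1 \<Longrightarrow> ev1 y = 0"
  using gen_mem by (auto simp: K1_def ev1_def ev.hom_mult ev_gen)

lemma ev1_mconst: "ev1 (mconst c) = c"
  by (simp add: ev1_def ev_mconst coef_mconst)

text \<open>First order expansion at x = 1 modulo the relation \<open>K1\<close>: a value plus a
  combination of the generators of the ideal of the identity. The condition defines a subring, so it
  only has to be verified on constants and variables.\<close>

definition near_const :: "((nat \<times> nat) option, complex) mps set" where
  "near_const = {w \<in> W1. \<exists>c y. (\<forall>i. c i \<in> W1) \<and> y \<in> K1 \<and> w = mconst (ev1 w) + (\<Sum>i\<in>I. xi i * c i) + y}"

lemma near_constI:
  assumes "w \<in> W1" "\<And>i. c i \<in> W1" "y \<in> K1" "w = mconst (ev1 w) + (\<Sum>i\<in>I. xi i * c i) + y"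
  shows "w \<in> near_const"
  using assms unfolding near_const_def by blast

lemma mconst_W1: "c \<in> S \<Longrightarrow> mconst c \<in> W1"
  by (rule mconst_mpoly[OF subr_S])

lemma subr_near_const: "subr near_const"
proof -
  interpret e: subr_hom W1 ev1 by (rule ev1_hom)
  note Kadd = Gh.K.K_add and Kmult = Gh.K.K_mult and Kright = Gh.K.K_mult_right
  have const: "mconst c \<in> near_const" if "c \<in> S" for c
    by (rule near_constI[of _ "\<lambda>_. 0" 0]) (use that mconst_W1 Gh.K.K_zero in \<open>simp_all add: ev1_mconst\<close>)
  have mult: "v * w \<in> near_const" if vn: "v \<in> near_const" and wn: "w \<in> near_const" for v w
  proof -
    obtain c y where v: "v \<in> W1" "\<And>i. c i \<in> W1" "y \<in> K1" "v = mconst (ev1 v) + (\<Sum>i\<in>I. xi i * c i) + y"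
      using vn unfolding near_const_def by blast
    obtain c' y' where w: "w \<in> W1" "\<And>i. c' i \<in> W1" "y' \<in> K1" "w = mconst (ev1 w) + (\<Sum>i\<in>I. xi i * c' i) + y'"
      using wn unfolding near_const_def by blast
    let ?a = "mconst (ev1 v) :: ((nat \<times> nat) option, complex) mps"
    have aW: "?a \<in> W1" by (rule mconst_W1[OF ev1_mem[OF v(1)]])
    show ?thesis
    proof (rule near_constI[of _ "\<lambda>i. c i * w + ?a * c' i" "y * w + ?a * y'"])
      show "v * w \<in> W1" by (rule P.mult_mem[OF v(1) w(1)])
      show "c i * w + ?a * c' i \<in> W1" for i by (intro P.add_mem P.mult_mem v w aW)
      show "y * w + ?a * y' \<in> K1" by (intro Kadd Kmult Kright v w aW)
      have "v * w = ?a * w + (\<Sum>i\<in>I. xi i * c i) * w + y * w"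
        by (subst v(4)) (simp only: distrib_right)
      also have "?a * w = ?a * mconst (ev1 w) + ?a * (\<Sum>i\<in>I. xi i * c' i) + ?a * y'"
        by (subst w(4)) (simp only: distrib_left)
      also have "?a * mconst (ev1 w) = mconst (ev1 (v * w))"
        unfolding e.hom_mult[OF v(1) w(1)] mconst_mult ..
      also have "mconst (ev1 (v * w)) + ?a * (\<Sum>i\<in>I. xi i * c' i) + ?a * y' + (\<Sum>i\<in>I. xi i * c i) * w + y * w =
          mconst (ev1 (v * w)) + (\<Sum>i\<in>I. xi i * (c i * w + ?a * c' i)) + (y * w + ?a * y')"
        by (simp add: sum_distrib_left sum_distrib_right sum.distrib distrib_left mult.assoc mult.left_commute add.commute add.left_commute)
      finally show "v * w = mconst (ev1 (v * w)) + (\<Sum>i\<in>I. xi i * (c i * w + ?a * c' i)) + (y * w + ?a * y')" .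
    qed
  qed
  show ?thesis
  proof
    show "1 \<in> near_const" using const[OF phi.one_mem] by simp
    show "v * w \<in> near_const" if "v \<in> near_const" "w \<in> near_const" for v w by (rule mult[OF that])
    show "- v \<in> near_const" if "v \<in> near_const" for v
      using mult[OF const[OF phi.uminus_mem[OF phi.one_mem]] that] by simp
    fix v w assume vn: "v \<in> near_const" and wn: "w \<in> near_const"
    obtain c y where v: "v \<in> W1" "\<And>i. c i \<in> W1" "y \<in> K1" "v = mconst (ev1 v) + (\<Sum>i\<in>I. xi i * c i) + y"
      using vn unfolding near_const_def by blast
    obtain c' y' where w: "w \<in> W1" "\<And>i. c' i \<in> W1" "y' \<in> K1" "w = mconst (ev1 w) + (\<Sum>i\<in>I. xi i * c' i) + y'"
      using wn unfolding near_const_def by blast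
    show "v + w \<in> near_const"
    proof (rule near_constI[of _ "\<lambda>i. c i + c' i" "y + y'"])
      show "v + w \<in> W1" by (rule P.add_mem[OF v(1) w(1)])
      show "c i + c' i \<in> W1" for i by (intro P.add_mem v w)
      show "y + y' \<in> K1" by (intro Kadd v w)
      have "v + w = (mconst (ev1 v) + (\<Sum>i\<in>I. xi i * c i) + y) + (mconst (ev1 w) + (\<Sum>i\<in>I. xi i * c' i) + y')"
        using v(4) w(4) by simp
      then show "v + w = mconst (ev1 (v + w)) + (\<Sum>i\<in>I. xi i * (c i + c' i)) + (y + y')"
        unfolding e.hom_add[OF v(1) w(1)] mconst_simps distrib_left sum.distrib by (simp only: add_ac)
    qed
  qed
qed

lemma near_const_eq: "w \<in> W1 \<Longrightarrow> w \<in> near_const"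
proof -
  interpret n: subr near_const by (rule subr_near_const)
  interpret e: subr_hom W1 ev1 by (rule ev1_hom)
  have const: "mconst c \<in> near_const" if "c \<in> S" for c
    by (rule near_constI[of _ "\<lambda>_. 0" 0]) (use that mconst_W1 Gh.K.K_zero in \<open>simp_all add: ev1_mconst\<close>)
  have x: "mvar (Some kl) \<in> near_const" if kl: "kl \<in> I" for kl
  proof (rule near_constI[of _ "\<lambda>i. if i = kl then 1 else 0" 0])
    show "mvar (Some kl) \<in> W1" by (rule mvar_mpoly[OF subr_S]) (use kl in auto)
    obtain a b where ab: "kl = (a, b)" "a < n" "b < n" using kl by auto
    have "ev1 (mvar (Some kl)) = (if fst kl = snd kl then 1 else 0)"
      using ab by (simp add: ev1_def ev_Some xm_def coef_one coef_mvar)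
    moreover have "(\<Sum>i\<in>I. xi i * (if i = kl then 1 else 0)) = xi kl"
      using kl by (simp add: if_distrib[of "(*) _"] sum.delta cong: if_cong)
    ultimately show "mvar (Some kl) = mconst (ev1 (mvar (Some kl))) + (\<Sum>i\<in>I. xi i * (if i = kl then 1 else 0)) + 0"
      by (simp add: xi_def)
  qed (auto simp: Gh.K.K_zero)
  let ?y = "mvar None :: ((nat \<times> nat) option, complex) mps" and ?D = "det Xvar"
  have DW: "?D \<in> W1" by (rule P.det_mem[OF Xvar_mem])
  have "?D \<in> near_const"
    by (rule n.det_mem[of _ n]) (rule smatsI, simp_all add: Xvar_def x)
  then obtain c y where D: "\<And>i. c i \<in> W1" "y \<in> K1" "?D = mconst (ev1 ?D) + (\<Sum>i\<in>I. xi i * c i) + y"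
    unfolding near_const_def by blast
  have eD: "ev1 ?D = 1"
    unfolding ev1_def ev.hom_det[OF Xvar_mem] ev_Xvar ct.hom_det[OF xm_mem] ctm_xm by simp
  have gK: "gen \<in> K1" unfolding K1_def using P.one_mem by (metis (mono_tags, lifting) CollectI mult_1)
  have "ev1 gen = 0" by (rule ev1_K1[OF gK])
  then have ey: "ev1 ?y = 1"
    unfolding gen_def e.hom_diff[OF P.mult_mem[OF None_mem DW] P.one_mem] e.hom_mult[OF None_mem DW] eD e.hom_one by simp
  have "?y \<in> near_const"
  proof (rule near_constI[of _ "\<lambda>i. - (?y * c i)" "gen * 1 + ?y * - y"])
    show "- (?y * c i) \<in> W1" for i by (intro P.uminus_mem P.mult_mem None_mem D)
    show "gen * 1 + ?y * - y \<in> K1"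
      by (intro Gh.K.K_add Gh.K.K_mult Gh.K.K_mult_right gK Gh.K.K_uminus D None_mem P.one_mem)
    \<comment> \<open>y det(x) = 1 + \<open>gen\<close>, and det(x) is 1 plus a combination of the
      \<open>xi\<close> modulo \<open>K1\<close>; solving for y puts it in the required
      form.\<close>
    have "?y * ?D = ?y + ?y * (\<Sum>i\<in>I. xi i * c i) + ?y * y"
      by (subst D(3)) (simp add: eD distrib_left)
    then have "?y = 1 + gen - ?y * (\<Sum>i\<in>I. xi i * c i) - ?y * y"
      unfolding gen_def by simp
    also have "\<dots> = mconst (ev1 ?y) + (\<Sum>i\<in>I. xi i * - (?y * c i)) + (gen * 1 + ?y * - y)"
      unfolding ey by (simp add: sum_distrib_left sum_negf mult.left_commute)
    finally show "?y = mconst (ev1 ?y) + (\<Sum>i\<in>I. xi i * - (?y * c i)) + (gen * 1 + ?y * - y)" .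
  qed (rule None_mem)
  then have "mvar i \<in> near_const" if "i \<in> I'" for i using that x by auto
  from mpoly_over_induct[OF subr_near_const const this] show "w \<in> W1 \<Longrightarrow> w \<in> near_const" by blast
qed

lemma identity_ideal_gens:
  "elements_mat (rmat_diff B (GLhat_coord AA n p) (rmat_one B n)) = (\<lambda>i. G.LL (\<lambda>_. xi i)) ` I"
proof -
  let ?M = "rmat_diff B (GLhat_coord AA n p) (rmat_one B n)"
  have M: "?M \<in> carrier_mat n n" by (rule carrier_matI) (simp_all add: rmat_diff_def GLhat_coord_eq Xvar_def)
  have e: "?M $$ (i, j) = G.LL (\<lambda>_. xi (i, j))" if "i < n" "j < n" for i j
  proof -
    have m: "mvar (Some (i, j)) \<in> W1" by (rule mvar_mpoly[OF subr_S]) (use that in auto)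
    show ?thesis
      using that Gh.L_minus[OF Gh.coh_const[OF m] Gh.coh_const[OF P.one_mem]]
        Gh.L_minus[OF Gh.coh_const[OF m] Gh.coh_const[OF P.zero_mem]]
      by (cases "i = j") (simp_all add: rmat_diff_def rmat_one_def GLhat_coord_eq Xvar_def xi_def Gh.L_one Gh.L_zero)
  qed
  show ?thesis
  proof (intro equalityI subsetI)
    fix a assume "a \<in> elements_mat ?M"
    then obtain i j where "i < n" "j < n" "a = ?M $$ (i, j)"
      using elements_matD[of a ?M] carrier_matD[OF M] by auto
    then show "a \<in> (\<lambda>i. G.LL (\<lambda>_. xi i)) ` I" using e by (intro image_eqI[of _ _ "(i, j)"]) auto
  next
    fix a assume "a \<in> (\<lambda>i. G.LL (\<lambda>_. xi i)) ` I"
    then obtain i j where "i < n" "j < n" "a = G.LL (\<lambda>_. xi (i, j))" by auto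
    then show "a \<in> elements_mat ?M" using e elements_matI[OF M] by metis
  qed
qed

lemma xi_closed: "i \<in> I \<Longrightarrow> G.LL (\<lambda>_. xi i) \<in> carrier B"
  by (rule Gh.L_closed[OF Gh.coh_const[OF xi_mem]])

lemma identity_ideal_ideal: "ideal (identity_ideal AA n p) B"
  unfolding identity_ideal_def Let_def identity_ideal_gens
  by (rule Gh.Q.genideal_ideal) (use xi_closed in blast)

text \<open>Every polynomial is its value at the identity plus a combination of the generators \<open>xi\<close>;
  applied to the increments of a coherent sequence, this gives coefficients that converge.\<close>
lemma identity_idealI:
  assumes f: "f \<in> carrier B" and z: "iota f {#} = \<zero>\<^bsub>Ahat\<^esub>"
  shows "f \<in> identity_ideal AA n p"
proof -
  interpret e: subr_hom W1 ev1 by (rule ev1_hom)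
  interpret J: ideal "identity_ideal AA n p" B by (rule identity_ideal_ideal)
  obtain g where g: "Gh.coh g" "f = G.LL g" using Gh.carrierE[OF f] by blast
  note gW = Gh.cohD(1)[OF g(1)]
  obtain u y where u: "\<And>j. u j \<in> W1" "\<And>j. y j \<in> K1" "\<And>j. g (Suc j) - g j = u j * of_nat p ^ j + y j"
    using Gh.increments[OF g(1)] by blast
  have "\<forall>w. \<exists>c. w \<in> W1 \<longrightarrow> (\<forall>i. c i \<in> W1) \<and> w - mconst (ev1 w) - (\<Sum>i\<in>I. xi i * c i) \<in> K1"
  proof
    fix w
    show "\<exists>c. w \<in> W1 \<longrightarrow> (\<forall>i. c i \<in> W1) \<and> w - mconst (ev1 w) - (\<Sum>i\<in>I. xi i * c i) \<in> K1"
    proof (cases "w \<in> W1")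
      case True
      obtain c y where c: "\<forall>i. c i \<in> W1" "y \<in> K1" "w = mconst (ev1 w) + (\<Sum>i\<in>I. xi i * c i) + y"
        using near_const_eq[OF True] unfolding near_const_def by blast
      have "w - mconst (ev1 w) - (\<Sum>i\<in>I. xi i * c i) = y" by (subst c(3)) simp
      then show ?thesis using c(1,2) by (intro exI[of _ c]) simp
    qed simp
  qed
  from choice[OF this] obtain C where C: "\<And>w i. w \<in> W1 \<Longrightarrow> C w i \<in> W1"
    "\<And>w. w \<in> W1 \<Longrightarrow> w - mconst (ev1 w) - (\<Sum>i\<in>I. xi i * C w i) \<in> K1" by blast
  \<comment> \<open>The coefficients are assembled from those of the first term and of the
    increments, which makes them coherent; separate choices for each \<open>g k\<close> need not fit
    together.\<close>
  define H where "H i k = C (g 0) i + (\<Sum>j<k. C (u j) i * of_nat p ^ j)" for i k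
  have H: "Gh.coh (H i)" for i unfolding H_def by (rule Gh.coh_series) (intro C gW u)+
  have d: "g k - mconst (ev1 (g k)) - (\<Sum>i\<in>I. xi i * H i k) \<in> K1" for k
  proof (induction k)
    case 0
    then show ?case using C(2)[OF gW] by (simp add: H_def)
  next
    case (Suc k)
    let ?p = "of_nat p ^ k :: ((nat \<times> nat) option, complex) mps"
    have pW: "?p \<in> W1" by (intro P.power_mem P.of_nat_mem)
    have gs: "g (Suc k) = g k + (u k * ?p + y k)" using u(3)[of k] by (simp add: algebra_simps)
    have yW: "y k \<in> W1" by (rule Gh.K.K_sub[THEN subsetD, OF u(2)])
    have up: "ev1 (u k * ?p) = ev1 (u k) * of_nat p ^ k"
      unfolding e.hom_mult[OF u(1) pW] e.hom_power[OF P.of_nat_mem] e.hom_of_nat ..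
    have "ev1 (g (Suc k)) = ev1 (g k) + ev1 (u k) * of_nat p ^ k"
      unfolding gs using e.hom_add[OF gW P.add_mem[OF P.mult_mem[OF u(1) pW] yW]]
        e.hom_add[OF P.mult_mem[OF u(1) pW] yW] ev1_K1[OF u(2)] up by simp
    then have m: "mconst (ev1 (g (Suc k))) = mconst (ev1 (g k)) + mconst (ev1 (u k)) * ?p"
      by (simp add: mconst_power mconst_of_nat)
    have h: "(\<Sum>i\<in>I. xi i * H i (Suc k)) = (\<Sum>i\<in>I. xi i * H i k) + (\<Sum>i\<in>I. xi i * C (u k) i) * ?p"
      by (simp add: H_def distrib_left sum.distrib sum_distrib_right mult.assoc)
    have "g (Suc k) - mconst (ev1 (g (Suc k))) - (\<Sum>i\<in>I. xi i * H i (Suc k)) =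
        (g k - mconst (ev1 (g k)) - (\<Sum>i\<in>I. xi i * H i k)) +
        ((u k - mconst (ev1 (u k)) - (\<Sum>i\<in>I. xi i * C (u k) i)) * ?p + y k)"
      unfolding gs m[unfolded gs] h by (simp add: left_diff_distrib)
    then show ?case
      by (simp only:) (intro Gh.K.K_add Gh.K.K_mult_right Suc C(2)[OF u(1)] u(2) pW)
  qed
  have evcoh: "Th.coh (\<lambda>k. ev (g k))" by (rule iota.coh_h[OF g(1)])
  \<comment> \<open>A vanishing constant term of the expansion means that \<open>ev1 (g k)\<close>
    is divisible by p^k, so it disappears at level k.\<close>
  have "A.LL (\<lambda>k. ev1 (g k)) = A.LL (\<lambda>_. 0)"
    using z unfolding g(2) iota.lift_L[OF g(1)] powser_lim_def ev1_def Ah.L_zero .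
  then have eN: "ev1 (g k) - 0 \<in> A.NN k" for k
    using Ah.L_eq_iff[OF coh_const_coef[OF evcoh, of "{#}"] Ah.coh_const[OF phi.zero_mem]] unfolding ev1_def by blast
  have eG: "mconst (ev1 (g k)) \<in> G.NN k" for k
  proof -
    obtain s where "s \<in> S" "ev1 (g k) = s * of_nat p ^ k" using eN[of k] by (auto simp: A.NN_def)
    then show ?thesis using Gh.pow_mem_N[OF mconst_W1, of s k] by (simp add: mconst_power mconst_of_nat)
  qed
  have fs: "finsum B (\<lambda>i. G.LL (\<lambda>k. xi i * H i k)) I = G.LL (\<lambda>k. \<Sum>i\<in>I. xi i * H i k) \<and>
      Gh.coh (\<lambda>k. \<Sum>i\<in>I. xi i * H i k)"
    by (rule Gh.L_finsum) (simp, rule Gh.coh_mult[OF Gh.coh_const[OF xi_mem] H])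
  have "g k - (\<Sum>i\<in>I. xi i * H i k) \<in> G.NN k" for k
  proof -
    have "(g k - mconst (ev1 (g k)) - (\<Sum>i\<in>I. xi i * H i k)) + mconst (ev1 (g k)) \<in> G.NN k"
      by (rule Gh.N.K_add[OF Gh.K_sub_N[THEN subsetD, OF d] eG])
    then show ?thesis by simp
  qed
  then have "f = finsum B (\<lambda>i. G.LL (\<lambda>k. xi i * H i k)) I"
    unfolding g(2) using Gh.L_eq_iff[OF g(1) conjunct2[OF fs]] fs by simp
  also have "\<dots> \<in> identity_ideal AA n p"
  proof (rule J.finsum_mem)
    fix i assume i: "i \<in> I"
    have "G.LL (\<lambda>_. xi i) \<in> identity_ideal AA n p"
      unfolding identity_ideal_def Let_def identity_ideal_gens
      using Gh.Q.genideal_self[of "(\<lambda>i. G.LL (\<lambda>_. xi i)) ` I"] xi_closed i by blast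
    then have "G.LL (\<lambda>_. xi i) \<otimes>\<^bsub>B\<^esub> G.LL (H i) \<in> identity_ideal AA n p"
      by (rule J.I_r_closed[OF _ Gh.L_closed[OF H]])
    then show "G.LL (\<lambda>k. xi i * H i k) \<in> identity_ideal AA n p"
      by (simp only: Gh.L_mult[OF Gh.coh_const[OF xi_mem[OF i]] H])
  qed simp
  finally show ?thesis .
qed

text \<open>The preimage of an ideal is an ideal, so only the generators x - 1 matter; their images
  expand to the \<tau>, which have no constant term, and \<open>identity_idealI\<close>
  applies.\<close>

lemma Phi_identity_ideal: "\<Phi> ` identity_ideal AA n p \<subseteq> identity_ideal AA n p"
proof -
  interpret ph: ring_hom_ring B B \<Phi>
    by (intro ring_hom_ringI2 Gh.Q.ring_axioms Phi_hom)
  have id: "ideal {f \<in> carrier B. \<Phi> f \<in> identity_ideal AA n p} B"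
    by (rule ph.ideal_vimage[OF identity_ideal_ideal])
  have "(\<lambda>i. G.LL (\<lambda>_. xi i)) ` I \<subseteq> {f \<in> carrier B. \<Phi> f \<in> identity_ideal AA n p}"
  proof
    fix f assume "f \<in> (\<lambda>i. G.LL (\<lambda>_. xi i)) ` I"
    then obtain i where i: "i \<in> I" "f = G.LL (\<lambda>_. xi i)" by blast
    have fB: "f \<in> carrier B" unfolding i(2) by (rule xi_closed[OF i(1)])
    obtain a b where ab: "i = (a, b)" "a < n" "b < n" using i(1) by auto
    have m: "mvar (Some i) \<in> W1" by (rule mvar_mpoly[OF subr_S]) (use i in auto)
    have dW: "(if fst i = snd i then 1 else 0) \<in> W1" by auto
    have "ev (xi i) = mvar i"
      unfolding xi_def ev.hom_diff[OF m dW] ev_Some using ab by (simp add: xm_def ev.hom_one ev.hom_zero)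
    then have "iota (\<Phi> f) = LT (\<lambda>_. \<tau> i)"
      using Psi_iota[OF fB] iota_const[OF xi_mem[OF i(1)]] Psi_const[OF mvar_over[OF subr_S i(1)]]
        psi.subst_mvar[OF i(1)] by (simp add: i(2))
    moreover have "coef (\<tau> i) {#} = 0" using psi.tau_ord[OF i(1)] by (simp add: ordge_1)
    ultimately have "iota (\<Phi> f) {#} = \<zero>\<^bsub>Ahat\<^esub>" by (simp add: powser_lim_def Ah.L_zero)
    then show "f \<in> {f \<in> carrier B. \<Phi> f \<in> identity_ideal AA n p}"
      using fB identity_idealI[OF ring_hom_closed[OF Phi_hom fB]] by blast
  qed
  from Gh.Q.genideal_minimal[OF id this] show ?thesis
    unfolding identity_ideal_def Let_def identity_ideal_gens by blast
qed

end

section \<open>Ideals of the power series ring\<close>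

context presentation
begin

lemma ideal_preimage:
  assumes "ideal J R"
  shows "subr_ideal W {w \<in> W. \<pi> w \<in> J}"
proof -
  interpret J: ideal J R by fact
  show ?thesis
    by unfold_locales (auto simp: pi_zero pi_add pi_mult pi_closed J.I_l_closed)
qed

lemma ideal_image:
  assumes "subr_ideal W J"
  shows "ideal (\<pi> ` J) R"
proof -
  interpret J: subr_ideal W J by fact
  have JW: "w \<in> W" if "w \<in> J" for w using that J.K_sub by blast
  show ?thesis
  proof (rule idealI[OF R.ring_axioms])
    show "subgroup (\<pi> ` J) (add_monoid R)"
    proof
      show "\<pi> ` J \<subseteq> carrier (add_monoid R)" using JW pi_closed by auto
      show "\<one>\<^bsub>add_monoid R\<^esub> \<in> \<pi> ` J" using J.K_zero pi_zero by (auto intro!: image_eqI[of _ _ 0])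
      fix x assume "x \<in> \<pi> ` J"
      then obtain w where w: "w \<in> J" "x = \<pi> w" by blast
      have "inv\<^bsub>add_monoid R\<^esub> x = \<pi> (- w)"
        unfolding w(2) pi_uminus[OF JW[OF w(1)]] by (simp add: a_inv_def)
      then show "inv\<^bsub>add_monoid R\<^esub> x \<in> \<pi> ` J" using J.K_uminus[OF w(1)] by blast
      fix y assume "y \<in> \<pi> ` J"
      then obtain v where v: "v \<in> J" "y = \<pi> v" by blast
      have "x \<otimes>\<^bsub>add_monoid R\<^esub> y = \<pi> (w + v)"
        unfolding w(2) v(2) using pi_add[OF JW[OF w(1)] JW[OF v(1)]] by simp
      then show "x \<otimes>\<^bsub>add_monoid R\<^esub> y \<in> \<pi> ` J" using J.K_add[OF w(1) v(1)] by blast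
    qed
    fix a x assume "a \<in> \<pi> ` J" "x \<in> carrier R"
    then obtain w v where w: "w \<in> J" "a = \<pi> w" and v: "v \<in> W" "x = \<pi> v" by (auto simp: carrier_R)
    have "x \<otimes>\<^bsub>R\<^esub> a = \<pi> (v * w)" "a \<otimes>\<^bsub>R\<^esub> x = \<pi> (w * v)"
      unfolding w(2) v(2) using pi_mult JW[OF w(1)] v(1) by auto
    then show "x \<otimes>\<^bsub>R\<^esub> a \<in> \<pi> ` J" "a \<otimes>\<^bsub>R\<^esub> x \<in> \<pi> ` J"
      using J.K_mult[OF v(1) w(1)] J.K_mult_right[OF w(1) v(1)] by blast+
  qed
qed

text \<open>Let J be the ideal of W that corresponds to the generated one. It contains G, hence h(G)
  by assumption; so its preimage under h is an ideal containing G and therefore contains J.\<close>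

lemma genideal_hom_stable:
  assumes inj: "inj_on \<pi> W" and G: "G \<subseteq> W" and h: "subr_hom W h" "\<And>w. w \<in> W \<Longrightarrow> h w \<in> W"
    and stable: "\<And>J. subr_ideal W J \<Longrightarrow> G \<subseteq> J \<Longrightarrow> h ` G \<subseteq> J"
    and w: "w \<in> W" "\<pi> w \<in> Idl\<^bsub>R\<^esub> (\<pi> ` G)"
  shows "\<pi> (h w) \<in> Idl\<^bsub>R\<^esub> (\<pi> ` G)"
proof -
  interpret h: subr_hom W h by fact
  let ?I = "Idl\<^bsub>R\<^esub> (\<pi> ` G)"
  have GR: "\<pi> ` G \<subseteq> carrier R" using G pi_closed by auto
  define J where "J = {w \<in> W. \<pi> w \<in> ?I}"
  have J: "subr_ideal W J" unfolding J_def by (rule ideal_preimage[OF R.genideal_ideal[OF GR]])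
  interpret J: subr_ideal W J by (rule J)
  have "G \<subseteq> J" using G R.genideal_self[OF GR] by (auto simp: J_def)
  then have hG: "h ` G \<subseteq> J" by (rule stable[OF J])
  have "subr_ideal W {w \<in> W. h w \<in> J}"
    by unfold_locales (auto simp: h.hom_zero h.hom_add h.hom_mult J.K_zero J.K_add J.K_mult h(2))
  from ideal_image[OF this] have "?I \<subseteq> \<pi> ` {w \<in> W. h w \<in> J}"
    by (rule R.genideal_minimal) (use G hG in blast)
  then obtain v where v: "v \<in> W" "h v \<in> J" "\<pi> w = \<pi> v" using w(2) by blast
  have "w = v" by (rule inj_onD[OF inj v(3) w(1) v(1)])
  then show ?thesis using v(2) by (simp add: J_def)
qed

end

lemma elements_map_mat: "elements_mat (map_mat f Y) = f ` elements_mat Y"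
  unfolding elements_mat_def by force

section \<open>The ideals of symmetries in terms of generators among the series\<close>

context chern_core
begin

lemma series_coord_eq: "series_coord AA n = map_mat coef xm"
proof (rule eq_matI)
  fix i j assume "i < dim_row (map_mat coef xm)" "j < dim_col (map_mat coef xm)"
  then have ij: "i < n" "j < n" by simp_all
  let ?d = "if i = j then 1 else 0 :: (nat \<times> nat, complex) mps"
  have m: "mvar (i, j) \<in> R" "?d \<in> R" using ij by (auto intro!: mvar_over[OF subr_S])
  have "rmat_one (T_series AA n) n $$ (i, j) = coef ?d"
    using ij by (simp add: T.pi_rmat_one)
  then show "series_coord AA n $$ (i, j) = map_mat coef xm $$ (i, j)"
    using ij T.pi_add[OF m(2,1)]
    by (simp add: series_coord_def rmat_add_def rmat_one_def xm_def indexed_var_rec[OF subr_S] del: coef_add)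
qed (simp_all add: series_coord_def rmat_add_def rmat_one_def)

lemma coef_transpose: "transpose_mat (map_mat coef Y) = map_mat coef (transpose_mat Y)"
  by (rule eq_matI) auto

lemma xm_transpose_mem: "transpose_mat xm \<in> smats R n"
  by (rule R.smats_intros(3)[OF xm_mem])

lemma ideal_J_eq:
  "ideal_J AA n q = Idl\<^bsub>T_series AA n\<^esub> (coef ` elements_mat (transpose_mat xm * cmat q * xm - cmat q))"
proof -
  have c: "map_mat (ring.indexed_const AA) q = map_mat coef (cmat q)"
    by (rule eq_matI) (auto simp: indexed_const_rec[OF subr_S])
  note m = R.smats_mult[OF xm_transpose_mem cmat_mem[OF q]]
  show ?thesis
    unfolding ideal_J_def Let_def c series_coord_eq rmat_conj_def coef_transpose
      T.pi_rmat_mult[OF xm_transpose_mem cmat_mem[OF q]] T.pi_rmat_mult[OF m xm_mem]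
      T.pi_rmat_diff[OF R.smats_mult[OF m xm_mem] cmat_mem[OF q]] elements_map_mat ..
qed

definition K_gens :: "nat \<Rightarrow> (nat \<times> nat, complex) mps set" where
  "K_gens r = elements_mat (transpose_mat xm * xm - 1\<^sub>m n) \<union>
     elements_mat (mat r r (\<lambda>(i, j). xm $$ (i, j) - xm $$ (i + r, j + r))) \<union>
     elements_mat (mat r r (\<lambda>(i, j). xm $$ (i, j + r) + xm $$ (i + r, j)))"

lemma ideal_K_eq:
  assumes n: "n = 2 * r"
  shows "ideal_K AA r = Idl\<^bsub>T_series AA n\<^esub> (coef ` K_gens r)"
proof -
  let ?T = "T_series AA n"
  let ?x = "series_coord AA n"
  let ?a = "mat r r (\<lambda>(i, j). coef (xm $$ (i, j)))" and ?b = "mat r r (\<lambda>(i, j). coef (xm $$ (i, j + r)))"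
    and ?c = "mat r r (\<lambda>(i, j). coef (xm $$ (i + r, j)))" and ?d = "mat r r (\<lambda>(i, j). coef (xm $$ (i + r, j + r)))"
  have r: "n - r = r" and lt: "\<And>i. i < r \<Longrightarrow> i < n" "\<And>i. i < r \<Longrightarrow> i + r < n" using n by simp_all
  have ent: "?x $$ (i, j) = coef (xm $$ (i, j))" if "i < n" "j < n" for i j
    unfolding series_coord_eq using that by simp
  have "split_block ?x r r = (mat r r (\<lambda>ij. ?x $$ ij), mat r r (\<lambda>(i, j). ?x $$ (i, j + r)),
      mat r r (\<lambda>(i, j). ?x $$ (i + r, j)), mat r r (\<lambda>(i, j). ?x $$ (i + r, j + r)))"
    by (simp add: split_block_def Let_def series_coord_eq r)
  also have "mat r r (\<lambda>ij. ?x $$ ij) = ?a" by (rule eq_matI) (auto simp: ent lt)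
  also have "mat r r (\<lambda>(i, j). ?x $$ (i, j + r)) = ?b" by (rule eq_matI) (auto simp: ent lt)
  also have "mat r r (\<lambda>(i, j). ?x $$ (i + r, j)) = ?c" by (rule eq_matI) (auto simp: ent lt)
  also have "mat r r (\<lambda>(i, j). ?x $$ (i + r, j + r)) = ?d" by (rule eq_matI) (auto simp: ent lt)
  finally have s: "split_block ?x r r = (?a, ?b, ?c, ?d)" .
  have xR: "xm $$ (i, j) \<in> R" if "i < n" "j < n" for i j by (rule smats_entry[OF xm_mem that])
  have 1: "rmat_diff ?T ?a ?d = map_mat coef (mat r r (\<lambda>(i, j). xm $$ (i, j) - xm $$ (i + r, j + r)))"
    unfolding rmat_diff_def by (rule eq_matI) (auto simp: T.pi_minus xR lt simp del: coef_diff)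
  have 2: "rmat_add ?T ?b ?c = map_mat coef (mat r r (\<lambda>(i, j). xm $$ (i, j + r) + xm $$ (i + r, j)))"
    unfolding rmat_add_def by (rule eq_matI) (auto simp: T.pi_add xR lt simp del: coef_add)
  have 3: "rmat_diff ?T (rmat_mult ?T (transpose_mat ?x) ?x) (rmat_one ?T n) =
      map_mat coef (transpose_mat xm * xm - 1\<^sub>m n)"
    unfolding series_coord_eq coef_transpose T.pi_rmat_mult[OF xm_transpose_mem xm_mem] T.pi_rmat_one
    by (rule T.pi_rmat_diff[OF R.smats_mult[OF xm_transpose_mem xm_mem] R.smats_intros(4)])
  show ?thesis
    unfolding ideal_K_def Let_def n[symmetric] s prod.case 1 2 3 elements_map_mat K_gens_def image_Un ..
qed

lemma J_gens_stable:
  assumes "subr_ideal R J" "elements_mat (transpose_mat xm * cmat q * xm - cmat q) \<subseteq> J"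
  shows "psi ` elements_mat (transpose_mat xm * cmat q * xm - cmat q) \<subseteq> J"
proof -
  have "transpose_mat xm * cmat q * xm - cmat q \<in> carrier_mat n n"
    by (rule minus_carrier_mat) simp
  then have "transpose_mat xm * cmat q * xm - cmat q \<in> smats J n"
    using assms(2) by (simp add: smats_elements)
  from psi_J[OF assms(1) this] show ?thesis by (simp add: smats_elements elements_map_mat)
qed

lemma K_gens_stable:
  assumes n: "n = 2 * r" and q1: "q = 1\<^sub>m n" and J: "subr_ideal R J" "K_gens r \<subseteq> J"
  shows "psi ` K_gens r \<subseteq> J"
proof -
  let ?o = "transpose_mat xm * xm - 1\<^sub>m n"
  let ?A = "mat r r (\<lambda>(i, j). xm $$ (i, j) - xm $$ (i + r, j + r))"
    and ?B = "mat r r (\<lambda>(i, j). xm $$ (i, j + r) + xm $$ (i + r, j))"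
  have el: "elements_mat ?o \<subseteq> J" "elements_mat ?A \<subseteq> J" "elements_mat ?B \<subseteq> J"
    using J(2) unfolding K_gens_def by blast+
  have "?o \<in> carrier_mat n n" by (rule minus_carrier_mat) simp
  then have o: "?o \<in> smats J n" using el(1) by (simp add: smats_elements)
  have AB: "?A \<in> smats J r" "?B \<in> smats J r" using el(2,3) by (simp_all add: smats_elements)
  have a: "xm $$ (i, j) - xm $$ (i + r, j + r) \<in> J" if "i < r" "j < r" for i j
    using smats_entry[OF AB(1) that] that by simp
  have b: "xm $$ (i, j + r) + xm $$ (i + r, j) \<in> J" if "i < r" "j < r" for i j
    using smats_entry[OF AB(2) that] that by simp
  have "map_mat psi ?o \<in> smats J n" by (rule psi_K_orth[OF n q1 J(1) o a b])
  moreover have "map_mat psi ?A \<in> smats J r"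
    by (rule smatsI) (simp_all add: psi_K_ad[OF n q1 J(1) o a b])
  moreover have "map_mat psi ?B \<in> smats J r"
    by (rule smatsI) (simp_all add: psi_K_bc[OF n q1 J(1) o a b])
  ultimately show ?thesis
    unfolding K_gens_def image_Un by (simp add: smats_elements elements_map_mat)
qed

lemma J_gens_sub: "elements_mat (transpose_mat xm * cmat q * xm - cmat q) \<subseteq> R"
proof -
  have "transpose_mat xm * cmat q * xm - cmat q \<in> smats R n"
    by (intro R.smats_intros(2) R.smats_mult xm_transpose_mem xm_mem cmat_mem q)
  then show ?thesis by (simp only: smats_elements)
qed

lemma K_gens_sub:
  assumes "n = 2 * r"
  shows "K_gens r \<subseteq> R"
proof -
  have lt: "\<And>i. i < r \<Longrightarrow> i < n" "\<And>i. i < r \<Longrightarrow> i + r < n" using assms by simp_all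
  have "transpose_mat xm * xm - 1\<^sub>m n \<in> smats R n"
    by (intro R.smats_intros(2,4) R.smats_mult xm_transpose_mem xm_mem)
  moreover have "mat r r (\<lambda>(i, j). xm $$ (i, j) - xm $$ (i + r, j + r)) \<in> smats R r"
    by (rule smatsI) (auto intro!: R.diff_mem smats_entry[OF xm_mem] lt)
  moreover have "mat r r (\<lambda>(i, j). xm $$ (i, j + r) + xm $$ (i + r, j)) \<in> smats R r"
    by (rule smatsI) (auto intro!: R.add_mem smats_entry[OF xm_mem] lt)
  ultimately show ?thesis unfolding K_gens_def by (simp only: smats_elements Un_least)
qed

lemma Mps_mem:
  assumes "f \<in> carrier (T_series AA n)"
  shows "Mps f \<in> R" "coef (Mps f) = f"
  using assms by (auto simp: T.carrier_R coef_inverse)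

lemma genideal_psi:
  assumes G: "G \<subseteq> R" and "\<And>J. subr_ideal R J \<Longrightarrow> G \<subseteq> J \<Longrightarrow> psi ` G \<subseteq> J"
  shows "Idl\<^bsub>T_series AA n\<^esub> (coef ` G) \<subseteq> carrier (T_series AA n)" (is "?I \<subseteq> _")
    and "f \<in> Idl\<^bsub>T_series AA n\<^esub> (coef ` G) \<Longrightarrow> coef (psi (Mps f)) \<in> Idl\<^bsub>T_series AA n\<^esub> (coef ` G)"
proof -
  have "coef ` G \<subseteq> carrier (T_series AA n)" unfolding T.carrier_R using G by (rule image_mono)
  then have "ideal ?I (T_series AA n)" by (rule T.R.genideal_ideal)
  then show sub: "?I \<subseteq> carrier (T_series AA n)" by (intro subsetI ideal.Icarr)
  assume f: "f \<in> ?I"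
  note m = Mps_mem[OF subsetD[OF sub f]]
  have "inj_on coef R" by (simp add: inj_on_def coef_inject)
  then show "coef (psi (Mps f)) \<in> ?I"
  proof (rule T.genideal_hom_stable[OF _ G psi.subst_hom])
    show "psi w \<in> R" if "w \<in> R" for w using that by (rule psi.subst_mem)
    show "psi ` G \<subseteq> J" if "subr_ideal R J" "G \<subseteq> J" for J using that by (rule assms(2))
    show "Mps f \<in> R" by (rule m(1))
    show "coef (Mps f) \<in> ?I" unfolding m(2) by (rule f)
  qed
qed

end

context chern_hat
begin

text \<open>Series over A embed as constant sequences, on which the induced endomorphism is the
  substitution \<open>psi\<close>; stability thus becomes a statement inside A[[T]].\<close>

lemma induced_endo_stable:
  assumes J: "J \<subseteq> carrier (T_series AA n)" and stable: "\<And>f. f \<in> J \<Longrightarrow> coef (psi (Mps f)) \<in> J"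
  shows "induced_endo AA n p \<Phi> ` (series_embed AA p ` J) \<subseteq> series_embed AA p ` J"
  unfolding image_image
proof (rule image_subsetI)
  have emb: "series_embed AA p (coef w) = LT (\<lambda>_. w)" for w :: "(nat \<times> nat, complex) mps"
    unfolding series_embed_def powser_lim_def A.to_completion_pi ..
  fix f assume f: "f \<in> J"
  note m = Mps_mem[OF subsetD[OF J f]]
  have "induced_endo AA n p \<Phi> (series_embed AA p (coef (Mps f))) = series_embed AA p (coef (psi (Mps f)))"
    unfolding induced_endo_eq emb by (rule Psi_const[OF m(1)])
  then show "induced_endo AA n p \<Phi> (series_embed AA p f) \<in> series_embed AA p ` J"
    unfolding m(2) using stable[OF f] by simp
qed

lemma stable_carrier:
  "induced_endo AA n p \<Phi> ` (series_embed AA p ` carrier (T_series AA n)) \<subseteq> series_embed AA p ` carrier (T_series AA n)"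
  by (rule induced_endo_stable) (simp_all add: T.pi_closed psi.subst_mem Mps_mem)

lemma stable_J:
  "induced_endo AA n p \<Phi> ` (series_embed AA p ` ideal_J AA n q) \<subseteq> series_embed AA p ` ideal_J AA n q"
  unfolding ideal_J_eq by (intro induced_endo_stable genideal_psi J_gens_sub J_gens_stable)

lemma stable_K:
  assumes "n = 2 * r" "q = 1\<^sub>m n"
  shows "induced_endo AA n p \<Phi> ` (series_embed AA p ` ideal_K AA r) \<subseteq> series_embed AA p ` ideal_K AA r"
  unfolding ideal_K_eq[OF assms(1)] by (intro induced_endo_stable genideal_psi K_gens_sub K_gens_stable assms)

end

section \<open>Chern connections over cyclotomic rings\<close>

text \<open>For w nonzero, \<phi>(w) and w^p are roots of unity congruent modulo p. Their quotient
  is \<phi>(w) v, where v = w^(p(k-1)) is the inverse of w^p; it is a root of unity congruent to 1,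
  hence equal to 1.\<close>

lemma frobenius_root_of_unity:
  fixes S :: "complex set"
  assumes hom: "subr_hom S \<phi>" and p: "prime p" "odd p" "1 / of_nat p \<notin> S"
    and closed: "\<And>a. a \<in> S \<Longrightarrow> \<phi> a \<in> S"
    and frob: "\<And>a. a \<in> S \<Longrightarrow> \<exists>x\<in>S. \<phi> a - a ^ p = x * of_nat p"
    and w: "w \<in> S" "w = 0 \<or> (\<exists>k>0. w ^ k = 1)"
  shows "\<phi> w = w ^ p"
proof (cases "w = 0")
  case True
  interpret phi: subr_hom S \<phi> by (rule hom)
  show ?thesis using p prime_gt_0_nat by (simp add: True phi.hom_zero zero_power)
next
  case False
  interpret phi: subr_hom S \<phi> by (rule hom)
  from False w(2) obtain k where k: "k > 0" "w ^ k = 1" by blast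
  define v where "v = (w ^ (k - 1)) ^ p"
  have v: "v \<in> S" unfolding v_def by (intro phi.power_mem w)
  have wv: "w ^ p * v = 1"
    unfolding v_def power_mult_distrib[symmetric] using k by (simp flip: power_Suc)
  obtain x where x: "x \<in> S" "\<phi> w - w ^ p = x * of_nat p" using frob[OF w(1)] by blast
  have "\<phi> w * v - w ^ p * v = x * of_nat p * v" unfolding x(2)[symmetric] by (rule left_diff_distrib[symmetric])
  then have c: "\<phi> w * v - 1 = of_nat p * (x * v)" unfolding wv by (simp add: ac_simps)
  have "\<phi> w ^ k = 1" using phi.hom_power[OF w(1), of k] by (simp add: k phi.hom_one)
  moreover have "v ^ k = 1"
    unfolding v_def power_mult[symmetric] using k(2) by (metis mult.commute power_mult power_one)
  ultimately have "(\<phi> w * v) ^ k = 1" by (simp add: power_mult_distrib)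
  then have "\<phi> w * v = 1"
    by (rule root_of_unity_congruent_1[OF phi.subr_axioms p k(1) _ c]) (intro phi.mult_mem x v)
  then have "\<phi> w * v = w ^ p * v" by (simp only: wv)
  moreover have "v \<noteq> 0" using wv by auto
  ultimately show ?thesis by simp
qed

lemma frobenius_lift_rec:
  assumes "subr S" and f: "frobenius_lift (rec S) p \<phi>"
  shows "subr_hom S \<phi>" "a \<in> S \<Longrightarrow> \<phi> a \<in> S" "a \<in> S \<Longrightarrow> \<exists>x\<in>S. \<phi> a - a ^ p = x * of_nat p"
proof -
  interpret subr S by fact
  have h: "\<phi> \<in> Ring.ring_hom (rec S) (rec S)" using f by (simp add: frobenius_lift_def)
  show c: "\<phi> a \<in> S" if "a \<in> S" for a using ring_hom_closed[OF h] that by simp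
  show "subr_hom S \<phi>"
    using ring_hom_one[OF h] ring_hom_add[OF h] ring_hom_mult[OF h] by unfold_locales simp_all
  show "\<exists>x\<in>S. \<phi> a - a ^ p = x * of_nat p" if a: "a \<in> S"
  proof -
    have "\<phi> a \<ominus>\<^bsub>rec S\<^esub> a [^]\<^bsub>rec S\<^esub> p \<in> pow_ideal (rec S) p 1"
      using f a by (simp add: frobenius_lift_def)
    then show ?thesis using a c[OF a] by (auto simp: pow_ideal_rec a_minus_def)
  qed
qed

lemma GL_rec:
  assumes "subr S" "q \<in> GL (rec S) n"
  obtains Z where "q \<in> smats S n" "Z \<in> smats S n" "q * Z = 1\<^sub>m n" "Z * q = 1\<^sub>m n"
proof -
  interpret A: presentation S "rec S" "\<lambda>x. x" "{0}" for p by (rule presentation_rec[OF assms(1)])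
  have id: "map_mat (\<lambda>x. x) Y = Y" for Y :: "'a mat" by (rule eq_matI) auto
  have sq: "Y \<in> sq_mats (rec S) n \<longleftrightarrow> Y \<in> smats S n" for Y
    by (simp add: sq_mats_def smats_elements)
  obtain Z where "rmat_inverse (rec S) n q Z" using assms(2) by (auto simp: GL_def)
  then have Z: "q \<in> smats S n" "Z \<in> smats S n" "rmat_mult (rec S) q Z = rmat_one (rec S) n"
    "rmat_mult (rec S) Z q = rmat_one (rec S) n"
    by (simp_all only: rmat_inverse_def sq)
  show ?thesis
    by (rule that[OF Z(1,2)])
      (use Z(3,4) A.pi_rmat_mult[OF Z(1,2)] A.pi_rmat_mult[OF Z(2,1)] A.pi_rmat_one in \<open>simp_all only: id\<close>)
qed

text \<open>The arithmetic is collected here: p is odd because M is even and not divisible by p, 1/2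
  is m/M for M = 2m, and 1/p is not in S, so that \<phi> acts on the entries of q by p-th
  powers.\<close>

lemma chern_connection_hat:
  fixes A :: "complex ring"
  assumes "primitive_root N \<zeta>" "even M" "M > 0" "N \<ge> 1" and A: "A = cyclotomic_ring M \<zeta>"
    and S: "S = generate_ring ring_of_type_algebra {1 / of_nat M, \<zeta>}"
    and p: "p \<in> V" "prime p" "\<not> p dvd M * N" and phi: "frobenius_lift A p (\<phi> p)"
    and q: "q \<in> GL A n" "transpose_mat q = q \<or> transpose_mat q = map_mat uminus q"
      "\<And>w. w \<in> elements_mat q \<Longrightarrow> w = 0 \<or> (\<exists>k>0. w ^ k = 1)"
    and chern: "chern_connection A \<phi> n q V \<delta>"
  shows "\<exists>Z. chern_hat S (\<phi> p) n p q Z (conn_frob A n \<delta> p)"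
proof -
  have AS: "A = rec S" unfolding A S cyclotomic_ring_def ..
  have subr: "subr S" unfolding S by (rule subr_generate)
  interpret S: subr S by (rule subr)
  have pM: "\<not> p dvd M" using p(3) by (meson dvd_mult2)
  have odd: "odd p"
  proof
    assume "even p"
    then have "p = 2" using p(2) primes_dvd_imp_eq[OF two_is_prime_nat p(2)] by simp
    then show False using pM assms(2) by simp
  qed
  have inv: "1 / of_nat p \<notin> S"
    unfolding S by (rule inverse_prime_not_cyclotomic[of _ N]) (use assms pM in \<open>auto simp: primitive_root_def\<close>)
  obtain m where m: "M = 2 * m" using assms(2) by (elim evenE)
  have "1 / of_nat M \<in> S" unfolding S by (rule generate_ring.incl) simp
  then have "of_nat m * (1 / of_nat M) \<in> S" by (intro S.mult_mem S.of_nat_mem)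
  also have "of_nat m * (1 / of_nat M) = (1 / 2 :: complex)" using assms(3) m by simp
  finally have half: "1 / 2 \<in> S" .
  note f = frobenius_lift_rec[OF subr phi[unfolded AS]]
  obtain Z where Z: "q \<in> smats S n" "Z \<in> smats S n" "q * Z = 1\<^sub>m n" "Z * q = 1\<^sub>m n"
    using GL_rec[OF subr q(1)[unfolded AS]] by blast
  have "chern_core S (\<phi> p) n p q Z"
  proof (intro chern_core.intro chern_core_axioms.intro f(1) half odd Z)
    show "\<phi> p c \<in> S" if "c \<in> S" for c using that by (rule f(2))
    have "map_mat uminus q = - q" by (rule eq_matI) auto
    then show "transpose_mat q = q \<or> transpose_mat q = - q" using q(2) by simp
    fix i j assume ij: "i < n" "j < n"
    have "q $$ (i, j) \<in> elements_mat q" using ij smats_carrier[OF Z(1)] by (intro elements_matI) auto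
    then show "\<phi> p (q $$ (i, j)) = q $$ (i, j) ^ p"
      by (intro frobenius_root_of_unity[OF f(1) p(2) odd inv f(2,3) smats_entry[OF Z(1) ij] q(3)])
  qed
  moreover have "chern_hat_axioms S (\<phi> p) n p q (conn_frob A n \<delta> p)"
  proof
    have "p_derivation (GLhat A n p) p (\<delta> p)"
      using chern p(1) by (simp add: chern_connection_def adelic_connection_def)
    then show "conn_frob A n \<delta> p \<in> Ring.ring_hom (GLhat (rec S) n p) (GLhat (rec S) n p)"
      by (simp add: p_derivation_def conn_frob_def AS)
  qed (use chern p(1) in \<open>simp_all add: chern_connection_def AS Let_def\<close>)
  ultimately show ?thesis by (intro exI[of _ Z] chern_hat.intro)
qed

theorem theorem3p1:
  fixes M N n :: nat and \<zeta> :: complex and A :: "complex ring" and V :: "nat set"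
    and \<phi> :: "nat \<Rightarrow> complex \<Rightarrow> complex" and q :: "complex mat"
    and \<delta> :: "nat \<Rightarrow> complex GLhat \<Rightarrow> complex GLhat"
  assumes "even M" and "M > 0" and "N \<ge> 1" and "primitive_root N \<zeta>"
    and A: "A = cyclotomic_ring M \<zeta>"
    and V: "\<And>p. p \<in> V \<Longrightarrow> prime p \<and> \<not> p dvd M * N"
    and \<phi>: "\<And>p. p \<in> V \<Longrightarrow> frobenius_lift A p (\<phi> p)"
    and "q \<in> GL A n"
    and "transpose_mat q = q \<or> transpose_mat q = map_mat uminus q"
    and "\<And>w. w \<in> elements_mat q \<Longrightarrow> w = 0 \<or> (\<exists>k>0. w ^ k = 1)"
    and "chern_connection A \<phi> n q V \<delta>"
  shows "global_along_one A n V \<delta> \<and>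
    (\<forall>p\<in>V. frob_stable A n \<delta> p (ideal_J A n q)) \<and>
    (\<forall>r. n = 2 * r \<and> q = rmat_one A n \<longrightarrow> (\<forall>p\<in>V. frob_stable A n \<delta> p (ideal_K A r)))"
proof -
  define S where "S = generate_ring ring_of_type_algebra {1 / of_nat M, \<zeta>}"
  have AS: "A = rec S" unfolding A S_def cyclotomic_ring_def ..
  have hat: "\<exists>Z. chern_hat S (\<phi> p) n p q Z (conn_frob A n \<delta> p)" if "p \<in> V" for p
    by (rule chern_connection_hat[where V = V and N = N and \<zeta> = \<zeta> and M = M]) (use assms that S_def in \<open>simp_all\<close>)
  have stable: "conn_frob A n \<delta> p ` identity_ideal A n p \<subseteq> identity_ideal A n p"
    "frob_stable A n \<delta> p (carrier (T_series A n))" "frob_stable A n \<delta> p (ideal_J A n q)"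
    "n = 2 * r \<Longrightarrow> q = rmat_one A n \<Longrightarrow> frob_stable A n \<delta> p (ideal_K A r)" if p: "p \<in> V" for p r
  proof -
    obtain Z where "chern_hat S (\<phi> p) n p q Z (conn_frob A n \<delta> p)" using hat[OF p] by blast
    then interpret chern_hat S "\<phi> p" n p q Z "conn_frob A n \<delta> p" .
    show "conn_frob A n \<delta> p ` identity_ideal A n p \<subseteq> identity_ideal A n p"
      using Phi_identity_ideal unfolding AS .
    show "frob_stable A n \<delta> p (carrier (T_series A n))" "frob_stable A n \<delta> p (ideal_J A n q)"
      using stable_carrier stable_J unfolding AS frob_stable_def formal_frob_def by blast+
    assume n: "n = 2 * r" and q1: "q = rmat_one A n"
    have "q = 1\<^sub>m n" unfolding q1 AS by (rule eq_matI) (auto simp: rmat_one_def)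
    from stable_K[OF n this] show "frob_stable A n \<delta> p (ideal_K A r)"
      unfolding AS frob_stable_def formal_frob_def .
  qed
  then show ?thesis unfolding global_along_one_def fixes_one_def by blast
qed

end
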